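(* Let $G$ be a finite group and $G^- = \{ g \in G : \langle g \rangle \text{ is not a maximal cyclic subgroup of } G\}$. Then: (1) If $N$ is a normal subgroup of $G$, then $G^- \subseteq N$ if and only if every element of $G \setminus N$ has prime power order and every nonidentity element of $G/N$ has prime order. In particular (when $G^- \subseteq N$), $G/N$ is either a $p$-group of exponent $p$, or a Frobenius group whose Frobenius kernel is a $p$-group of exponent $p$ and whose Frobenius complement has order $q$ for some prime $q \ne p$, or isomorphic to $A_5$. (2) If $M$ is a normal subgroup of $G$ and $p$ is a prime with $|G:M| = p$, then $G^- \subseteq M$ if and only if every element of $G \setminus M$ has $p$-power order. (3) If $G$ is a $p$-group and $N$ is a normal subgroup of $G$ such that $G/N$ has exponent $p$, then $G^- \subseteq N$.
   Context: A cyclic subgroup $C$ of $G$ is maximal cyclic if there is no cyclic subgroup $D$ of $G$ with $C < D$. *)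

theory Defs
  imports "HOL-Algebra.Algebra"
begin

definition cyclic_subgroup :: "('a, 'b) monoid_scheme \<Rightarrow> 'a set \<Rightarrow> bool" where
  "cyclic_subgroup G C \<longleftrightarrow> subgroup C G \<and> (\<exists>g\<in>carrier G. C = generate G {g})"

definition maximal_cyclic :: "('a, 'b) monoid_scheme \<Rightarrow> 'a set \<Rightarrow> bool" where
  "maximal_cyclic G C \<longleftrightarrow> cyclic_subgroup G C \<and> \<not> (\<exists>D. cyclic_subgroup G D \<and> C \<subset> D)"

definition Gminus :: "('a, 'b) monoid_scheme \<Rightarrow> 'a set" where
  "Gminus G = {g \<in> carrier G. \<not> maximal_cyclic G (generate G {g})}"

definition prime_power_order :: "('a, 'b) monoid_scheme \<Rightarrow> 'a \<Rightarrow> bool" where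
  "prime_power_order G x \<longleftrightarrow> (\<exists>p k. Factorial_Ring.prime p \<and> group.ord G x = p ^ k)"

definition exponent_p_set :: "('a, 'b) monoid_scheme \<Rightarrow> 'a set \<Rightarrow> nat \<Rightarrow> bool" where
  "exponent_p_set G S p \<longleftrightarrow> (\<forall>x\<in>S. x [^]\<^bsub>G\<^esub> p = \<one>\<^bsub>G\<^esub>)"

definition p_group_exp_p :: "('a, 'b) monoid_scheme \<Rightarrow> nat \<Rightarrow> bool" where
  "p_group_exp_p G p \<longleftrightarrow> Factorial_Ring.prime p \<and> (\<exists>k. card (carrier G) = p ^ k) \<and> exponent_p_set G (carrier G) p"

definition frobenius_complement :: "('a, 'b) monoid_scheme \<Rightarrow> 'a set \<Rightarrow> bool" where
  "frobenius_complement H C \<longleftrightarrow> subgroup C H \<and> C \<noteq> {\<one>\<^bsub>H\<^esub>} \<and> C \<noteq> carrier H \<and>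
     (\<forall>g\<in>carrier H - C. C \<inter> ((\<lambda>c. g \<otimes>\<^bsub>H\<^esub> c \<otimes>\<^bsub>H\<^esub> inv\<^bsub>H\<^esub> g) ` C) = {\<one>\<^bsub>H\<^esub>})"

definition frobenius_kernel :: "('a, 'b) monoid_scheme \<Rightarrow> 'a set \<Rightarrow> 'a set" where
  "frobenius_kernel H C =
     (carrier H - (\<Union>g\<in>carrier H. (\<lambda>c. g \<otimes>\<^bsub>H\<^esub> c \<otimes>\<^bsub>H\<^esub> inv\<^bsub>H\<^esub> g) ` C)) \<union> {\<one>\<^bsub>H\<^esub>}"

end

theory Submission
  imports Defs "HOL-Library.Function_Algebras" "HOL-Computational_Algebra.Fundamental_Theorem_Algebra"
begin

text \<open>
  Gminus G lies in N iff no element x outside N is a power of an element y outside cyc x; comparing the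
  orders of x and of its image in G/N, this becomes the condition of part (1), and parts (2) and (3) are
  special cases. It remains to classify the finite groups Q all of whose nonidentity elements have prime
  order. In such a group an element commuting with an element of order p satisfies the same equation
  x ^ p = 1, and distinct Sylow p-subgroups intersect trivially.

  If Q has a nontrivial normal p-subgroup, the product of the conjugates of a central element of it under
  any subgroup that is not a p-group is trivial; counting subgroups of prime order then shows that a Sylow
  r-subgroup with r different from p has order r and is self-normalising, so that Q is a p-group or a
  Frobenius group.

  If Q has even order and no such subgroup, all involutions are conjugate and the normaliser of a Sylow
  2-subgroup has order q (q + 1) with q prime. Counting involutions in its cosets shows that every
  nontrivial element fixes at most two of the q + 2 cosets and that Q has order q (q + 1) (q + 2). For q > 3
  the elements of order 3 would be too few, and q = 3 gives the alternating group.

  If Q has odd order and is minimal without such a subgroup, Q has no nontrivial linear character, and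
  each Sylow normaliser is a Frobenius group of prime index q_i over its kernel. The class equation gives
  1 < sum 1/q_i. The exceptional irreducible characters attached to the Sylow subgroups have to occur in
  each other's induced characters for parity reasons, and orthogonality bounds this sum by 1.
\<close>

section \<open>The complex group algebra\<close>

text \<open>The obstacle is the odd case, where there are no involutions to count. It is treated in
  the spirit of Suzuki's work on groups with nilpotent centralisers: centralisers are p-groups here,
  so Sylow subgroups have trivial intersection and induction from them preserves inner products of
  differences of linear characters. From character theory it takes orthonormality, integral
  multiplicities and degrees at least 1. This is why characters are built from self-adjoint
  idempotents of C[G]: positivity of the coefficient of \<open>a \<star> star a\<close> at the
  identity leads to primitive decompositions and to Schur's lemma. Each Sylow subgroup enters
  through its linear characters; their number is a power of p, which separates the primes in the
  final estimate. The parity argument comes from the fact that in odd order only the trivial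
  irreducible character is real. In even order the model is SL(2, q + 1) on the q + 2 points of the
  projective line: the normaliser of a Sylow 2-subgroup plays the Borel subgroup, the centraliser of
  an element of order q in it the split torus.\<close>

lemma Cauchy_Schwarz_sum:
  fixes a b :: "'i \<Rightarrow> real"
  shows "(\<Sum>i\<in>I. a i * b i)\<^sup>2 \<le> (\<Sum>i\<in>I. (a i)\<^sup>2) * (\<Sum>i\<in>I. (b i)\<^sup>2)"
proof -
  define A B C where "A = (\<Sum>i\<in>I. (a i)\<^sup>2)" and "B = (\<Sum>i\<in>I. (b i)\<^sup>2)" and "C = (\<Sum>i\<in>I. a i * b i)"
  have AB: "A \<ge> 0" "B \<ge> 0" by (auto simp: A_def B_def sum_nonneg)
  have q: "x\<^sup>2 * A - 2 * x * y * C + y\<^sup>2 * B \<ge> 0" for x y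
  proof -
    have "0 \<le> (\<Sum>i\<in>I. (x * a i - y * b i)\<^sup>2)" by (simp add: sum_nonneg)
    also have "\<dots> = (\<Sum>i\<in>I. x\<^sup>2 * (a i)\<^sup>2 - 2 * x * y * (a i * b i) + y\<^sup>2 * (b i)\<^sup>2)"
      by (rule sum.cong) (auto simp: power2_eq_square algebra_simps)
    also have "\<dots> = x\<^sup>2 * A - 2 * x * y * C + y\<^sup>2 * B"
      by (simp only: sum.distrib sum_subtractf sum_distrib_left A_def B_def C_def)
    finally show ?thesis .
  qed
  show ?thesis
  proof (cases "B = 0")
    case True
    have "2 * C * C * x \<le> A" for x using q[of 1 "x * C"] True by (simp add: algebra_simps)
    from this[of "(A + 1) / (2 * C * C)"] have "C = 0" by (cases "C = 0") (auto simp: divide_simps)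
    then show ?thesis using AB by (simp add: A_def[symmetric] B_def[symmetric] C_def[symmetric])
  next
    case False
    have "B * (C\<^sup>2) \<le> B * (A * B)" using q[of B C] by (simp add: power2_eq_square algebra_simps)
    then have "C\<^sup>2 \<le> A * B" using False AB(2) by (simp add: mult_le_cancel_left)
    then show ?thesis by (simp add: A_def B_def C_def)
  qed
qed

text \<open>Gaussian elimination on the coordinates: \<open>i0\<close> is a pivot for the coordinate
  \<open>x0\<close>, and its coefficient in \<open>d\<close> turns the relation between the reduced
  vectors into one between the given ones.\<close>

lemma linear_dependence:
  fixes v :: "'i \<Rightarrow> 'x \<Rightarrow> 'f::field"
  assumes "finite S" "finite I" "card S < card I"
  shows "\<exists>c. (\<exists>i\<in>I. c i \<noteq> 0) \<and> (\<forall>x\<in>S. (\<Sum>i\<in>I. c i * v i x) = 0)"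
  using assms
proof (induction S arbitrary: I v rule: finite_induct)
  case empty
  then have "I \<noteq> {}" by auto
  then show ?case by (intro exI[of _ "\<lambda>_. 1"]) auto
next
  case (insert x0 S)
  show ?case
  proof (cases "\<forall>i\<in>I. v i x0 = 0")
    case True
    have "card S < card I" using insert by simp
    from insert.IH[OF insert.prems(1) this, of v] True show ?thesis by auto
  next
    case False
    then obtain i0 where i0: "i0 \<in> I" "v i0 x0 \<noteq> 0" by blast
    let ?I = "I - {i0}" and ?v = "\<lambda>i x. v i x - v i x0 / v i0 x0 * v i0 x"
    have "card S < card ?I" using insert i0 by simp
    from insert.IH[OF _ this, of ?v] insert.prems(1) obtain c i1 where
      c: "i1 \<in> ?I" "c i1 \<noteq> 0" "\<And>x. x \<in> S \<Longrightarrow> (\<Sum>i\<in>?I. c i * ?v i x) = 0" by auto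
    define d where "d = c(i0 := - (\<Sum>i\<in>?I. c i * (v i x0 / v i0 x0)))"
    have s: "(\<Sum>i\<in>I. d i * v i x) = (\<Sum>i\<in>?I. c i * ?v i x)" for x
    proof -
      have "(\<Sum>i\<in>I. d i * v i x) = d i0 * v i0 x + (\<Sum>i\<in>?I. d i * v i x)"
        using insert.prems(1) i0(1) by (rule sum.remove)
      also have "(\<Sum>i\<in>?I. d i * v i x) = (\<Sum>i\<in>?I. c i * v i x)"
        by (intro sum.cong) (auto simp: d_def)
      also have "d i0 * v i0 x = - (\<Sum>i\<in>?I. c i * (v i x0 / v i0 x0) * v i0 x)"
        by (simp add: d_def sum_distrib_right)
      finally show ?thesis
        by (simp add: sum_subtractf algebra_simps)
    qed
    have "(\<Sum>i\<in>I. d i * v i x0) = 0"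
      unfolding s using i0(2) by simp
    moreover have "d i1 \<noteq> 0" using c by (auto simp: d_def)
    ultimately show ?thesis using c s by (intro exI[of _ d]) auto
  qed
qed

section \<open>Convolution and adjoint on functions supported on the group\<close>

locale fin_group = group G for G (structure) +
  assumes fin: "finite (carrier G)"
begin

lemma order_pos: "card (carrier G) > 0"
  using fin one_closed by (auto simp: card_gt_0_iff)

lemma sum_shift_left:
  assumes "x \<in> carrier G"
  shows "(\<Sum>y\<in>carrier G. f (x \<otimes> y)) = (\<Sum>y\<in>carrier G. f y)"
  by (rule sum.reindex_bij_witness[of _ "\<lambda>y. inv x \<otimes> y" "\<lambda>y. x \<otimes> y"])
     (use assms in \<open>auto simp: m_assoc[symmetric]\<close>)

lemma sum_shift_right:
  assumes "x \<in> carrier G"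
  shows "(\<Sum>y\<in>carrier G. f (y \<otimes> x)) = (\<Sum>y\<in>carrier G. f y)"
  by (rule sum.reindex_bij_witness[of _ "\<lambda>y. y \<otimes> inv x" "\<lambda>y. y \<otimes> x"])
     (use assms in \<open>auto simp: m_assoc\<close>)

lemma sum_inv: "(\<Sum>y\<in>carrier G. f (inv y)) = (\<Sum>y\<in>carrier G. f y)"
  by (rule sum.reindex_bij_witness[of _ "\<lambda>y. inv y" "\<lambda>y. inv y"]) auto

lemma sum_conj:
  assumes "x \<in> carrier G"
  shows "(\<Sum>y\<in>carrier G. f (x \<otimes> y \<otimes> inv x)) = (\<Sum>y\<in>carrier G. f y)"
  using sum_shift_left[OF assms, of "\<lambda>y. f (y \<otimes> inv x)"] sum_shift_right[of "inv x" f] assms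
  by simp

text \<open>Extension by zero makes equality of functions the equality of C[G], so the pointwise sum
  and zero of functions can serve as its addition.\<close>

definition galg :: "('a \<Rightarrow> complex) set" where
  "galg = {a. \<forall>x. x \<notin> carrier G \<longrightarrow> a x = 0}"

definition conv :: "('a \<Rightarrow> complex) \<Rightarrow> ('a \<Rightarrow> complex) \<Rightarrow> 'a \<Rightarrow> complex" (infixl "\<star>" 70) where
  "a \<star> b = (\<lambda>g. if g \<in> carrier G then \<Sum>x\<in>carrier G. a x * b (inv x \<otimes> g) else 0)"

text \<open>The adjoint for the hermitian inner product in which the group elements are orthonormal:
  x goes to its inverse and coefficients are conjugated.\<close>

definition star :: "('a \<Rightarrow> complex) \<Rightarrow> 'a \<Rightarrow> complex" where
  "star a = (\<lambda>g. if g \<in> carrier G then cnj (a (inv g)) else 0)"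

definition smul :: "complex \<Rightarrow> ('a \<Rightarrow> complex) \<Rightarrow> 'a \<Rightarrow> complex" where
  "smul c a = (\<lambda>x. c * a x)"

definition delta :: "'a \<Rightarrow> 'a \<Rightarrow> complex" where
  "delta z = (\<lambda>x. if x = z then 1 else 0)"

lemma galg_closed [simp, intro]:
  "0 \<in> galg" "conv a b \<in> galg" "star a \<in> galg"
  "a \<in> galg \<Longrightarrow> b \<in> galg \<Longrightarrow> a + b \<in> galg"
  "a \<in> galg \<Longrightarrow> b \<in> galg \<Longrightarrow> a - b \<in> galg"
  "a \<in> galg \<Longrightarrow> smul c a \<in> galg"
  "z \<in> carrier G \<Longrightarrow> delta z \<in> galg"
  by (auto simp: galg_def conv_def star_def smul_def delta_def)

lemma conv_assoc: "(a \<star> b) \<star> c = a \<star> (b \<star> c)"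
proof
  fix g
  show "((a \<star> b) \<star> c) g = (a \<star> (b \<star> c)) g"
  proof (cases "g \<in> carrier G")
    case True
    have "((a \<star> b) \<star> c) g = (\<Sum>x\<in>carrier G. \<Sum>y\<in>carrier G. a y * b (inv y \<otimes> x) * c (inv x \<otimes> g))"
      using True by (simp add: conv_def sum_distrib_right)
    also have "\<dots> = (\<Sum>y\<in>carrier G. \<Sum>x\<in>carrier G. a y * b (inv y \<otimes> x) * c (inv x \<otimes> g))"
      by (rule sum.swap)
    also have "\<dots> = (\<Sum>y\<in>carrier G. \<Sum>x\<in>carrier G. a y * b x * c (inv x \<otimes> (inv y \<otimes> g)))"
    proof (rule sum.cong)
      fix y assume y: "y \<in> carrier G"
      show "(\<Sum>x\<in>carrier G. a y * b (inv y \<otimes> x) * c (inv x \<otimes> g)) =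
            (\<Sum>x\<in>carrier G. a y * b x * c (inv x \<otimes> (inv y \<otimes> g)))"
        by (subst sum_shift_left[OF y, symmetric], rule sum.cong)
           (use y True in \<open>auto simp: m_assoc[symmetric] inv_mult_group\<close>)
    qed simp
    also have "\<dots> = (a \<star> (b \<star> c)) g"
      using True by (simp add: conv_def sum_distrib_left mult.assoc)
    finally show ?thesis .
  qed (simp add: conv_def)
qed

lemma conv_add_left: "(a + b) \<star> c = a \<star> c + b \<star> c"
  by (rule ext) (simp add: conv_def sum.distrib ring_distribs)
lemma conv_add_right: "a \<star> (b + c) = a \<star> b + a \<star> c"
  by (rule ext) (simp add: conv_def sum.distrib ring_distribs)
lemma conv_diff_left: "(a - b) \<star> c = a \<star> c - b \<star> c"
  by (rule ext) (simp add: conv_def sum_subtractf ring_distribs)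
lemma conv_diff_right: "a \<star> (b - c) = a \<star> b - a \<star> c"
  by (rule ext) (simp add: conv_def sum_subtractf ring_distribs)
lemma conv_zero [simp]: "0 \<star> a = 0" "a \<star> 0 = 0"
  by (auto simp: conv_def)
lemma conv_smul [simp]: "smul c a \<star> b = smul c (a \<star> b)" "a \<star> smul c b = smul c (a \<star> b)"
  by (auto simp: conv_def smul_def sum_distrib_left ac_simps intro!: ext sum.cong)
lemma smul_simps [simp]: "smul c (smul d a) = smul (c * d) a" "smul 0 a = 0" "smul 1 a = a" "smul c 0 = 0"
  by (auto simp: smul_def)
lemma smul_add: "smul (c + d) a = smul c a + smul d a" "smul c (a + b) = smul c a + smul c b"
  "smul (c - d) a = smul c a - smul d a" "smul c (a - b) = smul c a - smul c b"
  by (auto simp: smul_def algebra_simps)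
lemma smul_cancel: "smul c a = smul d a \<Longrightarrow> a \<noteq> 0 \<Longrightarrow> c = d"
  by (auto simp: smul_def fun_eq_iff)
lemma star_simps: "star (a + b) = star a + star b" "star (a - b) = star a - star b"
  "star (smul c a) = smul (cnj c) (star a)" "star 0 = 0"
  by (auto simp: star_def smul_def intro!: ext)
lemma star_star [simp]: "a \<in> galg \<Longrightarrow> star (star a) = a"
  by (auto simp: star_def galg_def intro!: ext)
lemma star_conv: "star (a \<star> b) = star b \<star> star a"
proof
  fix g
  show "star (a \<star> b) g = (star b \<star> star a) g"
  proof (cases "g \<in> carrier G")
    case True
    have "(star b \<star> star a) g = (\<Sum>x\<in>carrier G. cnj (b (inv x)) * cnj (a (inv (inv x \<otimes> g))))"
      using True by (auto simp: conv_def star_def intro!: sum.cong)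
    also have "\<dots> = (\<Sum>x\<in>carrier G. cnj (b (inv (g \<otimes> x))) * cnj (a (inv (inv (g \<otimes> x) \<otimes> g))))"
      by (rule sum_shift_left[OF True, symmetric])
    also have "\<dots> = (\<Sum>x\<in>carrier G. cnj (a x * b (inv x \<otimes> inv g)))"
      by (rule sum.cong) (use True in \<open>auto simp: inv_mult_group m_assoc\<close>)
    finally show ?thesis using True by (simp add: star_def conv_def)
  qed (simp add: star_def conv_def)
qed

lemma delta_one_conv [simp]: "a \<in> galg \<Longrightarrow> delta \<one> \<star> a = a" "a \<in> galg \<Longrightarrow> a \<star> delta \<one> = a"
proof -
  assume a: "a \<in> galg"
  show "delta \<one> \<star> a = a"
  proof
    fix g show "(delta \<one> \<star> a) g = a g"
      using a fin by (auto simp: conv_def delta_def galg_def if_distrib[of "\<lambda>x. x * _"] sum.delta cong: if_cong)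
  qed
  show "a \<star> delta \<one> = a"
  proof
    fix g show "(a \<star> delta \<one>) g = a g"
    proof (cases "g \<in> carrier G")
      case True
      have "(a \<star> delta \<one>) g = (\<Sum>x\<in>carrier G. if x = g then a x else 0)"
        using True by (auto simp: conv_def delta_def intro!: sum.cong) (metis inv_closed inv_equality inv_inv)
      then show ?thesis using True fin by simp
    qed (use a in \<open>auto simp: conv_def galg_def\<close>)
  qed
qed

lemma conv_star_one: "(a \<star> star a) \<one> = (\<Sum>x\<in>carrier G. of_real ((cmod (a x))\<^sup>2))"
  by (auto simp: conv_def star_def complex_norm_square[symmetric] simp del: of_real_power intro!: sum.cong)

text \<open>The coefficient at \<open>\<one>\<close> is a sum of squared moduli. This positivity
  stands in for Maschke's theorem in what follows.\<close>

lemma conv_star_eq_0: "a \<in> galg \<Longrightarrow> a \<star> star a = 0 \<Longrightarrow> a = 0"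
proof -
  assume a: "a \<in> galg" "a \<star> star a = 0"
  then have "complex_of_real (\<Sum>x\<in>carrier G. (cmod (a x))\<^sup>2) = 0"
    using conv_star_one[of a] by simp
  then have "(\<Sum>x\<in>carrier G. (cmod (a x))\<^sup>2) = 0" using of_real_eq_0_iff by blast
  then have "\<forall>x\<in>carrier G. a x = 0" using fin by (subst (asm) sum_nonneg_eq_0_iff) auto
  then show "a = 0" using a(1) by (auto simp: galg_def fun_eq_iff)
qed

lemma star_conv_eq_0: "a \<in> galg \<Longrightarrow> star a \<star> a = 0 \<Longrightarrow> a = 0"
  using conv_star_eq_0[of "star a"] star_star[of a] by (auto simp: star_simps)

section \<open>Self-adjoint idempotents and their splitting\<close>

definition proj :: "('a \<Rightarrow> complex) \<Rightarrow> bool" where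
  "proj e \<longleftrightarrow> e \<in> galg \<and> e \<star> e = e \<and> star e = e"

text \<open>Minimality is expressed by Schur's condition that the corner e C[G] e consists of
  scalars; \<open>proj_split\<close> shows that a nonzero projection failing it splits.\<close>

definition primitive :: "('a \<Rightarrow> complex) \<Rightarrow> bool" where
  "primitive e \<longleftrightarrow> proj e \<and> e \<noteq> 0 \<and> (\<forall>a\<in>galg. \<exists>c. e \<star> a \<star> e = smul c e)"

text \<open>Horner evaluation of p at h inside e C[G] e, whose unit is e: constants become multiples
  of e rather than of \<open>delta \<one>\<close>.\<close>

definition ev :: "('a \<Rightarrow> complex) \<Rightarrow> ('a \<Rightarrow> complex) \<Rightarrow> complex poly \<Rightarrow> 'a \<Rightarrow> complex" where
  "ev e h p = fold_coeffs (\<lambda>c v. smul c e + h \<star> v) p 0"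

lemma ev_simps [simp]: "ev e h 0 = 0" "ev e h (pCons c p) = smul c e + h \<star> ev e h p"
proof -
  show "ev e h 0 = 0" by (simp add: ev_def)
  then show "ev e h (pCons c p) = smul c e + h \<star> ev e h p"
    by (cases "p = 0 \<and> c = 0") (auto simp: ev_def)
qed

lemma ev_add: "ev e h (p + q) = ev e h p + ev e h q"
proof (induction p q rule: poly_induct2)
  case (pCons a p b q)
  show ?case
    unfolding ev_simps Polynomial.add_pCons smul_add pCons conv_add_right by (simp only: ac_simps)
qed simp

lemma ev_smult: "ev e h (Polynomial.smult c p) = smul c (ev e h p)"
proof (induction p)
  case (pCons a p)
  show ?case
    unfolding ev_simps smult_pCons smul_add pCons.IH conv_smul smul_simps ..
next
  case 0 show ?case unfolding smult_0_right ev_simps smul_simps ..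
qed

lemma ev_galg: "e \<in> galg \<Longrightarrow> ev e h p \<in> galg"
  by (induction p) auto

lemma ev_commute: "b \<star> h = h \<star> b \<Longrightarrow> b \<star> e = e \<star> b \<Longrightarrow> b \<star> ev e h p = ev e h p \<star> b"
proof (induction p)
  case (pCons a p)
  then have "b \<star> (h \<star> ev e h p) = h \<star> ev e h p \<star> b" using conv_assoc by metis
  then show ?case
    unfolding ev_simps conv_add_left conv_add_right conv_smul pCons.prems by simp
qed simp

lemma ev_eigen: "h \<star> f = smul l f \<Longrightarrow> e \<star> f = f \<Longrightarrow> ev e h p \<star> f = smul (poly p l) f"
proof (induction p)
  case (pCons a p)
  have "h \<star> ev e h p \<star> f = smul (l * poly p l) f"
    unfolding conv_assoc pCons.IH[OF pCons.prems] conv_smul pCons.prems by (simp add: mult.commute)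
  then show ?case
    unfolding ev_simps conv_add_left conv_smul pCons.prems smul_add poly_pCons by simp
qed simp

lemma ev_eq_sum: "ev e h p = (\<Sum>k\<le>Polynomial.degree p. smul (Polynomial.coeff p k) (((\<star>) h ^^ k) e))"
proof (induction p)
  case (pCons c p)
  have d: "h \<star> (\<Sum>k\<in>K. f k) = (\<Sum>k\<in>K. h \<star> f k)" for f :: "nat \<Rightarrow> 'a \<Rightarrow> complex" and K
  proof (induction K rule: infinite_finite_induct)
    case (insert x F)
    then show ?case by (simp only: sum.insert conv_add_right not_False_eq_True)
  qed (simp_all only: sum.infinite sum.empty conv_zero not_False_eq_True)
  show ?case
  proof (cases "p = 0")
    case True then show ?thesis by simp
  next
    case False
    then show ?thesis unfolding ev_simps pCons.IH
      by (simp add: sum.atMost_Suc_shift d del: sum.atMost_Suc)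
  qed
qed simp

text \<open>The n + 1 vectors obtained from e by multiplying up to n times with h lie in a space of
  dimension n.\<close>

lemma annihilating_poly: "\<exists>p. p \<noteq> 0 \<and> ev e h p = 0" if e: "e \<in> galg"
proof -
  let ?n = "card (carrier G)"
  let ?v = "\<lambda>k. ((\<star>) h ^^ k) e"
  have vg: "?v k \<in> galg" for k by (cases k) (auto simp: e)
  obtain c where c: "\<exists>k\<in>{..?n}. c k \<noteq> 0" "\<forall>x\<in>carrier G. (\<Sum>k\<in>{..?n}. c k * ?v k x) = 0"
    using linear_dependence[OF fin, of "{..?n}" ?v] by auto
  define p where "p = (\<Sum>k\<le>?n. Polynomial.monom (c k) k)"
  have cf: "Polynomial.coeff p j = (if j \<le> ?n then c j else 0)" for j
    by (auto simp: p_def Polynomial.coeff_sum)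
  have p0: "p \<noteq> 0"
  proof
    assume "p = 0"
    then have "Polynomial.coeff p j = 0" for j by simp
    then show False using c(1) cf by (metis atMost_iff)
  qed
  have dg: "Polynomial.degree p \<le> ?n" by (rule Polynomial.degree_le) (simp add: cf)
  have sap: "(\<Sum>k\<in>K. f k) x = (\<Sum>k\<in>K. f k x)" for f :: "nat \<Rightarrow> 'a \<Rightarrow> complex" and K x
    by (induction K rule: infinite_finite_induct) auto
  have "ev e h p x = 0" for x
  proof -
    have "ev e h p = (\<Sum>k\<le>?n. smul (Polynomial.coeff p k) (?v k))"
      unfolding ev_eq_sum using dg
      by (intro sum.mono_neutral_left) (auto simp: coeff_eq_0)
    then have s: "ev e h p x = (\<Sum>k\<le>?n. c k * ?v k x)"
      by (simp add: cf smul_def sap)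
    show ?thesis
      by (cases "x \<in> carrier G") (use c(2) s vg in \<open>auto simp: galg_def\<close>)
  qed
  then have "ev e h p = 0" by (simp add: fun_eq_iff)
  with p0 show ?thesis by blast
qed

text \<open>A spectral projection of h. If (X - l) r is the annihilating polynomial of least degree,
  then f = r(h) is nonzero with h f = l f, and f is normal because h is self-adjoint. So a real
  multiple of \<open>star f \<star> f\<close> is a projection inside the eigenspace of l.\<close>

lemma proj_split_selfadjoint:
  assumes e: "proj e" and h: "star h = h" "e \<star> h = h" "h \<star> e = h" "\<And>c. h \<noteq> smul c e"
  shows "\<exists>f. proj f \<and> f \<noteq> 0 \<and> f \<noteq> e \<and> e \<star> f = f \<and> f \<star> e = f"
proof -
  have eg: "e \<in> galg" "e \<star> e = e" "star e = e" using e by (auto simp: proj_def)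
  define P where "P p \<longleftrightarrow> p \<noteq> 0 \<and> ev e h p = 0" for p
  obtain p where p: "P p" "\<And>q. P q \<Longrightarrow> Polynomial.degree p \<le> Polynomial.degree q"
    using annihilating_poly[OF eg(1), of h] ex_has_least_nat[of P _ Polynomial.degree] by (auto simp: P_def)
  have e0: "e \<noteq> 0" using h(2) h(4)[of 0] by auto
  have "\<not> constant (poly p)"
  proof
    assume "constant (poly p)"
    then obtain c where "p = [:c:]" using constant_degree degree_eq_zeroE by metis
    then show False using p(1) e0 by (auto simp: P_def smul_def fun_eq_iff)
  qed
  then obtain l where "poly p l = 0" using fundamental_theorem_of_algebra by blast
  then obtain r where r: "p = [:-l, 1:] * r" using poly_eq_0_iff_dvd by (metis dvdE)
  have r0: "r \<noteq> 0" using p(1) r by (auto simp: P_def)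
  have dr: "Polynomial.degree r < Polynomial.degree p" unfolding r using r0 by (subst degree_mult_eq) auto
  define f where "f = ev e h r"
  have f0: "f \<noteq> 0" using p(2)[of r] dr r0 by (auto simp: P_def f_def)
  have fg: "f \<in> galg" by (simp add: f_def ev_galg eg)
  have "ev e h p = h \<star> f - smul l f"
    by (simp add: r ev_add[of e h "pCons 0 r" "- Polynomial.smult l r", simplified] ev_smult[of e h "-l" r, simplified] f_def fun_eq_iff smul_def)
  then have hf: "h \<star> f = smul l f" using p(1) by (simp add: P_def)
  have ef: "e \<star> ev e h q = ev e h q" for q
  proof (induction q)
    case 0 show ?case unfolding ev_simps conv_zero ..
  next
    case (pCons a q)
    show ?case unfolding ev_simps conv_add_right conv_smul eg conv_assoc[symmetric] h ..
  qed
  have fe: "ev e h q \<star> e = ev e h q" for q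
    using ev_commute[of e h e q] h ef by simp
  have fh: "f \<star> h = h \<star> f" using ev_commute[of h h e r] h by (simp add: f_def)
  have sfh: "star f \<star> h = h \<star> star f" using arg_cong[OF fh, of star] h by (simp add: star_conv)
  have sfe: "star f \<star> e = star f" "e \<star> star f = star f"
    using arg_cong[OF ef[of r], of star] arg_cong[OF fe[of r], of star] eg by (auto simp: star_conv f_def)
  have nrm: "star f \<star> f = f \<star> star f"
    using ev_commute[of "star f" h e r] sfh sfe by (simp add: f_def)
  have ff: "f \<star> f = smul (poly r l) f"
    using ev_eigen[OF hf, of e r] ef by (simp add: f_def)
  define k where "k = star f \<star> f"
  have k0: "k \<noteq> 0" using star_conv_eq_0[OF fg] f0 by (auto simp: k_def)
  have sk: "star k = k" by (simp add: k_def star_conv fg)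
  have kg: "k \<in> galg" by (simp add: k_def)
  define c where "c = cnj (poly r l) * poly r l"
  have kk: "k \<star> k = smul c k"
  proof -
    have "k \<star> k = star f \<star> (f \<star> star f) \<star> f" by (simp add: k_def conv_assoc)
    also have "\<dots> = star (f \<star> f) \<star> (f \<star> f)" by (simp add: nrm[symmetric] star_conv conv_assoc)
    also have "\<dots> = smul c k" by (simp add: ff star_simps k_def c_def mult.commute)
    finally show ?thesis .
  qed
  have c0: "c \<noteq> 0"
  proof
    assume "c = 0"
    then have "k \<star> star k = 0" using kk sk by simp
    then show False using conv_star_eq_0[OF kg] k0 by simp
  qed
  have cr: "cnj c = c" by (simp add: c_def)
  define k' where "k' = smul (1 / c) k"
  have hk: "h \<star> k' = smul l k'"
  proof -
    have "h \<star> k = h \<star> f \<star> star f" by (simp add: k_def nrm conv_assoc)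
    then show ?thesis by (simp add: hf k'_def k_def nrm mult.commute)
  qed
  have 1: "proj k'" using kg kk sk c0 cr by (auto simp: proj_def k'_def star_simps)
  have 2: "k' \<noteq> 0" using k0 c0 by (auto simp: k'_def smul_def fun_eq_iff)
  have 3: "e \<star> k' = k'" "k' \<star> e = k'"
    using sfe fe[of r] by (auto simp: k'_def k_def conv_assoc conv_assoc[symmetric, of e] f_def[symmetric])
  \<comment> \<open>If the spectral projection were all of e, then h would be the scalar l times
    e.\<close>
  have 4: "k' \<noteq> e" using hk h(3) h(4)[of l] by auto
  show ?thesis using 1 2 3 4 by blast
qed

text \<open>Real and imaginary parts: if h1 and h2 were both multiples of e, so would be the corner
  element b, against the choice of a.\<close>

lemma proj_split:
  assumes e: "proj e" "e \<noteq> 0" "\<not> primitive e"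
  shows "\<exists>f. proj f \<and> f \<noteq> 0 \<and> f \<noteq> e \<and> e \<star> f = f \<and> f \<star> e = f"
proof -
  have eg: "e \<in> galg" "e \<star> e = e" "star e = e" using e by (auto simp: proj_def)
  have ee: "e \<star> (e \<star> b) = e \<star> b" for b using eg conv_assoc by metis
  obtain a where a: "a \<in> galg" "\<And>c. e \<star> a \<star> e \<noteq> smul c e" using e by (auto simp: primitive_def)
  define b where "b = e \<star> a \<star> e"
  have b: "e \<star> b = b" "b \<star> e = b" "b \<in> galg" by (auto simp: b_def conv_assoc eg ee)
  have sb: "e \<star> star b = star b" "star b \<star> e = star b"
    using b eg star_conv by metis+
  define h1 where "h1 = b + star b"
  define h2 where "h2 = smul \<i> (b - star b)"
  have h1: "star h1 = h1" "e \<star> h1 = h1" "h1 \<star> e = h1"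
    using b sb by (auto simp: h1_def star_simps conv_add_left conv_add_right add.commute)
  have "star h2 = smul (- \<i>) (star b - b)" by (simp add: h2_def star_simps b)
  then have "star h2 = h2" by (simp add: h2_def smul_def fun_eq_iff algebra_simps)
  then have h2: "star h2 = h2" "e \<star> h2 = h2" "h2 \<star> e = h2"
    using b sb by (auto simp: h2_def conv_diff_left conv_diff_right)
  have "\<not> ((\<exists>c. h1 = smul c e) \<and> (\<exists>c. h2 = smul c e))"
  proof
    assume "(\<exists>c. h1 = smul c e) \<and> (\<exists>c. h2 = smul c e)"
    then obtain c d where cd: "h1 = smul c e" "h2 = smul d e" by blast
    have "b = smul (1/2) (h1 + smul (-\<i>) h2)"
      by (auto simp: h1_def h2_def smul_def fun_eq_iff algebra_simps)
    also have "\<dots> = smul ((c - \<i> * d) / 2) e" unfolding cd by (auto simp: smul_def fun_eq_iff field_simps)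
    finally show False using a(2)[of "(c - \<i> * d) / 2"] b_def by simp
  qed
  then show ?thesis using proj_split_selfadjoint[OF e(1) h1] proj_split_selfadjoint[OF e(1) h2] by blast
qed

lemma proj_one: "proj e \<Longrightarrow> e \<one> = of_real (\<Sum>x\<in>carrier G. (cmod (e x))\<^sup>2)"
  using conv_star_one[of e] by (simp add: proj_def)

text \<open>Cauchy-Schwarz applied to e = e \<star> e; the right-hand side is the value of e at
  \<open>\<one>\<close>. The equality case is what later identifies characters of degree
  one.\<close>

lemma proj_bound:
  assumes "proj e" "x \<in> carrier G"
  shows "cmod (e x) \<le> (\<Sum>x\<in>carrier G. (cmod (e x))\<^sup>2)"
proof -
  have "e x = (e \<star> e) x" using assms by (simp add: proj_def)
  also have "\<dots> = (\<Sum>y\<in>carrier G. e y * e (inv y \<otimes> x))" using assms by (simp add: conv_def)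
  also have "cmod \<dots> \<le> (\<Sum>y\<in>carrier G. cmod (e y) * cmod (e (inv y \<otimes> x)))"
    by (rule order.trans[OF norm_sum]) (simp add: norm_mult)
  finally have 1: "cmod (e x) \<le> (\<Sum>y\<in>carrier G. cmod (e y) * cmod (e (inv y \<otimes> x)))" .
  have "(\<Sum>y\<in>carrier G. (cmod (e (inv y \<otimes> x)))\<^sup>2) = (\<Sum>y\<in>carrier G. (cmod (e y))\<^sup>2)"
    using sum_inv[of "\<lambda>y. (cmod (e (y \<otimes> x)))\<^sup>2"] sum_shift_right[OF assms(2), of "\<lambda>y. (cmod (e y))\<^sup>2"] by simp
  then have "(\<Sum>y\<in>carrier G. cmod (e y) * cmod (e (inv y \<otimes> x)))\<^sup>2 \<le> (\<Sum>y\<in>carrier G. (cmod (e y))\<^sup>2)\<^sup>2"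
    using Cauchy_Schwarz_sum[of "\<lambda>y. cmod (e y)" "\<lambda>y. cmod (e (inv y \<otimes> x))" "carrier G"]
    by (simp add: power2_eq_square)
  then have "(\<Sum>y\<in>carrier G. cmod (e y) * cmod (e (inv y \<otimes> x))) \<le> (\<Sum>y\<in>carrier G. (cmod (e y))\<^sup>2)"
    by (rule power2_le_imp_le) (simp add: sum_nonneg)
  with 1 show ?thesis by linarith
qed

text \<open>Bounds the trace of a nonzero projection away from 0, so that repeated splitting terminates.\<close>

lemma proj_large:
  assumes "proj e" "e \<noteq> 0"
  shows "1 \<le> card (carrier G) * Re (e \<one>)"
proof -
  define t where "t = (\<Sum>x\<in>carrier G. (cmod (e x))\<^sup>2)"
  have et: "e \<one> = of_real t" unfolding t_def by (rule proj_one[OF assms(1)])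
  obtain x where x: "e x \<noteq> 0" using assms(2) by (auto simp: fun_eq_iff)
  then have xG: "x \<in> carrier G" using assms(1) by (auto simp: proj_def galg_def)
  have "0 < (cmod (e x))\<^sup>2" using x by simp
  also have "\<dots> \<le> t" unfolding t_def by (rule member_le_sum[OF xG]) (auto simp: fin)
  finally have t0: "t > 0" .
  have "t \<le> (\<Sum>x\<in>carrier G. t\<^sup>2)" unfolding t_def
    by (rule sum_mono) (use proj_bound[OF assms(1)] in \<open>auto intro: power_mono\<close>)
  then have "t * 1 \<le> t * (card (carrier G) * t)" by (simp add: power2_eq_square algebra_simps)
  then show ?thesis using t0 et by (simp add: mult_le_cancel_left)
qed

lemma primitive_decomposition:
  assumes "proj e"
  shows "\<exists>ps. (\<forall>p\<in>set ps. primitive p) \<and> e = sum_list ps"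
  using assms
\<comment> \<open>The measure is the integer part of the degree. The degree is additive under e = f
  + k and both summands have degree at least 1 by \<open>proj_large\<close>, so both integer parts
  drop.\<close>
proof (induction "nat \<lfloor>card (carrier G) * Re (e \<one>)\<rfloor>" arbitrary: e rule: less_induct)
  case less
  consider "e = 0" | "primitive e" | "e \<noteq> 0" "\<not> primitive e" by blast
  then show ?case
  proof cases
    case 1 then show ?thesis by (intro exI[of _ "[]"]) auto
  next
    case 2 then show ?thesis by (intro exI[of _ "[e]"]) auto
  next
    case 3
    from proj_split[OF less.prems 3] obtain f where
      f: "proj f" "f \<noteq> 0" "f \<noteq> e" "e \<star> f = f" "f \<star> e = f" by blast
    define k where "k = e - f"
    have k: "proj k" "k \<noteq> 0" using f less.prems
      by (auto simp: proj_def k_def conv_diff_left conv_diff_right star_simps)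
    have ek: "e = f + k" by (simp add: k_def)
    have lf: "1 \<le> card (carrier G) * Re (f \<one>)" using proj_large f by blast
    have lk: "1 \<le> card (carrier G) * Re (k \<one>)" using proj_large k by blast
    have s: "card (carrier G) * Re (e \<one>) = card (carrier G) * Re (f \<one>) + card (carrier G) * Re (k \<one>)"
      by (simp add: ek algebra_simps)
    have "nat \<lfloor>card (carrier G) * Re (f \<one>)\<rfloor> < nat \<lfloor>card (carrier G) * Re (e \<one>)\<rfloor>"
      "nat \<lfloor>card (carrier G) * Re (k \<one>)\<rfloor> < nat \<lfloor>card (carrier G) * Re (e \<one>)\<rfloor>"
      using lf lk s by linarith+
    from less.hyps[OF this(1) f(1)] less.hyps[OF this(2) k(1)]
    obtain ps qs where "\<forall>p\<in>set ps. primitive p" "f = sum_list ps" "\<forall>p\<in>set qs. primitive p" "k = sum_list qs"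
      by blast
    then show ?thesis using ek by (intro exI[of _ "ps @ qs"]) auto
  qed
qed

section \<open>Irreducible and induced characters\<close>

text \<open>For an idempotent e this is the character of the left ideal C[G] e.\<close>

definition ch :: "('a \<Rightarrow> complex) \<Rightarrow> 'a \<Rightarrow> complex" where
  "ch a = (\<lambda>g. if g \<in> carrier G then \<Sum>x\<in>carrier G. a (x \<otimes> inv g \<otimes> inv x) else 0)"

definition ip :: "('a \<Rightarrow> complex) \<Rightarrow> ('a \<Rightarrow> complex) \<Rightarrow> complex" where
  "ip f h = (\<Sum>g\<in>carrier G. f g * cnj (h g)) / of_nat (card (carrier G))"

text \<open>The identity tr(ab) = tr(ba) for the trace form behind \<open>ch\<close>. Through it
  linked idempotents get equal characters in \<open>primitive_dichotomy\<close>.\<close>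

lemma ch_conv_commute: "ch (a \<star> b) = ch (b \<star> a)"
proof
  fix g
  show "ch (a \<star> b) g = ch (b \<star> a) g"
  proof (cases "g \<in> carrier G")
    case True
    define k where "k = inv g"
    have k: "k \<in> carrier G" using True by (simp add: k_def)
    have "ch (a \<star> b) g = (\<Sum>x\<in>carrier G. \<Sum>u\<in>carrier G. a u * b (inv u \<otimes> (x \<otimes> k \<otimes> inv x)))"
      using True by (simp add: ch_def conv_def k_def)
    also have "\<dots> = (\<Sum>u\<in>carrier G. \<Sum>x\<in>carrier G. a u * b (inv u \<otimes> (x \<otimes> k \<otimes> inv x)))"
      by (rule sum.swap)
    also have "\<dots> = (\<Sum>u\<in>carrier G. \<Sum>x\<in>carrier G. a u * b ((x \<otimes> k \<otimes> inv x) \<otimes> inv u))"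
    proof (rule sum.cong)
      fix u assume u: "u \<in> carrier G"
      show "(\<Sum>x\<in>carrier G. a u * b (inv u \<otimes> (x \<otimes> k \<otimes> inv x))) =
            (\<Sum>x\<in>carrier G. a u * b ((x \<otimes> k \<otimes> inv x) \<otimes> inv u))"
        by (subst sum_shift_left[OF u, symmetric], rule sum.cong)
           (use u k in \<open>auto simp: m_assoc[symmetric] inv_mult_group\<close>)
    qed simp
    also have "\<dots> = (\<Sum>x\<in>carrier G. \<Sum>u\<in>carrier G. a u * b ((x \<otimes> k \<otimes> inv x) \<otimes> inv u))"
      by (rule sum.swap)
    also have "\<dots> = (\<Sum>x\<in>carrier G. \<Sum>v\<in>carrier G. b v * a (inv v \<otimes> (x \<otimes> k \<otimes> inv x)))"
    proof (rule sum.cong)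
      fix x assume x: "x \<in> carrier G"
      define w where "w = x \<otimes> k \<otimes> inv x"
      have w: "w \<in> carrier G" using x k by (simp add: w_def)
      have "(\<Sum>v\<in>carrier G. b v * a (inv v \<otimes> w)) = (\<Sum>u\<in>carrier G. b (w \<otimes> inv u) * a (inv (w \<otimes> inv u) \<otimes> w))"
        using sum_shift_left[OF w, of "\<lambda>v. b v * a (inv v \<otimes> w)"]
          sum_inv[of "\<lambda>u. b (w \<otimes> u) * a (inv (w \<otimes> u) \<otimes> w)"] by simp
      also have "\<dots> = (\<Sum>u\<in>carrier G. a u * b (w \<otimes> inv u))"
        by (rule sum.cong) (use w in \<open>auto simp: inv_mult_group m_assoc\<close>)
      finally show "(\<Sum>u\<in>carrier G. a u * b ((x \<otimes> k \<otimes> inv x) \<otimes> inv u)) =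
          (\<Sum>v\<in>carrier G. b v * a (inv v \<otimes> (x \<otimes> k \<otimes> inv x)))" by (simp add: w_def)
    qed simp
    also have "\<dots> = ch (b \<star> a) g" using True by (simp add: ch_def conv_def k_def)
    finally show ?thesis .
  qed (simp add: ch_def)
qed

lemma ch_class:
  assumes "x \<in> carrier G" "g \<in> carrier G"
  shows "ch a (x \<otimes> g \<otimes> inv x) = ch a g"
proof -
  have "ch a (x \<otimes> g \<otimes> inv x) = (\<Sum>y\<in>carrier G. a ((y \<otimes> x) \<otimes> inv g \<otimes> inv (y \<otimes> x)))"
    using assms by (auto simp: ch_def inv_mult_group m_assoc intro!: sum.cong)
  also have "\<dots> = ch a g"
    using sum_shift_right[OF assms(1), of "\<lambda>y. a (y \<otimes> inv g \<otimes> inv y)"] assms by (simp add: ch_def)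
  finally show ?thesis .
qed

lemma ch_smul: "ch (smul c a) = smul c (ch a)"
  by (auto simp: ch_def smul_def sum_distrib_left)

lemma conv_delta_conv:
  "g \<in> carrier G \<Longrightarrow> z \<in> carrier G \<Longrightarrow>
    (a \<star> delta z \<star> b) g = (\<Sum>u\<in>carrier G. a u * b (inv z \<otimes> inv u \<otimes> g))"
proof -
  assume g: "g \<in> carrier G" and z: "z \<in> carrier G"
  have d: "(delta z \<star> b) y = b (inv z \<otimes> y)" if "y \<in> carrier G" for y
    using that z fin by (simp add: conv_def delta_def if_distrib[of "\<lambda>x. x * _"] sum.delta cong: if_cong)
  have "(a \<star> (delta z \<star> b)) g = (\<Sum>u\<in>carrier G. a u * (delta z \<star> b) (inv u \<otimes> g))"
    using g by (simp add: conv_def)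
  also have "\<dots> = (\<Sum>u\<in>carrier G. a u * b (inv z \<otimes> inv u \<otimes> g))"
    using g z by (auto simp: d m_assoc intro!: sum.cong)
  finally show ?thesis by (simp add: conv_assoc)
qed

lemma conv_expand:
  "(a \<star> b \<star> c) g = (\<Sum>z\<in>carrier G. b z * (a \<star> delta z \<star> c) g)"
proof (cases "g \<in> carrier G")
  case True
  have "(a \<star> b \<star> c) g = (\<Sum>u\<in>carrier G. \<Sum>z\<in>carrier G. a u * (b z * c (inv z \<otimes> (inv u \<otimes> g))))"
    unfolding conv_assoc using True by (simp add: conv_def[of a] conv_def[of b] sum_distrib_left)
  also have "\<dots> = (\<Sum>z\<in>carrier G. \<Sum>u\<in>carrier G. a u * (b z * c (inv z \<otimes> (inv u \<otimes> g))))"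
    by (rule sum.swap)
  also have "\<dots> = (\<Sum>z\<in>carrier G. b z * (a \<star> delta z \<star> c) g)"
    using True by (auto simp: conv_delta_conv sum_distrib_left m_assoc ac_simps intro!: sum.cong)
  finally show ?thesis .
qed (simp add: conv_def)

text \<open>The right-hand side is the trace of a |-> e a f on C[G]. For idempotents this is the
  dimension of e C[G] f, that is, of the space of homomorphisms between the two left ideals.\<close>

lemma ip_ch:
  assumes f: "star f = f"
  shows "ip (ch e) (ch f) = (\<Sum>z\<in>carrier G. (e \<star> delta z \<star> f) z)"
proof -
  let ?C = "carrier G"
  have fs: "cnj (f w) = f (inv w)" if "w \<in> ?C" for w
    using fun_cong[OF f, of "inv w"] that by (simp add: star_def)
  define T where "T = (\<Sum>y\<in>?C. \<Sum>g\<in>?C. e g * f (y \<otimes> inv g \<otimes> inv y))"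
  have "(\<Sum>g\<in>?C. ch e g * cnj (ch f g)) =
      (\<Sum>g\<in>?C. \<Sum>x\<in>?C. \<Sum>y\<in>?C. e (x \<otimes> inv g \<otimes> inv x) * f (y \<otimes> g \<otimes> inv y))"
    by (rule sum.cong) (auto simp: ch_def sum_product fs inv_mult_group m_assoc)
  also have "\<dots> = (\<Sum>x\<in>?C. \<Sum>g\<in>?C. \<Sum>y\<in>?C. e (x \<otimes> inv g \<otimes> inv x) * f (y \<otimes> g \<otimes> inv y))"
    by (rule sum.swap)
  also have "\<dots> = (\<Sum>x\<in>?C. T)"
  proof (rule sum.cong)
    fix x assume x: "x \<in> ?C"
    have "(\<Sum>g\<in>?C. \<Sum>y\<in>?C. e (x \<otimes> inv g \<otimes> inv x) * f (y \<otimes> g \<otimes> inv y)) =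
        (\<Sum>y\<in>?C. \<Sum>g\<in>?C. e (x \<otimes> inv g \<otimes> inv x) * f (y \<otimes> g \<otimes> inv y))" by (rule sum.swap)
    also have "\<dots> = (\<Sum>y\<in>?C. \<Sum>g\<in>?C. e (x \<otimes> inv g \<otimes> inv x) * f ((y \<otimes> x) \<otimes> g \<otimes> inv (y \<otimes> x)))"
      by (rule sum_shift_right[OF x, symmetric])
    also have "\<dots> = T" unfolding T_def
    proof (rule sum.cong)
      fix y assume y: "y \<in> ?C"
      let ?h = "\<lambda>g. e g * f (y \<otimes> inv g \<otimes> inv y)"
      have "(\<Sum>g\<in>?C. ?h g) = (\<Sum>g\<in>?C. ?h (x \<otimes> g \<otimes> inv x))" by (rule sum_conj[OF x, symmetric])
      also have "\<dots> = (\<Sum>g\<in>?C. ?h (x \<otimes> inv g \<otimes> inv x))" by (rule sum_inv[symmetric])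
      also have "\<dots> = (\<Sum>g\<in>?C. e (x \<otimes> inv g \<otimes> inv x) * f ((y \<otimes> x) \<otimes> g \<otimes> inv (y \<otimes> x)))"
        by (rule sum.cong) (use x y in \<open>auto simp: inv_mult_group m_assoc\<close>)
      finally show "(\<Sum>g\<in>?C. e (x \<otimes> inv g \<otimes> inv x) * f ((y \<otimes> x) \<otimes> g \<otimes> inv (y \<otimes> x))) = (\<Sum>g\<in>?C. ?h g)" ..
    qed simp
    finally show "(\<Sum>g\<in>?C. \<Sum>y\<in>?C. e (x \<otimes> inv g \<otimes> inv x) * f (y \<otimes> g \<otimes> inv y)) = T" .
  qed simp
  also have "\<dots> = of_nat (card ?C) * T" by simp
  finally have "ip (ch e) (ch f) = T" using order_pos by (simp add: ip_def)
  also have "T = (\<Sum>z\<in>?C. \<Sum>g\<in>?C. e g * f (inv z \<otimes> inv g \<otimes> inv (inv z)))"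
    unfolding T_def by (rule sum_inv[symmetric])
  also have "\<dots> = (\<Sum>z\<in>?C. (e \<star> delta z \<star> f) z)"
    by (rule sum.cong) (auto simp: conv_delta_conv)
  finally show ?thesis .
qed

lemma primitiveD:
  assumes "primitive e"
  shows "e \<in> galg" "e \<star> e = e" "star e = e" "e \<noteq> 0" "e \<star> (e \<star> a) = e \<star> a"
  using assms conv_assoc[of e e a] by (auto simp: primitive_def proj_def)

lemma primitive_sandwich: "primitive e \<Longrightarrow> a \<in> galg \<Longrightarrow> \<exists>c. e \<star> a \<star> e = smul c e"
  by (simp add: primitive_def)

text \<open>For primitive e one has e z e = l(z) e with scalars l(z). Expanding e = e e e gives sum
  e(z) l(z) = 1, and this sum is also the trace in \<open>ip_ch\<close>.\<close>

lemma ip_primitive_self: "primitive e \<Longrightarrow> ip (ch e) (ch e) = 1"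
proof -
  assume p: "primitive e"
  note e = primitiveD[OF p]
  have "\<forall>z\<in>carrier G. \<exists>c. e \<star> delta z \<star> e = smul c e" using p by (auto simp: primitive_def)
  then obtain l where l: "\<And>z. z \<in> carrier G \<Longrightarrow> e \<star> delta z \<star> e = smul (l z) e" by metis
  obtain g where g: "e g \<noteq> 0" using e by (auto simp: fun_eq_iff)
  have "e g = (\<Sum>z\<in>carrier G. e z * (e \<star> delta z \<star> e) g)" using conv_expand[of e e e g] e by simp
  also have "\<dots> = (\<Sum>z\<in>carrier G. e z * l z) * e g"
    by (auto simp: l smul_def sum_distrib_right intro!: sum.cong)
  finally have 1: "(\<Sum>z\<in>carrier G. e z * l z) = 1" using g by simp
  show ?thesis unfolding ip_ch[OF e(3)] 1[symmetric]
    by (rule sum.cong) (auto simp: l smul_def)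
qed

text \<open>Schur's lemma in the form of a polar decomposition: a nonzero b in e C[G] f is a partial
  isometry up to a scalar. The two scalars agree because \<open>b \<star> star b \<star> b\<close>
  can be bracketed in two ways.\<close>

lemma primitive_link:
  assumes p: "primitive e" "primitive f" and b: "b = e \<star> a \<star> f" "b \<noteq> 0"
  obtains c where "c \<noteq> 0" "b \<star> star b = smul c e" "star b \<star> b = smul c f"
proof -
  note e = primitiveD[OF p(1)] and f = primitiveD[OF p(2)]
  have bg: "b \<in> galg" using b by simp
  have eb: "e \<star> b = b" "b \<star> f = b" using e f by (auto simp: b conv_assoc)
  have sb: "star b = f \<star> star b" "star b = star b \<star> e" using eb star_conv e f by metis+
  have "b \<star> star b = e \<star> (b \<star> star b) \<star> e" using eb sb conv_assoc by metis
  then obtain c where c: "b \<star> star b = smul c e"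
    using primitive_sandwich[OF p(1), of "b \<star> star b"] by auto
  have "star b \<star> b = f \<star> (star b \<star> b) \<star> f" using eb sb conv_assoc by metis
  then obtain d where d: "star b \<star> b = smul d f"
    using primitive_sandwich[OF p(2), of "star b \<star> b"] by auto
  have c0: "c \<noteq> 0" using c conv_star_eq_0[OF bg] b by auto
  have "smul c b = (b \<star> star b) \<star> b" by (simp add: c eb)
  also have "\<dots> = smul d b" by (simp add: conv_assoc d eb)
  finally have "c = d" using smul_cancel b by blast
  then show thesis using that c0 c d by blast
qed

lemma primitive_dichotomy:
  assumes p: "primitive e" "primitive f"
  shows "(\<forall>a. e \<star> a \<star> f = 0) \<or> ch e = ch f"
proof (rule ccontr)
  assume n: "\<not> ?thesis"
  then obtain a where "e \<star> a \<star> f \<noteq> 0" by blast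
  then obtain c where c: "c \<noteq> 0" "(e \<star> a \<star> f) \<star> star (e \<star> a \<star> f) = smul c e"
    "star (e \<star> a \<star> f) \<star> (e \<star> a \<star> f) = smul c f"
    using primitive_link[OF p refl] by metis
  then have "smul c (ch e) = smul c (ch f)" using ch_conv_commute ch_smul by metis
  then show False using n c(1) by (auto simp: smul_def fun_eq_iff)
qed

section \<open>Irreducible characters\<close>

definition irr :: "('a \<Rightarrow> complex) set" where
  "irr = ch ` {e. primitive e}"

lemma irr_orthonormal:
  assumes "\<chi> \<in> irr" "\<psi> \<in> irr"
  shows "ip \<chi> \<psi> = (if \<chi> = \<psi> then 1 else 0)"
proof -
  obtain e f where ef: "primitive e" "primitive f" "\<chi> = ch e" "\<psi> = ch f" using assms by (auto simp: irr_def)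
  show ?thesis
  proof (cases "\<chi> = \<psi>")
    case True then show ?thesis using ip_primitive_self ef by auto
  next
    case False
    then have "e \<star> delta z \<star> f = 0" for z using primitive_dichotomy[OF ef(1,2)] ef by blast
    then show ?thesis using False ef by (simp add: ip_ch primitiveD)
  qed
qed

lemma conv_sum_list: "f \<star> sum_list ps = (\<Sum>p\<leftarrow>ps. f \<star> p)"
  by (induction ps) (simp_all only: list.map sum_list.Nil sum_list.Cons conv_zero conv_add_right)

text \<open>In a decomposition of the unit into primitive idempotents every primitive f meets some
  component, and by the dichotomy it has the character of that component.\<close>

lemma finite_irr: "finite irr"
proof -
  have "proj (delta \<one>)"
    by (auto simp: proj_def) (auto simp: star_def delta_def fun_eq_iff)
  then obtain ps where ps: "\<forall>p\<in>set ps. primitive p" "delta \<one> = sum_list ps"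
    using primitive_decomposition by blast
  have "irr \<subseteq> ch ` set ps"
  proof
    fix \<chi> assume "\<chi> \<in> irr"
    then obtain f where f: "primitive f" "\<chi> = ch f" by (auto simp: irr_def)
    have "\<exists>p\<in>set ps. f \<star> p \<noteq> 0"
    proof (rule ccontr)
      assume "\<not> ?thesis"
      then have *: "\<forall>p\<in>set ps. f \<star> p = 0" by blast
      have "(\<Sum>p\<leftarrow>ps. f \<star> p) = 0" using * by (induction ps) auto
      then have "f = 0" using delta_one_conv(2)[of f] conv_sum_list[of f ps] ps primitiveD[OF f(1)] by simp
      then show False using primitiveD[OF f(1)] by simp
    qed
    then obtain p where p: "p \<in> set ps" "f \<star> p \<noteq> 0" by blast
    then have "f \<star> delta \<one> \<star> p \<noteq> 0" using primitiveD[OF f(1)] by simp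
    then have "ch f = ch p" using primitive_dichotomy[OF f(1), of p] ps p by blast
    then show "\<chi> \<in> ch ` set ps" using f p by auto
  qed
  then show ?thesis using finite_surj by blast
qed

lemma irr_class: "\<chi> \<in> irr \<Longrightarrow> x \<in> carrier G \<Longrightarrow> g \<in> carrier G \<Longrightarrow> \<chi> (x \<otimes> g \<otimes> inv x) = \<chi> g"
  by (auto simp: irr_def ch_class)

definition triv :: "'a \<Rightarrow> complex" where
  "triv = (\<lambda>g. if g \<in> carrier G then 1 else 0)"

definition cj :: "('a \<Rightarrow> complex) \<Rightarrow> 'a \<Rightarrow> complex" where
  "cj f = (\<lambda>g. cnj (f g))"

lemma triv_irr: "triv \<in> irr"
proof -
  define n where "n = complex_of_nat (card (carrier G))"
  have n0: "n \<noteq> 0" using order_pos by (simp add: n_def)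
  \<comment> \<open>The averaging idempotent: multiplying by it is the augmentation map, so its
    corner is scalar.\<close>
  define e where "e = (\<lambda>x. if x \<in> carrier G then 1 / n else 0)"
  have ea: "e \<star> a = smul (\<Sum>x\<in>carrier G. a x) e" for a
  proof
    fix g
    have "(\<Sum>x\<in>carrier G. a (inv x \<otimes> g)) = (\<Sum>x\<in>carrier G. a x)" if "g \<in> carrier G"
      using sum_inv[of "\<lambda>x. a (x \<otimes> g)"] sum_shift_right[OF that, of a] by simp
    then show "(e \<star> a) g = smul (\<Sum>x\<in>carrier G. a x) e g"
      by (auto simp: conv_def e_def smul_def sum_divide_distrib[symmetric])
  qed
  have es: "(\<Sum>x\<in>carrier G. e x) = 1" using n0 by (simp add: e_def n_def)
  have "star e = e" by (auto simp: star_def e_def n_def fun_eq_iff)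
  moreover have "e \<one> \<noteq> 0 \<one>" using n0 by (simp add: e_def)
  then have "e \<noteq> 0" by metis
  moreover have "e \<in> galg" by (auto simp: galg_def e_def)
  ultimately have "primitive e" by (auto simp: primitive_def proj_def ea es)
  moreover have "ch e = triv"
    using n0 by (auto simp: ch_def triv_def e_def n_def fun_eq_iff)
  ultimately show ?thesis unfolding irr_def by (metis imageI mem_Collect_eq)
qed

lemma cj_cj [simp]: "cj (cj f) = f"
  by (simp add: cj_def)

lemma cj_conv: "cj (a \<star> b) = cj a \<star> cj b"
  by (auto simp: cj_def conv_def)

lemma cj_primitive:
  assumes p: "primitive e"
  shows "primitive (cj e)"
proof -
  note e = primitiveD[OF p]
  have "cj e \<in> galg" using e(1) by (auto simp: galg_def cj_def)
  moreover have "star (cj e) = cj e"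
  proof
    fix x show "star (cj e) x = cj e x"
      using fun_cong[OF e(3), of x] e(1)
      by (auto simp: cj_def star_def galg_def) (metis complex_cnj_cnj)
  qed
  moreover have "cj e \<noteq> 0" using e(4) by (auto simp: cj_def fun_eq_iff)
  moreover have "\<exists>c. cj e \<star> a \<star> cj e = smul c (cj e)" if "a \<in> galg" for a
  proof -
    have "cj a \<in> galg" using that by (auto simp: galg_def cj_def)
    then obtain c where "e \<star> cj a \<star> e = smul c e" using p by (auto simp: primitive_def)
    then have "cj (e \<star> cj a \<star> e) = cj (smul c e)" by simp
    then have "cj e \<star> a \<star> cj e = smul (cnj c) (cj e)" by (simp add: cj_conv) (simp add: cj_def smul_def)
    then show ?thesis by blast
  qed
  ultimately show ?thesis using e(2) by (auto simp: primitive_def proj_def cj_conv[symmetric])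
qed

lemma ch_cj: "ch (cj a) = cj (ch a)"
  by (auto simp: ch_def cj_def)

lemma cj_irr: "\<chi> \<in> irr \<Longrightarrow> cj \<chi> \<in> irr"
  unfolding irr_def using cj_primitive ch_cj by (auto intro!: image_eqI[of _ ch "cj _"])

lemma square_root:
  assumes "odd (card (carrier G))" "g \<in> carrier G"
  shows "(g \<otimes> g) [^] ((card (carrier G) + 1) div 2) = g"
proof -
  let ?m = "(card (carrier G) + 1) div 2"
  have "(g \<otimes> g) [^] ?m = (g [^] (2::nat)) [^] ?m" using assms by (simp add: numeral_2_eq_2)
  also have "\<dots> = g [^] (2 * ?m)" using assms(2) by (rule nat_pow_pow)
  also have "2 * ?m = Coset.order G + 1" using assms by (simp add: Coset.order_def)
  also have "g [^] (Coset.order G + 1) = g" using assms by (simp add: pow_order_eq_1)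
  finally show ?thesis .
qed

lemma square_bij:
  assumes "odd (card (carrier G))"
  shows "bij_betw (\<lambda>g. g \<otimes> g) (carrier G) (carrier G)"
proof -
  have "inj_on (\<lambda>g. g \<otimes> g) (carrier G)"
    by (rule inj_on_inverseI) (rule square_root[OF assms])
  moreover have "(\<lambda>g. g \<otimes> g) ` carrier G \<subseteq> carrier G" by auto
  ultimately show ?thesis using fin by (simp add: bij_betw_def endo_inj_surj)
qed

text \<open>The Frobenius--Schur argument: inversion acts by a sign on the one-dimensional space
  e C[G] (cj e), and its trace there is the sum of e over all squares.\<close>

lemma real_irr_trivial:
  assumes odd: "odd (card (carrier G))" and "\<chi> \<in> irr" "cj \<chi> = \<chi>"
  shows "\<chi> = triv"
proof (rule ccontr)
  assume nt: "\<chi> \<noteq> triv"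
  let ?C = "carrier G"
  obtain e where p: "primitive e" "\<chi> = ch e" using assms by (auto simp: irr_def)
  note e = primitiveD[OF p(1)]
  define f where "f = cj e"
  have pf: "primitive f" using cj_primitive p by (simp add: f_def)
  note f = primitiveD[OF pf]
  have "ip (ch e) (ch f) = 1" using assms p irr_orthonormal[of \<chi> \<chi>] by (simp add: f_def ch_cj)
  then have sum1: "(\<Sum>z\<in>?C. (e \<star> delta z \<star> f) z) = 1" by (simp add: ip_ch f)
  have "\<exists>z. e \<star> delta z \<star> f \<noteq> 0"
  proof (rule ccontr)
    assume "\<not> ?thesis"
    then have "(e \<star> delta z \<star> f) z = 0" for z by simp
    then show False using sum1 by simp
  qed
  then obtain z0 where z0: "e \<star> delta z0 \<star> f \<noteq> 0" by blast
  define b where "b = e \<star> delta z0 \<star> f"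
  have b0: "b \<noteq> 0" and bg: "b \<in> galg" using z0 by (auto simp: b_def)
  obtain c where c: "c \<noteq> 0" "b \<star> star b = smul c e" "star b \<star> b = smul c f"
    using primitive_link[OF p(1) pf b_def b0] by blast
  have eb: "e \<star> b = b" "b \<star> f = b" using e f by (auto simp: b_def conv_assoc)
  have sb: "star b = f \<star> star b" "star b = star b \<star> e" using eb star_conv e f by metis+
  have one_dim: "\<exists>d. e \<star> a \<star> f = smul d b" for a
  proof -
    have "e \<star> a \<star> f \<star> star b = e \<star> (a \<star> f \<star> star b) \<star> e" using sb(2) by (simp add: conv_assoc)
    then obtain d where d: "e \<star> a \<star> f \<star> star b = smul d e" using p(1) by (auto simp: primitive_def)
    have "smul c (e \<star> a \<star> f) = e \<star> a \<star> f \<star> (star b \<star> b)" using f by (simp add: c conv_assoc)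
    also have "\<dots> = smul d b" using d eb by (simp add: conv_assoc[symmetric])
    finally have "smul (1/c) (smul c (e \<star> a \<star> f)) = smul (1/c) (smul d b)" by simp
    then show ?thesis using c(1) by auto
  qed
  define m where "m z = (SOME d. e \<star> delta z \<star> f = smul d b)" for z
  have m: "e \<star> delta z \<star> f = smul (m z) b" for z
    unfolding m_def by (rule someI_ex[OF one_dim])
  \<comment> \<open>The linear extension of inversion: an anti-automorphism of C[G] that exchanges e
    and f, hence maps the line spanned by b to itself with some factor t.\<close>
  define tp where "tp a = (\<lambda>x. if x \<in> ?C then a (inv x) else 0)" for a :: "'a \<Rightarrow> complex"
  have tp_star: "tp a = cj (star a)" for a by (auto simp: tp_def cj_def star_def)
  have tp_conv: "tp (a \<star> a') = tp a' \<star> tp a" for a a' by (simp add: tp_star star_conv cj_conv)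
  have "tp e = f" "tp f = e" by (auto simp: tp_star f e f_def[symmetric]) (simp add: f_def)
  then have "tp b = e \<star> tp (delta z0) \<star> f" by (simp add: b_def tp_conv conv_assoc)
  then obtain t where t: "tp b = smul t b" using one_dim[of "tp (delta z0)"] by auto
  have t0: "t \<noteq> 0"
  proof
    assume "t = 0"
    then have tb: "tp b = 0" using t by simp
    have "b x = 0" for x
    proof (cases "x \<in> ?C")
      case True then show ?thesis using fun_cong[OF tb, of "inv x"] by (simp add: tp_def)
    qed (use bg in \<open>auto simp: galg_def\<close>)
    then show False using b0 by (auto simp: fun_eq_iff)
  qed
  obtain g where g: "b g \<noteq> 0" using b0 by (auto simp: fun_eq_iff)
  have "b g = (\<Sum>z\<in>?C. b z * (e \<star> delta z \<star> f) g)" using conv_expand[of e b f g] eb by simp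
  also have "\<dots> = (\<Sum>z\<in>?C. b z * m z) * b g" by (simp add: m smul_def sum_distrib_right mult.assoc)
  finally have s1: "(\<Sum>z\<in>?C. b z * m z) = 1" using g by simp
  have "(\<Sum>z\<in>?C. (e \<star> delta (inv z) \<star> f) z) = (\<Sum>z\<in>?C. m (inv z) * b z)" by (simp add: m smul_def)
  also have "\<dots> = (\<Sum>z\<in>?C. m z * b (inv z))" using sum_inv[of "\<lambda>z. m (inv z) * b z"] by simp
  also have "\<dots> = (\<Sum>z\<in>?C. t * (b z * m z))"
  proof (rule sum.cong)
    fix z assume "z \<in> ?C"
    then have "b (inv z) = t * b z" using fun_cong[OF t, of z] by (simp add: tp_def smul_def)
    then show "m z * b (inv z) = t * (b z * m z)" by simp
  qed simp
  also have "\<dots> = t" by (simp add: sum_distrib_left[symmetric] s1)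
  finally have tr: "(\<Sum>z\<in>?C. (e \<star> delta (inv z) \<star> f) z) = t" .
  have fe: "f w = e (inv w)" if "w \<in> ?C" for w
    using fun_cong[OF e(3), of "inv w"] that by (simp add: star_def f_def cj_def)
  have "(\<Sum>z\<in>?C. (e \<star> delta (inv z) \<star> f) z) = (\<Sum>z\<in>?C. \<Sum>u\<in>?C. e u * e (inv z \<otimes> u \<otimes> inv z))"
    by (intro sum.cong) (simp_all add: conv_delta_conv fe inv_mult_group m_assoc)
  also have "\<dots> = (\<Sum>z\<in>?C. \<Sum>u\<in>?C. e u * e (z \<otimes> u \<otimes> z))"
    by (rule sum_inv[of "\<lambda>z. \<Sum>u\<in>?C. e u * e (z \<otimes> u \<otimes> z)"])
  also have "\<dots> = (\<Sum>u\<in>?C. \<Sum>z\<in>?C. e u * e (z \<otimes> u \<otimes> z))" by (rule sum.swap)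
  also have "\<dots> = (\<Sum>u\<in>?C. \<Sum>g\<in>?C. e u * e (inv u \<otimes> (g \<otimes> g)))"
  proof (rule sum.cong)
    fix u assume u: "u \<in> ?C"
    have "(\<Sum>z\<in>?C. e u * e (z \<otimes> u \<otimes> z)) = (\<Sum>z\<in>?C. e u * e ((inv u \<otimes> z) \<otimes> u \<otimes> (inv u \<otimes> z)))"
      by (rule sum_shift_left[symmetric]) (use u in simp)
    also have "\<dots> = (\<Sum>g\<in>?C. e u * e (inv u \<otimes> (g \<otimes> g)))"
    proof (rule sum.cong)
      fix z assume z: "z \<in> ?C"
      have "u \<otimes> (inv u \<otimes> z) = z" using u z by (simp add: m_assoc[symmetric])
      then have "(inv u \<otimes> z) \<otimes> u \<otimes> (inv u \<otimes> z) = inv u \<otimes> (z \<otimes> z)" using u z by (simp add: m_assoc)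
      then show "e u * e ((inv u \<otimes> z) \<otimes> u \<otimes> (inv u \<otimes> z)) = e u * e (inv u \<otimes> (z \<otimes> z))" by simp
    qed simp
    finally show "(\<Sum>z\<in>?C. e u * e (z \<otimes> u \<otimes> z)) = (\<Sum>g\<in>?C. e u * e (inv u \<otimes> (g \<otimes> g)))" .
  qed simp
  also have "\<dots> = (\<Sum>g\<in>?C. \<Sum>u\<in>?C. e u * e (inv u \<otimes> (g \<otimes> g)))" by (rule sum.swap)
  also have "\<dots> = (\<Sum>g\<in>?C. (e \<star> e) (g \<otimes> g))" by (simp add: conv_def)
  also have "\<dots> = (\<Sum>g\<in>?C. e g)"
    using sum.reindex_bij_betw[OF square_bij[OF odd], of e] e by simp
  finally have t_eq: "t = (\<Sum>g\<in>?C. e g)" using tr by simp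
  \<comment> \<open>Summing \<chi> over the group gives |G| t, while orthogonality to
    \<open>triv\<close> makes this sum 0; but t is nonzero because inversion is bijective.\<close>
  have "ip \<chi> triv = 0" using irr_orthonormal assms triv_irr nt by simp
  then have "(\<Sum>g\<in>?C. \<chi> g) = 0" using order_pos by (simp add: ip_def triv_def)
  moreover have "(\<Sum>g\<in>?C. \<chi> g) = (\<Sum>g\<in>?C. \<Sum>x\<in>?C. e (x \<otimes> inv g \<otimes> inv x))"
    by (simp add: p ch_def)
  moreover have "\<dots> = (\<Sum>x\<in>?C. \<Sum>g\<in>?C. e (x \<otimes> inv g \<otimes> inv x))" by (rule sum.swap)
  moreover have "\<dots> = (\<Sum>x\<in>?C. \<Sum>g\<in>?C. e g)"
  proof (rule sum.cong)
    fix x assume "x \<in> ?C"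
    then show "(\<Sum>g\<in>?C. e (x \<otimes> inv g \<otimes> inv x)) = (\<Sum>g\<in>?C. e g)"
      using sum_inv[of "\<lambda>g. e (x \<otimes> g \<otimes> inv x)"] sum_conj[of x e] by simp
  qed simp
  moreover have "\<dots> = of_nat (card ?C) * t" by (simp add: t_eq)
  ultimately have "of_nat (card ?C) * t = (0::complex)" by metis
  then show False using t0 order_pos by simp
qed

text \<open>The equality case of \<open>proj_bound\<close>: all values of e have modulus 1/n, and
  then equality in Cauchy-Schwarz for e = e \<star> e makes every left translate of e a multiple of
  e. After normalisation e itself is multiplicative.\<close>

lemma degree_one_hom:
  assumes "\<chi> \<in> irr" "\<chi> \<one> = 1"
  shows "\<forall>x\<in>carrier G. \<forall>y\<in>carrier G. \<chi> (x \<otimes> y) = \<chi> x * \<chi> y"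
proof -
  let ?C = "carrier G"
  obtain e where p: "primitive e" "\<chi> = ch e" using assms by (auto simp: irr_def)
  note e = primitiveD[OF p(1)]
  have pe: "proj e" using p by (simp add: primitive_def)
  define n where "n = real (card ?C)"
  have n0: "n > 0" using order_pos by (simp add: n_def)
  have "\<chi> \<one> = of_real n * e \<one>" by (simp add: p ch_def n_def)
  then have e1: "e \<one> = of_real (1 / n)" using assms n0 by (simp add: field_simps)
  then have s: "(\<Sum>x\<in>?C. (cmod (e x))\<^sup>2) = 1 / n" using proj_one[OF pe] of_real_eq_iff by metis
  have le: "cmod (e x) \<le> 1 / n" if "x \<in> ?C" for x using proj_bound[OF pe that] s by simp
  have eq: "cmod (e x) = 1 / n" if x: "x \<in> ?C" for x
  proof (rule ccontr)
    assume "cmod (e x) \<noteq> 1 / n"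
    then have "(cmod (e x))\<^sup>2 < (1 / n)\<^sup>2" using le[OF x] by (intro power_strict_mono) auto
    then have "(\<Sum>x\<in>?C. (cmod (e x))\<^sup>2) < (\<Sum>x\<in>?C. (1/n)\<^sup>2)"
      using x le by (intro sum_strict_mono_ex1) (auto simp: fin intro!: power_mono)
    also have "\<dots> = 1 / n" using n0 by (simp add: n_def power2_eq_square)
    finally show False using s by simp
  qed
  have mul: "e (y \<otimes> x) = of_real n * e y * e x" if y: "y \<in> ?C" and x: "x \<in> ?C" for x y
  proof -
    define k where "k = of_real n * e y"
    have k1: "cmod k = 1" using eq[OF y] n0 by (simp add: k_def norm_mult)
    have ec: "cnj (e x) = e (inv x)" if "x \<in> ?C" for x
      using fun_cong[OF e(3), of "inv x"] that by (simp add: star_def)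
    have "e y = (e \<star> e) y" using e by simp
    also have "\<dots> = (\<Sum>x\<in>?C. e x * e (inv x \<otimes> y))" using y by (simp add: conv_def)
    also have "\<dots> = (\<Sum>x\<in>?C. e (y \<otimes> x) * e (inv (y \<otimes> x) \<otimes> y))" by (rule sum_shift_left[OF y, symmetric])
    also have "\<dots> = (\<Sum>x\<in>?C. e (y \<otimes> x) * cnj (e x))"
      by (rule sum.cong) (use y in \<open>auto simp: ec inv_mult_group m_assoc\<close>)
    finally have cross: "(\<Sum>x\<in>?C. e (y \<otimes> x) * cnj (e x)) = e y" ..
    \<comment> \<open>The squared distance between the translate and k e: both square terms are 1/n,
      and so are both mixed terms, hence it vanishes.\<close>
    have "complex_of_real (\<Sum>x\<in>?C. (cmod (e (y \<otimes> x) - k * e x))\<^sup>2) =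
       (\<Sum>x\<in>?C. of_real ((cmod (e (y \<otimes> x)))\<^sup>2) + k * cnj k * of_real ((cmod (e x))\<^sup>2)
          - cnj k * (e (y \<otimes> x) * cnj (e x)) - k * cnj (e (y \<otimes> x) * cnj (e x)))"
      unfolding of_real_sum complex_norm_square
      by (rule sum.cong) (auto simp: complex_norm_square algebra_simps)
    also have "\<dots> = of_real (\<Sum>x\<in>?C. (cmod (e (y \<otimes> x)))\<^sup>2) + k * cnj k * of_real (\<Sum>x\<in>?C. (cmod (e x))\<^sup>2)
         - cnj k * e y - k * cnj (e y)"
      by (simp only: sum.distrib sum_subtractf sum_distrib_left[symmetric] of_real_sum[symmetric] cross cnj_sum[symmetric])
    also have "(\<Sum>x\<in>?C. (cmod (e (y \<otimes> x)))\<^sup>2) = 1 / n"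
      using sum_shift_left[OF y, of "\<lambda>x. (cmod (e x))\<^sup>2"] s by simp
    also have "k * cnj k = 1" using complex_norm_square[of k] k1 by simp
    also have "cnj k * e y = of_real (1/n)"
    proof -
      have "cnj k * e y = of_real n * (e y * cnj (e y))" by (simp add: k_def)
      also have "\<dots> = of_real (n * (1/n)\<^sup>2)" by (simp add: complex_norm_square[symmetric] eq[OF y])
      finally show ?thesis using n0 by (simp add: power2_eq_square)
    qed
    also have "k * cnj (e y) = of_real (1/n)"
    proof -
      have "k * cnj (e y) = of_real n * (e y * cnj (e y))" by (simp add: k_def)
      also have "\<dots> = of_real (n * (1/n)\<^sup>2)" by (simp add: complex_norm_square[symmetric] eq[OF y])
      finally show ?thesis using n0 by (simp add: power2_eq_square)
    qed
    finally have "complex_of_real (\<Sum>x\<in>?C. (cmod (e (y \<otimes> x) - k * e x))\<^sup>2) = 0" by (simp add: s)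
    then have "(\<Sum>x\<in>?C. (cmod (e (y \<otimes> x) - k * e x))\<^sup>2) = 0" using of_real_eq_0_iff by blast
    then have "(cmod (e (y \<otimes> x) - k * e x))\<^sup>2 = 0" using x fin by (subst (asm) sum_nonneg_eq_0_iff) auto
    then show ?thesis by (simp add: k_def)
  qed
  have comm: "e (x \<otimes> y \<otimes> inv x) = e y" if "x \<in> ?C" "y \<in> ?C" for x y
  proof -
    have "e (x \<otimes> y \<otimes> inv x) = e (inv x \<otimes> (x \<otimes> y))" using mul that by (simp add: mult.commute)
    also have "\<dots> = e y" using that by (simp add: m_assoc[symmetric])
    finally show ?thesis .
  qed
  have chi: "\<chi> g = of_real n * e (inv g)" if "g \<in> ?C" for g
    using that comm by (simp add: p ch_def n_def)
  show ?thesis using mul by (auto simp: chi inv_mult_group)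
qed

section \<open>Linear characters of subgroups and induction\<close>

definition lin :: "'a set \<Rightarrow> ('a \<Rightarrow> complex) set" where
  "lin P = {\<theta>. (\<forall>x\<in>P. \<forall>y\<in>P. \<theta> (x \<otimes> y) = \<theta> x * \<theta> y) \<and> (\<forall>x\<in>P. cmod (\<theta> x) = 1) \<and> (\<forall>x. x \<notin> P \<longrightarrow> \<theta> x = 0)}"

definition ind :: "'a set \<Rightarrow> ('a \<Rightarrow> complex) \<Rightarrow> 'a \<Rightarrow> complex" where
  "ind P \<theta> = (\<lambda>g. if g \<in> carrier G then (\<Sum>x\<in>carrier G. \<theta> (x \<otimes> g \<otimes> inv x)) / of_nat (card P) else 0)"

lemma subgroup_card_pos: "subgroup P G \<Longrightarrow> card P > 0"
  using fin subgroup.subset finite_subset subgroup.one_closed by (metis card_gt_0_iff empty_iff)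

lemma subgroup_finite: "subgroup P G \<Longrightarrow> finite P"
  using fin subgroup.subset finite_subset by metis

lemma subgroup_sum_shift:
  assumes P: "subgroup P G" and x: "x \<in> P"
  shows "(\<Sum>y\<in>P. f (x \<otimes> y)) = (\<Sum>y\<in>P. f y)"
proof -
  interpret H: fin_group "G\<lparr>carrier := P\<rparr>"
    using P subgroup.subgroup_is_group[OF P is_group] subgroup_finite[OF P]
    by (auto simp: fin_group_def fin_group_axioms_def)
  show ?thesis using H.sum_shift_left[of x f] x by simp
qed

lemma lin_one:
  assumes P: "subgroup P G" and t: "\<theta> \<in> lin P"
  shows "\<theta> \<one> = 1"
proof -
  have 1: "\<one> \<in> P" using P by (rule subgroup.one_closed)
  then have "\<theta> (\<one> \<otimes> \<one>) = \<theta> \<one> * \<theta> \<one>" "\<theta> \<one> \<noteq> 0" using t by (force simp: lin_def)+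
  then show ?thesis by auto
qed

lemma lin_inv:
  assumes P: "subgroup P G" and t: "\<theta> \<in> lin P" and x: "x \<in> P"
  shows "\<theta> (inv x) = cnj (\<theta> x)"
proof -
  have xG: "x \<in> carrier G" using P x subgroup.mem_carrier by metis
  have "\<theta> (inv x) * \<theta> x = \<theta> (inv x \<otimes> x)"
    using t x subgroup.m_inv_closed[OF P x] by (simp add: lin_def)
  then have 1: "\<theta> (inv x) * \<theta> x = 1" using xG lin_one[OF P t] by simp
  have "\<theta> x * cnj (\<theta> x) = 1" using t x by (simp add: lin_def complex_norm_square[symmetric])
  then show ?thesis using 1 by (metis mult.assoc mult.commute mult.right_neutral)
qed

lemma lin_orthonormal:
  assumes P: "subgroup P G" and t: "\<theta> \<in> lin P" "\<eta> \<in> lin P"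
  shows "(\<Sum>y\<in>P. \<theta> y * cnj (\<eta> y)) = (if \<theta> = \<eta> then of_nat (card P) else 0)"
proof (cases "\<theta> = \<eta>")
  case True
  have "\<theta> y * cnj (\<theta> y) = 1" if "y \<in> P" for y
    using t that by (simp add: lin_def complex_norm_square[symmetric])
  then show ?thesis using True by simp
next
  case False
  then obtain x where x: "x \<in> P" "\<theta> x \<noteq> \<eta> x" using t by (auto simp: lin_def fun_eq_iff) metis
  define S where "S = (\<Sum>y\<in>P. \<theta> y * cnj (\<eta> y))"
  have "S = (\<Sum>y\<in>P. \<theta> (x \<otimes> y) * cnj (\<eta> (x \<otimes> y)))"
    unfolding S_def by (rule subgroup_sum_shift[OF P x(1), symmetric])
  also have "\<dots> = \<theta> x * cnj (\<eta> x) * S"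
    using t x by (auto simp: S_def lin_def sum_distrib_left intro!: sum.cong)
  finally have "S = 0 \<or> \<theta> x * cnj (\<eta> x) = 1" by auto
  moreover have "\<theta> x * cnj (\<eta> x) \<noteq> 1"
  proof
    assume 1: "\<theta> x * cnj (\<eta> x) = 1"
    have "\<eta> x * cnj (\<eta> x) = 1" using t x by (simp add: lin_def complex_norm_square[symmetric])
    then show False using 1 x by (metis mult_cancel_right zero_neq_one mult_zero_right)
  qed
  ultimately show ?thesis using False by (simp add: S_def)
qed

lemma cj_lin: "\<theta> \<in> lin P \<Longrightarrow> cj \<theta> \<in> lin P"
  by (auto simp: lin_def cj_def)

text \<open>The idempotent of C[P] attached to \<theta>. The left ideal it generates in C[G] is the
  induced module, so splitting it into primitive idempotents gives nonnegative integral
  multiplicities for \<open>ind P \<theta>\<close>.\<close>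

lemma lin_proj:
  assumes P: "subgroup P G" and t: "\<theta> \<in> lin P"
  shows "proj (\<lambda>x. cnj (\<theta> x) / of_nat (card P))" "ch (\<lambda>x. cnj (\<theta> x) / of_nat (card P)) = ind P \<theta>"
proof -
  define e where "e = (\<lambda>x. cnj (\<theta> x) / of_nat (card P))"
  define n where "n = complex_of_nat (card P)"
  have n0: "n \<noteq> 0" using subgroup_card_pos[OF P] by (simp add: n_def)
  have out: "\<theta> x = 0" if "x \<notin> P" for x using t that by (simp add: lin_def)
  have PG: "P \<subseteq> carrier G" using P subgroup.subset by blast
  have outG: "\<theta> x = 0" if "x \<notin> carrier G" for x using out that PG by blast
  have ti: "\<theta> (inv x) = cnj (\<theta> x)" if x: "x \<in> carrier G" for x
  proof (cases "x \<in> P")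
    case True then show ?thesis using lin_inv[OF P t] by simp
  next
    case False
    then have "inv x \<notin> P" using x P subgroup.m_inv_closed inv_inv by metis
    then show ?thesis using False out by simp
  qed
  have "e \<in> galg" by (auto simp: galg_def e_def outG)
  moreover have "star e = e" by (auto simp: star_def e_def ti outG fun_eq_iff)
  moreover have "(e \<star> e) g = e g" for g
  proof (cases "g \<in> carrier G")
    case True
    have "(e \<star> e) g = (\<Sum>x\<in>P. e x * e (inv x \<otimes> g))"
      using True PG fin by (auto simp: conv_def e_def out intro!: sum.mono_neutral_right)
    also have "\<dots> = (\<Sum>x\<in>P. e g / n)"
    proof (rule sum.cong)
      fix x assume x: "x \<in> P"
      have xG: "x \<in> carrier G" using x PG by blast
      have xx: "cnj (\<theta> x) * \<theta> x = 1" using t x by (simp add: lin_def complex_norm_square[symmetric] mult.commute)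
      show "e x * e (inv x \<otimes> g) = e g / n"
      proof (cases "g \<in> P")
        case True
        have "\<theta> (inv x \<otimes> g) = cnj (\<theta> x) * \<theta> g"
          using t x True subgroup.m_inv_closed[OF P x] ti[OF xG] by (simp add: lin_def)
        then show ?thesis using xx by (simp add: e_def n_def mult.assoc[symmetric])
      next
        case False
        have "inv x \<otimes> g \<notin> P"
        proof
          assume "inv x \<otimes> g \<in> P"
          then have "x \<otimes> (inv x \<otimes> g) \<in> P" using subgroup.m_closed[OF P x] by blast
          then show False using False xG \<open>g \<in> carrier G\<close> by (simp add: m_assoc[symmetric])
        qed
        then show ?thesis using False by (simp add: e_def out)
      qed
    qed simp
    also have "\<dots> = e g" using n0 by (simp add: n_def)
    finally show ?thesis .
  qed (simp add: conv_def e_def outG)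
  ultimately show "proj (\<lambda>x. cnj (\<theta> x) / of_nat (card P))" unfolding proj_def e_def[symmetric] by (auto simp: fun_eq_iff)
  have "cnj (\<theta> (x \<otimes> inv g \<otimes> inv x)) = \<theta> (x \<otimes> g \<otimes> inv x)" if "x \<in> carrier G" "g \<in> carrier G" for x g
    using ti[of "x \<otimes> g \<otimes> inv x"] that by (simp add: inv_mult_group m_assoc)
  then show "ch (\<lambda>x. cnj (\<theta> x) / of_nat (card P)) = ind P \<theta>"
    by (auto simp: ch_def ind_def sum_divide_distrib)
qed

lemma ind_decomposition:
  assumes P: "subgroup P G" and t: "\<theta> \<in> lin P"
  shows "\<exists>n :: _ \<Rightarrow> nat. \<forall>g. ind P \<theta> g = (\<Sum>\<chi>\<in>irr. of_nat (n \<chi>) * \<chi> g)"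
proof -
  obtain ps where ps: "\<forall>p\<in>set ps. primitive p" "(\<lambda>x. cnj (\<theta> x) / of_nat (card P)) = sum_list ps"
    using primitive_decomposition lin_proj[OF P t] by blast
  have "\<exists>n :: _ \<Rightarrow> nat. \<forall>g. ch (sum_list ps) g = (\<Sum>\<chi>\<in>irr. of_nat (n \<chi>) * \<chi> g)"
    using ps(1)
  proof (induction ps)
    case Nil
    show ?case by (intro exI[of _ "\<lambda>_. 0"]) (auto simp: ch_def)
  next
    case (Cons p ps)
    then obtain n :: "_ \<Rightarrow> nat" where n: "\<And>g. ch (sum_list ps) g = (\<Sum>\<chi>\<in>irr. of_nat (n \<chi>) * \<chi> g)" by auto
    have pi: "ch p \<in> irr" using Cons.prems by (simp add: irr_def)
    have "ch (sum_list (p # ps)) g = ch p g + ch (sum_list ps) g" for g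
      by (simp add: ch_def sum.distrib)
    then have "ch (sum_list (p # ps)) g = (\<Sum>\<chi>\<in>irr. of_nat ((n(ch p := Suc (n (ch p)))) \<chi>) * \<chi> g)" for g
    proof -
      have "(\<Sum>\<chi>\<in>irr - {ch p}. of_nat ((n(ch p := Suc (n (ch p)))) \<chi>) * \<chi> g) =
          (\<Sum>\<chi>\<in>irr - {ch p}. of_nat (n \<chi>) * \<chi> g)"
        by (rule sum.cong) auto
      then show ?thesis using \<open>\<And>g. ch (sum_list (p # ps)) g = ch p g + ch (sum_list ps) g\<close>[of g]
        unfolding n sum.remove[OF finite_irr pi] by (simp add: algebra_simps)
    qed
    then show ?case by blast
  qed
  then show ?thesis using ps lin_proj(2)[OF P t] by simp
qed

text \<open>Stated for any \<theta> vanishing outside P, since it is applied to differences of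
  linear characters as well.\<close>

lemma frobenius_reciprocity:
  assumes P: "subgroup P G" and out: "\<And>x. x \<notin> P \<Longrightarrow> \<theta> x = 0"
    and F: "\<And>x g. x \<in> carrier G \<Longrightarrow> g \<in> carrier G \<Longrightarrow> F (x \<otimes> g \<otimes> inv x) = F g"
  shows "ip (ind P \<theta>) F = (\<Sum>y\<in>P. \<theta> y * cnj (F y)) / of_nat (card P)"
proof -
  let ?C = "carrier G"
  have PG: "P \<subseteq> ?C" using P subgroup.subset by blast
  have "(\<Sum>g\<in>?C. ind P \<theta> g * cnj (F g)) = (\<Sum>g\<in>?C. \<Sum>x\<in>?C. \<theta> (x \<otimes> g \<otimes> inv x) * cnj (F (x \<otimes> g \<otimes> inv x)) / of_nat (card P))"
    by (rule sum.cong) (auto simp: ind_def sum_distrib_right sum_divide_distrib F)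
  also have "\<dots> = (\<Sum>x\<in>?C. \<Sum>g\<in>?C. \<theta> (x \<otimes> g \<otimes> inv x) * cnj (F (x \<otimes> g \<otimes> inv x)) / of_nat (card P))"
    by (rule sum.swap)
  also have "\<dots> = (\<Sum>x\<in>?C. \<Sum>g\<in>?C. \<theta> g * cnj (F g) / of_nat (card P))"
    by (intro sum.cong refl sum_conj[of _ "\<lambda>g. \<theta> g * cnj (F g) / of_nat (card P)"])
  also have "\<dots> = of_nat (card ?C) * ((\<Sum>g\<in>?C. \<theta> g * cnj (F g)) / of_nat (card P))"
    by (simp add: sum_divide_distrib)
  also have "(\<Sum>g\<in>?C. \<theta> g * cnj (F g)) = (\<Sum>y\<in>P. \<theta> y * cnj (F y))"
    using PG fin out by (intro sum.mono_neutral_right) auto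
  finally show ?thesis using order_pos by (simp add: ip_def)
qed

end

section \<open>Finite p-groups\<close>

lemma card_fibres:
  assumes "finite A" "\<And>b. b \<in> f ` A \<Longrightarrow> card {a \<in> A. f a = b} = k"
  shows "card A = k * card (f ` A)"
proof -
  have "card A = (\<Sum>b\<in>f ` A. card {a \<in> A. f a = b})"
    using sum.image_gen[OF assms(1), of "\<lambda>_. 1 :: nat" f] by simp
  also have "\<dots> = (\<Sum>b\<in>f ` A. k)" by (rule sum.cong) (use assms(2) in auto)
  finally show ?thesis by simp
qed

lemma only_prime_factor:
  fixes n p :: nat
  assumes "n > 0" "\<And>r. Factorial_Ring.prime r \<Longrightarrow> r dvd n \<Longrightarrow> r = p"
  shows "\<exists>a. n = p ^ a"
  using assms
proof (induction n rule: less_induct)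
  case (less n)
  show ?case
  proof (cases "n = 1")
    case True then show ?thesis by (intro exI[of _ 0]) simp
  next
    case False
    then obtain r where r: "Factorial_Ring.prime r" "r dvd n" using prime_factor_nat by blast
    then have rp: "r = p" using less.prems by blast
    then obtain m where m: "n = p * m" using r by auto
    have "p > 1" using r rp prime_gt_1_nat by blast
    then have m0: "m > 0" "m < n" using less.prems(1) m by auto
    have "\<And>s. Factorial_Ring.prime s \<Longrightarrow> s dvd m \<Longrightarrow> s = p" using less.prems(2) m by auto
    from less.IH[OF m0(2,1) this] obtain a where "m = p ^ a" by blast
    then show ?thesis using m by (intro exI[of _ "Suc a"]) simp
  qed
qed

text \<open>Turns a congruence for a number of fixed points into a second fixed point.\<close>

lemma prime_dvd_card_not_singleton:
  assumes "Factorial_Ring.prime (p::nat)" "p dvd card S" "z \<in> S"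
  shows "\<not> S \<subseteq> {z}"
proof
  assume "S \<subseteq> {z}"
  then have "S = {z}" using assms by blast
  then show False using assms prime_gt_1_nat[of p] by simp
qed

section \<open>Lagrange, Cauchy and elements of prime order\<close>

context fin_group
begin

lemma subgroup_fin_group: "subgroup H G \<Longrightarrow> fin_group (G\<lparr>carrier := H\<rparr>)"
  using subgroup.subgroup_is_group[of H G] is_group subgroup_finite[of H]
  by (auto simp: fin_group_def fin_group_axioms_def)

lemma subgroup_inG: "subgroup H G \<Longrightarrow> x \<in> H \<Longrightarrow> x \<in> carrier G"
  using subgroup.mem_carrier by metis

lemma subgroup_pow_closed: "subgroup H G \<Longrightarrow> x \<in> H \<Longrightarrow> x [^] (n::nat) \<in> H"
  by (induction n) (auto intro: subgroup.one_closed subgroup.m_closed)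

lemma subgroup_pow_card:
  assumes "subgroup H G" "x \<in> H"
  shows "x [^] card H = \<one>"
proof -
  interpret H: fin_group "G\<lparr>carrier := H\<rparr>" by (rule subgroup_fin_group) fact
  have "x [^]\<^bsub>G\<lparr>carrier := H\<rparr>\<^esub> Coset.order (G\<lparr>carrier := H\<rparr>) = \<one>\<^bsub>G\<lparr>carrier := H\<rparr>\<^esub>"
    by (rule H.pow_order_eq_1) (use assms in simp)
  then show ?thesis by (simp add: Coset.order_def nat_pow_consistent[symmetric])
qed

lemma subgroup_card_dvd: "subgroup H G \<Longrightarrow> card H dvd card (carrier G)"
  using lagrange[of H] by (simp add: Coset.order_def) (metis dvd_triv_right)

lemma subgroup_card_dvd_subgroup:
  assumes "subgroup H G" "subgroup K G" "H \<subseteq> K"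
  shows "card H dvd card K"
proof -
  interpret K: fin_group "G\<lparr>carrier := K\<rparr>" by (rule subgroup_fin_group) fact
  have "subgroup H (G\<lparr>carrier := K\<rparr>)" using assms subgroup_incl by blast
  from K.subgroup_card_dvd[OF this] show ?thesis by simp
qed

lemma pow_coprime_one:
  assumes "x \<in> carrier G" "x [^] (m::nat) = \<one>" "x [^] (n::nat) = \<one>" "coprime m n"
  shows "x = \<one>"
  using assms pow_eq_id ord_eq_1 by (metis coprime_common_divisor_nat)

lemma pow_distinct_primes:
  assumes "x \<in> carrier G" "x [^] (p::nat) = \<one>" "x [^] (q::nat) = \<one>"
    "Factorial_Ring.prime p" "Factorial_Ring.prime q" "p \<noteq> q"
  shows "x = \<one>"
  using pow_coprime_one[OF assms(1-3)] assms primes_coprime by blast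

lemma prime_pow_dvd:
  assumes "x \<in> carrier G" "x \<noteq> \<one>" "x [^] (p::nat) = \<one>" "Factorial_Ring.prime p" "x [^] (n::nat) = \<one>"
  shows "p dvd n"
proof (rule ccontr)
  assume "\<not> p dvd n"
  then have "coprime p n" using assms(4) prime_imp_coprime_nat by blast
  then show False using pow_coprime_one assms by blast
qed

lemma elem_prime_dvd_card:
  assumes "subgroup H G" "x \<in> H" "x \<noteq> \<one>" "x [^] (p::nat) = \<one>" "Factorial_Ring.prime p"
  shows "p dvd card H"
  using prime_pow_dvd subgroup_pow_card subgroup_inG assms by meson

lemma sylow_subgroup:
  assumes "Factorial_Ring.prime p" "p ^ a dvd card (carrier G)"
  obtains H where "subgroup H G" "card H = p ^ a"
proof -
  obtain m where "Coset.order G = p ^ a * m" using assms by (auto simp: Coset.order_def)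
  then show thesis using sylow_thm[of p G a m] assms fin is_group that by blast
qed

lemma sylow_subgroup_in:
  assumes "Factorial_Ring.prime p" "subgroup K G" "p ^ a dvd card K"
  obtains H where "subgroup H G" "H \<subseteq> K" "card H = p ^ a"
proof -
  interpret K: fin_group "G\<lparr>carrier := K\<rparr>" by (rule subgroup_fin_group) fact
  obtain H where H: "subgroup H (G\<lparr>carrier := K\<rparr>)" "card H = p ^ a"
    using K.sylow_subgroup assms by auto
  then have "H \<subseteq> K" using subgroup.subset by fastforce
  moreover have "subgroup H G" using incl_subgroup[OF assms(2) H(1)] .
  ultimately show thesis using that H by blast
qed

lemma cauchy:
  assumes "subgroup H G" "Factorial_Ring.prime p" "p dvd card H"
  obtains x where "x \<in> H" "x \<noteq> \<one>" "x [^] p = \<one>"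
proof -
  obtain K where K: "subgroup K G" "K \<subseteq> H" "card K = p ^ 1"
    using sylow_subgroup_in[of p H 1] assms by auto
  then have "card K > 1" using assms prime_gt_1_nat by simp
  then have "\<not> K \<subseteq> {\<one>}" using card_mono[of "{\<one>}" K] by auto
  then obtain x where "x \<in> K" "x \<noteq> \<one>" by blast
  then show thesis using that K subgroup_pow_card[OF K(1)] by auto
qed

lemma exponent_card_power:
  assumes "subgroup H G" "Factorial_Ring.prime p" "\<And>x. x \<in> H \<Longrightarrow> x [^] p = \<one>"
  shows "\<exists>a. card H = p ^ a"
proof (rule only_prime_factor)
  show "card H > 0" using subgroup_card_pos assms by blast
next
  fix r assume r: "Factorial_Ring.prime r" "r dvd card H"
  then obtain x where "x \<in> H" "x \<noteq> \<one>" "x [^] r = \<one>" using cauchy assms by blast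
  then show "r = p" using pow_distinct_primes[of x r p] r assms subgroup_inG by blast
qed

text \<open>In a finite group the natural powers already form the cyclic subgroup generated by
  x.\<close>

definition cyc :: "'a \<Rightarrow> 'a set" where
  "cyc x = range (\<lambda>n::nat. x [^] n)"

lemma cyc_prime:
  assumes x: "x \<in> carrier G" "x \<noteq> \<one>" "x [^] (p::nat) = \<one>" "Factorial_Ring.prime p"
  shows "subgroup (cyc x) G" "card (cyc x) = p"
proof -
  have "ord x dvd p" using x pow_eq_id by blast
  then have o: "ord x = p" using x ord_eq_1 prime_nat_iff by metis
  then have "ord x \<noteq> 0" using x by auto
  have g: "cyc x = generate G {x}"
    using generate_pow_nat[OF x(1)] o x by (auto simp: cyc_def)
  show "subgroup (cyc x) G" unfolding g using generate_is_subgroup x by simp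
  show "card (cyc x) = p" unfolding g using generate_pow_card[OF x(1)] o by simp
qed

lemma cyc_mem: "x \<in> carrier G \<Longrightarrow> x \<in> cyc x"
  unfolding cyc_def using nat_pow_eone[of x] by (metis rangeI)

lemma cyc_sub: "subgroup H G \<Longrightarrow> x \<in> H \<Longrightarrow> cyc x \<subseteq> H"
  by (auto simp: cyc_def subgroup_pow_closed)

lemma prime_card_cyc:
  assumes "subgroup H G" "Factorial_Ring.prime (card H)" "x \<in> H" "x \<noteq> \<one>"
  shows "H = cyc x"
proof -
  have "x [^] card H = \<one>" "x \<in> carrier G" using assms subgroup_pow_card subgroup_inG by blast+
  then have "card (cyc x) = card H" using cyc_prime assms by blast
  then show ?thesis using cyc_sub[OF assms(1,3)] card_subset_eq subgroup_finite[OF assms(1)] by metis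
qed

section \<open>Conjugation, normalisers and centralisers\<close>

definition cg :: "'a \<Rightarrow> 'a \<Rightarrow> 'a" where
  "cg g y = g \<otimes> y \<otimes> inv g"

lemma cg_closed [simp]: "g \<in> carrier G \<Longrightarrow> y \<in> carrier G \<Longrightarrow> cg g y \<in> carrier G"
  by (simp add: cg_def)

lemma cg_one [simp]: "g \<in> carrier G \<Longrightarrow> cg g \<one> = \<one>" "y \<in> carrier G \<Longrightarrow> cg \<one> y = y"
  by (auto simp: cg_def)

lemma cg_mult: "g \<in> carrier G \<Longrightarrow> x \<in> carrier G \<Longrightarrow> y \<in> carrier G \<Longrightarrow> cg g (x \<otimes> y) = cg g x \<otimes> cg g y"
  by (simp add: cg_def m_assoc inv_solve_left)

lemma cg_cg: "g \<in> carrier G \<Longrightarrow> h \<in> carrier G \<Longrightarrow> y \<in> carrier G \<Longrightarrow> cg g (cg h y) = cg (g \<otimes> h) y"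
  by (simp add: cg_def m_assoc inv_mult_group)

lemma cg_inv: "g \<in> carrier G \<Longrightarrow> y \<in> carrier G \<Longrightarrow> cg g (inv y) = inv (cg g y)"
  by (simp add: cg_def m_assoc inv_mult_group)

lemma cg_pow: "g \<in> carrier G \<Longrightarrow> y \<in> carrier G \<Longrightarrow> cg g (y [^] (n::nat)) = cg g y [^] n"
  by (induction n) (auto simp: cg_mult)

lemma cg_inv_cancel [simp]:
  "g \<in> carrier G \<Longrightarrow> y \<in> carrier G \<Longrightarrow> cg (inv g) (cg g y) = y"
  "g \<in> carrier G \<Longrightarrow> y \<in> carrier G \<Longrightarrow> cg g (cg (inv g) y) = y"
  by (auto simp: cg_cg)

lemma cg_inj: "g \<in> carrier G \<Longrightarrow> y \<in> carrier G \<Longrightarrow> z \<in> carrier G \<Longrightarrow> cg g y = cg g z \<Longrightarrow> y = z"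
  using cg_inv_cancel(1) by metis

lemma cg_eq_one [simp]: "g \<in> carrier G \<Longrightarrow> y \<in> carrier G \<Longrightarrow> cg g y = \<one> \<longleftrightarrow> y = \<one>"
  using cg_inj[of g y \<one>] by auto

lemma cg_eq_self: "g \<in> carrier G \<Longrightarrow> y \<in> carrier G \<Longrightarrow> cg g y = y \<longleftrightarrow> g \<otimes> y = y \<otimes> g"
  by (metis cg_def inv_solve_right' m_closed)

lemma subgroup_cg_closed: "subgroup H G \<Longrightarrow> x \<in> H \<Longrightarrow> y \<in> H \<Longrightarrow> cg x y \<in> H"
  by (simp add: cg_def subgroup.m_closed subgroup.m_inv_closed)

lemma cg_subgroup:
  assumes H: "subgroup H G" and g: "g \<in> carrier G"
  shows "subgroup (cg g ` H) G" "card (cg g ` H) = card H"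
proof -
  have HG: "\<And>x. x \<in> H \<Longrightarrow> x \<in> carrier G" using subgroup_inG[OF H] .
  show "subgroup (cg g ` H) G"
  proof (rule subgroupI)
    show "cg g ` H \<subseteq> carrier G" using HG g by auto
    show "cg g ` H \<noteq> {}" using subgroup.one_closed[OF H] by auto
  next
    fix a assume "a \<in> cg g ` H"
    then obtain x where "x \<in> H" "a = cg g x" by blast
    then have "inv a = cg g (inv x)" "inv x \<in> H" using HG g cg_inv subgroup.m_inv_closed[OF H] by auto
    then show "inv a \<in> cg g ` H" by blast
  next
    fix a b assume "a \<in> cg g ` H" "b \<in> cg g ` H"
    then obtain x y where "x \<in> H" "a = cg g x" "y \<in> H" "b = cg g y" by blast
    then have "a \<otimes> b = cg g (x \<otimes> y)" "x \<otimes> y \<in> H" using HG g cg_mult subgroup.m_closed[OF H] by auto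
    then show "a \<otimes> b \<in> cg g ` H" by blast
  qed
  have "inj_on (cg g) H" using HG g cg_inj by (auto intro: inj_onI)
  then show "card (cg g ` H) = card H" by (rule card_image)
qed

definition nrm :: "'a set \<Rightarrow> 'a set" where
  "nrm P = {x \<in> carrier G. cg x ` P = P}"

lemma nrmI:
  assumes "subgroup P G" "x \<in> carrier G" "\<And>y. y \<in> P \<Longrightarrow> cg x y \<in> P"
  shows "x \<in> nrm P"
proof -
  have "cg x ` P \<subseteq> P" using assms by auto
  then have "cg x ` P = P"
    using cg_subgroup(2)[OF assms(1,2)] card_subset_eq[OF subgroup_finite[OF assms(1)]] by blast
  then show ?thesis using assms by (simp add: nrm_def)
qed

lemma nrmD: "x \<in> nrm P \<Longrightarrow> y \<in> P \<Longrightarrow> cg x y \<in> P" "x \<in> nrm P \<Longrightarrow> x \<in> carrier G"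
  by (auto simp: nrm_def)

lemma nrm_subgroup:
  assumes P: "subgroup P G"
  shows "subgroup (nrm P) G" "P \<subseteq> nrm P"
proof -
  show "P \<subseteq> nrm P" using P subgroup_cg_closed subgroup_inG by (auto intro!: nrmI)
  show "subgroup (nrm P) G"
  proof (rule subgroupI)
    show "nrm P \<subseteq> carrier G" by (auto simp: nrm_def)
    show "nrm P \<noteq> {}" using \<open>P \<subseteq> nrm P\<close> subgroup.one_closed[OF P] by blast
  next
    fix a assume a: "a \<in> nrm P"
    then have aG: "a \<in> carrier G" and im: "cg a ` P = P" by (auto simp: nrm_def)
    have "cg (inv a) y \<in> P" if "y \<in> P" for y
    proof -
      have "y \<in> cg a ` P" using that im by simp
      then obtain z where "z \<in> P" "y = cg a z" by blast
      then show ?thesis using aG subgroup_inG[OF P] by simp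
    qed
    then show "inv a \<in> nrm P" using aG P by (auto intro: nrmI)
  next
    fix a b assume ab: "a \<in> nrm P" "b \<in> nrm P"
    have "cg (a \<otimes> b) y \<in> P" if y: "y \<in> P" for y
      using nrmD(1)[OF ab(1) nrmD(1)[OF ab(2) y]] cg_cg[OF nrmD(2)[OF ab(1)] nrmD(2)[OF ab(2)] subgroup_inG[OF P y]]
      by simp
    then show "a \<otimes> b \<in> nrm P" using ab P by (auto intro!: nrmI simp: nrmD)
  qed
qed

definition cen :: "'a \<Rightarrow> 'a set" where
  "cen x = {y \<in> carrier G. y \<otimes> x = x \<otimes> y}"

lemma cen_subgroup: "x \<in> carrier G \<Longrightarrow> subgroup (cen x) G"
proof (rule subgroupI)
  assume x: "x \<in> carrier G"
  show "cen x \<subseteq> carrier G" "cen x \<noteq> {}" using x by (auto simp: cen_def intro!: exI[of _ \<one>])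
  fix a assume a: "a \<in> cen x"
  then have aG: "a \<in> carrier G" and "cg a x = x" using x cg_eq_self by (auto simp: cen_def)
  then have "cg (inv a) x = x" using cg_inv_cancel(1)[OF aG x] by simp
  then show "inv a \<in> cen x" using aG x cg_eq_self by (simp add: cen_def)
  fix b assume b: "b \<in> cen x"
  then show "a \<otimes> b \<in> cen x" using a x by (auto simp: cen_def m_assoc) (simp add: m_assoc[symmetric])
qed

lemma cen_sym: "x \<in> carrier G \<Longrightarrow> y \<in> cen x \<Longrightarrow> x \<in> cen y"
  by (auto simp: cen_def)

lemma cen_self: "x \<in> carrier G \<Longrightarrow> x \<in> cen x"
  by (auto simp: cen_def)

text \<open>Orbits of a p-group have p-power length, so those of length above 1 contribute 0 modulo
  p. The action is a parameter because it will be left translation of cosets, conjugation inside a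
  subgroup and twisting of linear characters.\<close>

lemma fixed_points_mod:
  fixes act :: "'a \<Rightarrow> 'x \<Rightarrow> 'x"
  assumes H: "subgroup H G" "card H = p ^ k" and p: "Factorial_Ring.prime p" and XS: "finite XS"
    and closed: "\<And>x v. x \<in> H \<Longrightarrow> v \<in> XS \<Longrightarrow> act x v \<in> XS"
    and one: "\<And>v. v \<in> XS \<Longrightarrow> act \<one> v = v"
    and mult: "\<And>x y v. x \<in> H \<Longrightarrow> y \<in> H \<Longrightarrow> v \<in> XS \<Longrightarrow> act (x \<otimes> y) v = act x (act y v)"
  shows "card XS mod p = card {v \<in> XS. \<forall>x\<in>H. act x v = v} mod p"
proof -
  define F where "F = {v \<in> XS. \<forall>x\<in>H. act x v = v}"
  define orb where "orb v = (\<lambda>x. act x v) ` H" for v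
  have HG: "\<And>x. x \<in> H \<Longrightarrow> x \<in> carrier G" using subgroup_inG[OF H(1)] .
  have fH: "finite H" using subgroup_finite[OF H(1)] .
  have one_in: "\<one> \<in> H" using subgroup.one_closed[OF H(1)] .
  have inv_act: "act (inv x) (act x v) = v" if "x \<in> H" "v \<in> XS" for x v
    using mult[of "inv x" x v] that one HG subgroup.m_inv_closed[OF H(1)] by simp
  have orb_self: "v \<in> orb v" if "v \<in> XS" for v
    unfolding orb_def using one[OF that] one_in by force
  have orb_eq: "orb w = orb v" if v: "v \<in> XS" and w: "w \<in> orb v" for v w
  proof -
    obtain x where x: "x \<in> H" "w = act x v" using w by (auto simp: orb_def)
    have wX: "w \<in> XS" using x v closed by simp
    have "orb w \<subseteq> orb v" using x v mult[symmetric] subgroup.m_closed[OF H(1)] by (auto simp: orb_def)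
    moreover have "orb v \<subseteq> orb w"
    proof
      fix u assume "u \<in> orb v"
      then obtain y where y: "y \<in> H" "u = act y v" by (auto simp: orb_def)
      have "u = act (y \<otimes> inv x) w"
        using y x wX mult[of y "inv x" w] inv_act[OF x(1) v] subgroup.m_inv_closed[OF H(1)] by simp
      then show "u \<in> orb w" using y x subgroup.m_closed[OF H(1)] subgroup.m_inv_closed[OF H(1)]
        by (auto simp: orb_def)
    qed
    ultimately show ?thesis by blast
  qed
  have orb_dvd: "card (orb v) dvd p ^ k" if v: "v \<in> XS" for v
  proof -
    have "card H = card {x \<in> H. act x v = v} * card ((\<lambda>x. act x v) ` H)"
    proof (rule card_fibres[OF fH])
      fix b assume "b \<in> (\<lambda>x. act x v) ` H"
      then obtain y where y: "y \<in> H" "b = act y v" by blast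
      have "bij_betw (\<lambda>x. y \<otimes> x) {x \<in> H. act x v = v} {x \<in> H. act x v = b}"
      proof (rule bij_betwI[where g = "\<lambda>x. inv y \<otimes> x"])
        show "(\<lambda>x. y \<otimes> x) \<in> {x \<in> H. act x v = v} \<rightarrow> {x \<in> H. act x v = b}"
          using y v mult subgroup.m_closed[OF H(1)] by auto
        show "(\<lambda>x. inv y \<otimes> x) \<in> {x \<in> H. act x v = b} \<rightarrow> {x \<in> H. act x v = v}"
          using y v mult subgroup.m_closed[OF H(1)] subgroup.m_inv_closed[OF H(1)] inv_act by auto
      qed (use y HG in \<open>auto simp: m_assoc[symmetric]\<close>)
      then show "card {x \<in> H. act x v = b} = card {x \<in> H. act x v = v}"
        by (simp add: bij_betw_same_card)
    qed
    then show ?thesis using H(2) by (simp add: orb_def)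
  qed
  have "p dvd card (\<Union>(orb ` (XS - F)))"
  proof (rule dvd_partition)
    show "finite (\<Union>(orb ` (XS - F)))" using XS fH by (auto simp: orb_def)
    show "\<forall>c\<in>orb ` (XS - F). p dvd card c"
    proof
      fix c assume "c \<in> orb ` (XS - F)"
      then obtain v where v: "v \<in> XS" "v \<notin> F" "c = orb v" by auto
      then obtain x where "x \<in> H" "act x v \<noteq> v" by (auto simp: F_def)
      then have "{v, act x v} \<subseteq> orb v" "card {v, act x v} = 2" using orb_self[OF v(1)] by (auto simp: orb_def)
      then have "card (orb v) \<ge> 2" using card_mono[of "orb v" "{v, act x v}"] fH by (simp add: orb_def)
      moreover obtain i where "card (orb v) = p ^ i" using orb_dvd[OF v(1)] p divides_primepow_nat by metis
      ultimately show "p dvd card c" using v by (cases i) auto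
    qed
    show "\<forall>c1\<in>orb ` (XS - F). \<forall>c2\<in>orb ` (XS - F). c1 \<noteq> c2 \<longrightarrow> c1 \<inter> c2 = {}"
    proof (intro ballI impI)
      fix c1 c2 assume c: "c1 \<in> orb ` (XS - F)" "c2 \<in> orb ` (XS - F)" "c1 \<noteq> c2"
      then obtain v w where vw: "v \<in> XS" "w \<in> XS" "c1 = orb v" "c2 = orb w" by blast
      show "c1 \<inter> c2 = {}"
      proof (rule ccontr)
        assume "c1 \<inter> c2 \<noteq> {}"
        then obtain u where "u \<in> orb v" "u \<in> orb w" using vw by auto
        then show False using c vw orb_eq by metis
      qed
    qed
  qed
  moreover have "\<Union>(orb ` (XS - F)) = XS - F"
  proof
    show "XS - F \<subseteq> \<Union>(orb ` (XS - F))" using orb_self by auto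
    show "\<Union>(orb ` (XS - F)) \<subseteq> XS - F"
    proof
      fix u assume "u \<in> \<Union>(orb ` (XS - F))"
      then obtain v where v: "v \<in> XS" "v \<notin> F" "u \<in> orb v" by auto
      have uX: "u \<in> XS" using v closed by (auto simp: orb_def)
      moreover have "u \<notin> F"
      proof
        assume "u \<in> F"
        then have "orb u = {u}" using one_in by (force simp: F_def orb_def)
        then have "v = u" using orb_eq[OF v(1,3)] orb_self[OF v(1)] by auto
        then show False using v \<open>u \<in> F\<close> by simp
      qed
      ultimately show "u \<in> XS - F" by simp
    qed
  qed
  moreover have "card XS = card F + card (XS - F)"
    using XS by (subst card_Un_disjoint[symmetric]) (auto simp: F_def intro: arg_cong[of _ _ card])
  ultimately show ?thesis unfolding F_def[symmetric] by (auto simp: mod_add_eq elim!: dvdE)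
qed

section \<open>Coset spaces and Sylow theory\<close>

definition lcs :: "'a set \<Rightarrow> 'a set set" where
  "lcs H = (\<lambda>x. x <# H) ` carrier G"

lemma lcos_eq_iff:
  assumes H: "subgroup H G" and x: "x \<in> carrier G" "y \<in> carrier G"
  shows "x <# H = y <# H \<longleftrightarrow> inv x \<otimes> y \<in> H"
proof
  assume e: "x <# H = y <# H"
  have "y \<in> y <# H" using x subgroup.one_closed[OF H] by (force simp: l_coset_def)
  then obtain h where "h \<in> H" "y = x \<otimes> h" using e by (auto simp: l_coset_def)
  then show "inv x \<otimes> y \<in> H" using x subgroup_inG[OF H] by (simp add: m_assoc[symmetric])
next
  assume h: "inv x \<otimes> y \<in> H"
  define h' where "h' = inv x \<otimes> y"
  have y: "y = x \<otimes> h'" and h'G: "h' \<in> carrier G" using x by (auto simp: h'_def m_assoc[symmetric])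
  show "x <# H = y <# H"
  proof
    show "y <# H \<subseteq> x <# H"
    proof
      fix z assume "z \<in> y <# H"
      then obtain k where k: "k \<in> H" "z = y \<otimes> k" by (auto simp: l_coset_def)
      have "z = x \<otimes> (h' \<otimes> k)" using k x h'G subgroup_inG[OF H] by (simp add: y m_assoc)
      then show "z \<in> x <# H" using k h subgroup.m_closed[OF H] by (auto simp: l_coset_def h'_def)
    qed
    show "x <# H \<subseteq> y <# H"
    proof
      fix z assume "z \<in> x <# H"
      then obtain k where k: "k \<in> H" "z = x \<otimes> k" by (auto simp: l_coset_def)
      have "z = y \<otimes> (inv h' \<otimes> k)" using k x h'G subgroup_inG[OF H] by (simp add: y m_assoc) (simp add: m_assoc[symmetric])
      then show "z \<in> y <# H" using k h subgroup.m_closed[OF H] subgroup.m_inv_closed[OF H]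
        by (auto simp: l_coset_def h'_def)
    qed
  qed
qed

lemma card_image_lcos:
  assumes H: "subgroup H G" and K: "subgroup K G" "H \<subseteq> K"
  shows "card K = card H * card ((\<lambda>x. x <# H) ` K)"
proof (rule card_fibres)
  show "finite K" using subgroup_finite K by blast
  fix b assume "b \<in> (\<lambda>x. x <# H) ` K"
  then obtain y where y: "y \<in> K" "b = y <# H" by blast
  have yG: "y \<in> carrier G" using y subgroup_inG K by blast
  have "bij_betw (\<lambda>h. y \<otimes> h) H {a \<in> K. a <# H = b}"
  proof (rule bij_betwI[where g = "\<lambda>x. inv y \<otimes> x"])
    show "(\<lambda>h. y \<otimes> h) \<in> H \<rightarrow> {a \<in> K. a <# H = b}"
    proof
      fix h assume h: "h \<in> H"
      then have "h \<in> carrier G" "h \<in> K" using subgroup_inG[OF H] K by auto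
      moreover have "inv (y \<otimes> h) \<otimes> y = inv h" using yG calculation by (simp add: inv_mult_group m_assoc)
      ultimately show "y \<otimes> h \<in> {a \<in> K. a <# H = b}"
        using y yG lcos_eq_iff[OF H, of "y \<otimes> h" y] subgroup.m_closed[OF K(1)] subgroup.m_inv_closed[OF H h] by simp
    qed
    show "(\<lambda>x. inv y \<otimes> x) \<in> {a \<in> K. a <# H = b} \<rightarrow> H"
      using y yG lcos_eq_iff[OF H yG] subgroup_inG[OF K(1)] by auto
  qed (use yG subgroup_inG[OF H] subgroup_inG[OF K(1)] in \<open>auto simp: m_assoc[symmetric]\<close>)
  then show "card {a \<in> K. a <# H = b} = card H" by (simp add: bij_betw_same_card)
qed

lemma card_lcs: "subgroup H G \<Longrightarrow> card (carrier G) = card H * card (lcs H)"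
  unfolding lcs_def using card_image_lcos[OF _ subgroup_self] subgroup.subset by blast

lemma lcs_finite: "finite (lcs H)"
  using fin by (simp add: lcs_def)

lemma lcs_act:
  assumes "subgroup H G" "g \<in> carrier G" "x \<in> carrier G"
  shows "g <# (x <# H) = (g \<otimes> x) <# H"
  using lcos_m_assoc assms subgroup.subset by blast

lemma lcs_fixed_iff:
  assumes H: "subgroup H G" and "g \<in> carrier G" "x \<in> carrier G"
  shows "g <# (x <# H) = x <# H \<longleftrightarrow> cg (inv x) g \<in> H"
proof -
  have "inv (g \<otimes> x) \<otimes> x = inv (cg (inv x) g)" using assms by (simp add: cg_def inv_mult_group m_assoc)
  moreover have "inv (cg (inv x) g) \<in> H \<longleftrightarrow> cg (inv x) g \<in> H"
    using subgroup.m_inv_closed[OF H] inv_inv assms by (metis cg_closed inv_closed)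
  ultimately show ?thesis using assms by (simp add: lcs_act lcos_eq_iff)
qed

text \<open>Q acts on the cosets of P, whose number is prime to p, and a fixed coset g P means that
  Q lies in the conjugate of P by g.\<close>

lemma sylow_contains:
  assumes p: "Factorial_Ring.prime p" and P: "subgroup P G" "card P = p ^ a" "\<not> p ^ Suc a dvd card (carrier G)"
    and Q: "subgroup Q G" "card Q = p ^ b"
  obtains g where "g \<in> carrier G" "Q \<subseteq> cg g ` P"
proof -
  have "\<not> p dvd card (lcs P)" using card_lcs[OF P(1)] P by (auto simp: mult.commute)
  moreover have "card (lcs P) mod p = card {v \<in> lcs P. \<forall>x\<in>Q. x <# v = v} mod p"
  proof (rule fixed_points_mod[OF Q p lcs_finite])
    fix x v assume "x \<in> Q" "v \<in> lcs P"
    then show "x <# v \<in> lcs P" using subgroup_inG[OF Q(1)] lcs_act[OF P(1)] by (auto simp: lcs_def)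
  next
    fix v assume "v \<in> lcs P"
    then show "\<one> <# v = v" using lcs_act[OF P(1)] by (auto simp: lcs_def)
  next
    fix x y v assume "x \<in> Q" "y \<in> Q" "v \<in> lcs P"
    then show "(x \<otimes> y) <# v = x <# (y <# v)" using subgroup_inG[OF Q(1)] lcs_act[OF P(1)]
      by (auto simp: lcs_def m_assoc)
  qed
  ultimately have "{v \<in> lcs P. \<forall>x\<in>Q. x <# v = v} \<noteq> {}" by (metis card.empty dvd_0_right mod_0 dvd_eq_mod_eq_0)
  then obtain g where g: "g \<in> carrier G" "\<forall>x\<in>Q. x <# (g <# P) = g <# P" by (auto simp: lcs_def)
  have "x \<in> cg g ` P" if x: "x \<in> Q" for x
  proof -
    have "x \<in> carrier G" using x subgroup_inG[OF Q(1)] by blast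
    then have "cg (inv g) x \<in> P" "cg g (cg (inv g) x) = x" using g x lcs_fixed_iff[OF P(1)] by auto
    then show ?thesis by force
  qed
  then show thesis using that g by blast
qed

text \<open>D acts on the cosets of D in P. Their number is divisible by p and D itself is fixed, so
  another coset is fixed, and its representatives normalise D.\<close>

lemma normalizer_grows:
  assumes p: "Factorial_Ring.prime p" and P: "subgroup P G" "card P = p ^ a" and D: "subgroup D G" "D \<subset> P"
  obtains x where "x \<in> P" "x \<notin> D" "x \<in> nrm D"
proof -
  define XS where "XS = (\<lambda>x. x <# D) ` P"
  have PG: "\<And>x. x \<in> P \<Longrightarrow> x \<in> carrier G" using subgroup_inG[OF P(1)] .
  have cP: "card P = card D * card XS" unfolding XS_def using card_image_lcos[OF D(1) P(1)] D(2) by blast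
  obtain b where b: "card D = p ^ b" using cP P(2) p divides_primepow_nat dvd_triv_left by metis
  have "card D < card P" using D(2) subgroup_finite[OF P(1)] psubset_card_mono by blast
  then have "card XS \<noteq> 1" using cP by auto
  moreover obtain i where i: "card XS = p ^ i" using cP P(2) p divides_primepow_nat dvd_triv_right by metis
  ultimately have pX: "p dvd card XS" by (cases i) auto
  have "card XS mod p = card {v \<in> XS. \<forall>x\<in>D. x <# v = v} mod p"
  proof (rule fixed_points_mod[OF D(1) b p])
    show "finite XS" using subgroup_finite[OF P(1)] by (simp add: XS_def)
  next
    fix x v assume "x \<in> D" "v \<in> XS"
    then show "x <# v \<in> XS" using PG lcs_act[OF D(1)] subgroup.m_closed[OF P(1)] D(2)
      by (auto simp: XS_def)
  next
    fix v assume "v \<in> XS"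
    then show "\<one> <# v = v" using lcs_act[OF D(1)] PG by (auto simp: XS_def)
  next
    fix x y v assume "x \<in> D" "y \<in> D" "v \<in> XS"
    then show "(x \<otimes> y) <# v = x <# (y <# v)" using PG D(2) lcs_act[OF D(1)]
      by (auto simp: XS_def m_assoc psubset_eq subset_iff)
  qed
  then have "p dvd card {v \<in> XS. \<forall>x\<in>D. x <# v = v}" using pX by (simp add: dvd_eq_mod_eq_0)
  moreover have one_in: "\<one> <# D \<in> {v \<in> XS. \<forall>x\<in>D. x <# v = v}"
    using subgroup.one_closed[OF P(1)] lcs_fixed_iff[OF D(1) _ one_closed] subgroup_inG[OF D(1)] by (auto simp: XS_def)
  ultimately have "\<not> {v \<in> XS. \<forall>x\<in>D. x <# v = v} \<subseteq> {\<one> <# D}"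
    by (rule prime_dvd_card_not_singleton[OF p])
  then obtain x where x: "x \<in> P" "x <# D \<noteq> \<one> <# D" "\<forall>d\<in>D. d <# (x <# D) = x <# D" by (auto simp: XS_def)
  have xG: "x \<in> carrier G" using x PG by blast
  have "inv x \<in> nrm D" using x(3) lcs_fixed_iff[OF D(1) _ xG] subgroup_inG[OF D(1)] xG
    by (auto intro!: nrmI[OF D(1)])
  then have "x \<in> nrm D" using subgroup.m_inv_closed[OF nrm_subgroup(1)[OF D(1)]] xG inv_inv by metis
  moreover have "x \<notin> D" using x(2) lcos_eq_iff[OF D(1) one_closed xG] xG by auto
  ultimately show thesis using that x by blast
qed

lemma pgroup_fixes_element:
  assumes p: "Factorial_Ring.prime p" and S: "subgroup S G" "card S = p ^ a"
    and V: "subgroup V G" "card V = p ^ b" "V \<noteq> {\<one>}" "\<And>s v. s \<in> S \<Longrightarrow> v \<in> V \<Longrightarrow> cg s v \<in> V"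
  obtains z where "z \<in> V" "z \<noteq> \<one>" "\<And>s. s \<in> S \<Longrightarrow> cg s z = z"
proof -
  note SG = subgroup_inG[OF S(1)] and VG = subgroup_inG[OF V(1)]
  have "card V \<noteq> 1" using V(3) subgroup.one_closed[OF V(1)] by (metis card_1_singletonE singletonD)
  then have "p dvd card V" using V(2) by (cases b) auto
  moreover have "card V mod p = card {v \<in> V. \<forall>s\<in>S. cg s v = v} mod p"
    by (rule fixed_points_mod[OF S p subgroup_finite[OF V(1)]]) (use V(4) SG VG cg_cg in auto)
  ultimately have "p dvd card {v \<in> V. \<forall>s\<in>S. cg s v = v}" by (simp add: dvd_eq_mod_eq_0)
  moreover have "\<one> \<in> {v \<in> V. \<forall>s\<in>S. cg s v = v}" using subgroup.one_closed[OF V(1)] SG by auto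
  ultimately have "\<not> {v \<in> V. \<forall>s\<in>S. cg s v = v} \<subseteq> {\<one>}"
    by (rule prime_dvd_card_not_singleton[OF p])
  then show thesis using that by blast
qed

section \<open>Linear characters and trivial intersection subgroups\<close>

definition triv_on :: "'a set \<Rightarrow> 'a \<Rightarrow> complex" where
  "triv_on P = (\<lambda>x. if x \<in> P then 1 else 0)"

lemma triv_on_lin: "subgroup P G \<Longrightarrow> triv_on P \<in> lin P"
  by (auto simp: triv_on_def lin_def subgroup.m_closed)

lemma maximal_subgroup:
  assumes P: "subgroup P G" "P \<noteq> {\<one>}"
  obtains M where "subgroup M G" "M \<subset> P" "\<And>K. subgroup K G \<Longrightarrow> M \<subset> K \<Longrightarrow> K \<subseteq> P \<Longrightarrow> K = P"
proof -
  define SS where "SS = {K. subgroup K G \<and> K \<subset> P}"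
  have "\<one> \<in> P" using subgroup.one_closed P by blast
  then have "{\<one>} \<in> SS" using P triv_subgroup by (auto simp: SS_def)
  moreover have "finite SS" by (rule finite_subset[of _ "Pow P"]) (use subgroup_finite P in \<open>auto simp: SS_def\<close>)
  ultimately obtain M where "M \<in> SS" "\<And>K. K \<in> SS \<Longrightarrow> M \<subseteq> K \<Longrightarrow> M = K"
    using finite_has_maximal[of SS] by (metis empty_iff)
  then show thesis using that[of M] by (auto simp: SS_def psubset_eq)
qed

text \<open>Let M be maximal in P. An element x of P outside M that normalises M generates P
  together with M, and it has order p, so P/M is cyclic of order p; \<theta> is the pullback of a
  faithful character of P/M.\<close>

lemma nontrivial_lin_exists:
  assumes p: "Factorial_Ring.prime p" and P: "subgroup P G" "card P = p ^ a" "P \<noteq> {\<one>}"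
    and ex: "\<And>x. x \<in> P \<Longrightarrow> x [^] p = \<one>"
  obtains \<theta> where "\<theta> \<in> lin P" "\<theta> \<noteq> triv_on P"
proof -
  note PG = subgroup_inG[OF P(1)]
  obtain M where M: "subgroup M G" "M \<subset> P" "\<And>K. subgroup K G \<Longrightarrow> M \<subset> K \<Longrightarrow> K \<subseteq> P \<Longrightarrow> K = P"
    using maximal_subgroup[OF P(1,3)] by blast
  note MG = subgroup_inG[OF M(1)]
  obtain x where x: "x \<in> P" "x \<notin> M" "x \<in> nrm M" using normalizer_grows[OF p P(1,2) M(1,2)] by blast
  have xG: "x \<in> carrier G" using x PG by blast
  \<comment> \<open>\<open>R i y\<close> says that y lies in the coset of M given by the i-th power
    of x. Working with this relation postpones the choice of an exponent until \<theta> is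
    defined.\<close>
  define R where "R i y \<longleftrightarrow> (\<exists>m\<in>M. y = x [^] (i::nat) \<otimes> m)" for i y
  have xn: "x [^] (i::nat) \<in> nrm M" for i using subgroup_pow_closed[OF nrm_subgroup(1)[OF M(1)] x(3)] .
  have inv_pow: "inv (x [^] i) = x [^] ((p - 1) * i)" for i :: nat
  proof (rule inv_equality)
    have "x [^] ((p - 1) * i) \<otimes> x [^] i = x [^] (p * i)"
      using xG prime_gt_0_nat[OF p] by (simp add: nat_pow_mult diff_mult_distrib)
    also have "\<dots> = (x [^] p) [^] i" using xG by (simp add: nat_pow_pow)
    finally show "x [^] ((p - 1) * i) \<otimes> x [^] i = \<one>" using ex[OF x(1)] by simp
  qed (use xG in auto)
  have Rmult: "R (i + j) (y \<otimes> z)" if yz: "R i y" "R j z" for i j y z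
  proof -
    obtain m n where m: "m \<in> M" "y = x [^] i \<otimes> m" "n \<in> M" "z = x [^] j \<otimes> n" using yz by (auto simp: R_def)
    have c: "cg (inv (x [^] j)) m \<in> M"
      using nrmD(1)[OF xn[of "(p-1)*j"] m(1)] by (simp add: inv_pow)
    have "y \<otimes> z = x [^] (i + j) \<otimes> (cg (inv (x [^] j)) m \<otimes> n)"
      using m xG MG by (simp add: cg_def m_assoc nat_pow_mult[symmetric]) (simp add: m_assoc[symmetric])
    then show ?thesis using c m(3) subgroup.m_closed[OF M(1)] by (auto simp: R_def)
  qed
  define K where "K = {y. \<exists>i. R i y}"
  have KG: "K \<subseteq> P"
    using M(2) subgroup_pow_closed[OF P(1) x(1)] subgroup.m_closed[OF P(1)] by (auto simp: K_def R_def)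
  have RM: "R 0 m" if "m \<in> M" for m using that MG by (auto simp: R_def)
  have R1: "R 1 x" using xG subgroup.one_closed[OF M(1)] by (auto simp: R_def intro!: bexI[of _ \<one>])
  have "subgroup K G"
  proof (rule subgroupI)
    show "K \<subseteq> carrier G" using KG PG by blast
    show "K \<noteq> {}" using R1 by (auto simp: K_def)
  next
    fix a assume a: "a \<in> K"
    then obtain i :: nat and m where im: "m \<in> M" "a = x [^] i \<otimes> m" by (auto simp: K_def R_def)
    have "inv a = inv m \<otimes> inv (x [^] i)" using im xG MG by (simp add: inv_mult_group)
    moreover have "R 0 (inv m)" using RM subgroup.m_inv_closed[OF M(1) im(1)] by blast
    moreover have "R ((p-1)*i) (inv (x [^] i))"
      unfolding inv_pow R_def using subgroup.one_closed[OF M(1)] xG by (intro bexI[of _ \<one>]) auto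
    ultimately have "R (0 + (p-1)*i) (inv a)" using Rmult by metis
    then show "inv a \<in> K" by (auto simp: K_def)
  next
    fix a b assume "a \<in> K" "b \<in> K"
    then show "a \<otimes> b \<in> K" using Rmult unfolding K_def by blast
  qed
  moreover have "M \<subset> K" using RM R1 x by (auto simp: K_def)
  ultimately have KP: "K = P" using M(3) KG by blast
  \<comment> \<open>A power of x in M with exponent prime to p would generate the same group of
    order p as x and put x into M.\<close>
  have xi: "p dvd i" if "x [^] i \<in> M" for i :: nat
  proof (rule ccontr)
    assume "\<not> p dvd i"
    then have "x [^] i \<noteq> \<one>" using prime_pow_dvd[OF xG _ ex[OF x(1)] p] x subgroup.one_closed[OF M(1)] by blast
    moreover have "(x [^] i) [^] p = \<one>" using ex[of "x [^] i"] subgroup_pow_closed[OF P(1) x(1)] by blast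
    ultimately have c: "subgroup (cyc (x [^] i)) G" "card (cyc (x [^] i)) = p"
      using cyc_prime[of "x [^] i" p] xG p by auto
    have x1: "x \<noteq> \<one>" using x subgroup.one_closed[OF M(1)] by blast
    have cx: "subgroup (cyc x) G" "card (cyc x) = p" using cyc_prime[OF xG x1 ex[OF x(1)] p] by auto
    have "cyc (x [^] i) \<subseteq> cyc x" using cyc_sub[OF cx(1)] subgroup_pow_closed[OF cx(1) cyc_mem[OF xG]] by blast
    then have "cyc (x [^] i) = cyc x" using c cx card_subset_eq subgroup_finite by metis
    then show False using cyc_mem[OF xG] cyc_sub[OF M(1) that] x by blast
  qed
  have Runiq: "p dvd j - i" if r: "R i y" "R j y" "i \<le> j" for i j y
  proof -
    obtain m n where m: "m \<in> M" "y = x [^] i \<otimes> m" "n \<in> M" "y = x [^] j \<otimes> n"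
      using r(1,2) unfolding R_def by blast
    have "x [^] j = x [^] i \<otimes> x [^] (j - i)" using r(3) xG by (simp add: nat_pow_mult)
    then have "x [^] i \<otimes> m = x [^] i \<otimes> (x [^] (j - i) \<otimes> n)" using m xG MG by (simp add: m_assoc)
    then have "m = x [^] (j - i) \<otimes> n" using xG MG m by simp
    then have "x [^] (j - i) = m \<otimes> inv n" using xG MG m by (simp add: m_assoc)
    then have "x [^] (j - i) \<in> M" using m subgroup.m_closed[OF M(1)] subgroup.m_inv_closed[OF M(1)] by simp
    then show ?thesis by (rule xi)
  qed
  have "card {z::complex. z ^ p = 1} = p" using p prime_gt_0_nat by (intro card_roots_unity_eq) auto
  then have "\<not> {z::complex. z ^ p = 1} \<subseteq> {1}"
    using prime_dvd_card_not_singleton[OF p, of "{z::complex. z ^ p = 1}" 1] by simp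
  then obtain z :: complex where z: "z ^ p = 1" "z \<noteq> 1" by auto
  have nz: "cmod z = 1" using z(1) by (metis norm_one norm_power power_eq_1_iff prime_gt_0_nat[OF p] norm_ge_zero less_numeral_extra(3))
  have zper: "z ^ i = z ^ j" if d: "p dvd j - i" "i \<le> j" for i j
  proof -
    obtain k where "j - i = p * k" using d(1) by (rule dvdE)
    then have "j = i + p * k" using d by simp
    then show ?thesis using z by (simp add: power_add power_mult)
  qed
  have zR: "z ^ i = z ^ j" if r: "R i y" "R j y" for i j y
  proof (cases "i \<le> j")
    case True
    show ?thesis by (rule zper[OF Runiq[OF r True] True])
  next
    case False
    then have ji: "j \<le> i" by simp
    show ?thesis by (rule zper[OF Runiq[OF r(2,1) ji] ji, symmetric])
  qed
  have inP: "y \<in> P \<longleftrightarrow> (\<exists>i. R i y)" for y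
    unfolding KP[symmetric] K_def by simp
  define \<theta> where "\<theta> y = (if y \<in> P then z ^ (SOME i. R i y) else 0)" for y
  have th: "\<theta> y = z ^ i" if "R i y" for i y
  proof -
    have "y \<in> P" using inP[of y] that by auto
    moreover have "R (SOME i. R i y) y" using that by (rule someI)
    ultimately show ?thesis using zR[OF _ that] by (simp add: \<theta>_def)
  qed
  have "\<theta> \<in> lin P"
  proof -
    have "\<theta> (u \<otimes> v) = \<theta> u * \<theta> v" if "u \<in> P" "v \<in> P" for u v
    proof -
      obtain i j where ij: "R i u" "R j v" using inP[of u] inP[of v] \<open>u \<in> P\<close> \<open>v \<in> P\<close> by auto
      show ?thesis unfolding th[OF Rmult[OF ij]] th[OF ij(1)] th[OF ij(2)] by (rule power_add)
    qed
    then show ?thesis by (auto simp: lin_def \<theta>_def norm_power nz)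
  qed
  moreover have "\<theta> \<noteq> triv_on P"
  proof
    assume "\<theta> = triv_on P"
    then have "\<theta> x = 1" using x by (simp add: triv_on_def)
    then show False using th[OF R1] z by simp
  qed
  ultimately show thesis using that by blast
qed

lemma lin_pow:
  assumes P: "subgroup P G" and t: "\<theta> \<in> lin P" and x: "x \<in> P"
  shows "\<theta> (x [^] (n::nat)) = \<theta> x ^ n"
proof (induction n)
  case (Suc n)
  then show ?case using t x subgroup_pow_closed[OF P x] by (simp add: lin_def)
qed (simp add: lin_one[OF P t])

lemma lin_finite:
  assumes P: "subgroup P G"
  shows "finite (lin P)"
proof (rule finite_subset)
  show "lin P \<subseteq> {f. \<forall>x. (x \<in> P \<longrightarrow> f x \<in> {z. z ^ card P = 1}) \<and> (x \<notin> P \<longrightarrow> f x = 0)}"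
    using lin_pow[OF P] lin_one[OF P] subgroup_pow_card[OF P] by (auto simp: lin_def)
  show "finite {f :: 'a \<Rightarrow> complex. \<forall>x. (x \<in> P \<longrightarrow> f x \<in> {z. z ^ card P = 1}) \<and> (x \<notin> P \<longrightarrow> f x = 0)}"
    by (rule finite_set_of_finite_funs) (use subgroup_finite[OF P] subgroup_card_pos[OF P] finite_roots_unity in auto)
qed

text \<open>The linear characters form the dual group, which has exponent p like P itself. That its
  order is a p-power keeps these numbers distinct for distinct primes in the odd-order
  estimate.\<close>

lemma card_lin_power:
  assumes p: "Factorial_Ring.prime p" and P: "subgroup P G" and ex: "\<And>x. x \<in> P \<Longrightarrow> x [^] p = \<one>"
  shows "\<exists>k. card (lin P) = p ^ k"
proof -
  define L where "L = \<lparr>carrier = lin P, monoid.mult = (\<lambda>a b x. a x * b x), one = triv_on P\<rparr>"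
  have "group L"
  proof (rule groupI)
    fix a assume a: "a \<in> carrier L"
    then have "cj a \<otimes>\<^bsub>L\<^esub> a = \<one>\<^bsub>L\<^esub>"
      by (auto simp: L_def lin_def cj_def triv_on_def complex_norm_square[symmetric] mult.commute fun_eq_iff)
    then show "\<exists>y\<in>carrier L. y \<otimes>\<^bsub>L\<^esub> a = \<one>\<^bsub>L\<^esub>" using a cj_lin by (auto simp: L_def)
  qed (auto simp: L_def lin_def triv_on_def norm_mult fun_eq_iff subgroup.m_closed[OF P])
  then interpret L: fin_group L using lin_finite[OF P] by (auto simp: fin_group_def fin_group_axioms_def L_def)
  have pw: "a [^]\<^bsub>L\<^esub> (n::nat) = (\<lambda>x. if x \<in> P then a x ^ n else 0)" if "a \<in> lin P" for a n
  proof (induction n)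
    case 0 then show ?case by (auto simp: L_def triv_on_def)
  next
    case (Suc n) then show ?case using that by (auto simp: L_def lin_def fun_eq_iff)
  qed
  have "\<exists>k. card (carrier L) = p ^ k"
  proof (rule L.exponent_card_power[OF L.subgroup_self p])
    fix a assume a: "a \<in> carrier L"
    then have aP: "a \<in> lin P" by (simp add: L_def)
    have "a x ^ p = 1" if "x \<in> P" for x
      using lin_pow[OF P aP that, of p] ex[OF that] lin_one[OF P aP] by simp
    then show "a [^]\<^bsub>L\<^esub> p = \<one>\<^bsub>L\<^esub>" unfolding pw[OF aP] by (auto simp: L_def triv_on_def)
  qed
  then show ?thesis by (simp add: L_def)
qed

text \<open>The multiplicity of an irreducible character in the character induced from theta. The function
  is only determined on irr, where it is unique by orthonormality.\<close>

definition mu :: "'a set \<Rightarrow> ('a \<Rightarrow> complex) \<Rightarrow> ('a \<Rightarrow> complex) \<Rightarrow> nat" where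
  "mu P \<theta> = (SOME n. \<forall>g. ind P \<theta> g = (\<Sum>\<chi>\<in>irr. of_nat (n \<chi>) * \<chi> g))"

lemma ind_mu: "subgroup P G \<Longrightarrow> \<theta> \<in> lin P \<Longrightarrow> ind P \<theta> g = (\<Sum>\<chi>\<in>irr. of_nat (mu P \<theta> \<chi>) * \<chi> g)"
proof -
  assume "subgroup P G" "\<theta> \<in> lin P"
  from someI_ex[OF ind_decomposition[OF this]] show ?thesis unfolding mu_def[symmetric] by (rule spec)
qed

lemma parseval:
  "ip (\<lambda>g. \<Sum>\<chi>\<in>irr. a \<chi> * \<chi> g) (\<lambda>g. \<Sum>\<chi>\<in>irr. b \<chi> * \<chi> g) = (\<Sum>\<chi>\<in>irr. a \<chi> * cnj (b \<chi>))"
proof -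
  let ?C = "carrier G"
  have "(\<Sum>g\<in>?C. (\<Sum>\<chi>\<in>irr. a \<chi> * \<chi> g) * cnj (\<Sum>\<psi>\<in>irr. b \<psi> * \<psi> g)) =
     (\<Sum>g\<in>?C. \<Sum>\<chi>\<in>irr. \<Sum>\<psi>\<in>irr. a \<chi> * cnj (b \<psi>) * (\<chi> g * cnj (\<psi> g)))"
    by (intro sum.cong refl) (simp add: sum_product ac_simps)
  also have "\<dots> = (\<Sum>\<chi>\<in>irr. \<Sum>g\<in>?C. \<Sum>\<psi>\<in>irr. a \<chi> * cnj (b \<psi>) * (\<chi> g * cnj (\<psi> g)))"
    by (rule sum.swap)
  also have "\<dots> = (\<Sum>\<chi>\<in>irr. \<Sum>\<psi>\<in>irr. \<Sum>g\<in>?C. a \<chi> * cnj (b \<psi>) * (\<chi> g * cnj (\<psi> g)))"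
    by (rule sum.cong[OF refl]) (rule sum.swap)
  also have "\<dots> = (\<Sum>\<chi>\<in>irr. \<Sum>\<psi>\<in>irr. a \<chi> * cnj (b \<psi>) * (ip \<chi> \<psi> * of_nat (card ?C)))"
    using order_pos by (intro sum.cong refl) (simp add: ip_def sum_distrib_left)
  also have "\<dots> = (\<Sum>\<chi>\<in>irr. \<Sum>\<psi>\<in>irr. if \<psi> = \<chi> then a \<chi> * cnj (b \<psi>) * of_nat (card ?C) else 0)"
    by (intro sum.cong refl) (auto simp: irr_orthonormal)
  also have "\<dots> = (\<Sum>\<chi>\<in>irr. a \<chi> * cnj (b \<chi>)) * of_nat (card ?C)"
    by (simp add: finite_irr sum_distrib_right)
  finally show ?thesis using order_pos by (simp add: ip_def)
qed

lemma mu_eq: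
  assumes P: "subgroup P G" and t: "\<theta> \<in> lin P" and c: "\<chi> \<in> irr"
  shows "of_nat (mu P \<theta> \<chi>) = (\<Sum>y\<in>P. \<theta> y * cnj (\<chi> y)) / of_nat (card P)"
proof -
  have "ip (ind P \<theta>) \<chi> = ip (\<lambda>g. \<Sum>\<psi>\<in>irr. of_nat (mu P \<theta> \<psi>) * \<psi> g) (\<lambda>g. \<Sum>\<psi>\<in>irr. (if \<psi> = \<chi> then 1 else 0) * \<psi> g)"
  proof -
    have "ind P \<theta> = (\<lambda>g. \<Sum>\<psi>\<in>irr. of_nat (mu P \<theta> \<psi>) * \<psi> g)" using ind_mu[OF P t] by blast
    moreover have "\<chi> = (\<lambda>g. \<Sum>\<psi>\<in>irr. (if \<psi> = \<chi> then 1 else 0) * \<psi> g)"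
      using c by (simp add: finite_irr if_distrib[of "\<lambda>x. x * _"] cong: if_cong)
    ultimately show ?thesis by metis
  qed
  also have "\<dots> = of_nat (mu P \<theta> \<chi>)"
    unfolding parseval using c by (simp add: finite_irr if_distrib[of cnj] if_distrib[of "\<lambda>x. _ * x"] cong: if_cong)
  finally show ?thesis
    using frobenius_reciprocity[OF P, of \<theta> \<chi>] t irr_class[OF c] by (simp add: lin_def)
qed

lemma triv_mult: "subgroup P G \<Longrightarrow> \<theta> \<in> lin P \<Longrightarrow> mu P \<theta> triv = (if \<theta> = triv_on P then 1 else 0)"
proof -
  assume P: "subgroup P G" and t: "\<theta> \<in> lin P"
  have "(\<Sum>y\<in>P. \<theta> y * cnj (triv y)) = (\<Sum>y\<in>P. \<theta> y * cnj (triv_on P y))"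
    by (rule sum.cong) (use subgroup_inG[OF P] in \<open>auto simp: triv_def triv_on_def\<close>)
  then have "complex_of_nat (mu P \<theta> triv) = of_nat (if \<theta> = triv_on P then 1 else 0)"
    using mu_eq[OF P t triv_irr] lin_orthonormal[OF P t triv_on_lin[OF P]] subgroup_card_pos[OF P] by simp
  then show ?thesis by (simp only: of_nat_eq_iff)
qed

lemma mu_cj:
  assumes P: "subgroup P G" and t: "\<theta> \<in> lin P" and c: "\<chi> \<in> irr"
  shows "mu P (cj \<theta>) (cj \<chi>) = mu P \<theta> \<chi>"
proof -
  have "complex_of_nat (mu P (cj \<theta>) (cj \<chi>)) = cnj (of_nat (mu P \<theta> \<chi>))"
    unfolding mu_eq[OF P t c] mu_eq[OF P cj_lin[OF t] cj_irr[OF c]] by (simp add: cj_def)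
  then show ?thesis by simp
qed

section \<open>Trivial intersection subgroups and the isometry of induction\<close>

definition TI :: "'a set \<Rightarrow> bool" where
  "TI P \<longleftrightarrow> (\<forall>g\<in>carrier G. \<forall>y\<in>P. y \<noteq> \<one> \<longrightarrow> cg g y \<in> P \<longrightarrow> g \<in> nrm P)"

definition tw :: "'a set \<Rightarrow> 'a \<Rightarrow> ('a \<Rightarrow> complex) \<Rightarrow> 'a \<Rightarrow> complex" where
  "tw P n \<theta> = (\<lambda>y. if y \<in> P then \<theta> (cg n y) else 0)"

lemma tw_lin:
  assumes "subgroup P G" "n \<in> nrm P" "\<theta> \<in> lin P"
  shows "tw P n \<theta> \<in> lin P"
  using assms nrmD[OF assms(2)] subgroup_inG[OF assms(1)] subgroup.m_closed[OF assms(1)]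
  by (auto simp: lin_def tw_def cg_mult)

lemma ind_diff: "ind P (\<lambda>y. a y - b y) g = ind P a g - ind P b g"
  by (simp add: ind_def sum_subtractf diff_divide_distrib)

text \<open>An element outside \<open>nrm P\<close> takes nontrivial elements of P out of P, and the
  identity contributes nothing as \<eta> vanishes there. So on P induction to G looks like induction
  to \<open>nrm P\<close>.\<close>

lemma ind_TI:
  assumes P: "subgroup P G" "TI P" and out: "\<And>y. y \<notin> P \<Longrightarrow> \<eta> y = 0" and "\<eta> \<one> = 0" and y: "y \<in> P"
  shows "ind P \<eta> y = (\<Sum>n\<in>nrm P. \<eta> (cg n y)) / of_nat (card P)"
proof -
  have yG: "y \<in> carrier G" using subgroup_inG P y by blast
  have "(\<Sum>x\<in>carrier G. \<eta> (cg x y)) = (\<Sum>n\<in>nrm P. \<eta> (cg n y))"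
  proof (rule sum.mono_neutral_right[OF fin])
    show "nrm P \<subseteq> carrier G" by (auto simp: nrm_def)
    show "\<forall>i\<in>carrier G - nrm P. \<eta> (cg i y) = 0"
    proof
      fix g assume g: "g \<in> carrier G - nrm P"
      show "\<eta> (cg g y) = 0"
      proof (cases "y = \<one>")
        case True then show ?thesis using g assms by simp
      next
        case False
        then have "cg g y \<notin> P" using g y P(2) unfolding TI_def by blast
        then show ?thesis using out by blast
      qed
    qed
  qed
  then show ?thesis using yG by (simp add: ind_def cg_def)
qed

text \<open>By Mackey's formula, \<open>sN P \<theta> \<eta>\<close> divided by
  \<open>card P\<close> is the inner product of the characters of \<open>nrm P\<close> induced from
  \<theta> and \<eta>.\<close>

definition sN :: "'a set \<Rightarrow> ('a \<Rightarrow> complex) \<Rightarrow> ('a \<Rightarrow> complex) \<Rightarrow> nat" where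
  "sN P \<theta> \<eta> = card {n \<in> nrm P. tw P n \<eta> = \<theta>}"

lemma mu_inner_eq:
  assumes P: "subgroup P G" "t1 \<in> lin P" "t2 \<in> lin P" and Q: "subgroup Q G" "t3 \<in> lin Q" "t4 \<in> lin Q"
  shows "of_int (\<Sum>\<chi>\<in>irr. (int (mu P t1 \<chi>) - int (mu P t2 \<chi>)) * (int (mu Q t3 \<chi>) - int (mu Q t4 \<chi>))) =
    ip (ind P (\<lambda>y. t1 y - t2 y)) (ind Q (\<lambda>y. t3 y - t4 y))"
proof -
  have 1: "ind R (\<lambda>y. s y - t y) = (\<lambda>g. \<Sum>\<chi>\<in>irr. of_int (int (mu R s \<chi>) - int (mu R t \<chi>)) * \<chi> g)"
    if "subgroup R G" "s \<in> lin R" "t \<in> lin R" for R s t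
    using that by (auto simp: ind_diff ind_mu sum_subtractf algebra_simps)
  show ?thesis unfolding 1[OF P] 1[OF Q] parseval by simp
qed

lemma ip_ind_lin:
  assumes P: "subgroup P G" and t: "t1 \<in> lin P" "t2 \<in> lin P"
    and F: "\<And>x g. x \<in> carrier G \<Longrightarrow> g \<in> carrier G \<Longrightarrow> F (x \<otimes> g \<otimes> inv x) = F g"
  shows "ip (ind P (\<lambda>y. t1 y - t2 y)) F = (\<Sum>y\<in>P. (t1 y - t2 y) * cnj (F y)) / of_nat (card P)"
  by (rule frobenius_reciprocity) (use assms in \<open>auto simp: lin_def\<close>)

lemma ind_class:
  assumes "x \<in> carrier G" "g \<in> carrier G"
  shows "ind P t (x \<otimes> g \<otimes> inv x) = ind P t g"
proof -
  have "(\<Sum>y\<in>carrier G. t (y \<otimes> (x \<otimes> g \<otimes> inv x) \<otimes> inv y)) = (\<Sum>y\<in>carrier G. t ((y \<otimes> x) \<otimes> g \<otimes> inv (y \<otimes> x)))"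
    by (rule sum.cong) (use assms in \<open>auto simp: inv_mult_group m_assoc\<close>)
  also have "\<dots> = (\<Sum>y\<in>carrier G. t (y \<otimes> g \<otimes> inv y))"
    by (rule sum_shift_right[OF assms(1)])
  finally show ?thesis using assms by (simp add: ind_def)
qed

text \<open>The function induced from Q vanishes on P: at the identity because the two linear
  characters agree there, elsewhere because no conjugate lies in Q. Reciprocity does the
  rest.\<close>

lemma mu_inner_disjoint:
  assumes P: "subgroup P G" "t1 \<in> lin P" "t2 \<in> lin P" and Q: "subgroup Q G" "t3 \<in> lin Q" "t4 \<in> lin Q"
    and dis: "\<And>g y. g \<in> carrier G \<Longrightarrow> y \<in> P \<Longrightarrow> y \<noteq> \<one> \<Longrightarrow> cg g y \<notin> Q"
  shows "(\<Sum>\<chi>\<in>irr. (int (mu P t1 \<chi>) - int (mu P t2 \<chi>)) * (int (mu Q t3 \<chi>) - int (mu Q t4 \<chi>))) = 0"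
proof -
  have "ind Q (\<lambda>y. t3 y - t4 y) y = 0" if y: "y \<in> P" for y
  proof -
    have "t3 (cg x y) - t4 (cg x y) = 0" if "x \<in> carrier G" for x
    proof (cases "y = \<one>")
      case True then show ?thesis using that lin_one[OF Q(1,2)] lin_one[OF Q(1,3)] by simp
    next
      case False then show ?thesis using dis[OF that y] Q by (simp add: lin_def)
    qed
    then show ?thesis by (simp add: ind_def cg_def[symmetric])
  qed
  then have "ip (ind P (\<lambda>y. t1 y - t2 y)) (ind Q (\<lambda>y. t3 y - t4 y)) = 0"
    using ip_ind_lin[OF P, of "ind Q (\<lambda>y. t3 y - t4 y)"] ind_class by simp
  then have "complex_of_int (\<Sum>\<chi>\<in>irr. (int (mu P t1 \<chi>) - int (mu P t2 \<chi>)) * (int (mu Q t3 \<chi>) - int (mu Q t4 \<chi>))) = 0"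
    unfolding mu_inner_eq[OF P Q] .
  then show ?thesis by (simp only: of_int_eq_0_iff)
qed

text \<open>On differences of linear characters, induction to G has the same inner products as
  induction to \<open>nrm P\<close>. The factor \<open>card P\<close> clears the denominator and
  keeps the identity between integers.\<close>

lemma mu_inner_TI:
  assumes P: "subgroup P G" "TI P" and t: "t1 \<in> lin P" "t2 \<in> lin P" "t3 \<in> lin P" "t4 \<in> lin P"
  shows "(\<Sum>\<chi>\<in>irr. (int (mu P t1 \<chi>) - int (mu P t2 \<chi>)) * (int (mu P t3 \<chi>) - int (mu P t4 \<chi>))) * int (card P)
    = int (sN P t1 t3) - int (sN P t1 t4) - int (sN P t2 t3) + int (sN P t2 t4)"
proof -
  define c where "c = complex_of_nat (card P)"
  have c0: "c \<noteq> 0" using subgroup_card_pos[OF P(1)] by (simp add: c_def)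
  have N: "n \<in> nrm P \<Longrightarrow> y \<in> P \<Longrightarrow> cg n y \<in> P" for n y using nrmD by blast
  have fN: "finite (nrm P)" using subgroup_finite nrm_subgroup(1)[OF P(1)] by blast
  have S: "(\<Sum>n\<in>nrm P. \<Sum>y\<in>P. s y * cnj (t (cg n y))) = of_nat (sN P s t) * c" if st: "s \<in> lin P" "t \<in> lin P" for s t
  proof -
    have "(\<Sum>n\<in>nrm P. \<Sum>y\<in>P. s y * cnj (t (cg n y))) = (\<Sum>n\<in>nrm P. if tw P n t = s then c else 0)"
    proof (rule sum.cong)
      fix n assume n: "n \<in> nrm P"
      have "(\<Sum>y\<in>P. s y * cnj (t (cg n y))) = (\<Sum>y\<in>P. s y * cnj (tw P n t y))" by (simp add: tw_def)
      also have "\<dots> = (if tw P n t = s then c else 0)"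
        using lin_orthonormal[OF P(1) st(1) tw_lin[OF P(1) n st(2)]] by (auto simp: c_def)
      finally show "(\<Sum>y\<in>P. s y * cnj (t (cg n y))) = (if tw P n t = s then c else 0)" .
    qed simp
    also have "\<dots> = of_nat (sN P s t) * c"
      using fN by (simp add: sN_def sum.If_cases Int_def conj_commute)
    finally show ?thesis .
  qed
  have i: "ind P (\<lambda>y. t3 y - t4 y) y = (\<Sum>n\<in>nrm P. t3 (cg n y) - t4 (cg n y)) / c" if "y \<in> P" for y
    unfolding c_def
  proof (rule ind_TI[OF P])
    show "t3 \<one> - t4 \<one> = 0" using lin_one[OF P(1) t(3)] lin_one[OF P(1) t(4)] by simp
  qed (use t that in \<open>auto simp: lin_def\<close>)
  have cc: "cnj c = c" by (simp add: c_def)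
  have "ip (ind P (\<lambda>y. t1 y - t2 y)) (ind P (\<lambda>y. t3 y - t4 y)) =
      (\<Sum>y\<in>P. \<Sum>n\<in>nrm P. (t1 y - t2 y) * cnj (t3 (cg n y) - t4 (cg n y))) / (c * c)"
  proof -
    have "ip (ind P (\<lambda>y. t1 y - t2 y)) (ind P (\<lambda>y. t3 y - t4 y)) =
        (\<Sum>y\<in>P. (t1 y - t2 y) * cnj (ind P (\<lambda>y. t3 y - t4 y) y)) / c"
      unfolding c_def by (rule ip_ind_lin[OF P(1) t(1,2)]) (rule ind_class)
    also have "\<dots> = (\<Sum>y\<in>P. \<Sum>n\<in>nrm P. (t1 y - t2 y) * cnj (t3 (cg n y) - t4 (cg n y)) / (c * c))"
      by (simp add: i sum_distrib_left sum_divide_distrib cc)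
    finally show ?thesis by (simp only: sum_divide_distrib)
  qed
  also have "(\<Sum>y\<in>P. \<Sum>n\<in>nrm P. (t1 y - t2 y) * cnj (t3 (cg n y) - t4 (cg n y))) =
      (\<Sum>n\<in>nrm P. \<Sum>y\<in>P. (t1 y - t2 y) * cnj (t3 (cg n y) - t4 (cg n y)))" by (rule sum.swap)
  also have "\<dots> = (of_nat (sN P t1 t3) - of_nat (sN P t1 t4) - of_nat (sN P t2 t3) + of_nat (sN P t2 t4)) * c"
    using S[OF t(1,3)] S[OF t(1,4)] S[OF t(2,3)] S[OF t(2,4)]
    by (simp add: algebra_simps sum.distrib sum_subtractf)
  finally have e: "ip (ind P (\<lambda>y. t1 y - t2 y)) (ind P (\<lambda>y. t3 y - t4 y)) * c =
    of_nat (sN P t1 t3) - of_nat (sN P t1 t4) - of_nat (sN P t2 t3) + of_nat (sN P t2 t4)"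
    using c0 by (simp add: divide_eq_eq)
  have "complex_of_int ((\<Sum>\<chi>\<in>irr. (int (mu P t1 \<chi>) - int (mu P t2 \<chi>)) * (int (mu P t3 \<chi>) - int (mu P t4 \<chi>))) * int (card P))
     = of_int (int (sN P t1 t3) - int (sN P t1 t4) - int (sN P t2 t3) + int (sN P t2 t4))"
    unfolding of_int_mult mu_inner_eq[OF P(1) t(1,2) P(1) t(3,4)] of_int_of_nat_eq c_def[symmetric] e by simp
  then show ?thesis by (simp only: of_int_eq_iff)
qed

lemma lin_class:
  assumes "subgroup P G" "\<theta> \<in> lin P" "n \<in> P"
  shows "tw P n \<theta> = \<theta>"
proof
  fix y
  show "tw P n \<theta> y = \<theta> y"
  proof (cases "y \<in> P")
    case True
    have "cmod (\<theta> n) = 1" using assms by (simp add: lin_def)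
    then have n: "\<theta> n * cnj (\<theta> n) = 1" by (simp add: complex_norm_square[symmetric])
    have "\<theta> (cg n y) = \<theta> n * \<theta> y * \<theta> (inv n)"
      using assms True subgroup.m_closed[OF assms(1)] subgroup.m_inv_closed[OF assms(1)] by (simp add: lin_def cg_def)
    also have "\<dots> = \<theta> y * (\<theta> n * cnj (\<theta> n))" using lin_inv[OF assms] by simp
    finally show ?thesis using True n by (simp add: tw_def)
  next
    case False then show ?thesis using assms by (simp add: tw_def lin_def)
  qed
qed

lemma irr_degree_ge_1: "\<chi> \<in> irr \<Longrightarrow> \<chi> \<one> \<in> \<real> \<and> Re (\<chi> \<one>) \<ge> 1"
proof -
  assume "\<chi> \<in> irr"
  then obtain e where e: "primitive e" "\<chi> = ch e" by (auto simp: irr_def)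
  then have p: "proj e" "e \<noteq> 0" by (auto simp: primitive_def)
  have "\<chi> \<one> = of_nat (card (carrier G)) * e \<one>" by (simp add: e ch_def)
  then show ?thesis using proj_large[OF p] proj_one[OF p(1)] by simp
qed

text \<open>A homomorphism to the nonzero complex numbers; unlike \<open>lin\<close> it says nothing
  about values off the carrier.\<close>

definition mult_char :: "('a \<Rightarrow> complex) \<Rightarrow> bool" where
  "mult_char l \<longleftrightarrow> (\<forall>x\<in>carrier G. \<forall>y\<in>carrier G. l (x \<otimes> y) = l x * l y) \<and> l \<one> = 1"

lemma mult_charD:
  assumes "mult_char l"
  shows "\<And>x y. x \<in> carrier G \<Longrightarrow> y \<in> carrier G \<Longrightarrow> l (x \<otimes> y) = l x * l y" "l \<one> = 1"
  using assms by (auto simp: mult_char_def)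

text \<open>The character induced from 1 - theta has norm 2 and degree 0, hence equals 1 - l with
  l of degree one.\<close>

lemma complement_linear_character:
  assumes p: "Factorial_Ring.prime p" and P: "subgroup P G" "card P = p ^ a" "P \<noteq> {\<one>}"
    and ex: "\<And>x. x \<in> P \<Longrightarrow> x [^] p = \<one>" and ti: "TI P" and N: "nrm P = P"
  obtains l y where "mult_char l" "y \<in> P" "l y \<noteq> 1"
proof -
  obtain \<theta> where th: "\<theta> \<in> lin P" "\<theta> \<noteq> triv_on P" using nontrivial_lin_exists[OF p P ex] by blast
  define t where "t = triv_on P"
  have tl: "t \<in> lin P" by (simp add: t_def triv_on_lin P)
  have s: "sN P u v = (if u = v then card P else 0)" if "u \<in> lin P" "v \<in> lin P" for u v
  proof -
    have "{n \<in> P. tw P n v = u} = (if u = v then P else {})" using lin_class[OF P(1) that(2)] by auto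
    then show ?thesis by (simp add: sN_def N)
  qed
  define m where "m \<chi> = int (mu P t \<chi>) - int (mu P \<theta> \<chi>)" for \<chi>
  have cP: "card P > 0" using subgroup_card_pos P by blast
  have "(\<Sum>\<chi>\<in>irr. m \<chi> * m \<chi>) * int (card P) = 2 * int (card P)"
    using mu_inner_TI[OF P(1) ti tl th(1) tl th(1)] th tl by (auto simp: s m_def t_def)
  then have "(\<Sum>\<chi>\<in>irr. m \<chi> * m \<chi>) = 2" using cP by simp
  moreover have mt: "m triv = 1"
    using triv_mult[OF P(1) tl] triv_mult[OF P(1) th(1)] th by (simp add: m_def t_def)
  ultimately have s1: "(\<Sum>\<chi>\<in>irr - {triv}. m \<chi> * m \<chi>) = 1"
    using sum.remove[OF finite_irr triv_irr, of "\<lambda>\<chi>. m \<chi> * m \<chi>"] by simp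
  have "\<exists>\<chi>\<in>irr - {triv}. m \<chi> \<noteq> 0"
  proof (rule ccontr)
    assume "\<not> ?thesis"
    then have "(\<Sum>\<chi>\<in>irr - {triv}. m \<chi> * m \<chi>) = 0" by simp
    then show False using s1 by simp
  qed
  then obtain X0 where X0: "X0 \<in> irr - {triv}" "m X0 \<noteq> 0" by blast
  have f: "finite (irr - {triv})" using finite_irr by simp
  have r: "m X0 * m X0 + (\<Sum>\<chi>\<in>irr - {triv} - {X0}. m \<chi> * m \<chi>) = 1"
    using sum.remove[OF f X0(1), of "\<lambda>\<chi>. m \<chi> * m \<chi>"] s1 by simp
  have nn: "(\<Sum>\<chi>\<in>irr - {triv} - {X0}. m \<chi> * m \<chi>) \<ge> 0" by (intro sum_nonneg) simp
  have "m X0 * m X0 \<ge> 1" using X0(2) by (metis linorder_not_le mult_eq_0_iff not_less_iff_gr_or_eq zero_le_square zless_imp_add1_zle add_0)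
  then have mX: "m X0 * m X0 = 1" and z: "(\<Sum>\<chi>\<in>irr - {triv} - {X0}. m \<chi> * m \<chi>) = 0" using r nn by linarith+
  have rest: "m \<chi> = 0" if "\<chi> \<in> irr - {triv} - {X0}" for \<chi>
    using z that f sum_nonneg_eq_0_iff[of "irr - {triv} - {X0}" "\<lambda>\<chi>. m \<chi> * m \<chi>"] by auto
  have dec: "ind P (\<lambda>y. t y - \<theta> y) g = triv g + of_int (m X0) * X0 g" for g
  proof -
    have "ind P (\<lambda>y. t y - \<theta> y) g = (\<Sum>\<chi>\<in>irr. of_int (m \<chi>) * \<chi> g)"
      using ind_mu[OF P(1) tl] ind_mu[OF P(1) th(1)] by (simp add: ind_diff m_def sum_subtractf algebra_simps)
    also have "\<dots> = triv g + (\<Sum>\<chi>\<in>irr - {triv}. of_int (m \<chi>) * \<chi> g)"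
      using sum.remove[OF finite_irr triv_irr, of "\<lambda>\<chi>. of_int (m \<chi>) * \<chi> g"] mt by simp
    also have "(\<Sum>\<chi>\<in>irr - {triv}. of_int (m \<chi>) * \<chi> g) = of_int (m X0) * X0 g + (\<Sum>\<chi>\<in>irr - {triv} - {X0}. of_int (m \<chi>) * \<chi> g)"
      by (rule sum.remove[OF f X0(1)])
    also have "(\<Sum>\<chi>\<in>irr - {triv} - {X0}. of_int (m \<chi>) * \<chi> g) = 0" by (rule sum.neutral) (use rest in auto)
    finally show ?thesis by simp
  qed
  have iv: "ind P (\<lambda>y. t y - \<theta> y) y = t y - \<theta> y" if y: "y \<in> P" for y
  proof -
    have "ind P (\<lambda>y. t y - \<theta> y) y = (\<Sum>n\<in>P. t (cg n y) - \<theta> (cg n y)) / of_nat (card P)"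
      using ind_TI[OF P(1) ti, of "\<lambda>y. t y - \<theta> y" y] y tl th lin_one[OF P(1) tl] lin_one[OF P(1) th(1)] N
      by (auto simp: lin_def)
    also have "\<dots> = (\<Sum>n\<in>P. t y - \<theta> y) / of_nat (card P)"
      using lin_class[OF P(1) tl] lin_class[OF P(1) th(1)] y by (intro arg_cong2[of _ _ _ _ "(/)"] sum.cong refl) (metis tw_def)
    finally show ?thesis using cP by simp
  qed
  have oneP: "\<one> \<in> P" using subgroup.one_closed P by blast
  have d: "1 + of_int (m X0) * X0 \<one> = 0"
    using dec[of \<one>] iv[OF oneP] lin_one[OF P(1) tl] lin_one[OF P(1) th(1)] by (simp add: triv_def)
  have "m X0 = 1 \<or> m X0 = -1" using mX by (metis zmult_eq_1_iff)
  \<comment> \<open>The virtual character has degree 0 and X0 has positive degree, so the sign of X0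
    is -1; this also makes its degree exactly 1.\<close>
  moreover have "m X0 \<noteq> 1" using d irr_degree_ge_1[of X0] X0 by (auto simp: complex_eq_iff)
  ultimately have mX0: "m X0 = -1" by blast
  then have X1: "X0 \<one> = 1" using d by simp
  \<comment> \<open>On P the induced difference is 1 - \<theta> itself, because
    \<open>nrm P = P\<close> and linear characters are constant on conjugacy classes of P; hence X0
    restricts to \<theta>.\<close>
  have val: "X0 y = \<theta> y" if "y \<in> P" for y
    using dec[of y] iv[OF that] mX0 that subgroup_inG[OF P(1)] by (simp add: triv_def t_def triv_on_def)
  obtain y where "y \<in> P" "\<theta> y \<noteq> 1" using th by (auto simp: lin_def triv_on_def fun_eq_iff) metis
  then show thesis using that[of X0 y] degree_one_hom[of X0] X0 X1 val by (auto simp: mult_char_def)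
qed

end

section \<open>Groups in which every element has prime order\<close>

lemma prime_dvd_prime_iff:
  "Factorial_Ring.prime (p::nat) \<Longrightarrow> Factorial_Ring.prime q \<Longrightarrow> p dvd q \<longleftrightarrow> p = q"
  by (auto simp: primes_dvd_imp_eq)

lemma root_of_unity_dvd:
  fixes z :: complex
  assumes "Factorial_Ring.prime q" "z ^ q = 1" "z \<noteq> 1" "z ^ n = 1"
  shows "q dvd n"
proof (rule ccontr)
  assume n: "\<not> q dvd n"
  then have "coprime n q" using assms(1) prime_imp_coprime_nat coprime_commute by blast
  moreover have "n \<noteq> 0" using n by (cases n) auto
  ultimately obtain a b where "n * a = q * b + 1"
    using bezout_nat[of n q] by (auto simp: coprime_iff_gcd_eq_1)
  then have "(z ^ n) ^ a = (z ^ q) ^ b * z" by (metis power_add power_mult power_one_right)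
  then show False using assms by simp
qed

context fin_group
begin

lemma cyc_bij:
  assumes x: "x \<in> carrier G" "x \<noteq> \<one>" "x [^] (p::nat) = \<one>" "Factorial_Ring.prime p"
  shows "bij_betw (\<lambda>i. x [^] i) {..<p} (cyc x)"
proof -
  have c: "card (cyc x) = p" "finite (cyc x)" using cyc_prime[OF x] subgroup_finite by blast+
  have "(\<lambda>i. x [^] i) ` {..<p} = cyc x"
  proof
    show "(\<lambda>i. x [^] i) ` {..<p} \<subseteq> cyc x" by (auto simp: cyc_def)
    show "cyc x \<subseteq> (\<lambda>i. x [^] i) ` {..<p}"
    proof
      fix y assume "y \<in> cyc x"
      then obtain n :: nat where n: "y = x [^] n" by (auto simp: cyc_def)
      have "x [^] n = x [^] (p * (n div p) + n mod p)" by simp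
      also have "\<dots> = (x [^] p) [^] (n div p) \<otimes> x [^] (n mod p)"
        using x(1) by (simp only: nat_pow_mult[symmetric] nat_pow_pow[symmetric] nat_pow_closed)
      also have "\<dots> = x [^] (n mod p)" using x by simp
      finally show "y \<in> (\<lambda>i. x [^] i) ` {..<p}" using n x(4) prime_gt_0_nat by auto
    qed
  qed
  moreover have "inj_on (\<lambda>i. x [^] i) {..<p}"
    by (rule eq_card_imp_inj_on) (use calculation c in auto)
  ultimately show ?thesis by (simp add: bij_betw_def)
qed

lemma cyc_generator:
  assumes x: "x \<in> carrier G" "x \<noteq> \<one>" "x [^] (p::nat) = \<one>" "Factorial_Ring.prime p"
    and y: "y \<in> cyc x" "y \<noteq> \<one>"
  shows "cyc y = cyc x" "y [^] p = \<one>" "y \<in> carrier G"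
proof -
  note c = cyc_prime[OF x]
  show "cyc y = cyc x" using prime_card_cyc[OF c(1) _ y] c(2) x(4) by simp
  show "y [^] p = \<one>" using subgroup_pow_card[OF c(1) y(1)] c(2) by simp
  show "y \<in> carrier G" using subgroup_inG[OF c(1) y(1)] .
qed

lemma cg_cyc: "g \<in> carrier G \<Longrightarrow> x \<in> carrier G \<Longrightarrow> cg g ` cyc x = cyc (cg g x)"
  by (auto simp: cyc_def cg_pow image_iff)

lemma prime_order_TI:
  assumes R: "subgroup R G" "Factorial_Ring.prime (card R)"
  shows "TI R"
  unfolding TI_def
proof (intro ballI impI)
  fix g y assume g: "g \<in> carrier G" and y: "y \<in> R" "y \<noteq> \<one>" "cg g y \<in> R"
  have yG: "y \<in> carrier G" using subgroup_inG R y by blast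
  have "cg g ` R = cg g ` cyc y" using prime_card_cyc[OF R y(1,2)] by simp
  also have "\<dots> = R" using cg_cyc[OF g yG] prime_card_cyc[OF R y(3)] y g yG by simp
  finally show "g \<in> nrm R" using g by (simp add: nrm_def)
qed

lemma prod_lcos:
  fixes f :: "'a \<Rightarrow> complex"
  assumes C: "subgroup C G" and F: "subgroup F G" "C \<subseteq> F"
    and one: "\<And>k. k \<in> F \<Longrightarrow> (\<Prod>c\<in>C. f (k \<otimes> c)) = 1"
  shows "(\<Prod>g\<in>F. f g) = 1"
proof -
  have "(\<Prod>g\<in>F. f g) = (\<Prod>K\<in>(\<lambda>g. g <# C) ` F. \<Prod>g\<in>{g \<in> F. g <# C = K}. f g)"
    using subgroup_finite[OF F(1)] by (intro prod.group[symmetric]) auto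
  also have "\<dots> = (\<Prod>K\<in>(\<lambda>g. g <# C) ` F. 1)"
  proof (rule prod.cong)
    fix K assume "K \<in> (\<lambda>g. g <# C) ` F"
    then obtain k where k: "k \<in> F" "K = k <# C" by blast
    have kG: "k \<in> carrier G" using subgroup_inG F k by blast
    have "bij_betw (\<lambda>h. k \<otimes> h) C {a \<in> F. a <# C = K}"
    proof (rule bij_betwI[where g = "\<lambda>x. inv k \<otimes> x"])
      show "(\<lambda>h. k \<otimes> h) \<in> C \<rightarrow> {a \<in> F. a <# C = K}"
      proof
        fix h assume h: "h \<in> C"
        then have hG: "h \<in> carrier G" "h \<in> F" using subgroup_inG[OF C] F by auto
        have "inv (k \<otimes> h) \<otimes> k = inv h" using kG hG by (simp add: inv_mult_group m_assoc)
        then show "k \<otimes> h \<in> {a \<in> F. a <# C = K}"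
          using k kG hG lcos_eq_iff[OF C, of "k \<otimes> h" k] subgroup.m_closed[OF F(1)] subgroup.m_inv_closed[OF C h] by simp
      qed
      show "(\<lambda>x. inv k \<otimes> x) \<in> {a \<in> F. a <# C = K} \<rightarrow> C"
        using k kG lcos_eq_iff[OF C kG] subgroup_inG[OF F(1)] by auto
    qed (use kG subgroup_inG[OF C] subgroup_inG[OF F(1)] in \<open>auto simp: m_assoc[symmetric]\<close>)
    then have "(\<Prod>g\<in>{g \<in> F. g <# C = K}. f g) = (\<Prod>c\<in>C. f (k \<otimes> c))"
      by (rule prod.reindex_bij_betw[symmetric])
    then show "(\<Prod>g\<in>{g \<in> F. g <# C = K}. f g) = 1" using one k by simp
  qed simp
  finally show ?thesis by simp
qed

end

text \<open>Every nonidentity element has prime order. The equational form covers the identity and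
  passes directly to subgroups.\<close>

locale pog = fin_group +
  assumes pog: "x \<in> carrier G \<Longrightarrow> \<exists>p. Factorial_Ring.prime p \<and> x [^] (p::nat) = \<one>"
begin

lemma subgroup_pog: "subgroup H G \<Longrightarrow> pog (G\<lparr>carrier := H\<rparr>)"
  using subgroup_fin_group[of H] pog subgroup_inG[of H]
  by (auto simp: pog_def pog_axioms_def nat_pow_consistent[symmetric])

lemma prime_order_of_power:
  assumes "x \<in> carrier G" "x [^] (p ^ k :: nat) = \<one>" "Factorial_Ring.prime p"
  shows "x [^] p = \<one>"
proof -
  obtain r where r: "Factorial_Ring.prime r" "x [^] (r::nat) = \<one>" using pog[OF assms(1)] by blast
  show ?thesis
  proof (cases "r = p")
    case False
    then have "coprime r (p ^ k)" using r assms primes_coprime coprime_power_right_iff by metis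
    then have "x = \<one>" using pow_coprime_one[OF assms(1) r(2) assms(2)] by simp
    then show ?thesis by simp
  qed (use r in simp)
qed

lemma p_subgroup_exponent:
  fixes p :: nat
  shows "subgroup H G \<Longrightarrow> card H = p ^ k \<Longrightarrow> Factorial_Ring.prime p \<Longrightarrow> x \<in> H \<Longrightarrow> x [^] p = \<one>"
  using prime_order_of_power subgroup_pow_card subgroup_inG by metis

text \<open>Commuting elements of distinct prime orders p and r would have a product of order p r,
  which is not a prime. So centralisers of nontrivial elements are p-groups, the fact on which
  everything below rests.\<close>

lemma commuting_same_prime:
  assumes x: "x \<in> carrier G" "x \<noteq> \<one>" "x [^] (p::nat) = \<one>" "Factorial_Ring.prime p"
    and y: "y \<in> carrier G" "y \<otimes> x = x \<otimes> y"
  shows "y [^] p = \<one>"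
proof (rule ccontr)
  assume n: "y [^] p \<noteq> \<one>"
  obtain r where r: "Factorial_Ring.prime r" "y [^] (r::nat) = \<one>" using pog[OF y(1)] by blast
  have rp: "r \<noteq> p" using n r by auto
  have y1: "y \<noteq> \<one>" using n by auto
  obtain t where t: "Factorial_Ring.prime t" "(y \<otimes> x) [^] (t::nat) = \<one>" using pog[of "y \<otimes> x"] x y by auto
  have e: "y [^] (k::nat) \<otimes> x [^] k = (y \<otimes> x) [^] k" for k using pow_mult_distrib[OF y(2)] x y by simp
  have tk: "(y \<otimes> x) [^] (t * k) = \<one>" for k :: nat using t x y by (simp add: nat_pow_pow[symmetric])
  have "y [^] (t * p) = \<one>"
    using e[of "t * p"] tk[of p] x y by (simp add: nat_pow_pow[symmetric] mult.commute[of t])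
  then have "r dvd t * p" using prime_pow_dvd y1 y r by blast
  then have "r = t" using r t x(4) rp by (simp add: prime_dvd_mult_iff prime_dvd_prime_iff)
  have "x [^] (t * r) = \<one>"
    using e[of "t * r"] tk[of r] r y x by (simp add: nat_pow_pow[symmetric] mult.commute[of t])
  then have "p dvd t * r" using prime_pow_dvd x by blast
  then have "p = t \<or> p = r" using r t x(4) by (simp add: prime_dvd_mult_iff prime_dvd_prime_iff)
  then show False using \<open>r = t\<close> rp by auto
qed

lemma cen_exponent:
  assumes "x \<in> carrier G" "x \<noteq> \<one>" "x [^] (p::nat) = \<one>" "Factorial_Ring.prime p" "y \<in> cen x"
  shows "y [^] p = \<one>"
  using commuting_same_prime[OF assms(1-4)] assms(5) by (auto simp: cen_def)

lemma cen_card: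
  assumes "x \<in> carrier G" "x \<noteq> \<one>" "x [^] (p::nat) = \<one>" "Factorial_Ring.prime p"
  shows "\<exists>a. card (cen x) = p ^ a"
  using exponent_card_power[OF cen_subgroup[OF assms(1)] assms(4)] cen_exponent[OF assms] by blast

end

section \<open>A normal elementary abelian p-subgroup\<close>

locale pog_normal = pog +
  fixes V and p :: nat
  assumes p: "Factorial_Ring.prime p" and V: "subgroup V G" "V \<noteq> {\<one>}"
    and V_norm: "g \<in> carrier G \<Longrightarrow> v \<in> V \<Longrightarrow> cg g v \<in> V"
    and V_comm: "u \<in> V \<Longrightarrow> v \<in> V \<Longrightarrow> u \<otimes> v = v \<otimes> u"
    and V_exp: "v \<in> V \<Longrightarrow> v [^] p = \<one>"
begin

lemma VG: "v \<in> V \<Longrightarrow> v \<in> carrier G"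
  using subgroup_inG V by blast

text \<open>In (v x)^s = w(s) x^s the factor w(s) is the product of the conjugates of v under powers
  of x. For s other than p, it commutes with v x and with v, hence with x, so its order divides both
  s and p. For s = p, the element v x has p-power order and therefore order p.\<close>

lemma trace_trivial:
  assumes x: "x \<in> carrier G" "x \<noteq> \<one>" "x [^] (s::nat) = \<one>" "Factorial_Ring.prime s" and v: "v \<in> V" and th: "\<theta> \<in> lin V"
  shows "(\<Prod>i<s. \<theta> (cg (x [^] i) v)) = 1"
proof -
  define w where "w n = rec_nat \<one> (\<lambda>i u. u \<otimes> cg (x [^] i) v) n" for n :: nat
  have w0: "w 0 = \<one>" and wS: "\<And>n. w (Suc n) = w n \<otimes> cg (x [^] n) v" by (simp_all add: w_def)
  have cV: "cg (x [^] (n::nat)) v \<in> V" for n using V_norm x v by simp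
  have wV: "w n \<in> V" for n by (induction n) (auto simp: w0 wS cV subgroup.one_closed[OF V(1)] subgroup.m_closed[OF V(1)])
  have vG: "v \<in> carrier G" using v VG by simp
  have pw: "(v \<otimes> x) [^] n = w n \<otimes> x [^] n" for n
  proof (induction n)
    case (Suc n)
    have "(v \<otimes> x) [^] Suc n = w n \<otimes> x [^] n \<otimes> (v \<otimes> x)" by (simp add: Suc.IH)
    also have "\<dots> = w n \<otimes> (cg (x [^] n) v \<otimes> x [^] n) \<otimes> x"
      using x vG VG[OF wV[of n]] by (simp add: cg_def m_assoc)
    finally show ?case using x vG VG[OF wV[of n]] by (simp add: wS m_assoc)
  qed (simp add: w0)
  have tw: "\<theta> (w n) = (\<Prod>i<n. \<theta> (cg (x [^] i) v))" for n
    by (induction n) (use th wV cV lin_one[OF V(1) th] in \<open>auto simp: w0 wS lin_def\<close>)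
  have ws: "(v \<otimes> x) [^] s = w s" using pw[of s] x VG[OF wV] by simp
  have "w s = \<one>"
  proof (cases "s = p")
    case False
    have wG: "w s \<in> carrier G" using VG wV by blast
    have "w s \<otimes> (v \<otimes> x) = (v \<otimes> x) \<otimes> w s"
      unfolding ws[symmetric] using vG x nat_pow_comm[of "v \<otimes> x" s 1] by simp
    then have "v \<otimes> (w s \<otimes> x) = v \<otimes> (x \<otimes> w s)"
      using V_comm[OF wV v] vG x wG by (simp add: m_assoc[symmetric])
    then have "w s \<otimes> x = x \<otimes> w s" using vG x wG by simp
    then have "w s [^] s = \<one>" using commuting_same_prime[OF x] wG by blast
    then show ?thesis using pow_distinct_primes[OF wG] V_exp[OF wV] p x(4) False by blast
  next
    case True
    have "(v \<otimes> x) [^] (p ^ 2) = w s [^] p"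
      using ws vG x True by (simp add: power2_eq_square nat_pow_pow[symmetric])
    then have "(v \<otimes> x) [^] p = \<one>" using prime_order_of_power[of "v \<otimes> x" p 2] vG x p V_exp[OF wV] by simp
    then show ?thesis using ws True by simp
  qed
  then show ?thesis using tw[of s] lin_one[OF V(1) th] by simp
qed

lemma trace_cyc:
  assumes x: "x \<in> carrier G" "x \<noteq> \<one>" "x [^] (s::nat) = \<one>" "Factorial_Ring.prime s" and v: "v \<in> V" and th: "\<theta> \<in> lin V"
  shows "(\<Prod>c\<in>cyc x. \<theta> (cg c v)) = 1"
  using prod.reindex_bij_betw[OF cyc_bij[OF x], of "\<lambda>c. \<theta> (cg c v)"] trace_trivial[OF assms] by simp

lemma twisted_lin:
  assumes "\<theta> \<in> lin V" "k \<in> carrier G"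
  shows "tw V k \<theta> \<in> lin V"
  by (rule tw_lin) (use assms V V_norm in \<open>auto intro!: nrmI\<close>)

text \<open>The product of all F-conjugates of v is trivial, both for F and for each of its subgroups of
  prime order. As these subgroups partition F, comparing the products gives v ^ (1 - n) = 1, where n is
  their number.\<close>

lemma partition_count:
  assumes F: "subgroup F G" and y: "y \<in> F" "y \<noteq> \<one>" "y [^] (r::nat) = \<one>" "Factorial_Ring.prime r"
    and CC: "CC = cyc ` (F - {\<one>})"
  shows "p dvd card CC - 1"
proof -
  note FG = subgroup_inG[OF F]
  have Fp: "\<exists>s. Factorial_Ring.prime s \<and> x [^] (s::nat) = \<one>" if "x \<in> F" for x using pog FG that by blast
  obtain a where "card V = p ^ a" using exponent_card_power[OF V(1) p] V_exp by blast
  \<comment> \<open>A linear character turns products in V into products of complex numbers, where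
    the final relation becomes one between roots of unity.\<close>
  then obtain \<theta> where th: "\<theta> \<in> lin V" "\<theta> \<noteq> triv_on V" using nontrivial_lin_exists[OF p V(1) _ V(2) V_exp] by blast
  then obtain v where v: "v \<in> V" "\<theta> v \<noteq> 1" by (auto simp: lin_def triv_on_def fun_eq_iff) metis
  have vG: "v \<in> carrier G" using v VG by simp
  have cm: "cmod (\<theta> v) = 1" using th v by (simp add: lin_def)
  then have t0: "\<theta> v \<noteq> 0" by auto
  let ?f = "\<lambda>g. \<theta> (cg g v)"
  have yG: "y \<in> carrier G" using y FG by simp
  \<comment> \<open>The product over F is split along the cosets of \<open>cyc y\<close>; on the
    coset of k the factor k is absorbed by replacing \<theta> with its twist by k.\<close>
  have 1: "(\<Prod>g\<in>F. ?f g) = 1"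
  proof (rule prod_lcos[OF cyc_prime(1)[OF yG y(2-4)] F])
    show "cyc y \<subseteq> F" using cyc_sub F y by blast
    fix k assume k: "k \<in> F"
    have kG: "k \<in> carrier G" using FG k by simp
    have "(\<Prod>c\<in>cyc y. \<theta> (cg (k \<otimes> c) v)) = (\<Prod>c\<in>cyc y. tw V k \<theta> (cg c v))"
    proof (rule prod.cong)
      fix c assume "c \<in> cyc y"
      then have "c \<in> carrier G" using subgroup_inG[OF cyc_prime(1)[OF yG y(2-4)]] by simp
      then show "\<theta> (cg (k \<otimes> c) v) = tw V k \<theta> (cg c v)"
        using kG vG V_norm v by (simp add: tw_def cg_cg)
    qed simp
    also have "\<dots> = 1" by (rule trace_cyc[OF yG y(2-4) v(1) twisted_lin[OF th(1) kG]])
    finally show "(\<Prod>c\<in>cyc y. \<theta> (cg (k \<otimes> c) v)) = 1" .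
  qed
  have fF: "finite F" using subgroup_finite F by blast
  have oneF: "\<one> \<in> F" using subgroup.one_closed F by blast
  have "(\<Prod>g\<in>F. ?f g) = \<theta> v * (\<Prod>g\<in>F - {\<one>}. ?f g)"
    using prod.remove[OF fF oneF, of ?f] vG by simp
  also have "(\<Prod>g\<in>F - {\<one>}. ?f g) = (\<Prod>C\<in>CC. \<Prod>g\<in>{g \<in> F - {\<one>}. cyc g = C}. ?f g)"
    unfolding CC using fF by (intro prod.group[symmetric]) auto
  also have "\<dots> = (\<Prod>C\<in>CC. inverse (\<theta> v))"
  proof (rule prod.cong)
    fix C assume "C \<in> CC"
    then obtain x where x: "x \<in> F" "x \<noteq> \<one>" "C = cyc x" using CC by blast
    obtain s where s: "Factorial_Ring.prime s" "x [^] (s::nat) = \<one>" using Fp x by blast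
    have xG: "x \<in> carrier G" using x FG by simp
    note cs = cyc_prime[OF xG x(2) s(2,1)]
    have "{g \<in> F - {\<one>}. cyc g = C} = C - {\<one>}"
    proof
      show "{g \<in> F - {\<one>}. cyc g = C} \<subseteq> C - {\<one>}" using cyc_mem FG by auto
      show "C - {\<one>} \<subseteq> {g \<in> F - {\<one>}. cyc g = C}"
        using cyc_sub[OF F x(1)] cyc_generator(1)[OF xG x(2) s(2,1)] x by auto
    qed
    moreover have "(\<Prod>g\<in>C. ?f g) = \<theta> v * (\<Prod>g\<in>C - {\<one>}. ?f g)"
      using prod.remove[OF _ subgroup.one_closed[OF cs(1)], of ?f] subgroup_finite[OF cs(1)] x vG by simp
    moreover have "(\<Prod>g\<in>C. ?f g) = 1" unfolding x(3) by (rule trace_cyc[OF xG x(2) s(2,1) v(1) th(1)])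
    ultimately show "(\<Prod>g\<in>{g \<in> F - {\<one>}. cyc g = C}. ?f g) = inverse (\<theta> v)"
      using t0 by (simp add: field_simps)
  qed simp
  finally have "\<theta> v * inverse (\<theta> v) ^ card CC = 1" using 1 by simp
  then have tc: "\<theta> v ^ card CC = \<theta> v" using t0 by (simp add: power_inverse field_simps)
  have "CC \<noteq> {}" using CC y by blast
  then have "card CC > 0" using CC fF by (simp add: card_gt_0_iff)
  then have e: "\<theta> v ^ (card CC - 1) = 1" using tc t0 by (cases "card CC") auto
  have ep: "\<theta> v ^ p = 1" using lin_pow[OF V(1) th(1) v(1), of p] V_exp[OF v(1)] lin_one[OF V(1) th(1)] by simp
  show ?thesis by (rule root_of_unity_dvd[OF p ep v(2) e])
qed

lemma card_cyc_partition:
  assumes F: "subgroup F G" and s: "Factorial_Ring.prime s"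
    and A: "A \<subseteq> F - {\<one>}" "\<And>x. x \<in> A \<Longrightarrow> x [^] (s::nat) = \<one>" "\<And>x. x \<in> A \<Longrightarrow> cyc x - {\<one>} \<subseteq> A"
  shows "card A = (s - 1) * card (cyc ` A)"
proof (rule card_fibres)
  show "finite A" using A subgroup_finite[OF F] finite_subset by blast
  fix C assume "C \<in> cyc ` A"
  then obtain x where x: "x \<in> A" "C = cyc x" by blast
  have xG: "x \<in> carrier G" "x \<noteq> \<one>" using x A subgroup_inG[OF F] by auto
  note c = cyc_prime[OF xG A(2)[OF x(1)] s]
  have "{a \<in> A. cyc a = C} = C - {\<one>}"
  proof
    show "{a \<in> A. cyc a = C} \<subseteq> C - {\<one>}" using A(1) cyc_mem subgroup_inG[OF F] by blast
    show "C - {\<one>} \<subseteq> {a \<in> A. cyc a = C}"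
      using A(3)[OF x(1)] cyc_generator(1)[OF xG A(2)[OF x(1)] s] x(2) by blast
  qed
  then show "card {a \<in> A. cyc a = C} = s - 1"
    using c x subgroup.one_closed[OF c(1)] subgroup_finite[OF c(1)] by simp
qed

text \<open>Such an F would have exponent r and therefore (r^2 - 1) / (r - 1) = r + 1 subgroups of
  order r, so p would divide r.\<close>

lemma no_square:
  assumes r: "Factorial_Ring.prime (r::nat)" "r \<noteq> p" and F: "subgroup F G" "card F = r ^ 2"
  shows False
proof -
  have ex: "x [^] r = \<one>" if "x \<in> F" for x using p_subgroup_exponent[OF F r(1) that] .
  have cs: "cyc x \<subseteq> F" if "x \<in> F" for x using cyc_sub[OF F(1) that] .
  have r1: "r > 1" using r prime_gt_1_nat by blast
  have fF: "finite F" and oneF: "\<one> \<in> F" using subgroup_finite subgroup.one_closed F by blast+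
  have "card (F - {\<one>}) = (r - 1) * card (cyc ` (F - {\<one>}))"
    by (rule card_cyc_partition[OF F(1) r(1)]) (use ex cs in auto)
  moreover have "card (F - {\<one>}) = r ^ 2 - 1" using F fF oneF by simp
  moreover have "r ^ 2 - 1 = (r - 1) * (r + 1)" by (simp add: power2_eq_square algebra_simps)
  ultimately have "(r - 1) * card (cyc ` (F - {\<one>})) = (r - 1) * (r + 1)" by simp
  then have c: "card (cyc ` (F - {\<one>})) = r + 1" using r1 by (simp only: mult_cancel1) simp
  have "r dvd card F" using F by simp
  then obtain y where y: "y \<in> F" "y \<noteq> \<one>" "y [^] r = \<one>" using cauchy[OF F(1) r(1)] by blast
  have "p dvd r" using partition_count[OF F(1) y r(1) refl] c by simp
  then show False using r p primes_dvd_imp_eq by blast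
qed

text \<open>A normalising z of prime order s outside R spans with R a group F of order r s. The case
  s = r is excluded by \<open>no_square\<close>. Otherwise everything outside R has order s, which
  gives r subgroups of order s besides R; again there are r + 1 in all and p would divide r.\<close>

lemma self_normalizing:
  assumes r: "Factorial_Ring.prime (r::nat)" "r \<noteq> p" and R: "subgroup R G" "card R = r"
  shows "nrm R = R"
proof (rule ccontr)
  assume "nrm R \<noteq> R"
  then obtain z where z: "z \<in> nrm R" "z \<notin> R" using nrm_subgroup[OF R(1)] by blast
  note RG = subgroup_inG[OF R(1)]
  have zG: "z \<in> carrier G" using nrmD z by blast
  obtain s where s: "Factorial_Ring.prime s" "z [^] (s::nat) = \<one>" using pog zG by blast
  have z1: "z \<noteq> \<one>" using z subgroup.one_closed[OF R(1)] by auto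
  note cz = cyc_prime[OF zG z1 s(2,1)]
  note CG = subgroup_inG[OF cz(1)]
  have zR: "cg c a \<in> R" if "c \<in> cyc z" "a \<in> R" for c a
    using that nrmD(1)[OF subsetD[OF cyc_sub[OF nrm_subgroup(1)[OF R(1)] z(1)]]] by blast
  have int: "R \<inter> cyc z = {\<one>}"
  proof -
    have "c = \<one>" if "c \<in> R" "c \<in> cyc z" for c
    proof (rule ccontr)
      assume "c \<noteq> \<one>"
      then have "cyc c = cyc z" using cyc_generator(1)[OF zG z1 s(2,1) that(2)] by blast
      then show False using cyc_sub[OF R(1) that(1)] cyc_mem[OF zG] z by blast
    qed
    then show ?thesis using subgroup.one_closed[OF R(1)] subgroup.one_closed[OF cz(1)] by blast
  qed
  define F where "F = (\<lambda>(a, c). a \<otimes> c) ` (R \<times> cyc z)"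
  have mm: "(a \<otimes> c) \<otimes> (b \<otimes> d) = (a \<otimes> cg c b) \<otimes> (c \<otimes> d)" if "a \<in> R" "b \<in> R" "c \<in> cyc z" "d \<in> cyc z" for a b c d
  proof -
    have g: "a \<in> carrier G" "b \<in> carrier G" "c \<in> carrier G" "d \<in> carrier G" using that RG CG by auto
    have "cg c b \<otimes> c = c \<otimes> b" using g by (simp add: cg_def m_assoc)
    then have "cg c b \<otimes> (c \<otimes> d) = c \<otimes> (b \<otimes> d)" using g by (simp add: m_assoc[symmetric])
    then show ?thesis using g by (simp add: m_assoc)
  qed
  have Fmem: "a \<otimes> c \<in> F" if "a \<in> R" "c \<in> cyc z" for a c using that by (auto simp: F_def)
  have F: "subgroup F G"
  proof (rule subgroupI)
    show "F \<subseteq> carrier G" using RG CG by (auto simp: F_def)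
    show "F \<noteq> {}" using Fmem[OF subgroup.one_closed[OF R(1)] subgroup.one_closed[OF cz(1)]] by blast
  next
    fix u assume "u \<in> F"
    then obtain a c where u: "a \<in> R" "c \<in> cyc z" "u = a \<otimes> c" by (auto simp: F_def)
    have g: "a \<in> carrier G" "c \<in> carrier G" using u RG CG by auto
    have "inv u = cg (inv c) (inv a) \<otimes> inv c" using g by (simp add: u cg_def inv_mult_group m_assoc)
    then show "inv u \<in> F"
      using Fmem[OF zR] subgroup.m_inv_closed[OF R(1) u(1)] subgroup.m_inv_closed[OF cz(1) u(2)] by simp
  next
    fix u w assume "u \<in> F" "w \<in> F"
    then obtain a b c d where u: "a \<in> R" "c \<in> cyc z" "u = a \<otimes> c" "b \<in> R" "d \<in> cyc z" "w = b \<otimes> d"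
      by (auto simp: F_def)
    then show "u \<otimes> w \<in> F" using mm[OF u(1,4,2,5)] Fmem[OF subgroup.m_closed[OF R(1) u(1) zR[OF u(2,4)]] subgroup.m_closed[OF cz(1) u(2,5)]]
      by simp
  qed
  have "inj_on (\<lambda>(a, c). a \<otimes> c) (R \<times> cyc z)"
  proof (rule inj_onI, clarify)
    fix a c b d assume h: "a \<in> R" "c \<in> cyc z" "b \<in> R" "d \<in> cyc z" "a \<otimes> c = b \<otimes> d"
    have g: "a \<in> carrier G" "b \<in> carrier G" "c \<in> carrier G" "d \<in> carrier G" using h RG CG by auto
    have "inv b \<otimes> a = d \<otimes> inv c"
    proof -
      have "inv b \<otimes> (a \<otimes> c) \<otimes> inv c = inv b \<otimes> (b \<otimes> d) \<otimes> inv c" using h by simp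
      then show ?thesis using g by (simp add: m_assoc) (simp add: m_assoc[symmetric])
    qed
    moreover have "inv b \<otimes> a \<in> R" "d \<otimes> inv c \<in> cyc z"
      using h subgroup.m_closed[OF R(1)] subgroup.m_inv_closed[OF R(1)] subgroup.m_closed[OF cz(1)] subgroup.m_inv_closed[OF cz(1)] by auto
    ultimately have "inv b \<otimes> a = \<one>" using int by auto
    then have "a = b" using g by (metis inv_equality inv_inv inv_closed)
    then show "a = b \<and> c = d" using h g by simp
  qed
  then have cF: "card F = r * s" using R cz by (simp add: F_def card_image card_cartesian_product)
  have RF: "R \<subseteq> F" using Fmem[OF _ subgroup.one_closed[OF cz(1)]] RG by force
  have powR: "\<exists>a\<in>R. u [^] n = a \<otimes> c [^] n" if bc: "b \<in> R" "c \<in> cyc z" "u = b \<otimes> c" for u b c and n :: nat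
  proof (induction n)
    case 0 then show ?case using subgroup.one_closed[OF R(1)] by (intro bexI[of _ \<one>]) auto
  next
    case (Suc n)
    then obtain a where a: "a \<in> R" "u [^] n = a \<otimes> c [^] n" by blast
    have cn: "c [^] n \<in> cyc z" using subgroup_pow_closed[OF cz(1) bc(2)] .
    have "u [^] Suc n = (a \<otimes> cg (c [^] n) b) \<otimes> c [^] Suc n" using mm[OF a(1) bc(1) cn bc(2)] a bc by simp
    then show ?case using subgroup.m_closed[OF R(1) a(1) zR[OF cn bc(1)]] by blast
  qed
  have inR: "u [^] s \<in> R" if uF: "u \<in> F" for u
  proof -
    obtain w where w: "u = (\<lambda>(a, c). a \<otimes> c) w" "w \<in> R \<times> cyc z"
      using uF[unfolded F_def] by (rule imageE)
    obtain b c where "w = (b, c)" by (cases w)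
    then have bc: "b \<in> R" "c \<in> cyc z" "u = b \<otimes> c" using w by auto
    obtain a where "a \<in> R" "u [^] s = a \<otimes> c [^] s" using powR[OF bc, of s] by blast
    moreover have "c [^] s = \<one>" using subgroup_pow_card[OF cz(1) bc(2)] cz(2) by simp
    ultimately show ?thesis using RG by simp
  qed
  show False
  proof (cases "s = r")
    case True
    then show False using no_square[OF r F] cF by (simp add: power2_eq_square)
  next
    case False
    have ordF: "u [^] s = \<one>" if "u \<in> F" "u \<notin> R" for u
    proof -
      have uG: "u \<in> carrier G" using subgroup_inG[OF F that(1)] .
      have u1: "u \<noteq> \<one>" using that subgroup.one_closed[OF R(1)] by auto
      obtain t where t: "Factorial_Ring.prime t" "u [^] (t::nat) = \<one>" using pog uG by blast
      have "t dvd r * s" using elem_prime_dvd_card[OF F that(1) u1 t(2,1)] cF by simp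
      then have "t = r \<or> t = s" using t r s by (simp add: prime_dvd_mult_iff prime_dvd_prime_iff)
      \<comment> \<open>As r and s are coprime, an element u of order r is a power of its s-th
        power, which lies in R.\<close>
      moreover have "t \<noteq> r"
      proof
        assume "t = r"
        then have us: "(u [^] s) [^] r = \<one>" "u [^] r = \<one>"
          using t uG by (auto simp: nat_pow_pow mult.commute[of s]) (simp add: nat_pow_pow[symmetric])
        have "u [^] s \<noteq> \<one>" using pow_distinct_primes[OF uG us(2)] r s False u1 by metis
        then have "cyc (u [^] s) = cyc u"
          using cyc_generator(1)[OF uG u1 us(2) r(1), of "u [^] s"] by (auto simp: cyc_def)
        then have "u \<in> R" using cyc_sub[OF R(1) inR[OF that(1)]] cyc_mem[OF uG] by blast
        then show False using that by simp
      qed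
      ultimately show ?thesis using t by auto
    qed
    have fF: "finite F" using subgroup_finite F by blast
    have oneR: "\<one> \<in> R" using subgroup.one_closed R by blast
    have s1: "s > 1" "r > 1" using s r prime_gt_1_nat by auto
    have disj: "cyc x - {\<one>} \<subseteq> F - R" if x: "x \<in> F - R" for x
    proof
      fix y assume y: "y \<in> cyc x - {\<one>}"
      have xG: "x \<in> carrier G" "x \<noteq> \<one>" using x subgroup_inG[OF F] oneR by auto
      have "cyc y = cyc x" using cyc_generator(1)[OF xG ordF s(1)] x y by blast
      then have "y \<notin> R" using cyc_sub[OF R(1), of y] cyc_mem[OF xG(1)] x by blast
      then show "y \<in> F - R" using y cyc_sub[OF F, of x] x by blast
    qed
    have "card (F - R) = (s - 1) * card (cyc ` (F - R))"
      by (rule card_cyc_partition[OF F s(1)]) (use oneR ordF disj in auto)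
    moreover have "card (F - R) = r * (s - 1)"
      using cF R RF fF by (simp add: card_Diff_subset finite_subset diff_mult_distrib2)
    ultimately have c1: "card (cyc ` (F - R)) = r" using s1 by simp
    obtain y where y: "y \<in> R" "y \<noteq> \<one>" "y [^] r = \<one>" using cauchy[OF R(1) r(1)] R by auto
    have cR: "cyc ` (R - {\<one>}) = {R}"
    proof -
      have "cyc x = R" if "x \<in> R - {\<one>}" for x using prime_card_cyc[OF R(1), of x] R r that by auto
      then show ?thesis using y by force
    qed
    have "F - {\<one>} = (R - {\<one>}) \<union> (F - R)" using RF oneR by blast
    then have "cyc ` (F - {\<one>}) = insert R (cyc ` (F - R))" using cR by (simp add: image_Un)
    moreover have "R \<notin> cyc ` (F - R)" using cyc_mem subgroup_inG[OF F] by blast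
    ultimately have "card (cyc ` (F - {\<one>})) = r + 1" using c1 fF by simp
    then have "p dvd r" using partition_count[OF F _ y(2,3) r(1) refl] y RF by auto
    then show False using r p primes_dvd_imp_eq by blast
  qed
qed

end

section \<open>Linear characters of the whole group and the elements of exponent p\<close>

lemma (in fin_group) hom_pow:
  assumes l: "mult_char l"
    and x: "x \<in> carrier G"
  shows "l (x [^] (n::nat)) = l x ^ n"
  by (induction n) (use mult_charD[OF l] x in auto)

lemma (in fin_group) hom_cg:
  assumes l: "mult_char l"
    and x: "x \<in> carrier G" "g \<in> carrier G"
  shows "l (cg g x) = l x"
proof -
  have "l (cg g x) * l g = l (g \<otimes> x)" using mult_charD(1)[OF l, of "cg g x" g] x by (simp add: cg_def m_assoc)
  also have "\<dots> = l x * l g" using mult_charD(1)[OF l] x by simp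
  finally have "l (cg g x) * l g = l x * l g" .
  moreover have "l g \<noteq> 0" using mult_charD(1)[OF l, of g "inv g"] mult_charD(2)[OF l] x by auto
  ultimately show ?thesis by simp
qed

text \<open>If x had prime order s other than r and l x were not 1, the value at x y would be a
  product of nontrivial roots of unity of orders s and r, hence of order r s, although x y has prime
  order.\<close>

lemma (in pog) hom_concentrated:
  assumes l: "mult_char l"
    and y: "y \<in> carrier G" "l y \<noteq> 1" "y [^] (r::nat) = \<one>" "Factorial_Ring.prime r"
    and x: "x \<in> carrier G" "x [^] r \<noteq> \<one>"
  shows "l x = 1"
proof (rule ccontr)
  assume lx: "l x \<noteq> 1"
  note lp = hom_pow[OF l]
  obtain s where s: "Factorial_Ring.prime s" "x [^] (s::nat) = \<one>" using pog x by blast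
  have sr: "s \<noteq> r" using s x by auto
  obtain t where t: "Factorial_Ring.prime t" "(x \<otimes> y) [^] (t::nat) = \<one>" using pog x y by blast
  have lyr: "l y ^ r = 1" and lxs: "l x ^ s = 1" using lp[OF y(1), of r] lp[OF x(1), of s] y s mult_charD(2)[OF l] by auto
  have e: "(l x * l y) ^ t = 1" using lp[of "x \<otimes> y" t] t mult_charD[OF l] x y by simp
  have "(l x * l y) ^ (t * s) = 1" using e by (simp add: power_mult)
  then have "l y ^ (t * s) = 1" using lxs by (simp add: power_mult_distrib power_mult[of "l x" s t] mult.commute[of t])
  then have "r dvd t * s" using root_of_unity_dvd[OF y(4) lyr y(2)] by blast
  then have 1: "r = t" using y(4) t s sr by (auto simp: prime_dvd_mult_iff prime_dvd_prime_iff)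
  have "(l x * l y) ^ (t * r) = 1" using e by (simp add: power_mult)
  then have "l x ^ (t * r) = 1" using lyr by (simp add: power_mult_distrib power_mult[of "l y" r t] mult.commute[of t])
  then have "s dvd t * r" using root_of_unity_dvd[OF s(1) lxs lx] by blast
  then show False using 1 y(4) t s sr by (auto simp: prime_dvd_mult_iff prime_dvd_prime_iff)
qed

context pog_normal
begin

text \<open>By \<open>no_square\<close> a Sylow r-subgroup R has order r, and it is its own
  normaliser, so \<open>complement_linear_character\<close> supplies l. Elements of order r are
  conjugate into R, where l is faithful because it is nontrivial on a group of prime order.\<close>

lemma other_prime:
  fixes r :: nat
  assumes r: "Factorial_Ring.prime r" "r \<noteq> p" "r dvd card (carrier G)"
  obtains l y where "mult_char l"
    "y \<in> carrier G" "l y \<noteq> 1" "y [^] r = \<one>"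
    "\<And>x. x \<in> carrier G \<Longrightarrow> l x = 1 \<Longrightarrow> x [^] r = \<one> \<Longrightarrow> x = \<one>"
proof -
  obtain R where R: "subgroup R G" "card R = r ^ 1" using sylow_subgroup[of r 1] r by auto
  have R': "card R = r" using R by simp
  have sq: "\<not> r ^ Suc 1 dvd card (carrier G)"
  proof
    assume "r ^ Suc 1 dvd card (carrier G)"
    then obtain F where "subgroup F G" "card F = r ^ Suc 1" using sylow_subgroup r by blast
    then show False using no_square[OF r(1,2)] by (simp add: numeral_2_eq_2)
  qed
  have ex: "x [^] r = \<one>" if "x \<in> R" for x using subgroup_pow_card[OF R(1) that] R' by simp
  have "R \<noteq> {\<one>}" using R' r(1) prime_gt_1_nat[of r] by auto
  then obtain l y where l: "mult_char l" and y: "y \<in> R" "l y \<noteq> 1"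
    using complement_linear_character[OF r(1) R] ex prime_order_TI[OF R(1)] self_normalizing[OF r(1,2) R(1) R'] r(1) R'
    by metis
  have "x = \<one>" if x: "x \<in> carrier G" "l x = 1" "x [^] r = \<one>" for x
  proof (rule ccontr)
    assume x1: "x \<noteq> \<one>"
    note cx = cyc_prime[OF x(1) x1 x(3) r(1)]
    obtain g where g: "g \<in> carrier G" "cyc x \<subseteq> cg g ` R"
      using sylow_contains[OF r(1) R sq cx(1), of 1] cx(2) by auto
    then obtain u where u: "u \<in> R" "x = cg g u" using cyc_mem[OF x(1)] by blast
    have uG: "u \<in> carrier G" using u subgroup_inG R by blast
    have lu: "l u = 1" using hom_cg[OF l uG g(1)] u x by simp
    have "u \<noteq> \<one>" using u x1 g by auto
    then have "R = cyc u" using prime_card_cyc[OF R(1) _ u(1)] R' r by simp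
    then obtain n :: nat where "y = u [^] n" using y by (auto simp: cyc_def)
    then show False using hom_pow[OF l uG, of n] lu y by simp
  qed
  then show thesis using that[of l y] l y ex subgroup_inG[OF R(1)] by blast
qed

text \<open>If another prime r occurs, K is the kernel of a linear character l: it is 1 at every
  element not of exponent r and differs from 1 at every element of order r. An element y with l y
  not 1 generates a complement of K.\<close>

theorem p_core_structure:
  defines "K \<equiv> {x \<in> carrier G. x [^] p = \<one>}"
  shows "subgroup K G" "\<exists>a. card K = p ^ a"
    "card (carrier G) = card K \<or> (\<exists>r. Factorial_Ring.prime r \<and> r \<noteq> p \<and> card (carrier G) = card K * r)"
proof -
  have "subgroup K G \<and> (card (carrier G) = card K \<or> (\<exists>r. Factorial_Ring.prime r \<and> r \<noteq> p \<and> card (carrier G) = card K * r))"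
  proof (cases "\<exists>r. Factorial_Ring.prime r \<and> r \<noteq> p \<and> r dvd card (carrier G)")
    case False
    then obtain a where "card (carrier G) = p ^ a" using only_prime_factor[OF order_pos, of p] by blast
    then have "K = carrier G" using p_subgroup_exponent[OF subgroup_self _ p] by (auto simp: K_def)
    then show ?thesis using subgroup_self by simp
  next
    case True
    then obtain r where r: "Factorial_Ring.prime r" "r \<noteq> p" "r dvd card (carrier G)" by blast
    obtain l y where l: "mult_char l"
      and y: "y \<in> carrier G" "l y \<noteq> 1" "y [^] r = \<one>"
      and inj: "\<And>x. x \<in> carrier G \<Longrightarrow> l x = 1 \<Longrightarrow> x [^] r = \<one> \<Longrightarrow> x = \<one>"
      by (rule other_prime[OF r]) (rule that)
    note lD = mult_charD[OF l]
    have conc: "l x = 1" if "x \<in> carrier G" "x [^] r \<noteq> \<one>" for x using hom_concentrated[OF l y(1,2,3) r(1) that] .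
    have "x [^] p = \<one>" if x: "x \<in> carrier G" "x [^] r \<noteq> \<one>" for x
    proof (rule ccontr)
      assume n: "x [^] p \<noteq> \<one>"
      obtain s where s: "Factorial_Ring.prime s" "x [^] (s::nat) = \<one>" using pog x by blast
      have x1: "x \<noteq> \<one>" using x by auto
      have sp: "s \<noteq> p" "s \<noteq> r" using s n x by auto
      have "s dvd card (carrier G)" using elem_prime_dvd_card[OF subgroup_self x(1) x1 s(2,1)] .
      then obtain l' y' where l': "mult_char l'"
        and y': "y' \<in> carrier G" "l' y' \<noteq> 1" "y' [^] s = \<one>"
        by (rule other_prime[OF s(1) sp(1)]) (rule that)
      note lD' = mult_charD[OF l']
      have y1: "y \<noteq> \<one>" "y' \<noteq> \<one>" using y lD(2) lD'(2) y' by auto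
      have "y' [^] r \<noteq> \<one>" "y [^] s \<noteq> \<one>"
        using pow_distinct_primes[OF y'(1) y'(3) _ s(1) r(1) sp(2)] pow_distinct_primes[OF y(1) y(3) _ r(1) s(1)] sp y1 by metis+
      then have a: "l y' = 1" "l' y = 1"
        using conc y' hom_concentrated[OF l' y'(1,2,3) s(1)] y by auto
      \<comment> \<open>With a third prime s the product y y' is seen by both characters, so it
        would have order r and order s at once.\<close>
      have yy: "y \<otimes> y' \<in> carrier G" "l (y \<otimes> y') \<noteq> 1" "l' (y \<otimes> y') \<noteq> 1" using lD(1) lD'(1) y y' a by auto
      have "(y \<otimes> y') [^] r = \<one>" "(y \<otimes> y') [^] s = \<one>"
        using conc[OF yy(1)] hom_concentrated[OF l' y'(1,2,3) s(1) yy(1)] yy by auto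
      then have "y \<otimes> y' = \<one>" using pow_distinct_primes[OF yy(1)] r s sp by metis
      then show False using yy lD(2) by simp
    qed
    then have exp: "\<And>x. x \<in> carrier G \<Longrightarrow> x [^] r \<noteq> \<one> \<Longrightarrow> x [^] p = \<one>" by blast
    have K: "x \<in> K \<longleftrightarrow> l x = 1" if "x \<in> carrier G" for x
    proof
      assume "x \<in> K"
      then have "x [^] p = \<one>" by (simp add: K_def)
      then have "x = \<one> \<or> x [^] r \<noteq> \<one>" using pow_distinct_primes[OF that _ _ r(1) p r(2)] by blast
      then show "l x = 1" using conc[OF that] lD(2) by blast
    next
      assume "l x = 1"
      then have "x = \<one> \<or> x [^] r \<noteq> \<one>" using inj[OF that] by blast
      then show "x \<in> K" using that exp[OF that] by (auto simp: K_def)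
    qed
    have KG: "K \<subseteq> carrier G" by (auto simp: K_def)
    have nz: "l x \<noteq> 0" if "x \<in> carrier G" for x using lD(1)[of x "inv x"] lD(2) that by auto
    have li: "l (inv x) = inverse (l x)" if "x \<in> carrier G" for x
      using lD(1)[of x "inv x"] lD(2) that nz[OF that] by (simp add: field_simps)
    have sK: "subgroup K G"
    proof (rule subgroupI)
      show "K \<subseteq> carrier G" by (rule KG)
      show "K \<noteq> {}" using K[OF one_closed] lD(2) by blast
      fix a assume a: "a \<in> K"
      then show "inv a \<in> K" using K[of a] K[of "inv a"] li[of a] KG by auto
      fix b assume "b \<in> K"
      then show "a \<otimes> b \<in> K" using a K[of a] K[of b] K[of "a \<otimes> b"] lD(1)[of a b] KG by auto
    qed
    have y1: "y \<noteq> \<one>" using y lD(2) by auto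
    note cy = cyc_prime[OF y(1) y1 y(3) r(1)]
    note CG = subgroup_inG[OF cy(1)]
    have inj_l: "inj_on l (cyc y)"
    proof (rule inj_onI)
      fix a b assume ab: "a \<in> cyc y" "b \<in> cyc y" "l a = l b"
      have g: "a \<in> carrier G" "b \<in> carrier G" using ab CG by auto
      have "inv a \<otimes> b \<in> cyc y" using ab subgroup.m_closed[OF cy(1)] subgroup.m_inv_closed[OF cy(1)] by blast
      then have "(inv a \<otimes> b) [^] r = \<one>" using subgroup_pow_card[OF cy(1)] cy(2) by metis
      moreover have "l (inv a \<otimes> b) = 1" using lD(1) li g ab(3) nz[of b] by simp
      ultimately have "inv a \<otimes> b = \<one>" using inj g by simp
      then show "a = b" using g by (metis inv_equality inv_inv inv_closed)
    qed
    have "l ` cyc y \<subseteq> {z. z ^ r = 1}"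
    proof
      fix w assume "w \<in> l ` cyc y"
      then obtain u where u: "u \<in> cyc y" "w = l u" by blast
      then have "u [^] r = \<one>" using subgroup_pow_card[OF cy(1) u(1)] cy(2) by simp
      then show "w \<in> {z. z ^ r = 1}" using hom_pow[OF l CG[OF u(1)], of r] u lD(2) by simp
    qed
    moreover have "card {z::complex. z ^ r = 1} = r" "finite {z::complex. z ^ r = 1}"
      using prime_gt_0_nat[OF r(1)] by (auto intro!: card_roots_unity_eq finite_roots_unity)
    \<comment> \<open>All values of l are r-th roots of unity and \<open>cyc y\<close> already
      attains them all, so every g differs from an element of \<open>cyc y\<close> by an element of
      K.\<close>
    ultimately have im: "l ` cyc y = {z. z ^ r = 1}"
      using card_image[OF inj_l] cy(2) card_subset_eq by metis
    have "bij_betw (\<lambda>(a, c). a \<otimes> c) (K \<times> cyc y) (carrier G)"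
      unfolding bij_betw_def
    proof
      show "inj_on (\<lambda>(a, c). a \<otimes> c) (K \<times> cyc y)"
      proof (rule inj_onI, clarify)
        fix a c b d assume h: "a \<in> K" "c \<in> cyc y" "b \<in> K" "d \<in> cyc y" "a \<otimes> c = b \<otimes> d"
        have g: "a \<in> carrier G" "b \<in> carrier G" "c \<in> carrier G" "d \<in> carrier G" using h KG CG by auto
        have "l (a \<otimes> c) = l (b \<otimes> d)" using h(5) by (rule arg_cong)
        moreover have "l a = 1" "l b = 1" using K g h by auto
        ultimately have "l c = l d" using lD(1) g by simp
        then have "c = d" using inj_l h inj_onD by metis
        then show "a = b \<and> c = d" using h g by simp
      qed
      show "(\<lambda>(a, c). a \<otimes> c) ` (K \<times> cyc y) = carrier G"
      proof
        show "(\<lambda>(a, c). a \<otimes> c) ` (K \<times> cyc y) \<subseteq> carrier G" using KG CG by auto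
        show "carrier G \<subseteq> (\<lambda>(a, c). a \<otimes> c) ` (K \<times> cyc y)"
        proof
          fix g assume g: "g \<in> carrier G"
          have "l g ^ r = 1" using conc[OF g] hom_pow[OF l g, of r] lD(2) by (cases "g [^] r = \<one>") auto
          then obtain c where c: "c \<in> cyc y" "l c = l g" using im by (metis (mono_tags) imageE mem_Collect_eq)
          have cG: "c \<in> carrier G" using c CG by blast
          have "g \<otimes> inv c \<in> K" using K[of "g \<otimes> inv c"] lD(1) li[OF cG] nz[OF g] c g cG by simp
          moreover have "g = (g \<otimes> inv c) \<otimes> c" using g cG by (simp add: m_assoc)
          ultimately show "g \<in> (\<lambda>(a, c). a \<otimes> c) ` (K \<times> cyc y)" using c by force
        qed
      qed
    qed
    then have "card (carrier G) = card K * r"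
      using bij_betw_same_card cy(2) card_cartesian_product by metis
    then show ?thesis using sK r by blast
  qed
  then show "subgroup K G" "card (carrier G) = card K \<or> (\<exists>r. Factorial_Ring.prime r \<and> r \<noteq> p \<and> card (carrier G) = card K * r)" by auto
  then show "\<exists>a. card K = p ^ a" using exponent_card_power[OF _ p] by (auto simp: K_def)
qed

end

context pog
begin

definition pel :: "nat \<Rightarrow> 'a set" where
  "pel p = {x \<in> carrier G. x [^] p = \<one>}"

text \<open>The centre Z of V is nontrivial, because the p-group V fixes a nontrivial element of
  itself under conjugation. It is invariant under G and elementary abelian, so it fits
  \<open>pog_normal\<close>.\<close>

lemma normal_p_subgroup_structure:
  assumes p: "Factorial_Ring.prime p" and V: "subgroup V G" "V \<noteq> {\<one>}" "card V = p ^ k"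
    and V_norm: "\<And>g v. g \<in> carrier G \<Longrightarrow> v \<in> V \<Longrightarrow> cg g v \<in> V"
  shows "subgroup (pel p) G" "\<exists>a. card (pel p) = p ^ a"
    "card (carrier G) = card (pel p) \<or> (\<exists>r. Factorial_Ring.prime r \<and> r \<noteq> p \<and> card (carrier G) = card (pel p) * r)"
proof -
  note VG = subgroup_inG[OF V(1)]
  define Z where "Z = {z \<in> V. \<forall>v\<in>V. z \<otimes> v = v \<otimes> z}"
  obtain z where z: "z \<in> V" "z \<noteq> \<one>" "\<And>s. s \<in> V \<Longrightarrow> cg s z = z"
    using pgroup_fixes_element[OF p V(1,3) V(1,3,2)] V_norm VG by blast
  have zZ: "z \<in> Z" using z cg_eq_self VG by (fastforce simp: Z_def)
  have sZ: "subgroup Z G"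
  proof (rule subgroupI)
    show "Z \<subseteq> carrier G" "Z \<noteq> {}" using VG zZ by (auto simp: Z_def)
    fix a assume a: "a \<in> Z"
    then have aV: "a \<in> V" "a \<in> carrier G" using VG by (auto simp: Z_def)
    have "inv a \<otimes> v = v \<otimes> inv a" if "v \<in> V" for v
    proof -
      have "cg a v = v" using cg_eq_self[of a v] a that aV VG by (auto simp: Z_def)
      then have "cg (inv a) v = v" using cg_inv_cancel(1)[of a v] aV VG[OF that] by simp
      then show ?thesis using cg_eq_self[of "inv a" v] aV VG[OF that] by simp
    qed
    then show "inv a \<in> Z" using aV subgroup.m_inv_closed[OF V(1)] by (auto simp: Z_def)
    fix b assume b: "b \<in> Z"
    have "a \<otimes> b \<otimes> v = v \<otimes> (a \<otimes> b)" if "v \<in> V" for v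
    proof -
      have "b \<in> carrier G" "v \<in> carrier G" "b \<otimes> v = v \<otimes> b" "a \<otimes> v = v \<otimes> a" using a b VG that by (auto simp: Z_def)
      then show ?thesis using aV(2) by (metis m_assoc)
    qed
    moreover have "b \<in> V" using b unfolding Z_def by blast
    then have "a \<otimes> b \<in> V" using aV subgroup.m_closed[OF V(1)] by blast
    ultimately show "a \<otimes> b \<in> Z" by (simp add: Z_def)
  qed
  have "cg g a \<in> Z" if g: "g \<in> carrier G" and a: "a \<in> Z" for g a
  proof -
    have aV: "a \<in> V" "a \<in> carrier G" using a VG by (auto simp: Z_def)
    have "cg g a \<otimes> v = v \<otimes> cg g a" if v: "v \<in> V" for v
    proof -
      have vG: "v \<in> carrier G" using VG v by blast
      have "cg (inv g) v \<in> V" using V_norm g v by simp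
      then have "a \<otimes> cg (inv g) v = cg (inv g) v \<otimes> a" using a by (auto simp: Z_def)
      then have "cg g (a \<otimes> cg (inv g) v) = cg g (cg (inv g) v \<otimes> a)" by simp
      then show ?thesis using g aV vG by (simp add: cg_mult)
    qed
    then show ?thesis using V_norm[OF g aV(1)] by (auto simp: Z_def)
  qed
  moreover have "v [^] p = \<one>" if "v \<in> Z" for v
    using p_subgroup_exponent[OF V(1,3) p] that by (simp add: Z_def)
  moreover have "u \<otimes> v = v \<otimes> u" if "u \<in> Z" "v \<in> Z" for u v using that unfolding Z_def by blast
  moreover have "Z \<noteq> {\<one>}" using zZ z(2) by blast
  ultimately have "pog_normal G Z p"
    using p sZ by (intro pog_normal.intro pog_normal_axioms.intro pog_axioms) auto
  then interpret N: pog_normal G Z p .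
  show "subgroup (pel p) G" "\<exists>a. card (pel p) = p ^ a"
    "card (carrier G) = card (pel p) \<or> (\<exists>r. Factorial_Ring.prime r \<and> r \<noteq> p \<and> card (carrier G) = card (pel p) * r)"
    unfolding pel_def using N.p_core_structure by auto
qed

end

section \<open>Sylow subgroups\<close>

lemma card_fibres_le:
  assumes "finite A" "\<And>b. b \<in> f ` A \<Longrightarrow> card {a \<in> A. f a = b} \<le> k"
  shows "card A \<le> k * card (f ` A)"
proof -
  have "card A = (\<Sum>b\<in>f ` A. card {a \<in> A. f a = b})"
    using sum.image_gen[OF assms(1), of "\<lambda>_. 1 :: nat" f] by simp
  also have "\<dots> \<le> (\<Sum>b\<in>f ` A. k)" by (rule sum_mono) (use assms(2) in auto)
  finally show ?thesis by (simp add: mult.commute)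
qed

lemma ex_max_if_finite:
  fixes f :: "'x \<Rightarrow> 'y::linorder"
  assumes "finite S" "x \<in> S"
  shows "\<exists>m\<in>S. \<forall>y\<in>S. f y \<le> f m"
proof -
  have "Max (f ` S) \<in> f ` S" using assms by (intro Max_in) auto
  then obtain m where "m \<in> S" "f m = Max (f ` S)" by auto
  moreover have "f y \<le> Max (f ` S)" if "y \<in> S" for y using assms(1) that by (intro Max_ge) auto
  ultimately show ?thesis by metis
qed

lemma even_sum_involution:
  fixes h :: "'x \<Rightarrow> int"
  assumes "finite S" "\<And>x. x \<in> S \<Longrightarrow> i x \<in> S" "\<And>x. x \<in> S \<Longrightarrow> i (i x) = x" "\<And>x. x \<in> S \<Longrightarrow> i x \<noteq> x"
    "\<And>x. x \<in> S \<Longrightarrow> h (i x) = h x"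
  shows "even (\<Sum>x\<in>S. h x)"
  using assms
proof (induction "card S" arbitrary: S rule: less_induct)
  case less
  show ?case
  proof (cases "S = {}")
    case False
    then obtain x where x: "x \<in> S" by blast
    let ?S = "S - {x, i x}"
    have "card ?S < card S" using x less.prems(1) by (intro psubset_card_mono) auto
    moreover have "i y \<in> ?S" if "y \<in> ?S" for y using less.prems(2,3) that x by (metis Diff_iff insert_iff empty_iff)
    ultimately have "even (\<Sum>x\<in>?S. h x)" using less.hyps[of ?S] less.prems by auto
    moreover have "(\<Sum>x\<in>S. h x) = h x + h (i x) + (\<Sum>x\<in>?S. h x)"
    proof -
      have "(\<Sum>x\<in>S. h x) = h x + (\<Sum>x\<in>S - {x}. h x)" using sum.remove less.prems(1) x by metis
      also have "(\<Sum>x\<in>S - {x}. h x) = h (i x) + (\<Sum>x\<in>S - {x} - {i x}. h x)"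
        using less.prems x by (intro sum.remove) auto
      also have "S - {x} - {i x} = ?S" by auto
      finally show ?thesis by simp
    qed
    ultimately show ?thesis using less.prems(5)[OF x] by simp
  qed simp
qed

context pog
begin

lemma subgroup_structure:
  assumes H: "subgroup H G" and p: "Factorial_Ring.prime p"
    and V: "subgroup V G" "V \<subseteq> H" "V \<noteq> {\<one>}" "card V = p ^ k"
    and V_norm: "\<And>g v. g \<in> H \<Longrightarrow> v \<in> V \<Longrightarrow> cg g v \<in> V"
  defines "T \<equiv> {x \<in> H. x [^] p = \<one>}"
  shows "subgroup T G" "\<exists>a. card T = p ^ a"
    "card H = card T \<or> (\<exists>r. Factorial_Ring.prime r \<and> r \<noteq> p \<and> card H = card T * r)"
proof -
  interpret H: pog "G\<lparr>carrier := H\<rparr>" by (rule subgroup_pog[OF H])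
  have T: "T = H.pel p" by (simp add: T_def H.pel_def nat_pow_consistent[symmetric])
  have sV: "subgroup V (G\<lparr>carrier := H\<rparr>)" using V H subgroup_incl by blast
  have Vn: "H.cg g v \<in> V" if "g \<in> carrier (G\<lparr>carrier := H\<rparr>)" "v \<in> V" for g v
    using V_norm[of g v] that m_inv_consistent[OF H] by (simp add: H.cg_def cg_def)
  have V1: "V \<noteq> {\<one>\<^bsub>G\<lparr>carrier := H\<rparr>\<^esub>}" using V by simp
  note s = H.normal_p_subgroup_structure[OF p sV V1 V(4) Vn]
  show "subgroup T G" using incl_subgroup[OF H s(1)] T by simp
  show "\<exists>a. card T = p ^ a"
    "card H = card T \<or> (\<exists>r. Factorial_Ring.prime r \<and> r \<noteq> p \<and> card H = card T * r)"
    using s(2,3) T by auto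
qed

text \<open>Requiring p to divide the group order excludes the trivial subgroup.\<close>

definition syl :: "nat \<Rightarrow> 'a set \<Rightarrow> bool" where
  "syl p P \<longleftrightarrow> Factorial_Ring.prime p \<and> p dvd card (carrier G) \<and> subgroup P G \<and>
     (\<exists>a. card P = p ^ a \<and> \<not> p ^ Suc a dvd card (carrier G))"

lemma sylD:
  assumes "syl p P"
  shows "Factorial_Ring.prime p" "p dvd card (carrier G)" "subgroup P G" "\<exists>a. card P = p ^ a" "P \<noteq> {\<one>}"
    "x \<in> P \<Longrightarrow> x [^] p = \<one>" "x \<in> P \<Longrightarrow> x \<in> carrier G"
proof -
  show s: "Factorial_Ring.prime p" "p dvd card (carrier G)" "subgroup P G" "\<exists>a. card P = p ^ a"
    using assms by (auto simp: syl_def)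
  show "P \<noteq> {\<one>}"
  proof
    assume P: "P = {\<one>}"
    obtain a where a: "card P = p ^ a" "\<not> p ^ Suc a dvd card (carrier G)" using assms by (auto simp: syl_def)
    then have "a = 0" using P prime_gt_1_nat[OF s(1)] by (cases a) auto
    then show False using a s by simp
  qed
  show "x \<in> P \<Longrightarrow> x [^] p = \<one>" "x \<in> P \<Longrightarrow> x \<in> carrier G" using s p_subgroup_exponent subgroup_inG by blast+
qed

lemma syl_ex:
  assumes "Factorial_Ring.prime p" "p dvd card (carrier G)"
  shows "\<exists>P. syl p P"
proof -
  let ?a = "multiplicity p (card (carrier G))"
  have nz: "card (carrier G) \<noteq> 0" using order_pos by simp
  obtain P where P: "subgroup P G" "card P = p ^ ?a" using sylow_subgroup[OF assms(1) multiplicity_dvd] by blast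
  have "\<not> is_unit p" using assms(1) not_prime_unit by blast
  then have "\<not> p ^ Suc ?a dvd card (carrier G)"
    using nz by (subst power_dvd_iff_le_multiplicity) auto
  then show ?thesis using P assms by (auto simp: syl_def)
qed

lemma syl_maximal:
  assumes S: "syl p P" and T: "subgroup T G" "card T = p ^ b" "P \<subseteq> T"
  shows "T = P"
proof -
  obtain a where a: "card P = p ^ a" "\<not> p ^ Suc a dvd card (carrier G)" using S by (auto simp: syl_def)
  have "b \<le> a"
  proof (rule ccontr)
    assume "\<not> b \<le> a"
    then have "p ^ Suc a dvd p ^ b" by (intro le_imp_power_dvd) simp
    then show False using a subgroup_card_dvd[OF T(1)] T(2) dvd_trans by metis
  qed
  then have "card T \<le> card P" using T a prime_gt_0_nat[OF sylD(1)[OF S]] by (simp add: power_increasing)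
  then show ?thesis using T card_seteq subgroup_finite by metis
qed

lemma syl_contains:
  assumes S: "syl p P" and Q: "subgroup Q G" "card Q = p ^ b"
  obtains g where "g \<in> carrier G" "Q \<subseteq> cg g ` P"
proof -
  obtain a where a: "card P = p ^ a" "\<not> p ^ Suc a dvd card (carrier G)" using S by (auto simp: syl_def)
  show thesis using sylow_contains[OF sylD(1,3)[OF S] a Q] that by blast
qed

lemma syl_elem:
  assumes S: "syl p P" and x: "x \<in> carrier G" "x [^] p = \<one>"
  obtains g where "g \<in> carrier G" "cg (inv g) x \<in> P"
proof (cases "x = \<one>")
  case True
  then show thesis using that[of \<one>] subgroup.one_closed[OF sylD(3)[OF S]] by simp
next
  case False
  note c = cyc_prime[OF x(1) False x(2) sylD(1)[OF S]]
  obtain g where g: "g \<in> carrier G" "cyc x \<subseteq> cg g ` P" using syl_contains[OF S c(1), of 1] c(2) by auto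
  then obtain u where "u \<in> P" "x = cg g u" using cyc_mem[OF x(1)] by blast
  then show thesis using that[OF g(1)] g(1) sylD(7)[OF S] by simp
qed

text \<open>Among the conjugates of P other than P that meet it nontrivially, take Q with the
  largest intersection D. The elements of exponent p in \<open>nrm D\<close> form a p-group T that
  meets both P and Q in more than D. By maximality a conjugate of P containing T is P itself, so Q
  would meet P in more than D.\<close>

lemma syl_TI:
  assumes S: "syl p P"
  shows "TI P"
proof (rule ccontr)
  note P = sylD(3)[OF S] and p = sylD(1)[OF S]
  define B where "B = {g \<in> carrier G. g \<notin> nrm P \<and> P \<inter> cg g ` P \<noteq> {\<one>}}"
  assume "\<not> TI P"
  then obtain g0 y where g0: "g0 \<in> carrier G" "y \<in> P" "y \<noteq> \<one>" "cg g0 y \<in> P" "g0 \<notin> nrm P" by (auto simp: TI_def)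
  have "cg g0 y \<noteq> \<one>" using g0 sylD(7)[OF S] by simp
  then have "g0 \<in> B" using g0 by (auto simp: B_def)
  moreover have "finite B" using fin by (simp add: B_def)
  ultimately obtain g where g: "g \<in> B" and mx: "\<And>h. h \<in> B \<Longrightarrow> card (P \<inter> cg h ` P) \<le> card (P \<inter> cg g ` P)"
    using ex_max_if_finite[of B g0 "\<lambda>g. card (P \<inter> cg g ` P)"] by blast
  have gG: "g \<in> carrier G" "g \<notin> nrm P" "P \<inter> cg g ` P \<noteq> {\<one>}" using g by (auto simp: B_def)
  define Q where "Q = cg g ` P"
  define D where "D = P \<inter> Q"
  have Q: "subgroup Q G" "card Q = card P" using cg_subgroup[OF P gG(1)] by (auto simp: Q_def)
  have D: "subgroup D G" unfolding D_def using subgroups_Inter_pair[OF P Q(1)] .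
  obtain a where a: "card P = p ^ a" using sylD(4)[OF S] by blast
  have fP: "finite P" "finite Q" using subgroup_finite P Q by auto
  have PQ: "P \<noteq> Q" using gG by (auto simp: nrm_def Q_def)
  have DP: "D \<subset> P" "D \<subset> Q"
    using PQ Q(2) fP card_subset_eq[of P Q] card_subset_eq[of Q P] by (auto simp: D_def)
  have D1: "D \<noteq> {\<one>}" using gG by (simp add: D_def Q_def)
  have "card D dvd p ^ a" using subgroup_card_dvd_subgroup[OF D P] DP a by auto
  then obtain b where b: "card D = p ^ b" using p divides_primepow_nat by metis
  define T where "T = {x \<in> nrm D. x [^] p = \<one>}"
  have T: "subgroup T G" "\<exists>a. card T = p ^ a"
    using subgroup_structure[OF nrm_subgroup(1)[OF D] p D nrm_subgroup(2)[OF D] D1 b] nrmD(1)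
    unfolding T_def by blast+
  obtain c where c: "card T = p ^ c" using T(2) by blast
  obtain h where h: "h \<in> carrier G" "T \<subseteq> cg h ` P" using syl_contains[OF S T(1) c] by blast
  have DT: "D \<subseteq> T" using nrm_subgroup(2)[OF D] DP sylD(6)[OF S] by (auto simp: T_def)
  obtain x where x: "x \<in> P" "x \<notin> D" "x \<in> nrm D" using normalizer_grows[OF p P a D DP(1)] by blast
  have "x \<in> T" using x sylD(6)[OF S] by (simp add: T_def)
  then have sub: "insert x D \<subseteq> P \<inter> cg h ` P" using x DP h DT by auto
  have "card D < card (insert x D)" using x subgroup_finite[OF D] by simp
  also have "\<dots> \<le> card (P \<inter> cg h ` P)" using sub fP by (intro card_mono) auto
  finally have lt: "card (P \<inter> cg g ` P) < card (P \<inter> cg h ` P)" by (simp add: D_def Q_def)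
  have "x \<noteq> \<one>" "x \<in> P \<inter> cg h ` P" using sub x(2) subgroup.one_closed[OF D] by auto
  then have "P \<inter> cg h ` P \<noteq> {\<one>}" by auto
  then have "h \<in> nrm P" using mx[of h] lt h by (auto simp: B_def)
  then have TP: "T \<subseteq> P" using h by (simp add: nrm_def)
  obtain x' where x': "x' \<in> Q" "x' \<notin> D" "x' \<in> nrm D" using normalizer_grows[OF p Q(1) _ D DP(2)] Q(2) a by metis
  have "x' [^] p = \<one>" using p_subgroup_exponent[OF Q(1) _ p x'(1)] Q(2) a by metis
  then have "x' \<in> P" using TP x' by (auto simp: T_def)
  then show False using x' by (simp add: D_def)
qed

lemma syl_normalizer:
  assumes S: "syl p P"
  shows "x \<in> nrm P \<Longrightarrow> x [^] p = \<one> \<Longrightarrow> x \<in> P"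
    "card (nrm P) = card P \<or> (\<exists>r. Factorial_Ring.prime r \<and> r \<noteq> p \<and> card (nrm P) = card P * r)"
proof -
  note P = sylD(3)[OF S]
  define T where "T = {x \<in> nrm P. x [^] p = \<one>}"
  obtain a where a: "card P = p ^ a" using sylD(4)[OF S] by blast
  have T: "subgroup T G" "\<exists>a. card T = p ^ a"
    "card (nrm P) = card T \<or> (\<exists>r. Factorial_Ring.prime r \<and> r \<noteq> p \<and> card (nrm P) = card T * r)"
    using subgroup_structure[OF nrm_subgroup(1)[OF P] sylD(1)[OF S] P nrm_subgroup(2)[OF P] sylD(5)[OF S] a] nrmD(1)
    unfolding T_def by blast+
  have "P \<subseteq> T" using nrm_subgroup(2)[OF P] sylD(6)[OF S] by (auto simp: T_def)
  then have TP: "T = P" using syl_maximal[OF S T(1)] T(2) by blast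
  show "card (nrm P) = card P \<or> (\<exists>r. Factorial_Ring.prime r \<and> r \<noteq> p \<and> card (nrm P) = card P * r)"
    using T(3) TP by simp
  show "x \<in> nrm P \<Longrightarrow> x [^] p = \<one> \<Longrightarrow> x \<in> P" using TP by (auto simp: T_def)
qed

text \<open>Double counting of pairs (g, x) such that conjugation by inv g takes x into P. An x of
  order p is conjugate into P, and by trivial intersection the suitable g form one coset of
  \<open>nrm P\<close>. The weight f will be 1 for counting elements and a squared character value
  in the norm estimate.\<close>

lemma syl_sum:
  fixes f :: "'a \<Rightarrow> real"
  assumes S: "syl p P" and f: "\<And>g x. g \<in> carrier G \<Longrightarrow> x \<in> carrier G \<Longrightarrow> f (cg g x) = f x"
  shows "card (nrm P) * (\<Sum>x\<in>{x \<in> carrier G. x \<noteq> \<one> \<and> x [^] p = \<one>}. f x) = card (carrier G) * (\<Sum>y\<in>P - {\<one>}. f y)"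
proof -
  note P = sylD(3)[OF S] and PG = sylD(7)[OF S]
  let ?E = "{x \<in> carrier G. x \<noteq> \<one> \<and> x [^] p = \<one>}"
  have fE: "finite ?E" using fin by simp
  have fP: "finite P" using subgroup_finite[OF P] .
  have 1: "(\<Sum>y\<in>P - {\<one>}. f y) = (\<Sum>x\<in>?E. if cg (inv g) x \<in> P then f x else 0)" if g: "g \<in> carrier G" for g
  proof -
    have "(\<Sum>y\<in>P - {\<one>}. f y) = (\<Sum>x\<in>{x \<in> ?E. cg (inv g) x \<in> P}. f x)"
    proof (rule sum.reindex_bij_witness[of _ "cg (inv g)" "cg g"])
      fix a assume a: "a \<in> P - {\<one>}"
      have "cg g a [^] p = \<one>" using a g PG sylD(6)[OF S, of a] cg_pow[of g a p] by simp
      then show "cg g a \<in> {x \<in> ?E. cg (inv g) x \<in> P}" using a g PG by simp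
    qed (use g PG f in auto)
    also have "\<dots> = (\<Sum>x\<in>?E. if cg (inv g) x \<in> P then f x else 0)" using fE by (intro sum.inter_filter) 
    finally show ?thesis .
  qed
  have 2: "card {g \<in> carrier G. cg (inv g) x \<in> P} = card (nrm P)" if x: "x \<in> ?E" for x
  proof -
    have xG: "x \<in> carrier G" "x [^] p = \<one>" "x \<noteq> \<one>" using x by auto
    obtain g0 where g0: "g0 \<in> carrier G" "cg (inv g0) x \<in> P" using syl_elem[OF S xG(1,2)] by blast
    define y0 where "y0 = cg (inv g0) x"
    have y0: "y0 \<in> P" "y0 \<noteq> \<one>" "y0 \<in> carrier G" using g0 xG PG by (auto simp: y0_def)
    have xy: "x = cg g0 y0" using g0 xG by (simp add: y0_def)
    have "bij_betw (\<lambda>n. g0 \<otimes> n) (nrm P) {g \<in> carrier G. cg (inv g) x \<in> P}"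
    proof (rule bij_betwI[where g = "\<lambda>g. inv g0 \<otimes> g"])
      show "(\<lambda>n. g0 \<otimes> n) \<in> nrm P \<rightarrow> {g \<in> carrier G. cg (inv g) x \<in> P}"
      proof
        fix n assume n: "n \<in> nrm P"
        have nG: "n \<in> carrier G" using nrmD(2) n by blast
        have "inv n \<in> nrm P" using subgroup.m_inv_closed[OF nrm_subgroup(1)[OF P] n] .
        moreover have "cg (inv (g0 \<otimes> n)) x = cg (inv n) y0"
          using nG g0 y0 by (simp add: xy inv_mult_group cg_cg m_assoc)
        ultimately show "g0 \<otimes> n \<in> {g \<in> carrier G. cg (inv g) x \<in> P}" using nrmD(1) y0 g0 nG by simp
      qed
      show "(\<lambda>g. inv g0 \<otimes> g) \<in> {g \<in> carrier G. cg (inv g) x \<in> P} \<rightarrow> nrm P"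
      proof
        fix g assume g: "g \<in> {g \<in> carrier G. cg (inv g) x \<in> P}"
        have "cg (inv g) x = cg (inv g \<otimes> g0) y0" using g g0 y0 by (simp add: xy cg_cg)
        then have "inv g \<otimes> g0 \<in> nrm P" using syl_TI[OF S] g g0 y0 unfolding TI_def by simp
        then have "inv (inv g \<otimes> g0) \<in> nrm P" using subgroup.m_inv_closed[OF nrm_subgroup(1)[OF P]] by blast
        then show "inv g0 \<otimes> g \<in> nrm P" using g g0 by (simp add: inv_mult_group)
      qed
    qed (use g0 nrmD(2) in \<open>auto simp: m_assoc[symmetric]\<close>)
    then show ?thesis by (simp add: bij_betw_same_card)
  qed
  have "card (carrier G) * (\<Sum>y\<in>P - {\<one>}. f y) = (\<Sum>g\<in>carrier G. \<Sum>y\<in>P - {\<one>}. f y)" by simp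
  also have "\<dots> = (\<Sum>g\<in>carrier G. \<Sum>x\<in>?E. if cg (inv g) x \<in> P then f x else 0)"
    by (rule sum.cong[OF refl 1])
  also have "\<dots> = (\<Sum>x\<in>?E. \<Sum>g\<in>carrier G. if cg (inv g) x \<in> P then f x else 0)" by (rule sum.swap)
  also have "\<dots> = (\<Sum>x\<in>?E. card (nrm P) * f x)"
  proof (rule sum.cong[OF refl])
    fix x assume x: "x \<in> ?E"
    have "(\<Sum>g\<in>carrier G. if cg (inv g) x \<in> P then f x else 0) = (\<Sum>g\<in>{g \<in> carrier G. cg (inv g) x \<in> P}. f x)"
      using fin by (intro sum.inter_filter[symmetric])
    then show "(\<Sum>g\<in>carrier G. if cg (inv g) x \<in> P then f x else 0) = card (nrm P) * f x"
      using 2[OF x] by simp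
  qed
  finally show ?thesis by (simp add: sum_distrib_left)
qed

section \<open>The normaliser of a Sylow subgroup acting on its linear characters\<close>

lemma tw_tw:
  assumes P: "subgroup P G" and n: "n \<in> nrm P" "m \<in> nrm P"
  shows "tw P n (tw P m \<theta>) = tw P (m \<otimes> n) \<theta>"
proof
  fix y
  have "n \<in> carrier G" "m \<in> carrier G" using n nrmD(2) by auto
  then show "tw P n (tw P m \<theta>) y = tw P (m \<otimes> n) \<theta> y"
    using subgroup_inG[OF P, of y] nrmD(1)[OF n(1), of y] cg_cg[of m n y] by (auto simp: tw_def)
qed

lemma tw_one: "subgroup P G \<Longrightarrow> \<theta> \<in> lin P \<Longrightarrow> tw P \<one> \<theta> = \<theta>"
  using subgroup_inG[of P] by (auto simp: tw_def lin_def)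

lemma tw_cj: "tw P n (cj \<theta>) = cj (tw P n \<theta>)"
  by (auto simp: tw_def cj_def)

lemma tw_triv: "n \<in> nrm P \<Longrightarrow> tw P n (triv_on P) = triv_on P"
  using nrmD(1)[of n P] by (auto simp: tw_def triv_on_def)

lemma cj_triv_on [simp]: "cj (triv_on P) = triv_on P"
  by (auto simp: cj_def triv_on_def)

text \<open>For n in \<open>nrm P\<close> outside P the commutator map y |-> [n, y] is injective on
  P, as n commutes with no nontrivial element of P. Hence it is onto, and an n-invariant \<theta> is
  1 at every commutator.\<close>

lemma tw_fixed:
  assumes S: "syl p P" and n: "n \<in> nrm P" "n \<notin> P" and th: "\<theta> \<in> lin P" "tw P n \<theta> = \<theta>"
  shows "\<theta> = triv_on P"
proof -
  note P = sylD(3)[OF S] and PG = sylD(7)[OF S]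
  have nG: "n \<in> carrier G" using nrmD(2) n by blast
  define f where "f y = cg n y \<otimes> inv y" for y
  have fP: "f y \<in> P" if "y \<in> P" for y
    using nrmD(1)[OF n(1) that] subgroup.m_closed[OF P] subgroup.m_inv_closed[OF P] that by (simp add: f_def)
  have "inj_on f P"
  proof (rule inj_onI)
    fix y z assume yz: "y \<in> P" "z \<in> P" "f y = f z"
    have g: "y \<in> carrier G" "z \<in> carrier G" using yz PG by auto
    define w where "w = inv z \<otimes> y"
    have w: "w \<in> P" "w \<in> carrier G" using yz g subgroup.m_closed[OF P] subgroup.m_inv_closed[OF P] by (auto simp: w_def)
    have "inv (cg n z) \<otimes> (cg n y \<otimes> inv y) \<otimes> y = inv (cg n z) \<otimes> (cg n z \<otimes> inv z) \<otimes> y" using yz(3) by (simp add: f_def)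
    then have "inv (cg n z) \<otimes> cg n y = inv z \<otimes> y" using g nG by (simp add: m_assoc) (simp add: m_assoc[symmetric])
    then have "cg n w = w" using g nG by (simp add: w_def cg_mult cg_inv)
    then have c: "n \<otimes> w = w \<otimes> n" using cg_eq_self nG w by blast
    have "w = \<one>"
    proof (rule ccontr)
      assume "w \<noteq> \<one>"
      then have "n [^] p = \<one>" using commuting_same_prime[OF w(2) _ sylD(6)[OF S w(1)] sylD(1)[OF S] nG c] by blast
      then show False using syl_normalizer(1)[OF S n(1)] n(2) by blast
    qed
    then show "y = z" using g by (metis w_def inv_equality inv_inv inv_closed)
  qed
  then have im: "f ` P = P" using fP subgroup_finite[OF P] by (intro endo_inj_surj) auto
  have "\<theta> x = 1" if x: "x \<in> P" for x
  proof -
    obtain y where y: "y \<in> P" "x = f y" using im x by (metis imageE)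
    have "\<theta> (cg n y) = \<theta> y" using th(2) y(1) by (metis tw_def)
    moreover have "\<theta> y * cnj (\<theta> y) = 1" using th(1) y by (simp add: lin_def complex_norm_square[symmetric])
    ultimately show ?thesis
      using y th(1) nrmD(1)[OF n(1) y(1)] subgroup.m_inv_closed[OF P y(1)] lin_inv[OF P th(1) y(1)]
      by (simp add: f_def lin_def)
  qed
  then show ?thesis using th(1) by (auto simp: lin_def triv_on_def)
qed

text \<open>\<open>tw_fixed\<close> says that the stabiliser of \<theta> in \<open>nrm P\<close> is
  P, so a nonempty set of elements taking \<theta> to \<eta> is a single coset of P.\<close>

lemma sN_value:
  assumes S: "syl p P" and th: "\<theta> \<in> lin P" "\<theta> \<noteq> triv_on P" and ex: "n0 \<in> nrm P" "tw P n0 \<theta> = \<eta>"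
  shows "sN P \<eta> \<theta> = card P"
proof -
  note P = sylD(3)[OF S] and PG = sylD(7)[OF S]
  note Ns = nrm_subgroup(1)[OF P]
  have n0G: "n0 \<in> carrier G" using nrmD(2) ex by blast
  have i0: "inv n0 \<in> nrm P" using subgroup.m_inv_closed[OF Ns ex(1)] .
  have "bij_betw (\<lambda>m. m \<otimes> n0) P {n \<in> nrm P. tw P n \<theta> = \<eta>}"
  proof (rule bij_betwI[where g = "\<lambda>n. n \<otimes> inv n0"])
    show "(\<lambda>m. m \<otimes> n0) \<in> P \<rightarrow> {n \<in> nrm P. tw P n \<theta> = \<eta>}"
    proof
      fix m assume m: "m \<in> P"
      then have mN: "m \<in> nrm P" using nrm_subgroup(2)[OF P] by blast
      have "tw P (m \<otimes> n0) \<theta> = \<eta>" using tw_tw[OF P ex(1) mN, of \<theta>] lin_class[OF P th(1) m] ex by simp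
      then show "m \<otimes> n0 \<in> {n \<in> nrm P. tw P n \<theta> = \<eta>}" using subgroup.m_closed[OF Ns mN ex(1)] by simp
    qed
    show "(\<lambda>n. n \<otimes> inv n0) \<in> {n \<in> nrm P. tw P n \<theta> = \<eta>} \<rightarrow> P"
    proof
      fix n assume n: "n \<in> {n \<in> nrm P. tw P n \<theta> = \<eta>}"
      then have nN: "n \<in> nrm P" "tw P n \<theta> = \<eta>" by auto
      have "tw P (n \<otimes> inv n0) \<theta> = tw P (inv n0) (tw P n \<theta>)" using tw_tw[OF P i0 nN(1)] by simp
      also have "\<dots> = tw P (n0 \<otimes> inv n0) \<theta>" using tw_tw[OF P i0 ex(1), of \<theta>] ex nN by simp
      also have "\<dots> = \<theta>" using n0G tw_one[OF P th(1)] by simp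
      finally have "tw P (n \<otimes> inv n0) \<theta> = \<theta>" .
      then show "n \<otimes> inv n0 \<in> P" using tw_fixed[OF S _ _ th(1)] th(2) subgroup.m_closed[OF Ns nN(1) i0] by blast
    qed
  qed (use n0G PG nrmD(2) in \<open>auto simp: m_assoc\<close>)
  then show ?thesis by (simp add: sN_def bij_betw_same_card)
qed

lemma sN_self: "syl p P \<Longrightarrow> \<theta> \<in> lin P \<Longrightarrow> \<theta> \<noteq> triv_on P \<Longrightarrow> sN P \<theta> \<theta> = card P"
  using sN_value[of p P \<theta> \<one> \<theta>] tw_one[of P \<theta>] sylD(3)[of p P] subgroup.one_closed[OF nrm_subgroup(1)] by blast

lemma sN_triv:
  assumes "syl p P" "\<theta> \<in> lin P" "\<theta> \<noteq> triv_on P"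
  shows "sN P (triv_on P) (triv_on P) = card (nrm P)" "sN P \<theta> (triv_on P) = 0" "sN P (triv_on P) \<theta> = 0"
proof -
  note P = sylD(3)[OF assms(1)]
  have "{n \<in> nrm P. tw P n (triv_on P) = triv_on P} = nrm P" using tw_triv by auto
  then show "sN P (triv_on P) (triv_on P) = card (nrm P)" by (simp add: sN_def)
  have "{n \<in> nrm P. tw P n (triv_on P) = \<theta>} = {}" using tw_triv assms(3) by auto
  then show "sN P \<theta> (triv_on P) = 0" unfolding sN_def by (simp only: card.empty)
  have "tw P n \<theta> \<noteq> triv_on P" if n: "n \<in> nrm P" for n
  proof
    assume e: "tw P n \<theta> = triv_on P"
    have nG: "n \<in> carrier G" using nrmD(2) n by blast
    have i: "inv n \<in> nrm P" using subgroup.m_inv_closed[OF nrm_subgroup(1)[OF P] n] .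
    have "tw P (n \<otimes> inv n) \<theta> = tw P (inv n) (triv_on P)" using tw_tw[OF P i n, of \<theta>] e by simp
    then show False using nG tw_one[OF P assms(2)] tw_triv[OF i] assms(3) by simp
  qed
  then have "{n \<in> nrm P. tw P n \<theta> = triv_on P} = {}" by blast
  then show "sN P (triv_on P) \<theta> = 0" unfolding sN_def by (simp only: card.empty)
qed

lemma sN_cj: "sN P (cj \<theta>) (cj \<eta>) = sN P \<theta> \<eta>"
  unfolding sN_def tw_cj by (metis cj_cj)

lemma sN_pos: "sN P \<theta> \<eta> > 0 \<Longrightarrow> \<exists>n\<in>nrm P. tw P n \<eta> = \<theta>"
  by (auto simp: sN_def card_gt_0_iff)

lemma mu_conj_eq:
  assumes S: "syl p P" and th: "\<theta> \<in> lin P" "\<theta> \<noteq> triv_on P" and n: "n \<in> nrm P" and c: "\<chi> \<in> irr"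
  shows "mu P (tw P n \<theta>) \<chi> = mu P \<theta> \<chi>"
proof -
  note P = sylD(3)[OF S] and PG = sylD(7)[OF S]
  have nG: "n \<in> carrier G" using nrmD(2) n by blast
  have "(\<Sum>y\<in>P. tw P n \<theta> y * cnj (\<chi> y)) = (\<Sum>y\<in>P. \<theta> y * cnj (\<chi> y))"
  proof (rule sum.reindex_bij_witness[of _ "cg (inv n)" "cg n"])
    fix y assume y: "y \<in> P"
    show "\<theta> (cg n y) * cnj (\<chi> (cg n y)) = tw P n \<theta> y * cnj (\<chi> y)"
      using y irr_class[OF c nG PG[OF y]] by (simp add: tw_def cg_def)
    show "cg n y \<in> P" using nrmD(1)[OF n y] .
    show "cg (inv n) y \<in> P" using nrmD(1)[OF subgroup.m_inv_closed[OF nrm_subgroup(1)[OF P] n] y] .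
  qed (use nG PG in auto)
  then have "complex_of_nat (mu P (tw P n \<theta>) \<chi>) = of_nat (mu P \<theta> \<chi>)"
    unfolding mu_eq[OF P th(1) c] mu_eq[OF P tw_lin[OF P n th(1)] c] by simp
  then show ?thesis by (simp only: of_nat_eq_iff)
qed

end

section \<open>Exceptional characters in odd order\<close>

lemma sum_remove_two:
  fixes g :: "'x \<Rightarrow> 'y::comm_monoid_add"
  assumes "finite S" "x \<in> S" "y \<in> S" "x \<noteq> y"
  shows "sum g S = g x + g y + sum g (S - {x, y})"
proof -
  have "sum g S = g x + sum g (S - {x})" using assms by (simp add: sum.remove)
  also have "sum g (S - {x}) = g y + sum g (S - {x} - {y})" using assms by (intro sum.remove) auto
  also have "S - {x} - {y} = S - {x, y}" by auto
  finally show ?thesis by (simp add: add.assoc)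
qed

lemma int_square_ge_1: "(x::int) \<noteq> 0 \<Longrightarrow> x * x \<ge> 1"
  by (metis add_0 linorder_neqE_linordered_idom mult_eq_0_iff zero_le_square zless_imp_add1_zle order_le_less)

context fin_group
begin

text \<open>Bessel's inequality on P without the identity. Subtracting the mean from n' gives
  coefficients t with sum 0, so h = sum t(\<eta>) \<eta> vanishes at \<open>\<one>\<close> and the
  degree of \<chi> drops out. The constant k disappears with the mean, which lets each application
  choose a convenient normalisation.\<close>

lemma bessel_linear:
  assumes P: "subgroup P G" and c: "\<chi> \<in> irr"
    and n: "\<And>\<eta>. \<eta> \<in> lin P \<Longrightarrow> real (mu P \<eta> \<chi>) = n' \<eta> + k"
  defines "m \<equiv> real (card (lin P))"
  shows "card P * ((\<Sum>\<eta>\<in>lin P. (n' \<eta>)\<^sup>2) - (\<Sum>\<eta>\<in>lin P. n' \<eta>)\<^sup>2 / m) \<le> (\<Sum>y\<in>P - {\<one>}. (cmod (\<chi> y))\<^sup>2)"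
proof -
  define L where "L = lin P"
  have fL: "finite L" using lin_finite[OF P] by (simp add: L_def)
  have "triv_on P \<in> L" using triv_on_lin[OF P] by (simp add: L_def)
  then have m0: "m > 0" using fL by (auto simp: m_def L_def[symmetric] card_gt_0_iff)
  define \<mu> where "\<mu> = (\<Sum>\<eta>\<in>L. n' \<eta>) / m"
  define t where "t \<eta> = n' \<eta> - \<mu>" for \<eta>
  define D where "D = (\<Sum>\<eta>\<in>L. (t \<eta>)\<^sup>2)"
  define S where "S = (\<Sum>y\<in>P - {\<one>}. (cmod (\<chi> y))\<^sup>2)"
  have mm: "m * \<mu> = (\<Sum>\<eta>\<in>L. n' \<eta>)" using m0 by (simp add: \<mu>_def)
  have cm: "real (card L) = m" by (simp add: m_def L_def)
  have st: "(\<Sum>\<eta>\<in>L. t \<eta>) = 0" using mm by (simp add: t_def sum_subtractf cm)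
  have "D = (\<Sum>\<eta>\<in>L. (n' \<eta>)\<^sup>2 - 2 * \<mu> * n' \<eta> + \<mu>\<^sup>2)"
    unfolding D_def t_def by (rule sum.cong) (auto simp: power2_diff)
  also have "\<dots> = (\<Sum>\<eta>\<in>L. (n' \<eta>)\<^sup>2) - 2 * \<mu> * (m * \<mu>) + m * \<mu>\<^sup>2"
    unfolding mm by (simp add: sum.distrib sum_subtractf sum_distrib_left[symmetric] cm)
  also have "\<dots> = (\<Sum>\<eta>\<in>L. (n' \<eta>)\<^sup>2) - (m * \<mu>)\<^sup>2 / m"
    using m0 by (simp add: power2_eq_square)
  finally have D: "D = (\<Sum>\<eta>\<in>L. (n' \<eta>)\<^sup>2) - (\<Sum>\<eta>\<in>L. n' \<eta>)\<^sup>2 / m" unfolding mm .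
  have D0: "D \<ge> 0" by (simp add: D_def sum_nonneg)
  define h where "h y = (\<Sum>\<eta>\<in>L. of_real (t \<eta>) * \<eta> y)" for y
  have h1: "h \<one> = 0"
  proof -
    have "h \<one> = (\<Sum>\<eta>\<in>L. of_real (t \<eta>))" unfolding h_def by (rule sum.cong) (use lin_one[OF P] in \<open>auto simp: L_def\<close>)
    also have "\<dots> = of_real (\<Sum>\<eta>\<in>L. t \<eta>)" by simp
    finally show ?thesis using st by simp
  qed
  have fP: "finite P" and oneP: "\<one> \<in> P" using subgroup_finite[OF P] subgroup.one_closed[OF P] by auto
  have cP: "card P > 0" using subgroup_card_pos[OF P] .
  have "(\<Sum>y\<in>P. h y * cnj (\<chi> y)) = (\<Sum>y\<in>P. \<Sum>\<eta>\<in>L. of_real (t \<eta>) * (\<eta> y * cnj (\<chi> y)))"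
    by (simp add: h_def sum_distrib_right mult.assoc)
  also have "\<dots> = (\<Sum>\<eta>\<in>L. \<Sum>y\<in>P. of_real (t \<eta>) * (\<eta> y * cnj (\<chi> y)))" by (rule sum.swap)
  also have "\<dots> = (\<Sum>\<eta>\<in>L. of_real (t \<eta> * (card P * (t \<eta> + (\<mu> + k)))))"
  proof (rule sum.cong[OF refl])
    fix \<eta> assume e: "\<eta> \<in> L"
    have "(\<Sum>y\<in>P. \<eta> y * cnj (\<chi> y)) = of_nat (card P) * of_nat (mu P \<eta> \<chi>)"
      using mu_eq[OF P _ c, of \<eta>] e cP by (simp add: L_def)
    also have "\<dots> = of_real (card P * (t \<eta> + (\<mu> + k)))"
    proof -
      have "real (mu P \<eta> \<chi>) = t \<eta> + (\<mu> + k)" using n[of \<eta>] e by (simp add: L_def t_def)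
      then have "complex_of_nat (mu P \<eta> \<chi>) = of_real (t \<eta> + (\<mu> + k))" by (metis of_real_of_nat_eq)
      then show ?thesis by simp
    qed
    finally show "(\<Sum>y\<in>P. of_real (t \<eta>) * (\<eta> y * cnj (\<chi> y))) = of_real (t \<eta> * (card P * (t \<eta> + (\<mu> + k))))"
      by (simp add: sum_distrib_left[symmetric])
  qed
  also have "\<dots> = of_real (\<Sum>\<eta>\<in>L. t \<eta> * (card P * (t \<eta> + (\<mu> + k))))" by (rule of_real_sum[symmetric])
  also have "(\<Sum>\<eta>\<in>L. t \<eta> * (card P * (t \<eta> + (\<mu> + k)))) = (\<Sum>\<eta>\<in>L. card P * (t \<eta>)\<^sup>2 + card P * (\<mu> + k) * t \<eta>)"
    by (rule sum.cong) (auto simp: algebra_simps power2_eq_square)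
  also have "\<dots> = card P * D" by (simp add: sum.distrib sum_distrib_left[symmetric] D_def st)
  finally have hx: "(\<Sum>y\<in>P. h y * cnj (\<chi> y)) = of_real (card P * D)" .
  have "(\<Sum>y\<in>P. h y * cnj (h y)) = (\<Sum>y\<in>P. \<Sum>\<eta>\<in>L. \<Sum>\<zeta>\<in>L. of_real (t \<eta> * t \<zeta>) * (\<eta> y * cnj (\<zeta> y)))"
    by (intro sum.cong refl) (simp add: h_def sum_product mult_ac)
  also have "\<dots> = (\<Sum>\<eta>\<in>L. \<Sum>y\<in>P. \<Sum>\<zeta>\<in>L. of_real (t \<eta> * t \<zeta>) * (\<eta> y * cnj (\<zeta> y)))" by (rule sum.swap)
  also have "\<dots> = (\<Sum>\<eta>\<in>L. \<Sum>\<zeta>\<in>L. \<Sum>y\<in>P. of_real (t \<eta> * t \<zeta>) * (\<eta> y * cnj (\<zeta> y)))"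
    by (rule sum.cong[OF refl]) (rule sum.swap)
  also have "\<dots> = (\<Sum>\<eta>\<in>L. \<Sum>\<zeta>\<in>L. if \<zeta> = \<eta> then of_real (t \<eta> * t \<zeta>) * of_nat (card P) else 0)"
  proof (intro sum.cong[OF refl])
    fix \<eta> \<zeta> assume e: "\<eta> \<in> L" "\<zeta> \<in> L"
    have "(\<Sum>y\<in>P. of_real (t \<eta> * t \<zeta>) * (\<eta> y * cnj (\<zeta> y))) = of_real (t \<eta> * t \<zeta>) * (\<Sum>y\<in>P. \<eta> y * cnj (\<zeta> y))"
      by (rule sum_distrib_left[symmetric])
    then show "(\<Sum>y\<in>P. of_real (t \<eta> * t \<zeta>) * (\<eta> y * cnj (\<zeta> y))) = (if \<zeta> = \<eta> then of_real (t \<eta> * t \<zeta>) * of_nat (card P) else 0)"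
      using lin_orthonormal[OF P] e by (auto simp: L_def)
  qed
  also have "\<dots> = (\<Sum>\<eta>\<in>L. of_real (t \<eta> * t \<eta>) * of_nat (card P))" using fL by simp
  also have "\<dots> = of_real (card P * D)" by (simp add: D_def sum_distrib_left power2_eq_square mult_ac)
  finally have "complex_of_real (\<Sum>y\<in>P. (cmod (h y))\<^sup>2) = of_real (card P * D)"
    unfolding of_real_sum complex_norm_square .
  then have hh: "(\<Sum>y\<in>P. (cmod (h y))\<^sup>2) = card P * D" using of_real_eq_iff by blast
  have hh': "(\<Sum>y\<in>P - {\<one>}. (cmod (h y))\<^sup>2) = card P * D"
    using sum.remove[OF fP oneP, of "\<lambda>y. (cmod (h y))\<^sup>2"] hh h1 by simp
  have hx': "(\<Sum>y\<in>P - {\<one>}. h y * cnj (\<chi> y)) = of_real (card P * D)"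
    using sum.remove[OF fP oneP, of "\<lambda>y. h y * cnj (\<chi> y)"] hx h1 by simp
  have "card P * D = cmod (\<Sum>y\<in>P - {\<one>}. h y * cnj (\<chi> y))" unfolding hx' norm_of_real using D0 by simp
  also have "\<dots> \<le> (\<Sum>y\<in>P - {\<one>}. cmod (h y) * cmod (\<chi> y))"
    by (rule order.trans[OF norm_sum]) (simp add: norm_mult)
  finally have le: "card P * D \<le> (\<Sum>y\<in>P - {\<one>}. cmod (h y) * cmod (\<chi> y))" .
  have "(card P * D)\<^sup>2 \<le> (\<Sum>y\<in>P - {\<one>}. cmod (h y) * cmod (\<chi> y))\<^sup>2" using le D0 by (intro power_mono) auto
  also have "\<dots> \<le> (card P * D) * S"
    using Cauchy_Schwarz_sum[of "\<lambda>y. cmod (h y)" "\<lambda>y. cmod (\<chi> y)" "P - {\<one>}"] unfolding hh' S_def .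
  finally have sq: "(card P * D) * (card P * D) \<le> (card P * D) * S" by (simp add: power2_eq_square)
  have S0: "S \<ge> 0" by (simp add: S_def sum_nonneg)
  have "card P * D \<le> S"
  proof (cases "D = 0")
    case False
    then have "0 < card P * D" using D0 cP by simp
    then show ?thesis using sq by (simp only: mult_le_cancel_left_pos)
  qed (use S0 in simp)
  then show ?thesis unfolding D S_def L_def .
qed

end

text \<open>In the induction of \<open>odd_pog_normal_pgroup\<close> a nontrivial linear character
  leads to its kernel, a smaller group; \<open>perfect\<close> describes the remaining case.\<close>

locale pog_min = pog +
  assumes odd_order: "odd (card (carrier G))"
    and perfect: "mult_char l \<Longrightarrow> x \<in> carrier G \<Longrightarrow> l x = 1"
begin

definition qi :: "'a set \<Rightarrow> nat" where
  "qi P = card (nrm P) div card P"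

text \<open>If P were its own normaliser, \<open>complement_linear_character\<close> would
  contradict \<open>perfect\<close>; so \<open>syl_normalizer\<close> leaves a prime index.\<close>

lemma syl_index:
  assumes S: "syl p P"
  shows "card (nrm P) = card P * qi P" "Factorial_Ring.prime (qi P)" "qi P \<noteq> p" "odd (qi P)"
proof -
  note P = sylD(3)[OF S]
  have "nrm P \<noteq> P"
  proof
    assume N: "nrm P = P"
    obtain a where a: "card P = p ^ a" using sylD(4)[OF S] by blast
    obtain l y where "mult_char l" "y \<in> P" "l y \<noteq> 1"
      using complement_linear_character[OF sylD(1)[OF S] P a sylD(5)[OF S] sylD(6)[OF S] syl_TI[OF S] N] by metis
    then show False using perfect sylD(7)[OF S] by blast
  qed
  then have "card (nrm P) \<noteq> card P"
    using nrm_subgroup[OF P] subgroup_finite card_subset_eq by metis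
  then obtain r where r: "Factorial_Ring.prime r" "r \<noteq> p" "card (nrm P) = card P * r" using syl_normalizer(2)[OF S] by blast
  then have q: "qi P = r" using subgroup_card_pos[OF P] by (simp add: qi_def)
  have "r dvd card (carrier G)" using r(3) subgroup_card_dvd[OF nrm_subgroup(1)[OF P]] dvd_mult_right by metis
  then have "odd r" using odd_order dvd_trans by blast
  then show "card (nrm P) = card P * qi P" "Factorial_Ring.prime (qi P)" "qi P \<noteq> p" "odd (qi P)" using q r by auto
qed

lemma odd_square_mem:
  assumes "subgroup H G" "x \<in> carrier G" "x \<otimes> x \<in> H"
  shows "x \<in> H"
  using subgroup_pow_closed[OF assms(1,3)] square_root[OF odd_order assms(2)] by metis

lemma cj_fixed_triv:
  assumes P: "subgroup P G" and th: "\<theta> \<in> lin P" "cj \<theta> = \<theta>"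
  shows "\<theta> = triv_on P"
proof -
  have "\<theta> y = 1" if y: "y \<in> P" for y
  proof -
    have "\<theta> y * cnj (\<theta> y) = 1" using th(1) y by (simp add: lin_def complex_norm_square[symmetric])
    moreover have "cnj (\<theta> y) = \<theta> y" using fun_cong[OF th(2), of y] by (simp add: cj_def)
    ultimately have "\<theta> (y \<otimes> y) = 1" using th(1) y by (simp add: lin_def)
    then have "\<theta> ((y \<otimes> y) [^] ((card (carrier G) + 1) div 2)) = 1"
      using lin_pow[OF P th(1) subgroup.m_closed[OF P y y]] by simp
    then show ?thesis using square_root[OF odd_order subgroup_inG[OF P y]] by simp
  qed
  then show ?thesis using th(1) by (auto simp: lin_def triv_on_def)
qed

definition linn :: "'a set \<Rightarrow> ('a \<Rightarrow> complex) set" where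
  "linn P = lin P - {triv_on P}"

lemma linnD: "\<theta> \<in> linn P \<Longrightarrow> \<theta> \<in> lin P" "\<theta> \<in> linn P \<Longrightarrow> \<theta> \<noteq> triv_on P"
  by (auto simp: linn_def)

lemma cj_linn: "\<theta> \<in> linn P \<Longrightarrow> cj \<theta> \<in> linn P"
  using cj_lin cj_triv_on cj_cj by (metis Diff_iff linn_def singletonD singletonI)

text \<open>If n takes \<theta> to its conjugate, the square of n fixes \<theta> and lies in P. In
  odd order n itself then lies in P and fixes \<theta>, which would be real.\<close>

lemma sN_cj_zero:
  assumes S: "syl p P" and th: "\<theta> \<in> linn P"
  shows "sN P (cj \<theta>) \<theta> = 0" "sN P \<theta> (cj \<theta>) = 0"
proof -
  note P = sylD(3)[OF S]
  have *: "sN P (cj \<theta>) \<theta> = 0" if th: "\<theta> \<in> linn P" for \<theta>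
  proof (rule ccontr)
    assume "sN P (cj \<theta>) \<theta> \<noteq> 0"
    then obtain n where n: "n \<in> nrm P" "tw P n \<theta> = cj \<theta>" using sN_pos[of P "cj \<theta>" \<theta>] by blast
    have nG: "n \<in> carrier G" using nrmD(2) n by blast
    have nn: "n \<otimes> n \<in> nrm P" using subgroup.m_closed[OF nrm_subgroup(1)[OF P]] n by blast
    have "tw P (n \<otimes> n) \<theta> = \<theta>" using tw_tw[OF P n(1) n(1), of \<theta>] n(2) by (simp add: tw_cj)
    then have "n \<otimes> n \<in> P" using tw_fixed[OF S nn] linnD[OF th] by blast
    then have "n \<in> P" using odd_square_mem[OF P nG] by blast
    then have "cj \<theta> = \<theta>" using lin_class[OF P linnD(1)[OF th]] n by simp
    then show False using cj_fixed_triv[OF P] linnD[OF th] by blast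
  qed
  show "sN P (cj \<theta>) \<theta> = 0" by (rule *[OF th])
  show "sN P \<theta> (cj \<theta>) = 0" using *[OF cj_linn[OF th]] by simp
qed

text \<open>The coefficients at chi of the generalised characters induced from theta - cj theta, which has norm 2
  and therefore equals X - cj X for an irreducible X = Xc P theta, and from 1 - theta, which has norm
  qi P + 1.\<close>

definition ff :: "'a set \<Rightarrow> ('a \<Rightarrow> complex) \<Rightarrow> ('a \<Rightarrow> complex) \<Rightarrow> int" where
  "ff P \<theta> \<chi> = int (mu P \<theta> \<chi>) - int (mu P (cj \<theta>) \<chi>)"

definition dd :: "'a set \<Rightarrow> ('a \<Rightarrow> complex) \<Rightarrow> ('a \<Rightarrow> complex) \<Rightarrow> int" where
  "dd P \<theta> \<chi> = int (mu P (triv_on P) \<chi>) - int (mu P \<theta> \<chi>)"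

lemma mu_cj': "subgroup P G \<Longrightarrow> \<theta> \<in> lin P \<Longrightarrow> \<chi> \<in> irr \<Longrightarrow> mu P \<theta> (cj \<chi>) = mu P (cj \<theta>) \<chi>"
  using mu_cj[OF _ cj_lin, of P \<theta> \<chi>] by simp

lemma ff_cj: "subgroup P G \<Longrightarrow> \<theta> \<in> lin P \<Longrightarrow> \<chi> \<in> irr \<Longrightarrow> ff P \<theta> (cj \<chi>) = - ff P \<theta> \<chi>"
  using mu_cj'[of P \<theta> \<chi>] mu_cj'[of P "cj \<theta>" \<chi>] cj_lin[of \<theta> P] by (simp add: ff_def)

lemma dd_cj: "subgroup P G \<Longrightarrow> \<theta> \<in> lin P \<Longrightarrow> \<chi> \<in> irr \<Longrightarrow> dd P \<theta> (cj \<chi>) = dd P \<theta> \<chi> + ff P \<theta> \<chi>"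
  using mu_cj'[of P \<theta> \<chi>] mu_cj'[of P "triv_on P" \<chi>] triv_on_lin[of P] by (simp add: ff_def dd_def)

lemma ff_norm:
  assumes S: "syl p P" and th: "\<theta> \<in> linn P"
  shows "(\<Sum>\<chi>\<in>irr. ff P \<theta> \<chi> * ff P \<theta> \<chi>) = 2"
proof -
  note P = sylD(3)[OF S] and l = linnD(1)[OF th] and lc = linnD(1)[OF cj_linn[OF th]]
  have "(\<Sum>\<chi>\<in>irr. ff P \<theta> \<chi> * ff P \<theta> \<chi>) * int (card P) = 2 * int (card P)"
    unfolding ff_def using mu_inner_TI[OF P syl_TI[OF S] l lc l lc]
      sN_self[OF S] linnD[OF th] linnD[OF cj_linn[OF th]] sN_cj_zero[OF S th] by simp
  then show ?thesis using subgroup_card_pos[OF P] by simp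
qed

text \<open>\<open>ff P \<theta>\<close> is odd under conjugation and its squares sum to 2, which
  leaves one conjugate pair with values 1 and -1.\<close>

lemma exceptional_exists:
  assumes S: "syl p P" and th: "\<theta> \<in> linn P"
  shows "\<exists>X0. X0 \<in> irr \<and> ff P \<theta> X0 = 1 \<and> ff P \<theta> (cj X0) = -1 \<and> cj X0 \<noteq> X0 \<and>
    (\<forall>\<chi>\<in>irr. \<chi> \<noteq> X0 \<longrightarrow> \<chi> \<noteq> cj X0 \<longrightarrow> ff P \<theta> \<chi> = 0)"
proof -
  note P = sylD(3)[OF S] and l = linnD(1)[OF th] and nrm2 = ff_norm[OF S th]
  note fc = ff_cj[OF P l]
  have "\<exists>c\<in>irr. ff P \<theta> c \<noteq> 0"
  proof (rule ccontr)
    assume "\<not> ?thesis"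
    then have "(\<Sum>\<chi>\<in>irr. ff P \<theta> \<chi> * ff P \<theta> \<chi>) = 0" by simp
    then show False using nrm2 by simp
  qed
  then obtain c where c: "c \<in> irr" "ff P \<theta> c \<noteq> 0" by blast
  have cc: "cj c \<in> irr" "cj c \<noteq> c" using cj_irr c fc[OF c(1)] by auto
  have s: "ff P \<theta> c * ff P \<theta> c + ff P \<theta> (cj c) * ff P \<theta> (cj c) + (\<Sum>\<chi>\<in>irr - {c, cj c}. ff P \<theta> \<chi> * ff P \<theta> \<chi>) = 2"
    using sum_remove_two[OF finite_irr c(1) cc(1), of "\<lambda>\<chi>. ff P \<theta> \<chi> * ff P \<theta> \<chi>"] cc(2) nrm2 by simp
  have nn: "(\<Sum>\<chi>\<in>irr - {c, cj c}. ff P \<theta> \<chi> * ff P \<theta> \<chi>) \<ge> 0" by (intro sum_nonneg) simp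
  have one: "ff P \<theta> c * ff P \<theta> c \<ge> 1" using int_square_ge_1[OF c(2)] .
  have ec: "ff P \<theta> (cj c) * ff P \<theta> (cj c) = ff P \<theta> c * ff P \<theta> c" using fc[OF c(1)] by simp
  have 1: "ff P \<theta> c * ff P \<theta> c = 1" and 0: "(\<Sum>\<chi>\<in>irr - {c, cj c}. ff P \<theta> \<chi> * ff P \<theta> \<chi>) = 0"
    using s nn one ec by linarith+
  have rest: "ff P \<theta> \<chi> = 0" if "\<chi> \<in> irr - {c, cj c}" for \<chi>
    using 0 that finite_irr sum_nonneg_eq_0_iff[of "irr - {c, cj c}" "\<lambda>\<chi>. ff P \<theta> \<chi> * ff P \<theta> \<chi>"] by auto
  consider "ff P \<theta> c = 1" | "ff P \<theta> c = -1" using 1 by (metis zmult_eq_1_iff)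
  then show ?thesis
  proof cases
    case 1
    then show ?thesis using c cc fc[OF c(1)] rest by (intro exI[of _ c]) auto
  next
    case 2
    then show ?thesis using c cc fc[OF c(1)] rest by (intro exI[of _ "cj c"]) auto
  qed
qed

definition Xc :: "'a set \<Rightarrow> ('a \<Rightarrow> complex) \<Rightarrow> 'a \<Rightarrow> complex" where
  "Xc P \<theta> = (SOME X0. X0 \<in> irr \<and> ff P \<theta> X0 = 1 \<and> ff P \<theta> (cj X0) = -1 \<and> cj X0 \<noteq> X0 \<and>
    (\<forall>\<chi>\<in>irr. \<chi> \<noteq> X0 \<longrightarrow> \<chi> \<noteq> cj X0 \<longrightarrow> ff P \<theta> \<chi> = 0))"

lemma XcD:
  assumes S: "syl p P" and th: "\<theta> \<in> linn P"
  shows "Xc P \<theta> \<in> irr" "ff P \<theta> (Xc P \<theta>) = 1" "ff P \<theta> (cj (Xc P \<theta>)) = -1" "cj (Xc P \<theta>) \<noteq> Xc P \<theta>"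
    "\<chi> \<in> irr \<Longrightarrow> \<chi> \<noteq> Xc P \<theta> \<Longrightarrow> \<chi> \<noteq> cj (Xc P \<theta>) \<Longrightarrow> ff P \<theta> \<chi> = 0"
    "cj (Xc P \<theta>) \<in> irr" "Xc P \<theta> \<noteq> triv" "cj (Xc P \<theta>) \<noteq> triv"
proof -
  note x = someI_ex[OF exceptional_exists[OF S th], folded Xc_def]
  show 1: "Xc P \<theta> \<in> irr" "ff P \<theta> (Xc P \<theta>) = 1" "ff P \<theta> (cj (Xc P \<theta>)) = -1" "cj (Xc P \<theta>) \<noteq> Xc P \<theta>"
    "\<chi> \<in> irr \<Longrightarrow> \<chi> \<noteq> Xc P \<theta> \<Longrightarrow> \<chi> \<noteq> cj (Xc P \<theta>) \<Longrightarrow> ff P \<theta> \<chi> = 0"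
    using x by blast+
  show "cj (Xc P \<theta>) \<in> irr" using cj_irr 1 by blast
  have "cj triv = triv" by (auto simp: cj_def triv_def)
  then show "Xc P \<theta> \<noteq> triv" "cj (Xc P \<theta>) \<noteq> triv" using 1(4) by (metis cj_cj)+
qed

lemma ff_inner:
  assumes S: "syl p P" and th: "\<theta> \<in> linn P"
  shows "(\<Sum>\<chi>\<in>irr. ff P \<theta> \<chi> * h \<chi>) = h (Xc P \<theta>) - h (cj (Xc P \<theta>))"
proof -
  note X = XcD[OF S th]
  have "(\<Sum>\<chi>\<in>irr - {Xc P \<theta>, cj (Xc P \<theta>)}. ff P \<theta> \<chi> * h \<chi>) = 0"
    by (rule sum.neutral) (use X(5) in auto)
  then show ?thesis
    using sum_remove_two[OF finite_irr X(1,6), of "\<lambda>\<chi>. ff P \<theta> \<chi> * h \<chi>"] X by simp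
qed

lemma syl_disjoint:
  assumes S: "syl p P" "syl p' P'" "p \<noteq> p'" and g: "g \<in> carrier G" "y \<in> P" "y \<noteq> \<one>"
  shows "cg g y \<notin> P'"
proof
  assume c: "cg g y \<in> P'"
  have yG: "y \<in> carrier G" using sylD(7)[OF S(1)] g by blast
  have "cg g y [^] p = \<one>" using sylD(6)[OF S(1) g(2)] g yG cg_pow[of g y p] by simp
  then have "cg g y = \<one>"
    using pow_distinct_primes[of "cg g y" p p'] sylD(6)[OF S(2) c] sylD(1)[OF S(1)] sylD(1)[OF S(2)] S(3) g yG by auto
  then show False using g yG by simp
qed

text \<open>Orthogonality of the two virtual characters makes \<open>ff P' \<eta>\<close> agree at
  the conjugate pair, while oddness makes the two values opposite.\<close>

lemma ff_other:
  assumes S: "syl p P" "syl p' P'" "p \<noteq> p'" and th: "\<theta> \<in> linn P" and et: "\<eta> \<in> linn P'"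
  shows "ff P' \<eta> (Xc P \<theta>) = 0" "ff P' \<eta> (cj (Xc P \<theta>)) = 0"
proof -
  have "(\<Sum>\<chi>\<in>irr. ff P \<theta> \<chi> * ff P' \<eta> \<chi>) = 0"
    unfolding ff_def
    by (rule mu_inner_disjoint) (use S sylD(3) linnD(1) cj_linn th et syl_disjoint in auto)
  then have "ff P' \<eta> (Xc P \<theta>) = ff P' \<eta> (cj (Xc P \<theta>))" using ff_inner[OF S(1) th] by simp
  moreover have "ff P' \<eta> (cj (Xc P \<theta>)) = - ff P' \<eta> (Xc P \<theta>)"
    by (rule ff_cj) (use S sylD(3) linnD(1) et XcD[OF S(1) th] in auto)
  ultimately show "ff P' \<eta> (Xc P \<theta>) = 0" "ff P' \<eta> (cj (Xc P \<theta>)) = 0" by simp_all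
qed

lemma Xc_distinct:
  assumes S: "syl p P" "syl p' P'" "p \<noteq> p'" and th: "\<theta> \<in> linn P" and et: "\<eta> \<in> linn P'"
  shows "Xc P \<theta> \<noteq> Xc P' \<eta>" "Xc P \<theta> \<noteq> cj (Xc P' \<eta>)" "cj (Xc P \<theta>) \<noteq> Xc P' \<eta>" "cj (Xc P \<theta>) \<noteq> cj (Xc P' \<eta>)"
  using ff_other[OF assms] XcD(2,3)[OF S(2) et] by (metis zero_neq_one, metis zero_neq_neg_one, metis zero_neq_one, metis zero_neq_neg_one)

text \<open>If the two values differed, the difference g of the induced characters would be nonzero
  and equal at the exceptional pair of P', which already accounts for norm 2, the largest possible.
  Then g would vanish at the exceptional pair of \<theta>, although its inner product with
  \<open>ff P \<theta>\<close> is at least 1.\<close>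

lemma dd_other_const:
  assumes S: "syl p P" "syl p' P'" "p \<noteq> p'" and th: "\<theta> \<in> linn P" "\<theta>' \<in> linn P" and et: "\<eta> \<in> linn P'"
  shows "dd P \<theta> (Xc P' \<eta>) = dd P \<theta>' (Xc P' \<eta>)"
proof (rule ccontr)
  note P = sylD(3)[OF S(1)] and TI = syl_TI[OF S(1)]
  note l = linnD(1)[OF th(1)] linnD(1)[OF th(2)] linnD(1)[OF cj_linn[OF th(1)]]
  define g where "g \<chi> = int (mu P \<theta> \<chi>) - int (mu P \<theta>' \<chi>)" for \<chi>
  let ?X = "Xc P' \<eta>" and ?Y = "Xc P \<theta>"
  note X = XcD[OF S(2) et] and Y = XcD[OF S(1) th(1)]
  assume "dd P \<theta> ?X \<noteq> dd P \<theta>' ?X"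
  then have gX: "g ?X \<noteq> 0" by (simp add: g_def dd_def)
  have "(\<Sum>\<chi>\<in>irr. ff P' \<eta> \<chi> * g \<chi>) = 0"
    unfolding ff_def g_def
    by (rule mu_inner_disjoint) (use S sylD(3) linnD(1) cj_linn l et syl_disjoint in auto)
  then have gc: "g (cj ?X) = g ?X" using ff_inner[OF S(2) et] by simp
  have cP: "int (card P) > 0" using subgroup_card_pos[OF P] by simp
  have norm: "(\<Sum>\<chi>\<in>irr. g \<chi> * g \<chi>) * int (card P) = 2 * int (card P) - int (sN P \<theta> \<theta>') - int (sN P \<theta>' \<theta>)"
    unfolding g_def using mu_inner_TI[OF P TI l(1,2,1,2)] sN_self[OF S(1)] linnD[OF th(1)] linnD[OF th(2)] by simp
  have split: "(\<Sum>\<chi>\<in>irr. g \<chi> * g \<chi>) = g ?X * g ?X + g (cj ?X) * g (cj ?X) + (\<Sum>\<chi>\<in>irr - {?X, cj ?X}. g \<chi> * g \<chi>)"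
    by (rule sum_remove_two) (use X finite_irr in auto)
  have nn: "(\<Sum>\<chi>\<in>irr - {?X, cj ?X}. g \<chi> * g \<chi>) \<ge> 0" by (intro sum_nonneg) simp
  have gX1: "g ?X * g ?X \<ge> 1" using int_square_ge_1[OF gX] .
  have ge2: "(\<Sum>\<chi>\<in>irr. g \<chi> * g \<chi>) \<ge> 2" using split nn gX1 gc by simp
  have "(\<Sum>\<chi>\<in>irr. g \<chi> * g \<chi>) * int (card P) \<ge> 2 * int (card P)" using ge2 cP by (intro mult_right_mono) auto
  then have s0: "sN P \<theta>' \<theta> = 0" "sN P \<theta> \<theta>' = 0" using norm by linarith+
  then have "(\<Sum>\<chi>\<in>irr. g \<chi> * g \<chi>) = 2" using norm cP by simp
  then have z: "(\<Sum>\<chi>\<in>irr - {?X, cj ?X}. g \<chi> * g \<chi>) = 0" using split gX1 gc nn by simp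
  have rest: "g \<chi> = 0" if "\<chi> \<in> irr - {?X, cj ?X}" for \<chi>
    using z that finite_irr sum_nonneg_eq_0_iff[of "irr - {?X, cj ?X}" "\<lambda>\<chi>. g \<chi> * g \<chi>"] by auto
  have "g ?Y = 0" "g (cj ?Y) = 0"
    using rest Y(1,6) Xc_distinct[OF S(1,2,3) th(1) et] by auto
  then have "(\<Sum>\<chi>\<in>irr. ff P \<theta> \<chi> * g \<chi>) = 0" using ff_inner[OF S(1) th(1)] by simp
  moreover have "(\<Sum>\<chi>\<in>irr. ff P \<theta> \<chi> * g \<chi>) * int (card P) =
      int (sN P \<theta> \<theta>) - int (sN P \<theta> \<theta>') - int (sN P (cj \<theta>) \<theta>) + int (sN P (cj \<theta>) \<theta>')"
    unfolding ff_def g_def by (rule mu_inner_TI[OF P TI l(1,3,1,2)])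
  ultimately have "int (card P) + int (sN P (cj \<theta>) \<theta>') = 0"
    using s0 sN_self[OF S(1) linnD[OF th(1)]] sN_cj_zero[OF S(1) th(1)] by simp
  then show False using cP by simp
qed

lemma dd_triv: "syl p P \<Longrightarrow> \<theta> \<in> linn P \<Longrightarrow> dd P \<theta> triv = 1"
  using triv_mult[OF sylD(3), of p P] triv_on_lin[OF sylD(3), of p P] linnD[of \<theta> P] by (simp add: dd_def)

text \<open>The character induced from 1 - theta is orthogonal to X' - cj X', so its coefficients pair off under
  complex conjugation up to the contributions of the two exceptional characters and of 1.\<close>

lemma parity:
  assumes S: "syl p P" "syl p' P'" "p \<noteq> p'" and th: "\<theta> \<in> linn P" and et: "\<eta> \<in> linn P'"
  shows "odd (dd P \<theta> (Xc P' \<eta>) + dd P' \<eta> (Xc P \<theta>))"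
proof -
  let ?X = "Xc P \<theta>" and ?Y = "Xc P' \<eta>"
  note X = XcD[OF S(1) th] and Y = XcD[OF S(2) et] and dist = Xc_distinct[OF S th et]
  note P = sylD(3)[OF S(1)] and P' = sylD(3)[OF S(2)] and lt = linnD(1)[OF th] and le = linnD(1)[OF et]
  define h where "h \<chi> = dd P \<theta> \<chi> * dd P' \<eta> \<chi>" for \<chi>
  have "(\<Sum>\<chi>\<in>irr. h \<chi>) = 0"
    unfolding h_def dd_def
    by (rule mu_inner_disjoint) (use P P' lt le triv_on_lin syl_disjoint[OF S] in auto)
  moreover have "(\<Sum>\<chi>\<in>irr. h \<chi>) = h triv + (\<Sum>\<chi>\<in>irr - {triv}. h \<chi>)"
    by (rule sum.remove[OF finite_irr triv_irr])
  moreover have "(\<Sum>\<chi>\<in>irr - {triv}. h \<chi>) = h ?X + h (cj ?X) + (\<Sum>\<chi>\<in>irr - {triv} - {?X, cj ?X}. h \<chi>)"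
    by (rule sum_remove_two) (use X finite_irr in auto)
  moreover have "(\<Sum>\<chi>\<in>irr - {triv} - {?X, cj ?X}. h \<chi>) = h ?Y + h (cj ?Y) + (\<Sum>\<chi>\<in>irr - {triv} - {?X, cj ?X} - {?Y, cj ?Y}. h \<chi>)"
    by (rule sum_remove_two) (use Y dist finite_irr in auto)
  moreover have "even (\<Sum>\<chi>\<in>irr - {triv} - {?X, cj ?X} - {?Y, cj ?Y}. h \<chi>)"
  proof (rule even_sum_involution[where i = cj])
    fix \<chi> assume c: "\<chi> \<in> irr - {triv} - {?X, cj ?X} - {?Y, cj ?Y}"
    then have ci: "\<chi> \<in> irr" by simp
    have ct: "cj triv = triv" by (auto simp: cj_def triv_def)
    have "cj \<chi> \<in> irr" using cj_irr ci by blast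
    moreover have "cj \<chi> \<noteq> triv" "cj \<chi> \<noteq> ?X" "cj \<chi> \<noteq> cj ?X" "cj \<chi> \<noteq> ?Y" "cj \<chi> \<noteq> cj ?Y"
      using c ct cj_cj by (metis DiffE insertI1, metis DiffE insertI1 insertI2, metis DiffE insertI1 insertI2, metis DiffE insertI1 insertI2, metis DiffE insertI1 insertI2)
    ultimately show "cj \<chi> \<in> irr - {triv} - {?X, cj ?X} - {?Y, cj ?Y}" by simp
    \<comment> \<open>Odd order enters here: conjugation moves every nontrivial irreducible
      character.\<close>
    show "cj \<chi> \<noteq> \<chi>" using real_irr_trivial[OF odd_order ci] c by blast
    show "h (cj \<chi>) = h \<chi>"
      using dd_cj[OF P lt ci] dd_cj[OF P' le ci] X(5)[OF ci] Y(5)[OF ci] c by (simp add: h_def)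
  qed (use finite_irr in auto)
  moreover have "h triv = 1" using dd_triv[OF S(1) th] dd_triv[OF S(2) et] by (simp add: h_def)
  \<comment> \<open>On this pair the coefficient for P changes by 1 under conjugation and that for
    P' does not change, so the pair contributes an odd multiple of the latter.\<close>
  moreover have "h ?X + h (cj ?X) = dd P' \<eta> ?X * (2 * dd P \<theta> ?X + 1)"
    using dd_cj[OF P lt X(1)] dd_cj[OF P' le X(1)] X(2) ff_other(1)[OF S th et] by (simp add: h_def algebra_simps)
  moreover have "h ?Y + h (cj ?Y) = dd P \<theta> ?Y * (2 * dd P' \<eta> ?Y + 1)"
    using dd_cj[OF P lt Y(1)] dd_cj[OF P' le Y(1)] Y(2) ff_other(1)[OF S(2,1) S(3)[symmetric] et th] by (simp add: h_def algebra_simps)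
  ultimately have "even (1 + dd P' \<eta> ?X * (2 * dd P \<theta> ?X + 1) + dd P \<theta> ?Y * (2 * dd P' \<eta> ?Y + 1))"
    by (smt (verit) dvd_0_right even_add)
  then show ?thesis by simp
qed

lemma dd_norm:
  assumes S: "syl p P" and th: "\<theta> \<in> linn P"
  shows "(\<Sum>\<chi>\<in>irr - {triv}. dd P \<theta> \<chi> * dd P \<theta> \<chi>) = int (qi P)"
proof -
  note P = sylD(3)[OF S] and l = linnD[OF th]
  have cP: "int (card P) > 0" using subgroup_card_pos[OF P] by simp
  have "(\<Sum>\<chi>\<in>irr. dd P \<theta> \<chi> * dd P \<theta> \<chi>) * int (card P) = int (card P) * (int (qi P) + 1)"
    unfolding dd_def using mu_inner_TI[OF P syl_TI[OF S] triv_on_lin[OF P] l(1) triv_on_lin[OF P] l(1)]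
      sN_self[OF S l] sN_triv[OF S l] syl_index(1)[OF S] by (simp add: algebra_simps)
  then have "(\<Sum>\<chi>\<in>irr. dd P \<theta> \<chi> * dd P \<theta> \<chi>) = int (qi P) + 1" using cP by simp
  then show ?thesis using sum.remove[OF finite_irr triv_irr, of "\<lambda>\<chi>. dd P \<theta> \<chi> * dd P \<theta> \<chi>"] dd_triv[OF S th] by simp
qed

lemma card_orbit:
  assumes S: "syl p P" and th: "\<theta> \<in> linn P"
  shows "card ((\<lambda>n. tw P n \<theta>) ` nrm P) = qi P"
proof -
  note P = sylD(3)[OF S]
  have "card (nrm P) = card P * card ((\<lambda>n. tw P n \<theta>) ` nrm P)"
  proof (rule card_fibres)
    show "finite (nrm P)" using subgroup_finite nrm_subgroup(1)[OF P] by blast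
    fix b assume "b \<in> (\<lambda>n. tw P n \<theta>) ` nrm P"
    then show "card {a \<in> nrm P. tw P a \<theta> = b} = card P"
      using sN_value[OF S linnD[OF th]] by (auto simp: sN_def)
  qed
  then show ?thesis using syl_index(1)[OF S] subgroup_card_pos[OF P] by simp
qed

text \<open>If two linear characters share their exceptional character, their virtual characters
  have inner product 2, and \<open>mu_inner_TI\<close> forces them to be conjugate under
  \<open>nrm P\<close>. So the fibres of \<open>Xc P\<close> lie in orbits of size
  \<open>qi P\<close>.\<close>

lemma card_Xc:
  assumes S: "syl p P"
  shows "card (linn P) \<le> qi P * card (Xc P ` linn P)"
proof (rule card_fibres_le)
  note P = sylD(3)[OF S]
  show "finite (linn P)" using lin_finite[OF P] by (simp add: linn_def)
  fix b assume "b \<in> Xc P ` linn P"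
  then obtain t0 where t0: "t0 \<in> linn P" "b = Xc P t0" by blast
  have "{a \<in> linn P. Xc P a = b} \<subseteq> (\<lambda>n. tw P n t0) ` nrm P"
  proof
    fix a assume a: "a \<in> {a \<in> linn P. Xc P a = b}"
    then have al: "a \<in> linn P" and e: "Xc P a = Xc P t0" using t0 by auto
    have "(\<Sum>\<chi>\<in>irr. ff P a \<chi> * ff P t0 \<chi>) = 2"
      using ff_inner[OF S al, of "ff P t0"] XcD(2,3)[OF S t0(1)] e by simp
    moreover have "(\<Sum>\<chi>\<in>irr. ff P a \<chi> * ff P t0 \<chi>) * int (card P) =
      int (sN P a t0) - int (sN P a (cj t0)) - int (sN P (cj a) t0) + int (sN P (cj a) (cj t0))"
      unfolding ff_def by (rule mu_inner_TI[OF P syl_TI[OF S]]) (use al t0 linnD cj_linn in auto)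
    ultimately have "2 * int (card P) = int (sN P a t0) - int (sN P a (cj t0)) - int (sN P (cj a) t0) + int (sN P (cj a) (cj t0))"
      by simp
    then have "sN P a t0 > 0" using subgroup_card_pos[OF P] sN_cj[of P a t0] by linarith
    then show "a \<in> (\<lambda>n. tw P n t0) ` nrm P" using sN_pos by blast
  qed
  then have "card {a \<in> linn P. Xc P a = b} \<le> card ((\<lambda>n. tw P n t0) ` nrm P)"
    using subgroup_finite nrm_subgroup(1)[OF P] by (intro card_mono) auto
  then show "card {a \<in> linn P. Xc P a = b} \<le> qi P" using card_orbit[OF S t0(1)] by simp
qed

text \<open>An element of order q in \<open>nrm P\<close> fixes only the trivial linear character by
  \<open>tw_fixed\<close>, so q divides the number of the others. That number is also even, because
  \<open>card (lin P)\<close> is a power of the odd prime p.\<close>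

lemma lin_card_cong:
  assumes S: "syl p P"
  shows "\<exists>k. card (lin P) = p ^ k" "card (lin P) > 1" "2 * qi P dvd card (lin P) - 1" "card (linn P) = card (lin P) - 1"
proof -
  note P = sylD(3)[OF S]
  show k: "\<exists>k. card (lin P) = p ^ k" using card_lin_power[OF sylD(1)[OF S] P] sylD(6)[OF S] by blast
  have fL: "finite (lin P)" using lin_finite[OF P] .
  have tl: "triv_on P \<in> lin P" using triv_on_lin[OF P] .
  obtain a where a: "card P = p ^ a" using sylD(4)[OF S] by blast
  obtain \<theta> where "\<theta> \<in> lin P" "\<theta> \<noteq> triv_on P"
    using nontrivial_lin_exists[OF sylD(1)[OF S] P a sylD(5)[OF S] sylD(6)[OF S]] by blast
  then have "card {triv_on P, \<theta>} = 2" "card {triv_on P, \<theta>} \<le> card (lin P)"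
    using card_mono[OF fL, of "{triv_on P, \<theta>}"] tl by auto
  then show c1: "card (lin P) > 1" by linarith
  show "card (linn P) = card (lin P) - 1" using fL tl by (simp add: linn_def)
  have "odd p" using sylD(2)[OF S] odd_order dvd_trans by blast
  then have "odd (card (lin P))" using k by auto
  then have e2: "2 dvd card (lin P) - 1" by simp
  define q where "q = qi P"
  have q: "Factorial_Ring.prime q" "q \<noteq> p" "odd q" using syl_index[OF S] by (auto simp: q_def)
  note N = nrm_subgroup(1)[OF P]
  obtain n where n: "n \<in> nrm P" "n \<noteq> \<one>" "n [^] q = \<one>" using cauchy[OF N q(1)] syl_index(1)[OF S] by (auto simp: q_def)
  have nG: "n \<in> carrier G" using nrmD(2) n by blast
  have nP: "n \<notin> P" using pow_distinct_primes[OF nG n(3) _ q(1) sylD(1)[OF S] q(2)] sylD(6)[OF S] n(2) by blast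
  note c = cyc_prime[OF nG n(2,3) q(1)]
  have cN: "x \<in> nrm P" if "x \<in> cyc n" for x using that cyc_sub[OF N n(1)] by blast
  have iN: "inv x \<in> nrm P" if "x \<in> cyc n" for x using subgroup.m_inv_closed[OF N cN[OF that]] .
  have "card (lin P) mod q = card {v \<in> lin P. \<forall>x\<in>cyc n. tw P (inv x) v = v} mod q"
  proof (rule fixed_points_mod[OF c(1) _ q(1) fL])
    show "card (cyc n) = q ^ 1" using c by simp
    show "tw P (inv x) v \<in> lin P" if "x \<in> cyc n" "v \<in> lin P" for x v using tw_lin[OF P iN] that by blast
    show "tw P (inv \<one>) v = v" if "v \<in> lin P" for v using tw_one[OF P that] by simp
    show "tw P (inv (x \<otimes> y)) v = tw P (inv x) (tw P (inv y) v)" if xy: "x \<in> cyc n" "y \<in> cyc n" "v \<in> lin P" for x y v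
      using tw_tw[OF P iN[OF xy(1)] iN[OF xy(2)], of v] subgroup_inG[OF c(1)] xy by (simp add: inv_mult_group)
  qed
  moreover have "{v \<in> lin P. \<forall>x\<in>cyc n. tw P (inv x) v = v} = {triv_on P}"
  proof
    show "{triv_on P} \<subseteq> {v \<in> lin P. \<forall>x\<in>cyc n. tw P (inv x) v = v}" using tl tw_triv iN by auto
    show "{v \<in> lin P. \<forall>x\<in>cyc n. tw P (inv x) v = v} \<subseteq> {triv_on P}"
    proof
      fix v assume v: "v \<in> {v \<in> lin P. \<forall>x\<in>cyc n. tw P (inv x) v = v}"
      have i: "inv n \<in> cyc n" using subgroup.m_inv_closed[OF c(1) cyc_mem[OF nG]] .
      then have "tw P (inv (inv n)) v = v" using v by blast
      then have "tw P n v = v" using nG by simp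
      then show "v \<in> {triv_on P}" using tw_fixed[OF S n(1) nP] v by blast
    qed
  qed
  ultimately have "card (lin P) mod q = 1 mod q" by simp
  then have "q dvd card (lin P) - 1" using c1 mod_eq_dvd_iff_nat[of 1 "card (lin P)" q] by linarith
  moreover have "coprime 2 q" using q by simp
  ultimately show "2 * qi P dvd card (lin P) - 1" using e2 divides_mult unfolding q_def by blast
qed

end

text \<open>A variance estimate, with equality when n vanishes off O1. On the remaining points
  Cauchy-Schwarz is combined with the bound n \<le> n^2 for integers.\<close>

lemma orbit_variance:
  fixes n :: "'x \<Rightarrow> int"
  assumes A: "finite A" "O1 \<subseteq> A" "O2 \<subseteq> A" and c: "card O1 = q" "card O2 = q"
    and n: "\<And>x. x \<in> O1 \<Longrightarrow> n x = 1" "\<And>x. x \<in> O2 \<Longrightarrow> n x = 0"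
  shows "int q * (int (card A) - int q) \<le> int (card A) * (\<Sum>x\<in>A. n x * n x) - (\<Sum>x\<in>A. n x) * (\<Sum>x\<in>A. n x)"
proof -
  define R where "R = A - O1 - O2"
  have d: "O1 \<inter> O2 = {}" using n by force
  have fs: "finite O1" "finite O2" "finite R" using A finite_subset by (auto simp: R_def)
  have split: "(\<Sum>x\<in>A. g x) = (\<Sum>x\<in>O1. g x) + (\<Sum>x\<in>O2. g x) + (\<Sum>x\<in>R. g x)" for g :: "'x \<Rightarrow> int"
  proof -
    have "A = O1 \<union> O2 \<union> R" using A by (auto simp: R_def)
    then have "(\<Sum>x\<in>A. g x) = (\<Sum>x\<in>O1 \<union> O2. g x) + (\<Sum>x\<in>R. g x)"
      using sum.union_disjoint[of "O1 \<union> O2" R g] fs by (auto simp: R_def)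
    then show ?thesis using sum.union_disjoint[of O1 O2 g] fs d by simp
  qed
  define s1 s2 where "s1 = (\<Sum>x\<in>R. n x)" and "s2 = (\<Sum>x\<in>R. n x * n x)"
  have S1: "(\<Sum>x\<in>A. n x) = int q + s1" unfolding split s1_def using n c by simp
  have S2: "(\<Sum>x\<in>A. n x * n x) = int q + s2" unfolding split s2_def using n c by simp
  have cA: "int (card A) = 2 * int q + int (card R)" using split[of "\<lambda>_. 1"] c by simp
  have "n x \<le> n x * n x" for x
    by (cases "n x \<le> 0") (auto intro: order.trans[of _ 0] simp: mult_le_cancel_left1)
  then have le: "s1 \<le> s2" by (auto simp: s1_def s2_def intro: sum_mono)
  have "(real_of_int s1)\<^sup>2 \<le> real (card R) * real_of_int s2"
    using Cauchy_Schwarz_sum[of "\<lambda>_. 1" "\<lambda>x. real_of_int (n x)" R] by (simp add: s1_def s2_def power2_eq_square)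
  then have "real_of_int (s1 * s1) \<le> real_of_int (int (card R) * s2)" by (simp add: power2_eq_square)
  then have cs: "s1 * s1 \<le> int (card R) * s2" by (simp only: of_int_le_iff)
  have "int q * s1 \<le> int q * s2" using le by (simp add: mult_left_mono)
  then show ?thesis unfolding S1 S2 cA using cs by (simp add: algebra_simps)
qed

text \<open>Here q i is the index of a Sylow subgroup in its normaliser and m i is the number of linear
  characters of that Sylow subgroup; the proof looks at the index i with q i minimal and then m i maximal.\<close>

lemma odd_order_arithmetic:
  fixes q m :: "nat \<Rightarrow> nat"
  assumes fin: "finite I"
    and q3: "\<And>i. i \<in> I \<Longrightarrow> q i \<ge> 3" "\<And>i. i \<in> I \<Longrightarrow> odd (q i)"
    and m1: "\<And>i. i \<in> I \<Longrightarrow> m i > 1" "\<And>i. i \<in> I \<Longrightarrow> 2 * q i dvd m i - 1" and inj: "inj_on m I"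
    and E1: "1 < (\<Sum>i\<in>I. 1 / real (q i))"
    and E2: "\<And>i. i \<in> I \<Longrightarrow> \<exists>J \<subseteq> I - {i}. (\<Sum>j\<in>J. (1 - 1 / real (m j)) / real (q j)) \<le> real (q i) / real (m i)
       \<and> (\<Sum>j\<in>I - {i} - J. (real (m j) - 1) / real (q j)) \<le> real (q i) - 1"
  shows False
proof -
  have "I \<noteq> {}" using E1 by auto
  then obtain i1 where i1: "i1 \<in> I" "\<And>j. j \<in> I \<Longrightarrow> q i1 \<le> q j"
    using ex_max_if_finite[OF fin, of _ "\<lambda>i. - int (q i)"] by force
  obtain i where i: "i \<in> {j \<in> I. q j = q i1}" "\<And>j. j \<in> {j \<in> I. q j = q i1} \<Longrightarrow> m j \<le> m i"
    using ex_max_if_finite[of "{j \<in> I. q j = q i1}" i1 m] fin i1 by auto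
  have iI: "i \<in> I" and qmin: "\<And>j. j \<in> I \<Longrightarrow> q i \<le> q j" and mmax: "\<And>j. j \<in> I \<Longrightarrow> q j = q i \<Longrightarrow> m j \<le> m i"
    using i i1 by auto
  define x where "x = real (q i)"
  have x3: "x \<ge> 3" using q3(1)[OF iI] by (simp add: x_def)
  have "\<forall>j\<in>I. \<exists>w. m j - 1 = 2 * q j * w" using m1(2) by (auto elim!: dvdE)
  from bchoice[OF this] obtain w where w: "\<And>j. j \<in> I \<Longrightarrow> m j - 1 = 2 * q j * w j" by auto
  have mw: "m j = 1 + 2 * q j * w j" if "j \<in> I" for j using w[OF that] m1(1)[OF that] by simp
  have w1: "w j \<ge> 1" if "j \<in> I" for j using mw[OF that] m1(1)[OF that] by (cases "w j") auto
  have m2: "m j \<ge> 2 * q j + 1" if "j \<in> I" for j using mw[OF that] w1[OF that] by simp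
  obtain J where J: "J \<subseteq> I - {i}" and SJ: "(\<Sum>j\<in>J. (1 - 1 / real (m j)) / real (q j)) \<le> x / real (m i)"
    and SK: "(\<Sum>j\<in>I - {i} - J. (real (m j) - 1) / real (q j)) \<le> x - 1"
    using E2[OF iI] unfolding x_def by blast
  define K where "K = I - {i} - J"
  have fJK: "finite J" "finite K" using fin J finite_subset by (auto simp: K_def)
  have KI: "K \<subseteq> I - {i}" by (auto simp: K_def)
  have "(\<Sum>j\<in>I. 1 / real (q j)) = 1 / x + (\<Sum>j\<in>I - {i}. 1 / real (q j))" unfolding x_def by (rule sum.remove[OF fin iI])
  also have "(\<Sum>j\<in>I - {i}. 1 / real (q j)) = (\<Sum>j\<in>K. 1 / real (q j)) + (\<Sum>j\<in>J. 1 / real (q j))"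
    unfolding K_def using J fin by (intro sum.subset_diff) auto
  finally have tot: "1 < 1 / x + (\<Sum>j\<in>J. 1 / real (q j)) + (\<Sum>j\<in>K. 1 / real (q j))" using E1 by simp
  \<comment> \<open>M is a uniform lower bound for the m j in J, chosen anew in each case; it
    controls the loss in replacing 1 - 1 / m j by 1.\<close>
  have Jb: "(\<Sum>j\<in>J. 1 / real (q j)) \<le> x / real (m i) * (M / (M - 1))"
    if M: "M > 1" "\<And>j. j \<in> J \<Longrightarrow> real (m j) \<ge> M" for M :: real
  proof -
    have "(M - 1) / M * (\<Sum>j\<in>J. 1 / real (q j)) = (\<Sum>j\<in>J. (1 - 1 / M) / real (q j))"
      using M(1) by (simp add: sum_distrib_left diff_divide_distrib)
    also have "\<dots> \<le> (\<Sum>j\<in>J. (1 - 1 / real (m j)) / real (q j))"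
    proof (rule sum_mono)
      fix j assume j: "j \<in> J"
      have "1 / real (m j) \<le> 1 / M" using M(1) M(2)[OF j] by (intro divide_left_mono) auto
      then show "(1 - 1 / M) / real (q j) \<le> (1 - 1 / real (m j)) / real (q j)" by (intro divide_right_mono) auto
    qed
    also have "\<dots> \<le> x / real (m i)" by (rule SJ)
    finally have "(M - 1) / M * (\<Sum>j\<in>J. 1 / real (q j)) \<le> x / real (m i)" .
    then have "M / (M - 1) * ((M - 1) / M * (\<Sum>j\<in>J. 1 / real (q j))) \<le> M / (M - 1) * (x / real (m i))"
      using M(1) by (intro mult_left_mono) auto
    then show ?thesis using M(1) by (simp add: mult.commute)
  qed
  \<comment> \<open>In K each summand of \<open>SK\<close> is 2 w j, at least 2, so
    \<open>SK\<close> limits the number of indices; Q is a lower bound for their q.\<close>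
  have Kb: "(\<Sum>j\<in>K. 1 / real (q j)) \<le> (x - 1) / (2 * Q)"
    if Q: "Q > 0" "\<And>j. j \<in> K \<Longrightarrow> real (q j) \<ge> Q" for Q :: real
  proof -
    have "(\<Sum>j\<in>K. 1 / real (q j)) \<le> (\<Sum>j\<in>K. (real (m j) - 1) / real (q j) / (2 * Q))"
    proof (rule sum_mono)
      fix j assume j: "j \<in> K"
      then have jI: "j \<in> I" using KI by blast
      have qp: "real (q j) > 0" using q3(1)[OF jI] by simp
      have "(real (m j) - 1) / real (q j) = 2 * real (w j)" using mw[OF jI] qp by simp
      moreover have "1 / real (q j) \<le> 1 / Q" using Q(1) Q(2)[OF j] by (intro divide_left_mono) auto
      moreover have "1 / Q \<le> real (w j) / Q" using w1[OF jI] Q(1) by (intro divide_right_mono) auto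
      ultimately show "1 / real (q j) \<le> (real (m j) - 1) / real (q j) / (2 * Q)" by simp
    qed
    also have "\<dots> = (\<Sum>j\<in>K. (real (m j) - 1) / real (q j)) / (2 * Q)" by (simp add: sum_divide_distrib)
    also have "\<dots> \<le> (x - 1) / (2 * Q)" using SK Q(1) by (intro divide_right_mono) (auto simp: K_def)
    finally show ?thesis .
  qed
  show False
  \<comment> \<open>For w i at least 2, the crude bounds 2 x + 1 for m on J and x for q on K bound
    the total by (6 x^2 + 6 x + 1) / (8 x^2 + 2 x), which is below 1 from x = 3 on.\<close>
  proof (cases "w i \<ge> 2")
    case True
    have mi: "real (m i) \<ge> 4 * x + 1"
    proof -
      have "q i * 2 \<le> q i * w i" using True by simp
      then have "m i \<ge> 4 * q i + 1" using mw[OF iI] by simp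
      then have "real (4 * q i + 1) \<le> real (m i)" by (simp only: of_nat_le_iff)
      then show ?thesis by (simp add: x_def)
    qed
    have "real (m j) \<ge> 2 * x + 1" if "j \<in> J" for j
    proof -
      have "j \<in> I" using that J by blast
      then have "m j \<ge> 2 * q i + 1" using m2 qmin by (meson add_le_mono1 le_trans mult_le_mono2)
      then have "real (2 * q i + 1) \<le> real (m j)" by (simp only: of_nat_le_iff)
      then show ?thesis by (simp add: x_def)
    qed
    then have "(\<Sum>j\<in>J. 1 / real (q j)) \<le> x / real (m i) * ((2 * x + 1) / (2 * x + 1 - 1))" using x3 by (intro Jb) auto
    also have "\<dots> \<le> x / (4 * x + 1) * ((2 * x + 1) / (2 * x + 1 - 1))"
      using x3 mi by (intro mult_right_mono divide_left_mono) auto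
    also have "\<dots> = (2 * x + 1) / (2 * (4 * x + 1))" using x3 by (simp add: divide_simps)
    finally have a: "(\<Sum>j\<in>J. 1 / real (q j)) \<le> (2 * x + 1) / (2 * (4 * x + 1))" .
    have b: "(\<Sum>j\<in>K. 1 / real (q j)) \<le> (x - 1) / (2 * x)"
      using x3 qmin KI by (intro Kb) (auto simp: x_def)
    have "1 < 1 / x + (2 * x + 1) / (2 * (4 * x + 1)) + (x - 1) / (2 * x)" using tot a b by linarith
    moreover have "1 / x + (2 * x + 1) / (2 * (4 * x + 1)) + (x - 1) / (2 * x) = (6 * x * x + 6 * x + 1) / (8 * x * x + 2 * x)"
    proof -
      have d: "8 * x * x + 2 * x = 2 * x * (4 * x + 1)" by (simp add: algebra_simps)
      have e: "1 / x = (2 * (4 * x + 1)) / (2 * x * (4 * x + 1))"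
        "(2 * x + 1) / (2 * (4 * x + 1)) = (x * (2 * x + 1)) / (2 * x * (4 * x + 1))"
        "(x - 1) / (2 * x) = ((x - 1) * (4 * x + 1)) / (2 * x * (4 * x + 1))"
        using x3 by (simp_all add: divide_simps)
      show ?thesis unfolding d e add_divide_distrib[symmetric] by (simp add: algebra_simps)
    qed
    moreover have "8 * x * x + 2 * x > 0" using x3 by (simp add: add_pos_pos)
    ultimately have "8 * x * x + 2 * x < 6 * x * x + 6 * x + 1" by (simp add: less_divide_eq)
    moreover have "2 * x * x \<ge> 6 * x" using x3 by (simp add: mult_right_mono)
    ultimately show False using x3 by linarith
  next
    case False
    then have wi: "w i = 1" using w1[OF iI] by simp
    then have mi: "m i = 2 * q i + 1" using mw[OF iI] by simp
    \<comment> \<open>Equal q would force equal m by the maximality of m i, against injectivity.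
      Both numbers being odd, the next value is q i + 2.\<close>
    have qj: "q j \<ge> q i + 2" if "j \<in> I - {i}" for j
    proof -
      have "q j \<noteq> q i"
      proof
        assume e: "q j = q i"
        then have "m j \<le> 2 * q i + 1" using mmax[of j] that mi by simp
        then have "m j = m i" using m2[of j] e that mi by simp
        then show False using inj that iI by (auto dest: inj_onD)
      qed
      moreover have "q i \<le> q j" "odd (q i)" "odd (q j)" using qmin q3(2) that iI by auto
      ultimately show ?thesis by presburger
    qed
    have mj: "m j \<ge> 2 * q i + 5" if "j \<in> I - {i}" for j using m2[of j] qj[OF that] that by simp
    have mix: "real (m i) = 2 * x + 1" using mi by (simp add: x_def)
    have a: "(\<Sum>j\<in>J. 1 / real (q j)) \<le> x / (2 * x + 1) * ((2 * x + 5) / (2 * x + 5 - 1))"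
    proof -
      have "real (m j) \<ge> 2 * x + 5" if "j \<in> J" for j
      proof -
        have "2 * q i + 5 \<le> m j" using mj that J by blast
        then have "real (2 * q i + 5) \<le> real (m j)" by (simp only: of_nat_le_iff)
        then show ?thesis by (simp add: x_def)
      qed
      then show ?thesis unfolding mix[symmetric] using x3 by (intro Jb) auto
    qed
    show False
    proof (cases "q i = 3")
      case False
      have "q i \<noteq> 4" using q3(2)[OF iI] by auto
      then have "q i \<ge> 5" using False q3(1)[OF iI] by linarith
      then have x5: "x \<ge> 5" by (simp add: x_def)
      have b: "(\<Sum>j\<in>K. 1 / real (q j)) \<le> (x - 1) / (2 * (x + 2))"
      proof (rule Kb)
        show "x + 2 > 0" using x3 by simp
        fix j assume "j \<in> K"
        then have "q i + 2 \<le> q j" using qj KI by blast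
        then have "real (q i + 2) \<le> real (q j)" by (simp only: of_nat_le_iff)
        then show "x + 2 \<le> real (q j)" by (simp add: x_def)
      qed
      have e0: "2 * x + 5 - 1 = 2 * x + 4" by simp
      have "1 < 1 / x + x / (2 * x + 1) * ((2 * x + 5) / (2 * x + 4)) + (x - 1) / (2 * (x + 2))"
        using tot a[unfolded e0] b by linarith
      moreover have "1 / x + x / (2 * x + 1) * ((2 * x + 5) / (2 * x + 4)) + (x - 1) / (2 * (x + 2))
         = (4 * x * x * x + 8 * x * x + 9 * x + 4) / (4 * x * x * x + 10 * x * x + 4 * x)"
      proof -
        have d: "4 * x * x * x + 10 * x * x + 4 * x = x * (2 * x + 1) * (2 * x + 4)" by (simp add: algebra_simps)
        have e: "1 / x = ((2 * x + 1) * (2 * x + 4)) / (x * (2 * x + 1) * (2 * x + 4))"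
          "x / (2 * x + 1) * ((2 * x + 5) / (2 * x + 4)) = (x * x * (2 * x + 5)) / (x * (2 * x + 1) * (2 * x + 4))"
          "(x - 1) / (2 * (x + 2)) = ((x - 1) * x * (2 * x + 1)) / (x * (2 * x + 1) * (2 * x + 4))"
          using x3 by (simp_all add: divide_simps)
        show ?thesis unfolding d e add_divide_distrib[symmetric] by (simp add: algebra_simps)
      qed
      moreover have "4 * x * x * x + 10 * x * x + 4 * x > 0" using x3 by (simp add: add_pos_pos)
      ultimately have "4 * x * x * x + 10 * x * x + 4 * x < 4 * x * x * x + 8 * x * x + 9 * x + 4" by (simp add: less_divide_eq)
      moreover have "2 * x * x \<ge> 10 * x" using x5 by (simp add: mult_right_mono)
      ultimately show False using x5 by linarith
    next
      case True
      have xx: "x = 3" using True by (simp add: x_def)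
      have q5: "q j \<ge> 5" if "j \<in> I - {i}" for j using qj[OF that] True by simp
      have Kw: "(real (m j) - 1) / real (q j) = 2 * real (w j)" if "j \<in> K" for j
        using mw[of j] that KI q5[of j] by (simp add: subset_iff)
      have sk: "(\<Sum>j\<in>K. 2 * real (w j)) \<le> 2"
      proof -
        have "(\<Sum>j\<in>K. 2 * real (w j)) = (\<Sum>j\<in>K. (real (m j) - 1) / real (q j))" using Kw by (intro sum.cong) auto
        also have "\<dots> \<le> x - 1" using SK by (simp add: K_def)
        finally show ?thesis by (simp add: xx)
      qed
      have wK: "w j \<ge> 1" if "j \<in> K" for j using w1 that KI by blast
      have "(\<Sum>j\<in>K. 2 * 1) \<le> (\<Sum>j\<in>K. 2 * real (w j))"
        by (rule sum_mono) (use wK in force)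
      then have cK: "card K \<le> 1" using sk by simp
      \<comment> \<open>This is 3/7 times 11/10, from x = 3, m i = 7 and m j at least 11.\<close>
      have a': "(\<Sum>j\<in>J. 1 / real (q j)) \<le> 33 / 70" using a by (simp add: xx)
      show False
      proof (cases "K = {}")
        case True
        then show False using tot a' by (simp add: xx)
      next
        case False
        then obtain j0 where "K = {j0}" using cK fJK card_1_singletonE
          by (metis card_0_eq le_neq_implies_less less_one)
        then have Kj: "K = {j0}" "j0 \<in> K" by auto
        have j0I: "j0 \<in> I - {i}" using Kj KI by blast
        have sK: "(\<Sum>j\<in>K. 1 / real (q j)) = 1 / real (q j0)" using Kj by simp
        have wj0: "w j0 = 1" using sk Kj wK[OF Kj(2)] by simp
        show False
        proof (cases "q j0 \<ge> 7")
          case True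
          then have "1 / real (q j0) \<le> 1 / 7" by (intro divide_left_mono) auto
          then show False using tot a' sK by (simp add: xx)
        next
          case False
          have "q j0 \<noteq> 6" using q3(2)[of j0] j0I by auto
          then have q0: "q j0 = 5" using False q5[OF j0I] by linarith
          have m0: "m j0 = 11" using mw[of j0] j0I wj0 q0 by simp
          \<comment> \<open>The value 11 is taken by j0. For q j = 5 the next one is 21, and q j at
            least 7 gives at least 15; with this bound 1/3 + 45/98 + 1/5 stays below 1.\<close>
          have "real (m j) \<ge> 15" if j: "j \<in> J" for j
          proof -
            have jI: "j \<in> I - {i}" using j J by blast
            have "m j \<noteq> 11"
            proof
              assume "m j = 11"
              then have "j = j0" using inj_onD[OF inj, of j j0] m0 jI j0I by simp
              then show False using Kj j by (auto simp: K_def)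
            qed
            have "m j \<ge> 15"
            proof (cases "q j \<ge> 7")
              case True
              then show ?thesis using m2[of j] jI by simp
            next
              case False
              have "q j \<noteq> 6" using q3(2)[of j] jI by auto
              then have "q j = 5" using False q5[OF jI] by linarith
              then have mm: "m j = 1 + 10 * w j" using mw[of j] jI by simp
              have "w j \<noteq> 1" using mm \<open>m j \<noteq> 11\<close> by auto
              then show ?thesis using mm w1[of j] jI by simp
            qed
            then show ?thesis by simp
          qed
          then have "(\<Sum>j\<in>J. 1 / real (q j)) \<le> x / real (m i) * (15 / (15 - 1))" by (intro Jb) auto
          then have "(\<Sum>j\<in>J. 1 / real (q j)) \<le> 45 / 98" by (simp add: mix xx)
          then show False using tot sK q0 by (simp add: xx)
        qed
      qed
    qed
  qed
qed

section \<open>Summation over the primes dividing the order\<close>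

context pog_min
begin

definition primes_of_order :: "nat set" where
  "primes_of_order = {p. Factorial_Ring.prime p \<and> p dvd card (carrier G)}"

definition Sy :: "nat \<Rightarrow> 'a set" where
  "Sy p = (SOME P. syl p P)"

lemma Sy: "p \<in> primes_of_order \<Longrightarrow> syl p (Sy p)"
  using syl_ex[of p] unfolding Sy_def primes_of_order_def by (auto intro: someI_ex)

lemma finite_primes: "finite primes_of_order"
  by (rule finite_subset[of _ "{..card (carrier G)}"]) (use order_pos in \<open>auto simp: primes_of_order_def dest: dvd_imp_le\<close>)

lemma sum_by_primes:
  fixes f :: "'a \<Rightarrow> real"
  shows "(\<Sum>x\<in>carrier G - {\<one>}. f x) = (\<Sum>p\<in>primes_of_order. \<Sum>x\<in>{x \<in> carrier G. x \<noteq> \<one> \<and> x [^] p = \<one>}. f x)"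
proof -
  have "carrier G - {\<one>} = (\<Union>p\<in>primes_of_order. {x \<in> carrier G. x \<noteq> \<one> \<and> x [^] p = \<one>})"
  proof
    show "carrier G - {\<one>} \<subseteq> (\<Union>p\<in>primes_of_order. {x \<in> carrier G. x \<noteq> \<one> \<and> x [^] p = \<one>})"
    proof
      fix x assume x: "x \<in> carrier G - {\<one>}"
      then obtain p where p: "Factorial_Ring.prime p" "x [^] (p::nat) = \<one>" using pog by blast
      then have "p \<in> primes_of_order" using elem_prime_dvd_card[OF subgroup_self, of x p] x by (simp add: primes_of_order_def)
      then show "x \<in> (\<Union>p\<in>primes_of_order. {x \<in> carrier G. x \<noteq> \<one> \<and> x [^] p = \<one>})" using x p by blast
    qed
  qed auto
  then show ?thesis
    using pow_distinct_primes finite_primes fin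
    by (simp only:) (intro sum.UNION_disjoint, auto simp: primes_of_order_def)
qed

lemma weighted_sum_by_primes:
  fixes f :: "'a \<Rightarrow> real"
  assumes f: "\<And>g x. g \<in> carrier G \<Longrightarrow> x \<in> carrier G \<Longrightarrow> f (cg g x) = f x"
  shows "(\<Sum>x\<in>carrier G - {\<one>}. f x) = card (carrier G) * (\<Sum>p\<in>primes_of_order. (\<Sum>y\<in>Sy p - {\<one>}. f y) / card (Sy p) / qi (Sy p))"
proof -
  have "(\<Sum>x\<in>{x \<in> carrier G. x \<noteq> \<one> \<and> x [^] p = \<one>}. f x) = card (carrier G) * ((\<Sum>y\<in>Sy p - {\<one>}. f y) / card (Sy p) / qi (Sy p))"
    if "p \<in> primes_of_order" for p
  proof -
    note S = Sy[OF that]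
    have "real (card (Sy p)) > 0" using subgroup_card_pos[OF sylD(3)[OF S]] by simp
    moreover have "real (qi (Sy p)) > 0" using prime_gt_0_nat[OF syl_index(2)[OF S]] by simp
    ultimately show ?thesis using syl_sum[OF S, of f] f syl_index(1)[OF S] by (simp add: field_simps)
  qed
  then show ?thesis unfolding sum_by_primes by (simp add: sum_distrib_left)
qed

text \<open>Counting nonidentity elements writes 1 - 1/|G| as the sum of 1/q - 1/|nrm P| over the
  primes. A single proper normaliser already has 1/|nrm P| > 1/|G|, which makes the inequality
  strict.\<close>

lemma class_equation:
  assumes nt: "carrier G \<noteq> {\<one>}" and nn: "\<And>p. p \<in> primes_of_order \<Longrightarrow> nrm (Sy p) \<noteq> carrier G"
  shows "1 < (\<Sum>p\<in>primes_of_order. 1 / real (qi (Sy p)))"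
proof -
  define n where "n = real (card (carrier G))"
  have n0: "n > 0" using order_pos by (simp add: n_def)
  have c1: "(\<Sum>x\<in>carrier G - {\<one>}. (1::real)) = n - 1"
    using fin order_pos by (simp add: n_def of_nat_diff)
  have "n - 1 = (\<Sum>x\<in>carrier G - {\<one>}. (1::real))" by (rule c1[symmetric])
  also have "\<dots> = n * (\<Sum>p\<in>primes_of_order. (\<Sum>y\<in>Sy p - {\<one>}. 1) / card (Sy p) / qi (Sy p))"
    unfolding n_def by (rule weighted_sum_by_primes) (rule refl)
  finally have e: "1 - 1 / n = (\<Sum>p\<in>primes_of_order. (\<Sum>y\<in>Sy p - {\<one>}. 1) / card (Sy p) / qi (Sy p))"
    using n0 by (simp add: field_simps)
  also have "\<dots> = (\<Sum>p\<in>primes_of_order. 1 / real (qi (Sy p)) - 1 / (card (Sy p) * qi (Sy p)))"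
  proof (rule sum.cong[OF refl])
    fix p assume p: "p \<in> primes_of_order"
    note P = sylD(3)[OF Sy[OF p]]
    have "(\<Sum>y\<in>Sy p - {\<one>}. (1::real)) = card (Sy p) - 1"
      using subgroup_finite[OF P] subgroup.one_closed[OF P] subgroup_card_pos[OF P] by (simp add: of_nat_diff)
    then show "(\<Sum>y\<in>Sy p - {\<one>}. 1) / card (Sy p) / qi (Sy p) = 1 / real (qi (Sy p)) - 1 / (card (Sy p) * qi (Sy p))"
      using subgroup_card_pos[OF P] by (simp add: diff_divide_distrib)
  qed
  finally have e2: "(\<Sum>p\<in>primes_of_order. 1 / real (qi (Sy p))) = 1 - 1 / n + (\<Sum>p\<in>primes_of_order. 1 / (card (Sy p) * qi (Sy p)))"
    by (simp add: sum_subtractf)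
  have "card (carrier G) \<noteq> 1" using nt one_closed by (metis card_1_singletonE singletonD)
  then obtain p where p: "Factorial_Ring.prime p" "p dvd card (carrier G)" using prime_factor_nat by blast
  then have pI: "p \<in> primes_of_order" by (simp add: primes_of_order_def)
  note S = Sy[OF pI] and N = nrm_subgroup(1)[OF sylD(3)[OF Sy[OF pI]]]
  have "card (nrm (Sy p)) < card (carrier G)"
    using nn[OF pI] subgroup.subset[OF N] fin by (intro psubset_card_mono) auto
  then have "real (card (Sy p) * qi (Sy p)) < n" using syl_index(1)[OF S] by (simp only: n_def of_nat_less_iff)
  moreover have "card (Sy p) * qi (Sy p) > 0" using subgroup_card_pos[OF N] syl_index(1)[OF S] by simp
  ultimately have "1 / n < 1 / real (card (Sy p) * qi (Sy p))" using n0 by (intro divide_strict_left_mono mult_pos_pos) auto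
  also have "\<dots> \<le> (\<Sum>p\<in>primes_of_order. 1 / real (card (Sy p) * qi (Sy p)))"
    by (rule member_le_sum[OF pI]) (auto simp: finite_primes)
  finally show ?thesis using e2 by simp
qed

text \<open>Fix an exceptional character X0 for p. J collects the primes j for which X0 occurs in
  some \<open>dd (Sy j) \<eta>\<close>. For j outside J, parity makes all exceptional characters of
  j occur in \<open>dd P \<theta>\<close>, whose coefficients off \<open>triv\<close> have square
  sum \<open>qi P\<close>. For j in J, Bessel's inequality gives X0 a definite mass on the elements
  of order j, and the total mass over all primes is at most 1.\<close>

lemma exceptional_bounds:
  assumes pI: "p \<in> primes_of_order"
  shows "\<exists>J \<subseteq> primes_of_order - {p}.
      (\<Sum>j\<in>J. (1 - 1 / real (card (lin (Sy j)))) / real (qi (Sy j))) \<le> real (qi (Sy p)) / real (card (lin (Sy p)))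
    \<and> (\<Sum>j\<in>primes_of_order - {p} - J. (real (card (lin (Sy j))) - 1) / real (qi (Sy j))) \<le> real (qi (Sy p)) - 1"
proof -
  let ?I = primes_of_order
  note S = Sy[OF pI]
  define P where "P = Sy p"
  have SP: "syl p P" using S by (simp add: P_def)
  note PG = sylD(3)[OF SP]
  have "linn P \<noteq> {}" using lin_card_cong(2,4)[OF SP] by force
  then obtain \<theta> where th: "\<theta> \<in> linn P" by blast
  define X0 where "X0 = Xc P \<theta>"
  note X = XcD[OF SP th, folded X0_def]
  have lnn: "linn (Sy j) \<noteq> {}" if "j \<in> ?I" for j using lin_card_cong(2,4)[OF Sy[OF that]] by force
  define J where "J = {j \<in> ?I - {p}. \<exists>\<eta>\<in>linn (Sy j). dd (Sy j) \<eta> X0 \<noteq> 0}"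
  define K where "K = ?I - {p} - J"
  have JI: "J \<subseteq> ?I - {p}" by (auto simp: J_def)
  have KI: "j \<in> ?I" "j \<noteq> p" if "j \<in> K" for j using that by (auto simp: K_def)
  have fJK: "finite J" "finite K" using finite_primes by (auto simp: J_def K_def)
  have qpos: "real (qi (Sy j)) > 0" if "j \<in> ?I" for j using prime_gt_0_nat[OF syl_index(2)[OF Sy[OF that]]] by simp
  define E where "E j = Xc (Sy j) ` linn (Sy j)" for j
  have fE: "finite (E j)" if "j \<in> ?I" for j
    using lin_finite[OF sylD(3)[OF Sy[OF that]]] by (simp add: E_def linn_def)
  have Kdd: "dd P \<theta> \<chi> \<noteq> 0" if "j \<in> K" "\<chi> \<in> E j" for j \<chi>
  proof -
    obtain \<eta> where e: "\<eta> \<in> linn (Sy j)" "\<chi> = Xc (Sy j) \<eta>" using \<open>\<chi> \<in> E j\<close> by (auto simp: E_def)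
    have "dd (Sy j) \<eta> X0 = 0" using \<open>j \<in> K\<close> e(1) by (auto simp: K_def J_def)
    then have "odd (dd P \<theta> \<chi>)"
      using parity[OF SP Sy[OF KI(1)[OF that(1)]] _ th e(1)] KI(2)[OF that(1)] e(2) by (auto simp: X0_def)
    then show ?thesis by auto
  qed
  have "int (\<Sum>j\<in>K. card (E j)) \<le> int (qi P) - 1"
  proof -
    define U where "U = (\<Union>j\<in>K. E j)"
    have cU: "card U = (\<Sum>j\<in>K. card (E j))"
      unfolding U_def
    proof (rule card_UN_disjoint[OF fJK(2)])
      show "\<forall>i\<in>K. finite (E i)" using fE KI by blast
      show "\<forall>i\<in>K. \<forall>j\<in>K. i \<noteq> j \<longrightarrow> E i \<inter> E j = {}"
        using Xc_distinct(1)[OF Sy Sy] KI by (fastforce simp: E_def)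
    qed
    have Ui: "U \<subseteq> irr - {triv} - {X0, cj X0}"
    proof
      fix \<chi> assume "\<chi> \<in> U"
      then obtain j \<eta> where j: "j \<in> K" "\<eta> \<in> linn (Sy j)" "\<chi> = Xc (Sy j) \<eta>" by (auto simp: U_def E_def)
      note Sj = Sy[OF KI(1)[OF j(1)]]
      show "\<chi> \<in> irr - {triv} - {X0, cj X0}"
        using XcD[OF Sj j(2)] Xc_distinct[OF SP Sj _ th j(2)] KI(2)[OF j(1)] j(3) by (auto simp: X0_def)
    qed
    have fU: "finite U" using Ui finite_irr finite_subset by blast
    let ?h = "\<lambda>\<chi>. dd P \<theta> \<chi> * dd P \<theta> \<chi>"
    have "int (qi P) = (\<Sum>\<chi>\<in>irr - {triv}. ?h \<chi>)" using dd_norm[OF SP th] by simp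
    also have "\<dots> = ?h X0 + ?h (cj X0) + (\<Sum>\<chi>\<in>irr - {triv} - {X0, cj X0}. ?h \<chi>)"
      by (rule sum_remove_two) (use X finite_irr in auto)
    also have "\<dots> \<ge> 1 + int (card U)"
    proof -
      \<comment> \<open>The coefficients at X0 and \<open>cj X0\<close> differ by 1, so one of them
        is nonzero; this is the 1 subtracted from \<open>qi P\<close>.\<close>
      have "?h X0 + ?h (cj X0) \<ge> 1"
      proof -
        have "dd P \<theta> (cj X0) = dd P \<theta> X0 + 1" using dd_cj[OF PG linnD(1)[OF th] X(1)] X(2) by simp
        then consider "dd P \<theta> X0 \<noteq> 0" | "dd P \<theta> (cj X0) \<noteq> 0" by linarith
        then show ?thesis
        proof cases
          case 1
          then show ?thesis using int_square_ge_1[OF 1] zero_le_square[of "dd P \<theta> (cj X0)"] by linarith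
        next
          case 2
          then show ?thesis using int_square_ge_1[OF 2] zero_le_square[of "dd P \<theta> X0"] by linarith
        qed
      qed
      moreover have "int (card U) = (\<Sum>\<chi>\<in>U. 1)" by simp
      moreover have "(\<Sum>\<chi>\<in>U. 1) \<le> (\<Sum>\<chi>\<in>U. ?h \<chi>)"
        by (rule sum_mono) (use Kdd int_square_ge_1 in \<open>auto simp: U_def\<close>)
      moreover have "(\<Sum>\<chi>\<in>U. ?h \<chi>) \<le> (\<Sum>\<chi>\<in>irr - {triv} - {X0, cj X0}. ?h \<chi>)"
        by (rule sum_mono2) (use Ui finite_irr in auto)
      ultimately show ?thesis by linarith
    qed
    finally show ?thesis using cU by simp
  qed
  then have "real_of_int (int (\<Sum>j\<in>K. card (E j))) \<le> real_of_int (int (qi P) - 1)" by (simp only: of_int_le_iff)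
  then have cE: "(\<Sum>j\<in>K. real (card (E j))) \<le> real (qi P) - 1" by simp
  have "(\<Sum>j\<in>K. (real (card (lin (Sy j))) - 1) / real (qi (Sy j))) \<le> (\<Sum>j\<in>K. real (card (E j)))"
  proof (rule sum_mono)
    fix j assume j: "j \<in> K"
    note Sj = Sy[OF KI(1)[OF j]]
    have "card (lin (Sy j)) - 1 \<le> qi (Sy j) * card (E j)" using card_Xc[OF Sj] lin_card_cong(4)[OF Sj] by (simp add: E_def)
    then have "real (card (lin (Sy j)) - 1) \<le> real (qi (Sy j) * card (E j))" by (simp only: of_nat_le_iff)
    then have "real (card (lin (Sy j))) - 1 \<le> real (card (E j)) * real (qi (Sy j))"
      using lin_card_cong(2)[OF Sj] by (simp add: of_nat_diff mult.commute)
    then show "(real (card (lin (Sy j))) - 1) / real (qi (Sy j)) \<le> real (card (E j))"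
      using qpos[OF KI(1)[OF j]] by (simp add: divide_le_eq)
  qed
  then have part2: "(\<Sum>j\<in>K. (real (card (lin (Sy j))) - 1) / real (qi (Sy j))) \<le> real (qi P) - 1" using cE by linarith
  \<comment> \<open>The mass of X0 on one Sylow subgroup for j; divided by \<open>qi (Sy j)\<close>
    it is the share of all elements of order j in the norm 1 of X0.\<close>
  define T where "T j = (\<Sum>y\<in>Sy j - {\<one>}. (cmod (X0 y))\<^sup>2) / card (Sy j)" for j
  have T0: "T j \<ge> 0" for j by (simp add: T_def sum_nonneg)
  have tot: "(\<Sum>j\<in>?I. T j / qi (Sy j)) \<le> 1"
  proof -
    have n0: "real (card (carrier G)) > 0" using order_pos by simp
    have "(\<Sum>x\<in>carrier G. X0 x * cnj (X0 x)) = of_nat (card (carrier G))"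
      using irr_orthonormal[OF X(1) X(1)] order_pos by (simp add: ip_def divide_eq_eq)
    then have "complex_of_real (\<Sum>x\<in>carrier G. (cmod (X0 x))\<^sup>2) = of_real (card (carrier G))"
      by (simp only: of_real_sum complex_norm_square of_real_of_nat_eq)
    then have "(\<Sum>x\<in>carrier G. (cmod (X0 x))\<^sup>2) = card (carrier G)" using of_real_eq_iff by blast
    moreover have "(\<Sum>x\<in>carrier G - {\<one>}. (cmod (X0 x))\<^sup>2) \<le> (\<Sum>x\<in>carrier G. (cmod (X0 x))\<^sup>2)"
      by (rule sum_mono2) (auto simp: fin)
    moreover have "(\<Sum>x\<in>carrier G - {\<one>}. (cmod (X0 x))\<^sup>2) = card (carrier G) * (\<Sum>j\<in>?I. T j / qi (Sy j))"
      unfolding T_def using irr_class[OF X(1)] by (intro weighted_sum_by_primes) (simp add: cg_def)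
    ultimately have "real (card (carrier G)) * (\<Sum>j\<in>?I. T j / qi (Sy j)) \<le> real (card (carrier G)) * 1" by simp
    then show ?thesis using n0 by (simp only: mult_le_cancel_left_pos)
  qed
  have TJ: "1 - 1 / real (card (lin (Sy j))) \<le> T j" if j: "j \<in> J" for j
  proof -
    have jI: "j \<in> ?I" "j \<noteq> p" using j by (auto simp: J_def)
    note Sj = Sy[OF jI(1)] and Pj = sylD(3)[OF Sy[OF jI(1)]]
    define L where "L = lin (Sy j)"
    define t where "t = triv_on (Sy j)"
    have fL: "finite L" and tL: "t \<in> L" using lin_finite[OF Pj] triv_on_lin[OF Pj] by (auto simp: L_def t_def)
    obtain \<eta>0 where e0: "\<eta>0 \<in> linn (Sy j)" "dd (Sy j) \<eta>0 X0 \<noteq> 0" using j by (auto simp: J_def)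
    define c where "c = real_of_int (dd (Sy j) \<eta>0 X0)"
    have dc: "dd (Sy j) \<eta> X0 = dd (Sy j) \<eta>0 X0" if "\<eta> \<in> linn (Sy j)" for \<eta>
      unfolding X0_def by (rule dd_other_const[OF Sj SP jI(2) that e0(1) th])
    \<comment> \<open>By \<open>dd_other_const\<close> the multiplicity of X0 is the same at all
      nontrivial linear characters, so only its distance c from the value at the trivial one
      matters.\<close>
    define n' where "n' \<eta> = (if \<eta> = t then 0 else - c)" for \<eta>
    have n: "real (mu (Sy j) \<eta> X0) = n' \<eta> + real (mu (Sy j) t X0)" if "\<eta> \<in> lin (Sy j)" for \<eta>
    proof (cases "\<eta> = t")
      case False
      then have "\<eta> \<in> linn (Sy j)" using that by (simp add: linn_def t_def)
      then have "real_of_int (dd (Sy j) \<eta> X0) = c" using dc c_def by simp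
      then show ?thesis using False by (simp add: dd_def n'_def t_def)
    qed (simp add: n'_def)
    have m1: "card L > 1" using lin_card_cong(2)[OF Sj] by (simp add: L_def)
    have s1: "(\<Sum>\<eta>\<in>L. n' \<eta>) = - c * (real (card L) - 1)"
      using sum.remove[OF fL tL, of n'] fL tL m1 by (simp add: n'_def of_nat_diff algebra_simps)
    have s2: "(\<Sum>\<eta>\<in>L. (n' \<eta>)\<^sup>2) = c\<^sup>2 * (real (card L) - 1)"
      using sum.remove[OF fL tL, of "\<lambda>\<eta>. (n' \<eta>)\<^sup>2"] fL tL m1 by (simp add: n'_def of_nat_diff algebra_simps)
    have "card (Sy j) * ((\<Sum>\<eta>\<in>L. (n' \<eta>)\<^sup>2) - (\<Sum>\<eta>\<in>L. n' \<eta>)\<^sup>2 / real (card L)) \<le> (\<Sum>y\<in>Sy j - {\<one>}. (cmod (X0 y))\<^sup>2)"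
      unfolding L_def by (rule bessel_linear[OF Pj X(1) n])
    then have b: "(\<Sum>\<eta>\<in>L. (n' \<eta>)\<^sup>2) - (\<Sum>\<eta>\<in>L. n' \<eta>)\<^sup>2 / real (card L) \<le> T j"
      using subgroup_card_pos[OF Pj] by (simp add: T_def le_divide_eq mult.commute)
    have "(\<Sum>\<eta>\<in>L. (n' \<eta>)\<^sup>2) - (\<Sum>\<eta>\<in>L. n' \<eta>)\<^sup>2 / real (card L) = c\<^sup>2 * (1 - 1 / real (card L))"
      unfolding s1 s2 using m1 by (simp add: field_simps power2_eq_square)
    moreover have "c\<^sup>2 \<ge> 1"
    proof -
      have "dd (Sy j) \<eta>0 X0 * dd (Sy j) \<eta>0 X0 \<ge> 1" using int_square_ge_1[OF e0(2)] .
      then have "real_of_int (dd (Sy j) \<eta>0 X0 * dd (Sy j) \<eta>0 X0) \<ge> real_of_int 1" by (simp only: of_int_le_iff)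
      then show ?thesis by (simp add: c_def power2_eq_square)
    qed
    moreover have "1 - 1 / real (card L) \<ge> 0" using m1 by (simp add: divide_le_eq)
    ultimately have "1 - 1 / real (card L) \<le> (\<Sum>\<eta>\<in>L. (n' \<eta>)\<^sup>2) - (\<Sum>\<eta>\<in>L. n' \<eta>)\<^sup>2 / real (card L)"
      using mult_right_mono[of 1 "c\<^sup>2" "1 - 1 / real (card L)"] by simp
    then show ?thesis using b by (simp add: L_def)
  qed
  have TP: "real (qi P) * (real (card (lin P)) - real (qi P)) / real (card (lin P)) \<le> T p"
  proof -
    define L where "L = lin P"
    have fL: "finite L" using lin_finite[OF PG] by (simp add: L_def)
    \<comment> \<open>Normalised so that n is 1 on the orbit of \<theta> under \<open>nrm P\<close>
      and 0 on the orbit of its conjugate, as \<open>orbit_variance\<close> requires.\<close>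
    define n where "n \<eta> = int (mu P \<eta> X0) - int (mu P (cj \<theta>) X0)" for \<eta>
    define O1 where "O1 = (\<lambda>g. tw P g \<theta>) ` nrm P"
    define O2 where "O2 = cj ` O1"
    have lt: "\<theta> \<in> lin P" "\<theta> \<noteq> triv_on P" "cj \<theta> \<in> lin P" "cj \<theta> \<noteq> triv_on P"
      using linnD[OF th] linnD[OF cj_linn[OF th]] by auto
    have O1: "O1 \<subseteq> L" using tw_lin[OF PG _ lt(1)] by (auto simp: O1_def L_def)
    have O2: "O2 \<subseteq> L" using O1 cj_lin by (auto simp: O2_def L_def)
    have c1: "card O1 = qi P" unfolding O1_def by (rule card_orbit[OF SP th])
    have "inj_on cj O1" by (rule inj_onI) (metis cj_cj)
    then have c2: "card O2 = qi P" unfolding O2_def using c1 by (simp add: card_image)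
    have n1: "n \<eta> = 1" if "\<eta> \<in> O1" for \<eta>
      using that mu_conj_eq[OF SP lt(1,2) _ X(1)] X(2) by (auto simp: O1_def n_def ff_def)
    have n2: "n \<eta> = 0" if h: "\<eta> \<in> O2" for \<eta>
    proof -
      obtain g where g: "g \<in> nrm P" "\<eta> = cj (tw P g \<theta>)" using h by (auto simp: O2_def O1_def)
      then show ?thesis using mu_conj_eq[OF SP lt(3,4) g(1) X(1)] by (simp add: n_def tw_cj)
    qed
    define m where "m = card L"
    have m0: "m > 1" using lin_card_cong(2)[OF SP] by (simp add: m_def L_def)
    have "int (qi P) * (int m - int (qi P)) \<le> int m * (\<Sum>x\<in>L. n x * n x) - (\<Sum>x\<in>L. n x) * (\<Sum>x\<in>L. n x)"
      unfolding m_def by (rule orbit_variance[OF fL O1 O2 c1 c2 n1 n2])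
    then have "real_of_int (int (qi P) * (int m - int (qi P))) \<le> real_of_int (int m * (\<Sum>x\<in>L. n x * n x) - (\<Sum>x\<in>L. n x) * (\<Sum>x\<in>L. n x))"
      by (simp only: of_int_le_iff)
    then have v: "real (qi P) * (real m - real (qi P)) \<le> real m * (\<Sum>x\<in>L. (real_of_int (n x))\<^sup>2) - (\<Sum>x\<in>L. real_of_int (n x))\<^sup>2"
      by (simp add: power2_eq_square)
    have "card P * ((\<Sum>\<eta>\<in>L. (real_of_int (n \<eta>))\<^sup>2) - (\<Sum>\<eta>\<in>L. real_of_int (n \<eta>))\<^sup>2 / real m) \<le> (\<Sum>y\<in>P - {\<one>}. (cmod (X0 y))\<^sup>2)"
      unfolding L_def m_def
      by (rule bessel_linear[OF PG X(1), of _ "real (mu P (cj \<theta>) X0)"]) (simp add: n_def)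
    then have b: "(\<Sum>\<eta>\<in>L. (real_of_int (n \<eta>))\<^sup>2) - (\<Sum>\<eta>\<in>L. real_of_int (n \<eta>))\<^sup>2 / real m \<le> T p"
      using subgroup_card_pos[OF PG] by (simp add: T_def P_def le_divide_eq mult.commute)
    have "real (qi P) * (real m - real (qi P)) / real m \<le> (real m * (\<Sum>x\<in>L. (real_of_int (n x))\<^sup>2) - (\<Sum>x\<in>L. real_of_int (n x))\<^sup>2) / real m"
      using v m0 by (intro divide_right_mono) auto
    also have "\<dots> = (\<Sum>\<eta>\<in>L. (real_of_int (n \<eta>))\<^sup>2) - (\<Sum>\<eta>\<in>L. real_of_int (n \<eta>))\<^sup>2 / real m"
      using m0 by (simp add: diff_divide_distrib)
    finally show ?thesis using b by (simp add: m_def L_def)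
  qed
  have part1: "(\<Sum>j\<in>J. (1 - 1 / real (card (lin (Sy j)))) / real (qi (Sy j))) \<le> real (qi P) / real (card (lin P))"
  proof -
    have m0: "real (card (lin P)) > 0" using lin_card_cong(2)[OF SP] by simp
    have q0: "real (qi P) > 0" using qpos[OF pI] by (simp add: P_def)
    have "(\<Sum>j\<in>J. (1 - 1 / real (card (lin (Sy j)))) / real (qi (Sy j))) \<le> (\<Sum>j\<in>J. T j / qi (Sy j))"
      by (rule sum_mono) (use TJ in \<open>auto intro!: divide_right_mono\<close>)
    moreover have "(\<Sum>j\<in>J. T j / qi (Sy j)) + T p / qi P \<le> (\<Sum>j\<in>?I. T j / qi (Sy j))"
    proof -
      have "(\<Sum>j\<in>insert p J. T j / qi (Sy j)) \<le> (\<Sum>j\<in>?I. T j / qi (Sy j))"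
        by (rule sum_mono2) (use finite_primes JI pI T0 in auto)
      moreover have "p \<notin> J" using JI by blast
      ultimately show ?thesis using fJK by (simp add: P_def)
    qed
    moreover have "(real (card (lin P)) - real (qi P)) / real (card (lin P)) \<le> T p / qi P"
      using TP q0 by (simp add: le_divide_eq mult.commute)
    moreover have "(real (card (lin P)) - real (qi P)) / real (card (lin P)) = 1 - real (qi P) / real (card (lin P))"
      using m0 by (simp add: diff_divide_distrib)
    ultimately show ?thesis using tot by linarith
  qed
  show ?thesis
    using JI part1 part2 unfolding K_def P_def by blast
qed

lemma impossible:
  assumes nt: "carrier G \<noteq> {\<one>}" and nn: "\<And>p. p \<in> primes_of_order \<Longrightarrow> nrm (Sy p) \<noteq> carrier G"
  shows False
proof (rule odd_order_arithmetic[of primes_of_order "\<lambda>p. qi (Sy p)" "\<lambda>p. card (lin (Sy p))"])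
  show "finite primes_of_order" by (rule finite_primes)
  show "1 < (\<Sum>p\<in>primes_of_order. 1 / real (qi (Sy p)))" by (rule class_equation[OF assms])
  fix p assume p: "p \<in> primes_of_order"
  note i = syl_index[OF Sy[OF p]] and l = lin_card_cong[OF Sy[OF p]]
  show "3 \<le> qi (Sy p)" using i prime_ge_2_nat[OF i(2)] by (metis dvd_refl le_neq_implies_less not_less_eq_eq numeral_2_eq_2 numeral_3_eq_3 Suc_leI)
  show "odd (qi (Sy p))" by (rule i)
  show "1 < card (lin (Sy p))" "2 * qi (Sy p) dvd card (lin (Sy p)) - 1" by (rule l)+
  show "\<exists>J\<subseteq>primes_of_order - {p}.
            (\<Sum>j\<in>J. (1 - 1 / real (card (lin (Sy j)))) / real (qi (Sy j))) \<le> real (qi (Sy p)) / real (card (lin (Sy p))) \<and>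
            (\<Sum>j\<in>primes_of_order - {p} - J. (real (card (lin (Sy j))) - 1) / real (qi (Sy j))) \<le> real (qi (Sy p)) - 1"
    by (rule exceptional_bounds[OF p])
next
  show "inj_on (\<lambda>p. card (lin (Sy p))) primes_of_order"
  proof (rule inj_onI)
    fix p p' assume p: "p \<in> primes_of_order" "p' \<in> primes_of_order" and e: "card (lin (Sy p)) = card (lin (Sy p'))"
    obtain k k' where k: "card (lin (Sy p)) = p ^ k" "card (lin (Sy p')) = p' ^ k'"
      using lin_card_cong(1)[OF Sy] p by metis
    have pr: "Factorial_Ring.prime p" "Factorial_Ring.prime p'" using p by (auto simp: primes_of_order_def)
    have "k \<noteq> 0" using k lin_card_cong(2)[OF Sy[OF p(1)]] by (cases k) auto
    then have "p dvd p' ^ k'" using e k by (metis dvd_power gr0I)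
    then show "p = p'" using pr prime_dvd_power_nat primes_dvd_imp_eq by blast
  qed
qed

end

section \<open>Normal p-subgroups and the induction in odd order\<close>

context fin_group
begin

definition normal_pgroup :: "nat \<Rightarrow> 'a set \<Rightarrow> bool" where
  "normal_pgroup p V \<longleftrightarrow> Factorial_Ring.prime p \<and> subgroup V G \<and> V \<noteq> {\<one>} \<and> (\<exists>k. card V = p ^ k) \<and>
     (\<forall>g\<in>carrier G. \<forall>v\<in>V. cg g v \<in> V)"

definition ker :: "('a \<Rightarrow> complex) \<Rightarrow> 'a set" where
  "ker l = {x \<in> carrier G. l x = 1}"

lemma ker_subgroup:
  assumes l: "mult_char l"
  shows "subgroup (ker l) G"
proof (rule subgroupI)
  note m = mult_charD[OF l]
  show "ker l \<subseteq> carrier G" "ker l \<noteq> {}" using m(2) by (auto simp: ker_def)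
  fix x y assume x: "x \<in> ker l" and y: "y \<in> ker l"
  show "x \<otimes> y \<in> ker l" using x y m by (auto simp: ker_def)
  have "l (inv x) * l x = 1" using x m(1)[of "inv x" x] m(2) by (simp add: ker_def)
  then show "inv x \<in> ker l" using x by (simp add: ker_def)
qed

lemma ker_normal: "mult_char l \<Longrightarrow> g \<in> carrier G \<Longrightarrow> v \<in> ker l \<Longrightarrow> cg g v \<in> ker l"
  by (simp add: ker_def hom_cg)

lemma ker_trivial_comm:
  assumes l: "mult_char l" and k: "ker l = {\<one>}" and x: "x \<in> carrier G" and y: "y \<in> carrier G"
  shows "x \<otimes> y = y \<otimes> x"
proof -
  note m = mult_charD[OF l]
  have "l (x \<otimes> y) = l (y \<otimes> x)" using m(1) x y by (simp add: mult.commute)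
  moreover have "l (inv (y \<otimes> x)) * l (y \<otimes> x) = 1"
    using m(1)[of "inv (y \<otimes> x)" "y \<otimes> x"] m(2) x y by simp
  moreover have "l (inv (y \<otimes> x) \<otimes> (x \<otimes> y)) = l (inv (y \<otimes> x)) * l (x \<otimes> y)" using x y by (intro m(1)) auto
  ultimately have "l (inv (y \<otimes> x) \<otimes> (x \<otimes> y)) = 1" by (simp only:)
  then have "inv (y \<otimes> x) \<otimes> (x \<otimes> y) \<in> ker l" using x y by (simp add: ker_def)
  then have "inv (y \<otimes> x) \<otimes> (x \<otimes> y) = \<one>" using k by simp
  then show ?thesis using x y by (metis inv_equality inv_inv inv_closed m_closed)
qed

lemma inverted_comm:
  assumes A: "subgroup A G" and u: "u \<in> carrier G" and i: "\<And>a. a \<in> A \<Longrightarrow> cg u a = inv a"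
    and x: "x \<in> A" and y: "y \<in> A"
  shows "x \<otimes> y = y \<otimes> x"
proof -
  have c: "x \<in> carrier G" "y \<in> carrier G" using A x y subgroup_inG by auto
  have "inv (x \<otimes> y) = inv x \<otimes> inv y"
    using cg_mult[OF u c] i[OF x] i[OF y] i[OF subgroup.m_closed[OF A x y]] by simp
  then have "inv y \<otimes> inv x = inv x \<otimes> inv y" using c by (simp add: inv_mult_group)
  then have "inv (inv y \<otimes> inv x) = inv (inv x \<otimes> inv y)" by simp
  then show ?thesis using c by (simp add: inv_mult_group)
qed

text \<open>The map a |-> a^-1 u(a) is injective for lack of fixed points, hence onto, and
  conjugation by the involution u inverts every element of this form.\<close>

lemma fixed_point_free_inverts:
  assumes A: "subgroup A G" and u: "u \<in> carrier G" "u \<otimes> u = \<one>" and n: "\<And>a. a \<in> A \<Longrightarrow> cg u a \<in> A"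
    and f: "\<And>a. a \<in> A \<Longrightarrow> cg u a = a \<Longrightarrow> a = \<one>" and a: "a \<in> A"
  shows "cg u a = inv a"
proof -
  have c: "x \<in> carrier G" if "x \<in> A" for x using A that subgroup_inG by auto
  define f where "f x = inv x \<otimes> cg u x" for x
  have "inj_on f A"
  proof (rule inj_onI)
    fix x y assume x: "x \<in> A" and y: "y \<in> A" and e: "f x = f y"
    have "y \<otimes> inv x \<otimes> cg u x = cg u y"
    proof -
      have "y \<otimes> (inv x \<otimes> cg u x) = y \<otimes> (inv y \<otimes> cg u y)" using e by (simp add: f_def)
      then show ?thesis using x y c u by (simp add: m_assoc[symmetric])
    qed
    then have "y \<otimes> inv x = cg u y \<otimes> inv (cg u x)" using x y c u by (metis cg_closed inv_closed inv_solve_right m_closed)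
    moreover have "cg u (y \<otimes> inv x) = cg u y \<otimes> inv (cg u x)" using x y c u by (simp add: cg_mult cg_inv)
    ultimately have "cg u (y \<otimes> inv x) = y \<otimes> inv x" by (simp only:)
    then have "y \<otimes> inv x = \<one>" using f[of "y \<otimes> inv x"] x y A subgroup.m_closed subgroup.m_inv_closed by metis
    then show "x = y" using x y c by (metis inv_equality inv_inv inv_closed)
  qed
  moreover have "f ` A \<subseteq> A" using n A by (auto simp: f_def subgroup.m_closed subgroup.m_inv_closed)
  ultimately have "f ` A = A" using subgroup_finite[OF A] by (simp add: endo_inj_surj)
  then obtain x where x: "x \<in> A" "a = inv x \<otimes> cg u x" using a by (auto simp: f_def)
  have "cg u a = inv (cg u x) \<otimes> cg u (cg u x)" using x c u n by (simp add: cg_mult cg_inv)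
  also have "cg u (cg u x) = x" using x c u cg_cg[of u u x] by simp
  also have "inv (cg u x) \<otimes> x = inv a" using x c u by (simp add: inv_mult_group)
  finally show ?thesis .
qed

end

context pog
begin

lemma abelian_normal:
  assumes K: "subgroup K G" "K \<noteq> {\<one>}" "\<And>g v. g \<in> carrier G \<Longrightarrow> v \<in> K \<Longrightarrow> cg g v \<in> K"
    and comm: "\<And>x y. x \<in> K \<Longrightarrow> y \<in> K \<Longrightarrow> x \<otimes> y = y \<otimes> x"
  shows "\<exists>p V. normal_pgroup p V"
proof -
  obtain x where x: "x \<in> K" "x \<noteq> \<one>" using K subgroup.one_closed by blast
  obtain p where p: "Factorial_Ring.prime p" "x [^] (p::nat) = \<one>" using pog subgroup_inG[OF K(1) x(1)] by blast
  have "y [^] p = \<one>" if "y \<in> K" for y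
    using commuting_same_prime[OF _ x(2) p(2,1)] comm[OF that x(1)] that x subgroup_inG[OF K(1)] by blast
  then have "\<exists>k. card K = p ^ k" using exponent_card_power[OF K(1) p(1)] by blast
  then show ?thesis unfolding normal_pgroup_def using K(1-3) p(1) by blast
qed

text \<open>V is normal in K only. The elements of exponent p in K form a p-group by
  \<open>subgroup_structure\<close>, and this larger set is invariant under all of G.\<close>

lemma normal_pgroup_subgroup:
  assumes K: "subgroup K G" "\<And>g v. g \<in> carrier G \<Longrightarrow> v \<in> K \<Longrightarrow> cg g v \<in> K"
    and V: "fin_group.normal_pgroup (G\<lparr>carrier := K\<rparr>) p V"
  shows "\<exists>p V. normal_pgroup p V"
proof -
  interpret K: pog "G\<lparr>carrier := K\<rparr>" by (rule subgroup_pog[OF K(1)])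
  have p: "Factorial_Ring.prime p" and V1: "subgroup V (G\<lparr>carrier := K\<rparr>)" "V \<noteq> {\<one>}" and k: "\<exists>k. card V = p ^ k"
    and n: "\<And>g v. g \<in> K \<Longrightarrow> v \<in> V \<Longrightarrow> K.cg g v \<in> V" using V by (auto simp: K.normal_pgroup_def)
  have VK: "V \<subseteq> K" using subgroup.subset[OF V1(1)] by simp
  have VG: "subgroup V G" by (rule incl_subgroup[OF K(1) V1(1)])
  have n': "cg g v \<in> V" if "g \<in> K" "v \<in> V" for g v
    using n[OF that] that m_inv_consistent[OF K(1)] by (simp add: K.cg_def cg_def)
  define T where "T = {x \<in> K. x [^] p = \<one>}"
  obtain k where k: "card V = p ^ k" using k by blast
  have T: "subgroup T G" "\<exists>a. card T = p ^ a"
    using subgroup_structure[OF K(1) p VG VK V1(2) k n'] by (auto simp: T_def)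
  obtain v where v: "v \<in> V" "v \<noteq> \<one>" using V1(2) subgroup.one_closed[OF VG] by blast
  have "v \<in> T" using v VK p_subgroup_exponent[OF VG k p] by (auto simp: T_def)
  moreover have "cg g x \<in> T" if "g \<in> carrier G" "x \<in> T" for g x
    using that K(2) subgroup_inG[OF K(1)] by (auto simp: T_def cg_pow[symmetric])
  ultimately show ?thesis using T p v unfolding normal_pgroup_def by blast
qed

lemma syl_cg:
  assumes "syl p P" "g \<in> carrier G"
  shows "syl p (cg g ` P)"
  using assms cg_subgroup[OF sylD(3)[OF assms(1)] assms(2)] by (auto simp: syl_def)

lemma syl_normal:
  assumes S: "syl p P" and n: "nrm P = carrier G"
  shows "normal_pgroup p P"
  using sylD(1,3,4,5)[OF S] nrmD(1)[of _ P] n unfolding normal_pgroup_def by blast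

end

text \<open>A nontrivial linear character has a smaller kernel. Either the kernel is trivial and the
  group abelian, or induction gives a normal p-subgroup of the kernel, which extends upwards.
  Without such a character the locale \<open>pog_min\<close> applies.\<close>

theorem odd_pog_normal_pgroup:
  assumes "pog G" "odd (card (carrier G))" "carrier G \<noteq> {\<one>\<^bsub>G\<^esub>}"
  shows "\<exists>p V. fin_group.normal_pgroup G p V"
  using assms
proof (induction "card (carrier G)" arbitrary: G rule: less_induct)
  case (less G)
  interpret pog G by (rule less.prems)
  show ?case
  proof (cases "\<forall>l x. mult_char l \<longrightarrow> x \<in> carrier G \<longrightarrow> l x = 1")
    case True
    interpret pog_min G
      by (intro pog_min.intro pog_min_axioms.intro less.prems) (use True in blast)
    show ?thesis
    proof (rule ccontr)
      assume n: "\<not> ?thesis"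
      have "nrm (Sy p) \<noteq> carrier G" if "p \<in> primes_of_order" for p
        using syl_normal[OF Sy[OF that]] n by blast
      then show False using impossible less.prems(3) by blast
    qed
  next
    case False
    then obtain l x where l: "mult_char l" and x: "x \<in> carrier G" "l x \<noteq> 1" by blast
    note K = ker_subgroup[OF l]
    show ?thesis
    proof (cases "ker l = {\<one>\<^bsub>G\<^esub>}")
      case True
      show ?thesis
        by (rule abelian_normal[OF subgroup_self less.prems(3)]) (use ker_trivial_comm[OF l True] in auto)
    next
      case False
      have "ker l \<subset> carrier G" using x subgroup.subset[OF K] by (auto simp: ker_def)
      then have "card (ker l) < card (carrier G)" using fin by (rule psubset_card_mono[rotated])
      moreover have "odd (card (ker l))" using subgroup_card_dvd[OF K] less.prems(2) dvd_trans by blast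
      ultimately obtain p V where "fin_group.normal_pgroup (G\<lparr>carrier := ker l\<rparr>) p V"
        using less.hyps[of "G\<lparr>carrier := ker l\<rparr>"] subgroup_pog[OF K] False by auto
      then show ?thesis using normal_pgroup_subgroup[OF K ker_normal[OF l]] by blast
    qed
  qed
qed

section \<open>Involutions and the normaliser of a Sylow 2-subgroup\<close>

context pog
begin

text \<open>A Sylow 2-subgroup has exponent 2 and is therefore abelian, so it lies in the
  centraliser of t, which is a 2-group by \<open>cen_card\<close>.\<close>

lemma cen_involution:
  assumes S: "syl 2 S" and t: "t \<in> S" "t \<noteq> \<one>"
  shows "cen t = S"
proof -
  note SG = sylD(7)[OF S]
  have sq: "s \<otimes> s = \<one>" if "s \<in> S" for s using sylD(6)[OF S that] SG[OF that] by (simp add: numeral_2_eq_2)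
  have si: "inv s = s" if "s \<in> S" for s using sq[OF that] SG[OF that] by (simp add: inv_equality)
  have comm: "s \<otimes> t = t \<otimes> s" if "s \<in> S" for s
    using si[OF subgroup.m_closed[OF sylD(3)[OF S] that t(1)]] si[OF that] si[OF t(1)] SG[OF that] SG[OF t(1)]
    by (simp add: inv_mult_group)
  then have "S \<subseteq> cen t" using SG by (auto simp: cen_def)
  moreover obtain a where "card (cen t) = 2 ^ a"
    using cen_card[OF SG[OF t(1)] t(2) sylD(6)[OF S t(1)] sylD(1)[OF S]] by blast
  ultimately show ?thesis using syl_maximal[OF S cen_subgroup[OF SG[OF t(1)]]] by blast
qed

definition invols :: "'a set" where
  "invols = {t \<in> carrier G. t \<noteq> \<one> \<and> t \<otimes> t = \<one>}"

lemma involsD: "t \<in> invols \<Longrightarrow> t \<in> carrier G" "t \<in> invols \<Longrightarrow> t \<noteq> \<one>" "t \<in> invols \<Longrightarrow> t \<otimes> t = \<one>"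
  "t \<in> invols \<Longrightarrow> inv t = t" "t \<in> invols \<Longrightarrow> t [^] (2::nat) = \<one>"
  by (auto simp: invols_def inv_equality numeral_2_eq_2)

lemma cg_invols: "g \<in> carrier G \<Longrightarrow> t \<in> invols \<Longrightarrow> cg g t \<in> invols"
  by (auto simp: invols_def cg_mult[symmetric])

end

text \<open>\<open>simple\<close> rules out nontrivial normal p-subgroups for every p, and the
  presence of S makes the order even.\<close>

locale pog_simple = pog +
  fixes S
  assumes S: "syl 2 S" and simple: "\<not> normal_pgroup p V"
begin

lemma invol_syl:
  assumes t: "t \<in> invols"
  shows "syl 2 (cen t)"
proof -
  obtain g where g: "g \<in> carrier G" "cg (inv g) t \<in> S"
    using syl_elem[OF S involsD(1)[OF t] involsD(5)[OF t]] by blast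
  have "cg g (cg (inv g) t) \<in> cg g ` S" using g by blast
  then have "t \<in> cg g ` S" using g involsD(1)[OF t] by simp
  then have "cen t = cg g ` S" using cen_involution[OF syl_cg[OF S g(1)]] involsD(2)[OF t] by blast
  then show ?thesis using syl_cg[OF S g(1)] by simp
qed

lemma invol_cen:
  assumes t: "t \<in> invols" and s: "s \<in> cen t" "s \<noteq> \<one>"
  shows "cen s = cen t"
  using cen_involution[OF invol_syl[OF t] s] .

text \<open>i and j generate a dihedral group of order 2 r, where r is the prime order of i j and is
  odd because i and j do not commute.\<close>

lemma noncommuting_conj:
  assumes i: "i \<in> invols" and j: "j \<in> invols" and n: "i \<notin> cen j"
  shows "\<exists>g\<in>carrier G. cg g i = j"
proof -
  note ij = involsD[OF i] involsD[OF j]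
  define w where "w = i \<otimes> j"
  have w: "w \<in> carrier G" using ij by (simp add: w_def)
  have wi: "inv w = j \<otimes> i" using ij by (simp add: w_def inv_mult_group)
  obtain r where r: "Factorial_Ring.prime r" "w [^] (r::nat) = \<one>" using pog[OF w] by blast
  have "r \<noteq> 2"
  proof
    assume "r = 2"
    then have "w \<otimes> w = \<one>" using r w by (simp add: numeral_2_eq_2)
    then have "inv w = w" using w by (simp add: inv_equality)
    then show False using n ij wi by (simp add: cen_def w_def)
  qed
  then have "odd r" using r(1) prime_ge_2_nat[OF r(1)] by (intro prime_odd_nat) auto
  then obtain k where k: "r = 2 * k + 1" by (rule oddE)
  have iw: "cg i w = inv w" using ij by (simp add: cg_def w_def inv_mult_group m_assoc[symmetric])
  \<comment> \<open>With r = 2 k + 1, the k-th power of w conjugates i to i w^(-2k) = i w =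
    j.\<close>
  define c where "c = w [^] k"
  have c: "c \<in> carrier G" using w by (simp add: c_def)
  have ic: "cg i c = inv c" using cg_pow[OF ij(1) w, of k] iw w by (simp add: c_def nat_pow_inv)
  have "i \<otimes> c = inv c \<otimes> i"
  proof -
    have "i \<otimes> c \<otimes> i = inv c" using ic ij by (simp add: cg_def)
    then have "i \<otimes> c \<otimes> i \<otimes> i = inv c \<otimes> i" by simp
    then show ?thesis using ij c by (simp add: m_assoc)
  qed
  have ci: "c \<otimes> i = i \<otimes> inv c"
  proof -
    have "c \<otimes> i = c \<otimes> (i \<otimes> c) \<otimes> inv c" using ij c by (simp add: m_assoc)
    also have "\<dots> = c \<otimes> (inv c \<otimes> i) \<otimes> inv c" using \<open>i \<otimes> c = inv c \<otimes> i\<close> by simp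
    also have "\<dots> = i \<otimes> inv c" using ij c by (simp add: m_assoc[symmetric])
    finally show ?thesis .
  qed
  have "cg c i = i \<otimes> inv c \<otimes> inv c" by (simp add: cg_def ci)
  also have "\<dots> = i \<otimes> inv (c \<otimes> c)" using ij c by (simp add: inv_mult_group m_assoc)
  also have "inv (c \<otimes> c) = w"
  proof -
    have "r = Suc (k + k)" using k by simp
    then have "w \<otimes> (c \<otimes> c) = w [^] r" using nat_pow_Suc2[OF w, of "k + k"] w by (simp only: c_def nat_pow_mult)
    then show ?thesis using r w c inv_equality[of w "c \<otimes> c"] by simp
  qed
  also have "i \<otimes> w = j" using ij by (simp add: w_def m_assoc[symmetric])
  finally show ?thesis using c by blast
qed

lemma not_normal: "nrm S \<noteq> carrier G"
  using syl_normal[OF S] simple by blast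

text \<open>Commuting involutions t and u have the same centraliser, a Sylow 2-subgroup that is not
  normal. So some involution j lies outside it and is conjugate to both by
  \<open>noncommuting_conj\<close>.\<close>

lemma invols_conj:
  assumes t: "t \<in> invols" and u: "u \<in> invols"
  shows "\<exists>g\<in>carrier G. cg g t = u"
proof (cases "t \<in> cen u")
  case False
  then show ?thesis by (rule noncommuting_conj[OF t u])
next
  case True
  have "\<not> invols \<subseteq> cen u"
  proof
    assume s: "invols \<subseteq> cen u"
    note T = invol_syl[OF u]
    have "cg g v \<in> cen u" if "g \<in> carrier G" "v \<in> cen u" for g v
    proof (cases "v = \<one>")
      case False
      then have "v \<in> invols" using sylD(6,7)[OF T that(2)] by (simp add: invols_def numeral_2_eq_2)
      then show ?thesis using cg_invols[OF that(1)] s by blast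
    qed (use that subgroup.one_closed[OF sylD(3)[OF T]] in simp)
    then have "normal_pgroup 2 (cen u)" using sylD(1,3,4,5)[OF T] unfolding normal_pgroup_def by blast
    then show False using simple by blast
  qed
  then obtain j where j: "j \<in> invols" "j \<notin> cen u" by blast
  have ct: "cen t = cen u" using invol_cen[OF u True involsD(2)[OF t]] .
  have nj: "t \<notin> cen j" "j \<notin> cen u" using j ct cen_sym[OF involsD(1)[OF j(1)]] by auto
  obtain g where g: "g \<in> carrier G" "cg g t = j" using noncommuting_conj[OF t j(1) nj(1)] by blast
  obtain h where h: "h \<in> carrier G" "cg h j = u" using noncommuting_conj[OF j(1) u nj(2)] by blast
  have "cg (h \<otimes> g) t = u" using cg_cg[OF h(1) g(1) involsD(1)[OF t]] g h by simp
  then show ?thesis using g h by blast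
qed

lemma S_invols: "s \<in> S \<Longrightarrow> s \<noteq> \<one> \<Longrightarrow> s \<in> invols"
  using sylD(6,7)[OF S] by (simp add: invols_def numeral_2_eq_2)

text \<open>The number of involutions in S; \<open>card_H\<close> identifies it with the index of S
  in its normaliser.\<close>

definition q :: nat where "q = card S - 1"

definition H :: "'a set" where "H = nrm S"

lemma H: "subgroup H G" "S \<subseteq> H" "h \<in> H \<Longrightarrow> h \<in> carrier G"
  unfolding H_def using nrm_subgroup[OF sylD(3)[OF S]] nrmD(2) by auto

lemma HS: "h \<in> H \<Longrightarrow> s \<in> S \<Longrightarrow> cg h s \<in> S"
  unfolding H_def by (rule nrmD)

lemma S_TI: "g \<in> carrier G \<Longrightarrow> y \<in> S \<Longrightarrow> y \<noteq> \<one> \<Longrightarrow> cg g y \<in> S \<Longrightarrow> g \<in> H"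
  using syl_TI[OF S] unfolding TI_def H_def by blast

lemma conj_fibre:
  assumes K: "subgroup K G" and t: "t \<in> carrier G" "cen t \<subseteq> K"
  shows "card K = card (cen t) * card ((\<lambda>h. cg h t) ` K)"
proof (rule card_fibres[OF subgroup_finite[OF K]])
  fix b assume "b \<in> (\<lambda>h. cg h t) ` K"
  then obtain k where k: "k \<in> K" "b = cg k t" by blast
  note kG = subgroup_inG[OF K k(1)]
  have c: "x \<in> carrier G" if "x \<in> cen t" for x using that by (simp add: cen_def)
  have "{a \<in> K. cg a t = b} = (\<lambda>x. k \<otimes> x) ` cen t"
  proof
    show "(\<lambda>x. k \<otimes> x) ` cen t \<subseteq> {a \<in> K. cg a t = b}"
    proof
      fix a assume "a \<in> (\<lambda>x. k \<otimes> x) ` cen t"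
      then obtain x where x: "x \<in> cen t" "a = k \<otimes> x" by blast
      have "cg x t = t" using x c[OF x(1)] t by (simp add: cg_eq_self cen_def)
      then have "cg a t = b" using cg_cg[OF kG c[OF x(1)] t(1)] x k by simp
      then show "a \<in> {a \<in> K. cg a t = b}" using x k t subgroup.m_closed[OF K] by blast
    qed
    show "{a \<in> K. cg a t = b} \<subseteq> (\<lambda>x. k \<otimes> x) ` cen t"
    proof
      fix a assume a: "a \<in> {a \<in> K. cg a t = b}"
      then have aG: "a \<in> carrier G" using subgroup_inG[OF K] by simp
      have "cg (inv k \<otimes> a) t = t" using cg_cg[of "inv k" a t] aG kG t a k by simp
      then have "inv k \<otimes> a \<in> cen t" using cg_eq_self[of "inv k \<otimes> a" t] aG kG t by (simp add: cen_def)
      moreover have "a = k \<otimes> (inv k \<otimes> a)" using aG kG by (simp add: m_assoc[symmetric])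
      ultimately show "a \<in> (\<lambda>x. k \<otimes> x) ` cen t" by blast
    qed
  qed
  moreover have "inj_on (\<lambda>x. k \<otimes> x) (cen t)" using kG c by (intro inj_onI) simp
  ultimately show "card {a \<in> K. cg a t = b} = card (cen t)" by (simp add: card_image)
qed

text \<open>By trivial intersection any element of G taking one involution of S to another lies in
  H, so H is transitive on the q involutions of S, with stabiliser S.\<close>

lemma card_H: "card H = card S * q"
proof -
  obtain t where t: "t \<in> S" "t \<noteq> \<one>" using sylD(5)[OF S] subgroup.one_closed[OF sylD(3)[OF S]] by blast
  note tG = sylD(7)[OF S t(1)] and ct = cen_involution[OF S t]
  have "(\<lambda>h. cg h t) ` H = S - {\<one>}"
  proof
    show "(\<lambda>h. cg h t) ` H \<subseteq> S - {\<one>}" using HS H(3) t tG by auto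
    show "S - {\<one>} \<subseteq> (\<lambda>h. cg h t) ` H"
    proof
      fix u assume u: "u \<in> S - {\<one>}"
      then obtain g where g: "g \<in> carrier G" "cg g t = u" using invols_conj S_invols t by blast
      then have "g \<in> H" using S_TI t u by blast
      then show "u \<in> (\<lambda>h. cg h t) ` H" using g by blast
    qed
  qed
  then have "card ((\<lambda>h. cg h t) ` H) = q"
    using subgroup_finite[OF sylD(3)[OF S]] subgroup.one_closed[OF sylD(3)[OF S]] by (simp add: q_def)
  then show ?thesis using conj_fibre[OF H(1) tG] ct H(2) by simp
qed

lemma card_S: "\<exists>n. n > 0 \<and> card S = 2 ^ n" "card S = q + 1" "q > 0"
proof -
  obtain n where n: "card S = 2 ^ n" using sylD(4)[OF S] by blast
  have "n \<noteq> 0"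
  proof
    assume "n = 0"
    then have "card S = 1" using n by simp
    then show False using sylD(5)[OF S] subgroup.one_closed[OF sylD(3)[OF S]] by (metis card_1_singletonE singletonD)
  qed
  then show "\<exists>n. n > 0 \<and> card S = 2 ^ n" using n by blast
  have "(2::nat) ^ n > 1" using power_increasing[of 1 n "2::nat"] \<open>n \<noteq> 0\<close> by simp
  then show "card S = q + 1" "q > 0" using n by (auto simp: q_def)
qed

text \<open>For q = 1 the subgroup S is self-normalising and
  \<open>complement_linear_character\<close> applies. For k in the kernel of l, the value l (y k) is
  not 1, so y k is an involution by \<open>hom_concentrated\<close>. Hence y inverts the kernel,
  which is abelian; it yields a normal p-subgroup, or, if it is trivial, the abelian group G
  does.\<close>

lemma q_not_1: "q \<noteq> 1"
proof
  assume q1: "q = 1"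
  have cS: "card S = 2" using card_S q1 by simp
  have "card H = card S" using card_H q1 by simp
  then have "S = H" using H(2) subgroup_finite[OF H(1)] by (intro card_subset_eq) auto
  then have nS: "nrm S = S" by (simp add: H_def)
  have cS1: "card S = 2 ^ 1" using cS by simp
  obtain l y where l: "mult_char l" and y: "y \<in> S" "l y \<noteq> 1"
    using complement_linear_character[OF sylD(1)[OF S] sylD(3)[OF S] cS1 sylD(5)[OF S] sylD(6)[OF S] syl_TI[OF S] nS] by blast
  note K = ker_subgroup[OF l]
  note yG = sylD(7)[OF S y(1)]
  have y1: "y \<noteq> \<one>" using y mult_charD(2)[OF l] by auto
  note yi = involsD[OF S_invols[OF y(1) y1]]
  have inverted: "cg y k = inv k" if k: "k \<in> ker l" for k
  proof -
    have kG: "k \<in> carrier G" "l k = 1" using k by (auto simp: ker_def)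
    have "l (y \<otimes> k) \<noteq> 1" using mult_charD(1)[OF l yG kG(1)] kG y by simp
    then have "(y \<otimes> k) [^] (2::nat) = \<one>"
      using hom_concentrated[OF l yG y(2) sylD(6)[OF S y(1)] sylD(1)[OF S], of "y \<otimes> k"] yG kG by auto
    then have "y \<otimes> k \<otimes> y \<otimes> k = \<one>" using yG kG by (simp add: numeral_2_eq_2 m_assoc)
    then show ?thesis using yG kG yi by (simp add: cg_def inv_equality)
  qed
  have kc: "x \<otimes> z = z \<otimes> x" if "x \<in> ker l" "z \<in> ker l" for x z
    by (rule inverted_comm[OF K yG inverted that])
  show False
  proof (cases "ker l = {\<one>}")
    case True
    have "carrier G \<noteq> {\<one>}" using yG y1 by auto
    then have "\<exists>p V. normal_pgroup p V"
      by (rule abelian_normal[OF subgroup_self]) (use ker_trivial_comm[OF l True] in auto)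
    then show False using simple by blast
  next
    case False
    have "\<exists>p V. normal_pgroup p V" by (rule abelian_normal[OF K False ker_normal[OF l] kc])
    then show False using simple by blast
  qed
qed

lemma q_prime: "Factorial_Ring.prime q" "odd q"
proof -
  have "card H = card S \<or> (\<exists>r. Factorial_Ring.prime r \<and> r \<noteq> 2 \<and> card H = card S * r)"
    unfolding H_def by (rule syl_normalizer(2)[OF S])
  then show p: "Factorial_Ring.prime q"
  proof
    assume "card H = card S"
    then have "card S * q = card S * 1" using card_H by simp
    then show ?thesis using card_S q_not_1 by (simp only: mult_cancel1) simp
  next
    assume "\<exists>r. Factorial_Ring.prime r \<and> r \<noteq> 2 \<and> card H = card S * r"
    then obtain r where r: "Factorial_Ring.prime r" "card S * q = card S * r" using card_H by auto
    then have "q = r" using card_S by (simp only: mult_cancel1) simp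
    then show ?thesis using r by simp
  qed
  obtain n where n: "n > 0" "card S = 2 ^ n" using card_S(1) by blast
  then have "even (card S)" by simp
  then show "odd q" using card_S(2) by simp
qed

section \<open>Even order\<close>

lemma SG: "subgroup S G" "s \<in> S \<Longrightarrow> s \<in> carrier G"
  using sylD(3,7)[OF S] by auto

lemma card_Hq: "card H = (q + 1) * q"
  using card_H card_S(2) by simp

lemma q_ge_3: "q \<ge> 3"
proof -
  have "q \<ge> 2" using prime_ge_2_nat[OF q_prime(1)] .
  moreover have "q \<noteq> 2" using q_prime(2) by auto
  ultimately show ?thesis by simp
qed

lemma H_square: "h \<in> H \<Longrightarrow> h [^] (2::nat) = \<one> \<Longrightarrow> h \<in> S"
  unfolding H_def by (rule syl_normalizer(1)[OF S])

lemma q_square_not_dvd: "\<not> q ^ Suc 1 dvd card H"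
proof
  assume "q ^ Suc 1 dvd card H"
  then have "q * q dvd (q + 1) * q" by (simp add: card_Hq)
  then have "q dvd q + 1" using q_ge_3 by simp
  then have "q dvd 1" by (metis dvd_add_right_iff dvd_refl)
  then show False using q_ge_3 by simp
qed

lemma H_order_q:
  assumes h: "h \<in> H" "h \<notin> S"
  shows "h [^] q = \<one>"
proof -
  obtain p where p: "Factorial_Ring.prime p" "h [^] (p::nat) = \<one>" using pog H(3)[OF h(1)] by blast
  have h1: "h \<noteq> \<one>" using h subgroup.one_closed[OF SG(1)] by auto
  have "p dvd card H" by (rule elem_prime_dvd_card[OF H(1) h(1) h1 p(2,1)])
  then have "p dvd card S \<or> p dvd q" unfolding card_H using prime_dvd_mult_iff[OF p(1)] by simp
  then show ?thesis
  proof
    assume "p dvd card S"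
    then have "p dvd 2" using card_S(1) p(1) prime_dvd_power by metis
    then have "p = 2" using primes_dvd_imp_eq[OF p(1) two_is_prime_nat] by simp
    then show ?thesis using H_square h p by simp
  next
    assume "p dvd q"
    then show ?thesis using primes_dvd_imp_eq[OF p(1) q_prime(1)] p by simp
  qed
qed

lemma odd_subgroup_H:
  assumes K: "subgroup K G" "K \<subseteq> H" "K \<inter> S \<subseteq> {\<one>}"
  shows "x \<in> K \<Longrightarrow> x [^] q = \<one>" "card K = 1 \<or> card K = q"
proof -
  show ex: "x [^] q = \<one>" if "x \<in> K" for x
    using H_order_q[of x] K that by (cases "x \<in> S") auto
  obtain a where a: "card K = q ^ a" using exponent_card_power[OF K(1) q_prime(1) ex] by blast
  have "a < Suc 1"
  proof (rule ccontr)
    assume "\<not> a < Suc 1"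
    then have "q ^ Suc 1 dvd card K" unfolding a by (intro le_imp_power_dvd) simp
    then show False using subgroup_card_dvd_subgroup[OF K(1) H(1) K(2)] q_square_not_dvd dvd_trans by blast
  qed
  then show "card K = 1 \<or> card K = q" using a by (cases a) auto
qed

text \<open>For an involution u, the stabiliser of the two points H and u H of the coset
  space.\<close>

definition DD :: "'a \<Rightarrow> 'a set" where "DD u = {h \<in> H. cg u h \<in> H}"

lemma DD_subgroup:
  assumes u: "u \<in> carrier G"
  shows "subgroup (DD u) G"
proof (rule subgroupI)
  show "DD u \<subseteq> carrier G" "DD u \<noteq> {}" using H(3) subgroup.one_closed[OF H(1)] u by (auto simp: DD_def)
  fix x y assume x: "x \<in> DD u" and y: "y \<in> DD u"
  show "x \<otimes> y \<in> DD u" using x y u H(3) subgroup.m_closed[OF H(1)] by (auto simp: DD_def cg_mult)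
  show "inv x \<in> DD u" using x u H(3) subgroup.m_inv_closed[OF H(1)] by (auto simp: DD_def cg_inv)
qed

lemma DD:
  assumes u: "u \<in> invols" "u \<notin> H"
  shows "x \<in> DD u \<Longrightarrow> x [^] q = \<one>" "card (DD u) = 1 \<or> card (DD u) = q"
proof -
  note uG = involsD(1)[OF u(1)]
  have s1: "s = \<one>" if "s \<in> DD u" "s \<in> S" for s
  proof (rule ccontr)
    assume s1: "s \<noteq> \<one>"
    then have "cg u s \<in> invols" using cg_invols[OF uG S_invols[OF that(2)]] by simp
    then have "cg u s \<in> S" using H_square involsD(5) that by (simp add: DD_def)
    then show False using S_TI[OF uG that(2) s1] u by simp
  qed
  have s: "subgroup (DD u) G" "DD u \<subseteq> H" "DD u \<inter> S \<subseteq> {\<one>}"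
    using DD_subgroup[OF uG] s1 by (auto simp: DD_def)
  show "x \<in> DD u \<Longrightarrow> x [^] q = \<one>" "card (DD u) = 1 \<or> card (DD u) = q" using odd_subgroup_H[OF s] by auto
qed

lemma coset_products:
  assumes x: "x \<in> carrier G" and u: "u \<in> invols" "inv x \<otimes> u \<in> H" and v: "v \<in> invols" "inv x \<otimes> v \<in> H"
  shows "u \<otimes> v \<in> DD u" "cg u (u \<otimes> v) = inv (u \<otimes> v)"
proof -
  note uv = involsD[OF u(1)] involsD[OF v(1)]
  have "inv (inv x \<otimes> u) \<otimes> (inv x \<otimes> v) \<in> H" using u v subgroup.m_closed[OF H(1)] subgroup.m_inv_closed[OF H(1)] by blast
  moreover have "inv (inv x \<otimes> u) \<otimes> (inv x \<otimes> v) = u \<otimes> (x \<otimes> (inv x \<otimes> v))"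
    using uv x by (simp add: inv_mult_group m_assoc)
  moreover have "x \<otimes> (inv x \<otimes> v) = v" using uv x by (simp add: m_assoc[symmetric])
  ultimately have uvH: "u \<otimes> v \<in> H" by simp
  show i: "cg u (u \<otimes> v) = inv (u \<otimes> v)" using uv by (simp add: cg_def inv_mult_group m_assoc[symmetric])
  show "u \<otimes> v \<in> DD u" using uvH subgroup.m_inv_closed[OF H(1) uvH] i by (simp add: DD_def)
qed

text \<open>Left multiplication by an involution u of the coset maps the involutions of the coset
  injectively into \<open>DD u\<close>, a group of order 1 or q, and to elements inverted by u. If
  there are q of them, they fill \<open>DD u\<close>.\<close>

lemma coset_invols:
  assumes x: "x \<in> carrier G" "x \<notin> H"
  defines "J \<equiv> {v \<in> invols. inv x \<otimes> v \<in> H}"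
  shows "card J \<le> q" "u \<in> J \<Longrightarrow> u \<notin> H" "card J = q \<Longrightarrow> u \<in> J \<Longrightarrow> card (DD u) = q \<and> (\<forall>h\<in>DD u. cg u h = inv h)"
proof -
  show uH: "u \<notin> H" if "u \<in> J" for u
  proof
    assume u: "u \<in> H"
    have uG: "u \<in> carrier G" using H(3)[OF u] .
    have "u \<otimes> inv (inv x \<otimes> u) \<in> H"
      using u that subgroup.m_closed[OF H(1)] subgroup.m_inv_closed[OF H(1)] by (simp add: J_def)
    moreover have "u \<otimes> inv (inv x \<otimes> u) = x" using uG x by (simp add: inv_mult_group m_assoc[symmetric])
    ultimately show False using x by simp
  qed
  have im: "(\<lambda>v. u \<otimes> v) ` J \<subseteq> DD u" if "u \<in> J" for u
    using coset_products(1)[OF x(1)] that by (auto simp: J_def)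
  have ci: "card ((\<lambda>v. u \<otimes> v) ` J) = card J" if "u \<in> J" for u
  proof (rule card_image, rule inj_onI)
    fix v w assume "v \<in> J" "w \<in> J" "u \<otimes> v = u \<otimes> w"
    then show "v = w" using that involsD(1) by (auto simp: J_def)
  qed
  have fD: "finite (DD u)" for u using subgroup_finite[OF H(1)] by (simp add: DD_def)
  have cD: "card (DD u) \<le> q" if "u \<in> J" for u
    using DD(2)[of u] uH[OF that] that q_ge_3 by (auto simp: J_def)
  have le: "card J \<le> card (DD u)" if "u \<in> J" for u using card_mono[OF fD im[OF that]] ci[OF that] by simp
  show "card J \<le> q"
  proof (cases "J = {}")
    case False
    then obtain u where u: "u \<in> J" by blast
    show ?thesis using le[OF u] cD[OF u] by simp
  qed simp
  assume J: "card J = q" and u: "u \<in> J"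
  have cq: "card (DD u) = q" using le[OF u] cD[OF u] J by simp
  then have "(\<lambda>v. u \<otimes> v) ` J = DD u" using ci[OF u] J im[OF u] fD by (intro card_subset_eq) auto
  moreover have "\<forall>h\<in>(\<lambda>v. u \<otimes> v) ` J. cg u h = inv h"
    using coset_products(2)[OF x(1)] u by (auto simp: J_def)
  ultimately show "card (DD u) = q \<and> (\<forall>h\<in>DD u. cg u h = inv h)" using cq by simp
qed

definition NN :: nat where "NN = card (lcs H)"

lemma card_G: "card (carrier G) = (q + 1) * q * NN"
  using card_lcs[OF H(1)] by (simp add: card_Hq NN_def)

text \<open>The involutions form one class, with centralisers of order q + 1.\<close>

lemma card_invols: "card invols = q * NN"
proof -
  obtain t where t: "t \<in> S" "t \<noteq> \<one>" using sylD(5)[OF S] subgroup.one_closed[OF SG(1)] by blast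
  have ct: "cen t \<subseteq> carrier G" by (auto simp: cen_def)
  have "(\<lambda>h. cg h t) ` carrier G = invols"
    using cg_invols S_invols[OF t] invols_conj[OF S_invols[OF t]] by blast
  then have "card (carrier G) = (q + 1) * card invols"
    using conj_fibre[OF subgroup_self SG(2)[OF t(1)] ct] cen_involution[OF S t] card_S(2) by simp
  then have "(q + 1) * card invols = (q + 1) * (q * NN)" by (simp only: card_G mult.assoc)
  then show ?thesis by (simp only: mult_cancel1) simp
qed

text \<open>There are q * NN involutions, q of them in H, and every coset other than H contains at most q of
  them; hence each such coset contains exactly q.\<close>

lemma coset_inverter:
  assumes x: "x \<in> carrier G" "x \<notin> H"
  obtains u where "u \<in> invols" "u \<notin> H" "inv x \<otimes> u \<in> H" "card (DD u) = q" "\<And>h. h \<in> DD u \<Longrightarrow> cg u h = inv h"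
proof -
  let ?F = "\<lambda>c. {v \<in> invols. v <# H = c}"
  have fi: "finite invols" using fin by (simp add: invols_def)
  have "card invols = (\<Sum>c\<in>lcs H. card (?F c))"
  proof -
    have "(\<lambda>v. v <# H) ` invols \<subseteq> lcs H" using involsD(1) by (auto simp: lcs_def)
    then show ?thesis using sum.group[OF fi lcs_finite, of "\<lambda>v. v <# H" H "\<lambda>_. 1::nat"] by simp
  qed
  then have tot: "(\<Sum>c\<in>lcs H. card (?F c)) = (\<Sum>c\<in>lcs H. q)" using card_invols by (simp add: NN_def mult.commute[of q])
  have F: "?F (y <# H) = {v \<in> invols. inv y \<otimes> v \<in> H}" if "y \<in> carrier G" for y
    using lcos_eq_iff[OF H(1) that] involsD(1) by auto
  have le: "card (?F c) \<le> q" if "c \<in> lcs H" for c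
  proof -
    obtain y where y: "y \<in> carrier G" "c = y <# H" using \<open>c \<in> lcs H\<close> by (auto simp: lcs_def)
    show ?thesis
    proof (cases "y \<in> H")
      case False
      then show ?thesis using coset_invols(1)[OF y(1)] F y by simp
    next
      case True
      have "{v \<in> invols. inv y \<otimes> v \<in> H} \<subseteq> S - {\<one>}"
      proof
        fix v assume v: "v \<in> {v \<in> invols. inv y \<otimes> v \<in> H}"
        then have vG: "v \<in> carrier G" using involsD(1) by simp
        have "y \<otimes> (inv y \<otimes> v) \<in> H" using v subgroup.m_closed[OF H(1) True] by simp
        then have "v \<in> H" using vG y by (simp add: m_assoc[symmetric])
        then show "v \<in> S - {\<one>}" using H_square involsD v by blast
      qed
      moreover have "card (S - {\<one>}) = q" using subgroup_finite[OF SG(1)] subgroup.one_closed[OF SG(1)] card_S by simp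
      ultimately have "card {v \<in> invols. inv y \<otimes> v \<in> H} \<le> q"
        using card_mono[OF finite_Diff[OF subgroup_finite[OF SG(1)]]] by metis
      then show ?thesis using F[OF y(1)] y(2) by simp
    qed
  qed
  have xc: "x <# H \<in> lcs H" using x by (auto simp: lcs_def)
  have "card (?F (x <# H)) = q"
  proof (rule ccontr)
    assume "card (?F (x <# H)) \<noteq> q"
    then have "card (?F (x <# H)) < q" using le[OF xc] by simp
    then have "(\<Sum>c\<in>lcs H. card (?F c)) < (\<Sum>c\<in>lcs H. q)"
      using le xc by (intro sum_strict_mono_ex1 lcs_finite) auto
    then show False using tot by simp
  qed
  then have J: "card {v \<in> invols. inv x \<otimes> v \<in> H} = q" using F[OF x(1)] by simp
  then have "{v \<in> invols. inv x \<otimes> v \<in> H} \<noteq> {}" using J q_ge_3 by (metis card.empty not_numeral_le_zero)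
  then obtain u where u: "u \<in> {v \<in> invols. inv x \<otimes> v \<in> H}" by blast
  show thesis
    using that[of u] u coset_invols(2)[OF x u] coset_invols(3)[OF x J u] by blast
qed

lemma cyc_in_H:
  assumes "h \<in> H" "h \<notin> S"
  shows "subgroup (cyc h) G" "card (cyc h) = q" "cyc h \<subseteq> H" "h \<in> carrier G" "h \<noteq> \<one>"
proof -
  show h: "h \<in> carrier G" "h \<noteq> \<one>" using assms H(3) subgroup.one_closed[OF SG(1)] by auto
  show "subgroup (cyc h) G" "card (cyc h) = q" using cyc_prime[OF h H_order_q[OF assms] q_prime(1)] by auto
  show "cyc h \<subseteq> H" by (rule cyc_sub[OF H(1) assms(1)])
qed

lemma H_cyc_conj:
  assumes h: "h \<in> H" "h \<notin> S" and h': "h' \<in> H" "h' \<notin> S"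
  obtains k where "k \<in> H" "cg k ` cyc h = cyc h'"
proof -
  interpret HH: pog "G\<lparr>carrier := H\<rparr>" by (rule subgroup_pog[OF H(1)])
  note c = cyc_in_H[OF h] and c' = cyc_in_H[OF h']
  have s: "subgroup (cyc h) (G\<lparr>carrier := H\<rparr>)" "subgroup (cyc h') (G\<lparr>carrier := H\<rparr>)"
    using subgroup_incl H(1) c c' by blast+
  have d: "card (cyc h) = q ^ 1" "card (cyc h') = q ^ 1" using c c' by auto
  have nd: "\<not> q ^ Suc 1 dvd card (carrier (G\<lparr>carrier := H\<rparr>))" using q_square_not_dvd by simp
  obtain k where k: "k \<in> H" "cyc h' \<subseteq> HH.cg k ` cyc h"
    using HH.sylow_contains[OF q_prime(1) s(1) d(1) nd s(2) d(2)] by auto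
  have "HH.cg k ` cyc h = cg k ` cyc h"
    using k m_inv_consistent[OF H(1)] by (simp add: HH.cg_def cg_def)
  then have "cyc h' \<subseteq> cg k ` cyc h" using k by simp
  moreover have "card (cg k ` cyc h) = q" using cg_subgroup(2)[OF c(1) H(3)[OF k(1)]] c by simp
  ultimately have "cyc h' = cg k ` cyc h"
    using c' subgroup_finite[OF c(1)] by (intro card_subset_eq) auto
  then show thesis using that k by simp
qed

text \<open>Subgroups of order q in H are conjugate by Sylow's theorem in H, and one of them, some
  \<open>DD u\<close>, is inverted by the involution u.\<close>

lemma H_inverter:
  assumes h: "h \<in> H" "h \<notin> S"
  obtains u where "u \<in> invols" "cg u h = inv h"
proof -
  have "H \<subset> carrier G" using not_normal H(3) by (auto simp: H_def)
  then obtain x where x: "x \<in> carrier G" "x \<notin> H" by blast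
  obtain u where u: "u \<in> invols" "u \<notin> H" "card (DD u) = q" "\<And>d. d \<in> DD u \<Longrightarrow> cg u d = inv d"
    using coset_inverter[OF x] by blast
  note uG = involsD(1)[OF u(1)]
  have "DD u \<noteq> {\<one>}" using u(3) q_ge_3 by auto
  then obtain d where d: "d \<in> DD u" "d \<noteq> \<one>" using subgroup.one_closed[OF DD_subgroup[OF uG]] by blast
  have dH: "d \<in> H" "d \<notin> S"
  proof -
    show "d \<in> H" using d by (simp add: DD_def)
    show "d \<notin> S"
    proof
      assume "d \<in> S"
      then have "d [^] (2::nat) = \<one>" using sylD(6)[OF S] by blast
      then show False
        using pow_distinct_primes[OF H(3)[OF \<open>d \<in> H\<close>] _ DD(1)[OF u(1,2) d(1)] two_is_prime_nat q_prime(1)] d q_ge_3 by simp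
    qed
  qed
  obtain k where k: "k \<in> H" "cg k ` cyc d = cyc h" using H_cyc_conj[OF dH h] by blast
  note kG = H(3)[OF k(1)]
  have "h \<in> cg k ` cyc d" using cyc_mem[OF H(3)[OF h(1)]] k by simp
  then obtain e where e: "e \<in> cyc d" "h = cg k e" by blast
  have eD: "e \<in> DD u" using cyc_sub[OF DD_subgroup[OF uG] d(1)] e by blast
  have eG: "e \<in> carrier G" using eD H(3) by (simp add: DD_def)
  have "cg (cg k u) h = cg k (cg u e)"
    using kG uG eG by (simp add: e cg_def inv_mult_group m_assoc) (simp add: m_assoc[symmetric])
  also have "\<dots> = inv h" using u(4)[OF eD] kG eG e by (simp add: cg_inv)
  finally show thesis using that cg_invols[OF kG u(1)] by blast
qed

text \<open>An involution u inverting z has no nontrivial fixed point on \<open>cen z\<close>, since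
  a fixed element would have exponent 2 and exponent q; so u inverts \<open>cen z\<close>, which is
  abelian. For z = h this concerns A; for a nontrivial z in A it gives an abelian
  \<open>cen z\<close> containing h, hence contained in A.\<close>

lemma torus:
  assumes h: "h \<in> H" "h \<notin> S"
  defines "A \<equiv> cen h"
  shows "subgroup A G" "\<exists>a. card A = q ^ a" "x \<in> A \<Longrightarrow> y \<in> A \<Longrightarrow> x \<otimes> y = y \<otimes> x"
    "z \<in> A \<Longrightarrow> z \<noteq> \<one> \<Longrightarrow> cen z = A" "z \<in> A \<Longrightarrow> z [^] q = \<one>"
    "\<exists>u\<in>invols. \<forall>z\<in>A. cg u z = inv z"
proof -
  note c = cyc_in_H[OF h] and hq = H_order_q[OF h]
  show A: "subgroup A G" using cen_subgroup[OF c(4)] by (simp add: A_def)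
  have ex: "y [^] q = \<one>" if "y \<in> cen z" "z \<in> carrier G" "z \<noteq> \<one>" "z [^] q = \<one>" for y z
    using cen_exponent[OF that(2-4) q_prime(1) that(1)] .
  show "\<exists>a. card A = q ^ a" using cen_card[OF c(4,5) hq q_prime(1)] by (simp add: A_def)
  show exA: "z [^] q = \<one>" if "z \<in> A" for z using ex[of z h] that c hq by (simp add: A_def)
  obtain u where u: "u \<in> invols" "cg u h = inv h" using H_inverter[OF h] by blast
  note u' = involsD[OF u(1)]
  have inverted: "cg u y = inv y" if z: "z \<in> carrier G" "z \<noteq> \<one>" "z [^] q = \<one>" "cg u z = inv z" and y: "y \<in> cen z" for y z
  proof (rule fixed_point_free_inverts[OF cen_subgroup[OF z(1)] u'(1,3) _ _ y])
    fix a assume a: "a \<in> cen z"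
    then have aG: "a \<in> carrier G" "a \<otimes> z = z \<otimes> a" by (auto simp: cen_def)
    have "cg u a \<otimes> inv z = inv z \<otimes> cg u a"
      using cg_mult[OF u'(1) aG(1) z(1)] cg_mult[OF u'(1) z(1) aG(1)] aG(2) z(4) by simp
    moreover have "z \<otimes> cg u a = z \<otimes> (cg u a \<otimes> inv z) \<otimes> z" using z u' aG by (simp add: m_assoc)
    moreover have "z \<otimes> (inv z \<otimes> cg u a) \<otimes> z = cg u a \<otimes> z" using z u' aG by (simp add: m_assoc[symmetric])
    ultimately have "z \<otimes> cg u a = cg u a \<otimes> z" by simp
    then show "cg u a \<in> cen z" using u' aG by (simp add: cen_def)
    assume "cg u a = a"
    then have "a \<in> cen u" using cg_eq_self[OF u'(1) aG(1)] aG by (simp add: cen_def)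
    then have "a [^] (2::nat) = \<one>" using sylD(6)[OF invol_syl[OF u(1)]] by blast
    then show "a = \<one>"
      using pow_distinct_primes[OF aG(1) _ ex[OF a z(1-3)] two_is_prime_nat q_prime(1)] q_ge_3 by simp
  qed
  have invA: "cg u z = inv z" if "z \<in> A" for z using inverted[of h z] that c hq u by (simp add: A_def)
  then show "\<exists>u\<in>invols. \<forall>z\<in>A. cg u z = inv z" using u by blast
  show comm: "x \<otimes> y = y \<otimes> x" if "x \<in> A" "y \<in> A" for x y
    by (rule inverted_comm[OF A u'(1) invA that])
  show "cen z = A" if z: "z \<in> A" "z \<noteq> \<one>" for z
  proof
    have zG: "z \<in> carrier G" using z subgroup_inG[OF A] by blast
    show "A \<subseteq> cen z" using comm[OF _ z(1)] subgroup_inG[OF A] by (auto simp: cen_def)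
    have hz: "h \<in> cen z" using cen_sym[OF c(4)] z by (simp add: A_def)
    show "cen z \<subseteq> A"
    proof
      fix y assume y: "y \<in> cen z"
      have "y \<otimes> h = h \<otimes> y"
        by (rule inverted_comm[OF cen_subgroup[OF zG] u'(1) _ y hz]) (rule inverted[OF zG z(2) exA[OF z(1)] invA[OF z(1)]])
      then show "y \<in> A" using y by (simp add: A_def cen_def)
    qed
  qed
qed

text \<open>The elements of exponent q in \<open>nrm V\<close> form a q-group T, which fixes a
  nontrivial z in V; so T lies in \<open>cen z\<close>, which is \<open>cen h\<close>. The index of
  T is 1 or a prime, and the inverting involution in \<open>nrm V\<close> makes it 2.\<close>

lemma torus_normalizer:
  assumes h: "h \<in> H" "h \<notin> S" and V: "subgroup V G" "V \<subseteq> cen h" "V \<noteq> {\<one>}"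
  shows "card (nrm V) = 2 * card (cen h)" "x \<in> nrm V \<Longrightarrow> x [^] q = \<one> \<Longrightarrow> x \<in> cen h"
proof -
  define A where "A = cen h"
  note t = torus[OF h, folded A_def]
  have VA: "V \<subseteq> A" using V by (simp add: A_def)
  obtain b where b: "card V = q ^ b" using exponent_card_power[OF V(1) q_prime(1)] t(5) VA by blast
  define T where "T = {x \<in> nrm V. x [^] q = \<one>}"
  note N = nrm_subgroup[OF V(1)]
  have T: "subgroup T G" "\<exists>a. card T = q ^ a"
    "card (nrm V) = card T \<or> (\<exists>r. Factorial_Ring.prime r \<and> r \<noteq> q \<and> card (nrm V) = card T * r)"
    unfolding T_def using subgroup_structure[OF N(1) q_prime(1) V(1) N(2) V(3) b] nrmD(1) by blast+
  obtain a where a: "card T = q ^ a" using T(2) by blast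
  have Tn: "cg s v \<in> V" if "s \<in> T" "v \<in> V" for s v using that nrmD(1) by (simp add: T_def)
  obtain z where z: "z \<in> V" "z \<noteq> \<one>" "\<And>s. s \<in> T \<Longrightarrow> cg s z = z"
    using pgroup_fixes_element[OF q_prime(1) T(1) a V(1) b V(3) Tn] by blast
  have zA: "z \<in> A" using z VA by blast
  have AG: "y \<in> carrier G" if "y \<in> A" for y using that subgroup_inG[OF t(1)] by blast
  have "T = A"
  proof
    show "T \<subseteq> A"
    proof
      fix s assume s: "s \<in> T"
      have sG: "s \<in> carrier G" using s nrmD(2) by (auto simp: T_def)
      have "s \<in> cen z" using z(3)[OF s] cg_eq_self[OF sG AG[OF zA]] sG by (simp add: cen_def)
      then show "s \<in> A" using t(4)[OF zA z(2)] by simp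
    qed
    show "A \<subseteq> T"
    proof
      fix y assume y: "y \<in> A"
      have "cg y v = v" if "v \<in> V" for v using t(3)[OF y] VA that AG[OF y] AG by (subst cg_eq_self) auto
      then have "y \<in> nrm V" using AG[OF y] by (intro nrmI[OF V(1)]) auto
      then show "y \<in> T" using t(5)[OF y] by (simp add: T_def)
    qed
  qed
  then show "x \<in> nrm V \<Longrightarrow> x [^] q = \<one> \<Longrightarrow> x \<in> cen h" unfolding A_def[symmetric] by (auto simp: T_def)
  obtain u where u: "u \<in> invols" "\<And>z. z \<in> A \<Longrightarrow> cg u z = inv z" using t(6) by blast
  have "u \<in> nrm V"
    using u(2) VA subgroup.m_inv_closed[OF V(1)] by (intro nrmI[OF V(1) involsD(1)[OF u(1)]]) auto
  then have even: "2 dvd card (nrm V)" using elem_prime_dvd_card[OF N(1) _ involsD(2,5)[OF u(1)]] by simp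
  have oddT: "\<not> 2 dvd card T" using a q_prime(2) by simp
  then obtain r where r: "Factorial_Ring.prime r" "card (nrm V) = card T * r" using T(3) even by auto
  then have "2 dvd r" using even oddT by simp
  then have "r = 2" using primes_dvd_imp_eq[OF two_is_prime_nat r(1)] by simp
  then show "card (nrm V) = 2 * card (cen h)" using r \<open>T = A\<close> by (simp add: A_def)
qed

text \<open>A larger q-group would contain an element normalising \<open>cen h\<close> outside it,
  against \<open>torus_normalizer\<close>.\<close>

lemma torus_syl:
  assumes h: "h \<in> H" "h \<notin> S"
  shows "syl q (cen h)"
proof -
  define A where "A = cen h"
  note t = torus[OF h, folded A_def] and c = cyc_in_H[OF h]
  have hA: "h \<in> A" using cen_self[OF c(4)] by (simp add: A_def)
  obtain a where a: "card A = q ^ a" using t(2) by blast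
  have qd: "q dvd card (carrier G)" by (simp add: card_G)
  obtain P where P: "syl q P" using syl_ex[OF q_prime(1) qd] by blast
  obtain g where g: "g \<in> carrier G" "A \<subseteq> cg g ` P" using syl_contains[OF P t(1) a] by blast
  define Q where "Q = cg g ` P"
  have Q: "syl q Q" unfolding Q_def by (rule syl_cg[OF P g(1)])
  obtain b where b: "card Q = q ^ b" using sylD(4)[OF Q] by blast
  have "A = Q"
  proof (rule ccontr)
    assume "A \<noteq> Q"
    then have "A \<subset> Q" using g by (auto simp: Q_def)
    then obtain x where x: "x \<in> Q" "x \<notin> A" "x \<in> nrm A"
      using normalizer_grows[OF q_prime(1) sylD(3)[OF Q] b t(1)] by blast
    have "A \<noteq> {\<one>}" using hA c by auto
    then have "x \<in> A" using torus_normalizer(2)[OF h t(1) _ _ x(3) sylD(6)[OF Q x(1)]] by (simp add: A_def)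
    then show False using x by simp
  qed
  then show ?thesis using Q by (simp add: A_def)
qed

end

text \<open>N is the number of points on which G acts, f the number of points fixed by an element h of order q
  in a point stabiliser, q ^ a the order of the centraliser of h and n the number of Sylow q-subgroups.\<close>

lemma even_order_arithmetic:
  fixes q N n f a :: nat
  assumes q: "Factorial_Ring.prime q" "q \<ge> 3" and N: "(q + 1) * q * N = 2 * q ^ a * n"
    and f: "N = 1 + (q + 1) * (f - 1)" "f \<ge> 1" "q * f = 2 * q ^ a" and n: "n mod q = 1"
  shows "a = 1"
proof (cases a)
  case 0
  then have "q dvd 2" using f(3) by (metis dvd_triv_left mult.right_neutral power_0)
  then show ?thesis using q(2) by (auto dest: dvd_imp_le)
next
  case (Suc b)
  have f2: "f = 2 * q ^ b" using f(3) q(2) Suc by simp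
  show ?thesis
  proof (cases b)
    case (Suc e)
    \<comment> \<open>Inserting f gives N = q M; then two factors q cancel from the order equation
      and leave (q + 1) M = 2 q^e n.\<close>
    define M :: int where "M = 2 * (int q + 1) * int q ^ e - 1"
    have fi: "int f = 2 * int q * int q ^ e" using f2 Suc by simp
    obtain k where k: "f = Suc k" using f(2) by (cases f) auto
    have "int N = 1 + (int q + 1) * int k" using f(1) by (simp add: k algebra_simps)
    also have "int k = 2 * int q * int q ^ e - 1" using fi k by simp
    also have "1 + (int q + 1) * (2 * int q * int q ^ e - 1) = int q * M" by (simp add: M_def algebra_simps)
    finally have Ni: "int N = int q * M" .
    have "int q * int q * ((int q + 1) * M) = (int q + 1) * int q * int N" by (simp only: Ni mult_ac)
    also have "\<dots> = int ((q + 1) * q * N)" by (simp add: algebra_simps)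
    also have "\<dots> = 2 * int q ^ a * int n" unfolding N by simp
    also have "\<dots> = int q * int q * (2 * int q ^ e * int n)"
      by (simp only: Suc \<open>a = Suc b\<close> power_Suc mult_ac)
    finally have "int q * int q * ((int q + 1) * M) = int q * int q * (2 * int q ^ e * int n)" .
    moreover have "int q * int q \<noteq> 0" using q(2) by simp
    ultimately have key: "(int q + 1) * M = 2 * int q ^ e * int n" by (metis mult_left_cancel)
    have qn: "\<not> int q dvd 1" using q(2) by simp
    have False
    \<comment> \<open>Modulo q the two sides are 1 and 2 for e = 0, and -1 and 0 for e > 0.\<close>
    proof (cases e)
      case 0
      obtain m where m: "n = 1 + q * m" using n by (metis add.commute mult_div_mod_eq)
      have "(int q + 1) * (2 * int q + 1) = 2 * (1 + int q * int m)" using key m 0 by (simp add: M_def algebra_simps)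
      then have "1 = int q * (2 * int q + 3 - 2 * int m)" by (simp add: algebra_simps)
      then show False using qn by (metis dvd_triv_left)
    next
      case (Suc e')
      define z where "z = 2 * int q ^ e' * int n - 2 * (int q + 1) * (int q + 1) * int q ^ e' + 1"
      have "- 1 = int q * z" using key by (simp add: M_def Suc z_def algebra_simps)
      then have "int q dvd - 1" by (rule dvdI)
      then show False using qn by simp
    qed
    then show ?thesis ..
  qed (use Suc in simp)
qed

section \<open>Fixed points on the cosets of H\<close>

context pog_simple
begin

definition fx :: "'a \<Rightarrow> 'a set set" where
  "fx g = {c \<in> lcs H. g <# c = c}"

lemma fx_finite: "finite (fx g)"
  by (simp add: fx_def lcs_finite)

lemma fx_iff: "g \<in> carrier G \<Longrightarrow> x \<in> carrier G \<Longrightarrow> x <# H \<in> fx g \<longleftrightarrow> cg (inv x) g \<in> H"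
  using lcs_fixed_iff[OF H(1)] by (auto simp: fx_def lcs_def)

lemma lcsE: "c \<in> lcs H \<Longrightarrow> (\<And>x. x \<in> carrier G \<Longrightarrow> c = x <# H \<Longrightarrow> thesis) \<Longrightarrow> thesis"
  by (auto simp: lcs_def)

lemma lcos_H: "x \<in> carrier G \<Longrightarrow> x <# H = H \<longleftrightarrow> x \<in> H" "\<one> <# H = H" "H \<in> lcs H"
proof -
  show 1: "\<one> <# H = H" using H(3) by (force simp: l_coset_def)
  then show "H \<in> lcs H" unfolding lcs_def by (metis image_eqI one_closed)
  show "x \<in> carrier G \<Longrightarrow> x <# H = H \<longleftrightarrow> x \<in> H"
    using lcos_eq_iff[OF H(1) one_closed, of x] 1 by auto
qed

lemma H_fixes: "h \<in> H \<Longrightarrow> H \<in> fx h"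
  using fx_iff[of h \<one>] H(3) lcos_H(2) by simp

text \<open>For s in S normalising \<open>cyc h\<close>, the commutator of s and h lies in both S
  and \<open>cyc h\<close> and is trivial; if s were nontrivial, h would lie in its centraliser S.
  So the intersection avoids S and \<open>odd_subgroup_H\<close> applies.\<close>

lemma normalizer_in_H:
  assumes h: "h \<in> H" "h \<notin> S"
  shows "card (nrm (cyc h) \<inter> H) = q"
proof -
  note c = cyc_in_H[OF h] and N = nrm_subgroup[OF cyc_in_H(1)[OF h]]
  let ?M = "nrm (cyc h) \<inter> H"
  have M: "subgroup ?M G" using subgroups_Inter_pair[OF N(1) H(1)] .
  have s1: "s = \<one>" if s: "s \<in> nrm (cyc h)" "s \<in> S" for s
  proof (rule ccontr)
    assume s1: "s \<noteq> \<one>"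
    have sG: "s \<in> carrier G" using SG(2)[OF s(2)] .
    define w where "w = cg s h \<otimes> inv h"
    have "w \<in> cyc h"
      using nrmD(1)[OF s(1) cyc_mem[OF c(4)]] cyc_mem[OF c(4)] subgroup.m_closed[OF c(1)] subgroup.m_inv_closed[OF c(1)]
      by (simp add: w_def)
    then have wq: "w [^] q = \<one>" "w \<in> carrier G" using subgroup_pow_card[OF c(1)] c(2) subgroup_inG[OF c(1)] by auto
    have "w = s \<otimes> cg h (inv s)" using sG c(4) by (simp add: w_def cg_def m_assoc)
    then have "w \<in> S" using HS[OF h(1)] subgroup.m_inv_closed[OF SG(1)] subgroup.m_closed[OF SG(1)] s(2) by simp
    then have "w [^] (2::nat) = \<one>" using sylD(6)[OF S] by blast
    then have "w = \<one>" using pow_distinct_primes[OF wq(2) _ wq(1) two_is_prime_nat q_prime(1)] q_ge_3 by simp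
    then have "cg s h = h" using sG c(4) by (metis cg_closed inv_closed inv_equality inv_inv w_def)
    then have "h \<in> cen s" using cg_eq_self[OF sG c(4)] c(4) by (simp add: cen_def)
    then show False using cen_involution[OF S s(2) s1] h by simp
  qed
  have "card ?M = 1 \<or> card ?M = q" using odd_subgroup_H(2)[OF M] s1 by auto
  moreover have "q \<le> card ?M"
    using card_mono[of ?M "cyc h"] subgroup_finite[OF M] N(2) c(2,3) by simp
  ultimately show ?thesis using q_ge_3 by auto
qed

text \<open>If h fixes x H, the conjugate of \<open>cyc h\<close> by inv x lies in H and is
  conjugate to \<open>cyc h\<close> inside H. So the fixed cosets are those with a representative
  normalising \<open>cyc h\<close>; that normaliser has order 2 |cen h| and meets H in q
  elements.\<close>

lemma card_fx:
  assumes h: "h \<in> H" "h \<notin> S"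
  shows "q * card (fx h) = 2 * card (cen h)"
proof -
  note c = cyc_in_H[OF h] and N = nrm_subgroup[OF cyc_in_H(1)[OF h]]
  note NG = nrmD(2)[of _ "cyc h"]
  let ?N = "nrm (cyc h)"
  have im: "(\<lambda>n. n <# H) ` ?N = fx h"
  proof
    show "(\<lambda>n. n <# H) ` ?N \<subseteq> fx h"
    proof
      fix d assume "d \<in> (\<lambda>n. n <# H) ` ?N"
      then obtain n where n: "n \<in> ?N" "d = n <# H" by blast
      have "cg (inv n) h \<in> cyc h" by (rule nrmD(1)[OF subgroup.m_inv_closed[OF N(1) n(1)] cyc_mem[OF c(4)]])
      then show "d \<in> fx h" using fx_iff[OF c(4) NG[OF n(1)]] c(3) n by auto
    qed
    show "fx h \<subseteq> (\<lambda>n. n <# H) ` ?N"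
    proof
      fix d assume d: "d \<in> fx h"
      then obtain x where x: "x \<in> carrier G" "d = x <# H" using lcsE by (auto simp: fx_def)
      define h' where "h' = cg (inv x) h"
      have h'H: "h' \<in> H" using d fx_iff[OF c(4) x(1)] x by (simp add: h'_def)
      have "h' \<notin> S"
      proof
        assume s: "h' \<in> S"
        have "h' [^] (2::nat) = \<one>" using sylD(6)[OF S s] .
        then have "cg (inv x) (h [^] (2::nat)) = \<one>" using cg_pow[of "inv x" h 2] x c(4) by (simp add: h'_def)
        then have "h [^] (2::nat) = \<one>" using x c(4) by simp
        then show False using H_square h by blast
      qed
      then obtain k where k: "k \<in> H" "cg k ` cyc h = cyc h'" using H_cyc_conj[OF h h'H] by blast
      note kG = H(3)[OF k(1)]
      have ch: "cyc h' = cg (inv x) ` cyc h" using cg_cyc[of "inv x" h] x c(4) by (simp add: h'_def)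
      have "x \<otimes> k \<in> ?N"
      proof (rule nrmI[OF c(1)])
        fix y assume y: "y \<in> cyc h"
        then have yG: "y \<in> carrier G" using subgroup_inG[OF c(1)] by blast
        have "cg k y \<in> cg (inv x) ` cyc h" using y k ch by blast
        then obtain z where z: "z \<in> cyc h" "cg k y = cg (inv x) z" by blast
        have "cg (x \<otimes> k) y = cg x (cg k y)" using cg_cg[OF x(1) kG yG] by simp
        also have "\<dots> = z" using z x subgroup_inG[OF c(1)] by simp
        finally show "cg (x \<otimes> k) y \<in> cyc h" using z by simp
      qed (use x kG in simp)
      moreover have "(x \<otimes> k) <# H = x <# H"
        using lcos_eq_iff[OF H(1), of x "x \<otimes> k"] x kG k by (simp add: m_assoc[symmetric])
      ultimately show "d \<in> (\<lambda>n. n <# H) ` ?N" using x by (metis image_eqI)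
    qed
  qed
  have "card ?N = q * card ((\<lambda>n. n <# H) ` ?N)"
  proof (rule card_fibres[OF subgroup_finite[OF N(1)]])
    fix b assume "b \<in> (\<lambda>n. n <# H) ` ?N"
    then obtain m where m: "m \<in> ?N" "b = m <# H" by blast
    note mG = NG[OF m(1)]
    have "{n \<in> ?N. n <# H = b} = (\<lambda>y. m \<otimes> y) ` (?N \<inter> H)"
    proof
      show "{n \<in> ?N. n <# H = b} \<subseteq> (\<lambda>y. m \<otimes> y) ` (?N \<inter> H)"
      proof
        fix n assume n: "n \<in> {n \<in> ?N. n <# H = b}"
        then have nG: "n \<in> carrier G" using NG by simp
        have "inv m \<otimes> n \<in> ?N \<inter> H"
          using n m lcos_eq_iff[OF H(1) mG nG] subgroup.m_closed[OF N(1)] subgroup.m_inv_closed[OF N(1)] by auto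
        moreover have "n = m \<otimes> (inv m \<otimes> n)" using mG nG by (simp add: m_assoc[symmetric])
        ultimately show "n \<in> (\<lambda>y. m \<otimes> y) ` (?N \<inter> H)" by blast
      qed
      show "(\<lambda>y. m \<otimes> y) ` (?N \<inter> H) \<subseteq> {n \<in> ?N. n <# H = b}"
      proof
        fix n assume "n \<in> (\<lambda>y. m \<otimes> y) ` (?N \<inter> H)"
        then obtain y where y: "y \<in> ?N" "y \<in> H" "n = m \<otimes> y" by blast
        then show "n \<in> {n \<in> ?N. n <# H = b}"
          using m lcos_eq_iff[OF H(1) mG, of n] mG H(3)[OF y(2)] subgroup.m_closed[OF N(1) m(1) y(1)]
          by (simp add: m_assoc[symmetric])
      qed
    qed
    moreover have "inj_on (\<lambda>y. m \<otimes> y) (?N \<inter> H)" using mG H(3) by (intro inj_onI) auto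
    ultimately show "card {n \<in> ?N. n <# H = b} = q" using normalizer_in_H[OF h] by (simp add: card_image)
  qed
  moreover have "cyc h \<subseteq> cen h" by (rule cyc_sub[OF cen_subgroup[OF c(4)] cen_self[OF c(4)]])
  moreover have "cyc h \<noteq> {\<one>}" using cyc_mem[OF c(4)] c(5) by auto
  ultimately show ?thesis using torus_normalizer(1)[OF h c(1)] im by simp
qed

lemma syl_card_eq:
  assumes P: "syl p P" and Q: "syl p Q"
  shows "card P = card Q"
proof -
  have "card P' \<le> card Q'" if P': "syl p P'" and Q': "syl p Q'" for P' Q'
  proof -
    obtain a where a: "card P' = p ^ a" using sylD(4)[OF P'] by blast
    obtain g where g: "g \<in> carrier G" "P' \<subseteq> cg g ` Q'" using syl_contains[OF Q' sylD(3)[OF P'] a] by blast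
    have fQ: "finite Q'" using subgroup_finite[OF sylD(3)[OF Q']] .
    have "card P' \<le> card (cg g ` Q')" using g fQ by (intro card_mono) auto
    also have "\<dots> \<le> card Q'" using fQ by (rule card_image_le)
    finally show ?thesis .
  qed
  then show ?thesis using P Q by (simp add: order_antisym)
qed

lemma card_H_minus_S: "card (H - S) = (q + 1) * (q - 1)"
proof -
  have "card (H - S) = card H - card S" using H(2) subgroup_finite[OF SG(1)] by (simp add: card_Diff_subset)
  also have "\<dots> = (q + 1) * q - (q + 1) * 1" by (simp add: card_Hq card_S(2))
  also have "\<dots> = (q + 1) * (q - 1)" by (simp only: diff_mult_distrib2)
  finally show ?thesis .
qed

lemma H_minus_S_ex: obtains h where "h \<in> H" "h \<notin> S"
proof -
  have "card (H - S) \<noteq> 0" unfolding card_H_minus_S using q_ge_3 by simp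
  then have "H - S \<noteq> {}" by (metis card.empty)
  then show thesis using that by blast
qed

text \<open>Double counting of pairs of an element k of H - S and a point other than H fixed by k.
  Each point is fixed by q - 1 such k, the nontrivial elements of some \<open>DD u\<close>. Each k
  fixes f - 1 such points, with f independent of k because the centralisers are all Sylow
  q-subgroups.\<close>

lemma NN_eq:
  assumes h: "h \<in> H" "h \<notin> S"
  shows "NN = 1 + (q + 1) * (card (fx h) - 1)"
proof -
  define f where "f = card (fx h)"
  define Om where "Om = lcs H - {H}"
  have fOm: "finite Om" by (simp add: Om_def lcs_finite)
  have cOm: "NN = 1 + card Om"
    using lcos_H(3) lcs_finite card_Suc_Diff1[of "lcs H" H] by (simp add: Om_def NN_def)
  have fH: "finite (H - S)" using subgroup_finite[OF H(1)] by simp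
  have st: "card {k \<in> H - S. k <# c = c} = q - 1" if c: "c \<in> Om" for c
  proof -
    obtain x where x: "x \<in> carrier G" "c = x <# H" using c lcsE by (auto simp: Om_def)
    have "x \<notin> H" using x c lcos_H(1) by (auto simp: Om_def)
    then obtain u where u: "u \<in> invols" "u \<notin> H" "inv x \<otimes> u \<in> H" "card (DD u) = q"
      using coset_inverter[OF x(1)] by metis
    note u' = involsD[OF u(1)]
    have cu: "c = u <# H" using lcos_eq_iff[OF H(1) x(1) u'(1)] u x by simp
    have s1: "s = \<one>" if "s \<in> DD u" "s \<in> S" for s
      using pow_distinct_primes[OF SG(2)[OF that(2)] sylD(6)[OF S that(2)] DD(1)[OF u(1,2) that(1)] two_is_prime_nat q_prime(1)]
        q_ge_3 by simp
    have "{k \<in> H - S. k <# c = c} = DD u - {\<one>}"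
      using lcs_fixed_iff[OF H(1) H(3) u'(1)] u'(4) s1 subgroup.one_closed[OF SG(1)] by (auto simp: cu DD_def)
    then show ?thesis using u(4) subgroup.one_closed[OF DD_subgroup[OF u'(1)]] by simp
  qed
  have fc: "card {c \<in> Om. k <# c = c} = f - 1" if k: "k \<in> H - S" for k
  proof -
    have "card (cen k) = card (cen h)" using syl_card_eq torus_syl h k by blast
    then have "q * card (fx k) = q * f" using card_fx h k by (simp add: f_def)
    then have "card (fx k) = f" using q_ge_3 by simp
    moreover have "{c \<in> Om. k <# c = c} = fx k - {H}" by (auto simp: fx_def Om_def)
    moreover have "H \<in> fx k" using H_fixes k by simp
    ultimately show ?thesis by (simp add: fx_finite)
  qed
  have "(\<Sum>k\<in>H - S. card {c \<in> Om. k <# c = c}) = (q - 1) * card Om"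
    by (rule sum_multicount[OF fH fOm]) (use st in blast)
  moreover have "(\<Sum>k\<in>H - S. card {c \<in> Om. k <# c = c}) = (\<Sum>k\<in>H - S. f - 1)" by (rule sum.cong[OF refl fc])
  ultimately have "card (H - S) * (f - 1) = (q - 1) * card Om" by simp
  then have "(q - 1) * ((q + 1) * (f - 1)) = (q - 1) * card Om" by (simp only: card_H_minus_S mult_ac)
  then have "(q + 1) * (f - 1) = card Om" using q_ge_3 by (simp only: mult_cancel1) simp
  then show ?thesis using cOm by (simp add: f_def)
qed

text \<open>Sylow's congruence: A acts on the cosets of \<open>nrm A\<close> and fixes only
  \<open>nrm A\<close> itself, because A contains all elements of exponent q in its
  normaliser.\<close>

lemma torus_sylow_count:
  assumes h: "h \<in> H" "h \<notin> S"
  shows "\<exists>n. card (carrier G) = 2 * card (cen h) * n \<and> n mod q = 1"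
proof -
  define A where "A = cen h"
  note t = torus[OF h, folded A_def] and c = cyc_in_H[OF h]
  have A1: "A \<noteq> {\<one>}" using cen_self[OF c(4)] c(5) by (auto simp: A_def)
  note N = nrm_subgroup[OF t(1)]
  have cN: "card (nrm A) = 2 * card A" using torus_normalizer(1)[OF h t(1) _ A1] by (simp add: A_def)
  obtain a where a: "card A = q ^ a" using t(2) by blast
  note AG = subgroup_inG[OF t(1)] and NG = subgroup_inG[OF N(1)]
  have "card (lcs (nrm A)) mod q = card {v \<in> lcs (nrm A). \<forall>x\<in>A. x <# v = v} mod q"
  proof (rule fixed_points_mod[OF t(1) a q_prime(1) lcs_finite])
    fix x v assume "x \<in> A" "v \<in> lcs (nrm A)"
    then show "x <# v \<in> lcs (nrm A)" using lcs_act[OF N(1)] AG by (fastforce simp: lcs_def)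
  next
    fix v assume "v \<in> lcs (nrm A)"
    then show "\<one> <# v = v" using lcs_act[OF N(1)] by (auto simp: lcs_def)
  next
    fix x y v assume "x \<in> A" "y \<in> A" "v \<in> lcs (nrm A)"
    then show "(x \<otimes> y) <# v = x <# (y <# v)" using lcs_act[OF N(1)] AG by (auto simp: lcs_def m_assoc)
  qed
  also have "{v \<in> lcs (nrm A). \<forall>x\<in>A. x <# v = v} = {\<one> <# nrm A}"
  proof
    show "{\<one> <# nrm A} \<subseteq> {v \<in> lcs (nrm A). \<forall>x\<in>A. x <# v = v}"
      using lcs_fixed_iff[OF N(1) AG one_closed] N(2) AG by (auto simp: lcs_def)
    show "{v \<in> lcs (nrm A). \<forall>x\<in>A. x <# v = v} \<subseteq> {\<one> <# nrm A}"
    proof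
      fix v assume v: "v \<in> {v \<in> lcs (nrm A). \<forall>x\<in>A. x <# v = v}"
      then obtain y where y: "y \<in> carrier G" "v = y <# nrm A" by (auto simp: lcs_def)
      have "cg (inv y) x \<in> A" if x: "x \<in> A" for x
      proof -
        have "cg (inv y) x \<in> nrm A" using v x y lcs_fixed_iff[OF N(1) AG[OF x] y(1)] by auto
        moreover have "cg (inv y) x [^] q = \<one>" using t(5)[OF x] y AG[OF x] by (simp add: cg_pow[symmetric])
        ultimately show ?thesis using torus_normalizer(2)[OF h t(1) _ A1] by (simp add: A_def)
      qed
      then have "inv y \<in> nrm A" using y by (intro nrmI[OF t(1)]) auto
      then have "inv (inv y) \<in> nrm A" by (rule subgroup.m_inv_closed[OF N(1)])
      then have "\<one> <# nrm A = y <# nrm A" using lcos_eq_iff[OF N(1) one_closed y(1)] y by simp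
      then show "v \<in> {\<one> <# nrm A}" using y by simp
    qed
  qed
  finally have "card (lcs (nrm A)) mod q = 1" using q_ge_3 by simp
  moreover have "card (carrier G) = 2 * card A * card (lcs (nrm A))" using card_lcs[OF N(1)] cN by simp
  ultimately show ?thesis unfolding A_def by blast
qed

lemma cen_q:
  assumes h: "h \<in> H" "h \<notin> S"
  shows "card (cen h) = q" "card (fx h) = 2" "NN = q + 2" "card (carrier G) = (q + 1) * q * (q + 2)"
proof -
  obtain a where a: "card (cen h) = q ^ a" using torus(2)[OF h] by blast
  obtain n where n: "card (carrier G) = 2 * card (cen h) * n" "n mod q = 1" using torus_sylow_count[OF h] by blast
  have "card (fx h) \<ge> 1"
    using card_fx[OF h] a q_ge_3 by (cases "card (fx h) = 0") auto
  then have "a = 1"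
    using even_order_arithmetic[OF q_prime(1) q_ge_3, of NN a n "card (fx h)"] n card_G a card_fx[OF h] NN_eq[OF h] by simp
  then show c: "card (cen h) = q" using a by simp
  then have "q * card (fx h) = q * 2" using card_fx[OF h] by (simp only: mult.commute)
  then show f: "card (fx h) = 2" using q_ge_3 by simp
  show N: "NN = q + 2" using NN_eq[OF h] f by simp
  show "card (carrier G) = (q + 1) * q * (q + 2)" using card_G N by simp
qed

text \<open>A g with a fixed point is conjugate to some y in H. If y lies in S, it fixes only H by
  trivial intersection; otherwise \<open>cen_q\<close> gives two fixed points.\<close>

lemma fx_le_2:
  assumes g: "g \<in> carrier G" "g \<noteq> \<one>"
  shows "card (fx g) \<le> 2"
proof (cases "fx g = {}")
  case False
  then obtain d where d: "d \<in> fx g" by blast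
  then obtain x where x: "x \<in> carrier G" "d = x <# H" using lcsE by (auto simp: fx_def)
  define y where "y = cg (inv x) g"
  have yH: "y \<in> H" using d x fx_iff[OF g(1) x(1)] by (simp add: y_def)
  have yG: "y \<in> carrier G" and y1: "y \<noteq> \<one>" using g x by (auto simp: y_def)
  have gy: "g = cg x y" using g x by (simp add: y_def)
  have "card (fx y) \<le> 2"
  proof (cases "y \<in> S")
    case True
    have "fx y \<subseteq> {H}"
    proof
      fix c assume c: "c \<in> fx y"
      then obtain z where z: "z \<in> carrier G" "c = z <# H" using lcsE by (auto simp: fx_def)
      have "cg (inv z) y \<in> H" using c z fx_iff[OF yG z(1)] by simp
      moreover have "cg (inv z) y [^] (2::nat) = \<one>"
        using sylD(6)[OF S True] z yG by (simp add: cg_pow[symmetric])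
      ultimately have "cg (inv z) y \<in> S" by (rule H_square)
      then have "inv z \<in> H" using S_TI[OF _ True y1] z by simp
      then have "z \<in> H" using subgroup.m_inv_closed[OF H(1), of "inv z"] z by simp
      then show "c \<in> {H}" using z lcos_H(1) by simp
    qed
    then have "card (fx y) \<le> card {H}" by (intro card_mono) auto
    then show ?thesis by simp
  next
    case False
    then show ?thesis using cen_q(2)[OF yH] by simp
  qed
  moreover have "fx g \<subseteq> (\<lambda>c. x <# c) ` fx y"
  proof
    fix c assume c: "c \<in> fx g"
    then obtain z where z: "z \<in> carrier G" "c = z <# H" using lcsE by (auto simp: fx_def)
    have "cg (inv z) g \<in> H" using c z fx_iff[OF g(1) z(1)] by simp
    moreover have "cg (inv (inv x \<otimes> z)) y = cg (inv z) g"
      using x z yG cg_cg[of "inv z" x y] by (simp add: gy inv_mult_group)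
    ultimately have "(inv x \<otimes> z) <# H \<in> fx y" using fx_iff[OF yG, of "inv x \<otimes> z"] x z by simp
    moreover have "x <# ((inv x \<otimes> z) <# H) = c"
      using lcs_act[OF H(1) x(1), of "inv x \<otimes> z"] x z by (simp add: m_assoc[symmetric])
    ultimately show "c \<in> (\<lambda>c. x <# c) ` fx y" by blast
  qed
  ultimately show ?thesis using fx_finite[of y] by (meson card_image_le card_mono finite_imageI order_trans)
qed simp

lemma card_order_q: "2 * card {x \<in> carrier G. x \<noteq> \<one> \<and> x [^] q = \<one>} = (q + 1) * (q + 2) * (q - 1)"
proof -
  obtain h where h: "h \<in> H" "h \<notin> S" by (rule H_minus_S_ex)
  define A where "A = cen h"
  define E where "E = {x \<in> carrier G. x \<noteq> \<one> \<and> x [^] q = \<one>}"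
  note t = torus[OF h, folded A_def] and c = cyc_in_H[OF h] and k = cen_q[OF h, folded A_def]
  have A1: "A \<noteq> {\<one>}" using k(1) q_ge_3 by auto
  have cN: "card (nrm A) = 2 * q" using torus_normalizer(1)[OF h t(1) _ A1] k(1) by (simp add: A_def)
  have "real (card (nrm A)) * (\<Sum>x\<in>E. 1) = real (card (carrier G)) * (\<Sum>y\<in>A - {\<one>}. 1)"
    unfolding E_def by (rule syl_sum[OF torus_syl[OF h, folded A_def]]) (rule refl)
  moreover have "card (A - {\<one>}) = q - 1"
    using k(1) subgroup_finite[OF t(1)] subgroup.one_closed[OF t(1)] by simp
  ultimately have "real (2 * q * card E) = real ((q + 1) * q * (q + 2) * (q - 1))" using cN k(4) by simp
  then have "2 * q * card E = (q + 1) * q * (q + 2) * (q - 1)" by (simp only: of_nat_eq_iff)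
  then have "q * (2 * card E) = q * ((q + 1) * (q + 2) * (q - 1))" by (simp only: mult_ac)
  then show ?thesis using q_ge_3 unfolding E_def by (simp only: mult_cancel1) simp
qed

lemma three_fixed_points:
  assumes g: "g \<in> carrier G" and b: "b \<in> fx g" "c \<in> fx g" "d \<in> fx g" "b \<noteq> c" "c \<noteq> d" "b \<noteq> d"
  shows "g = \<one>"
proof (rule ccontr)
  assume "g \<noteq> \<one>"
  have "3 = card {b, c, d}" using b by simp
  also have "\<dots> \<le> card (fx g)" using b by (intro card_mono fx_finite) auto
  also have "\<dots> \<le> 2" by (rule fx_le_2[OF g \<open>g \<noteq> \<one>\<close>])
  finally show False by simp
qed

text \<open>As q + 1 is a power of 2 and q a prime other than 3, the prime 3 divides q + 2. An
  element x of order 3 is determined by the two points x H and x^-1 H, so there are at most (q + 1)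
  q of them, and the class of x forces its centraliser to have order q + 2 = 3^e. Then 2, 3 and q
  are the only primes, and there are too few elements to fill G.\<close>

lemma q_eq_3: "q = 3"
proof (rule ccontr)
  assume q3: "q \<noteq> 3"
  obtain h where h: "h \<in> H" "h \<notin> S" by (rule H_minus_S_ex)
  note k = cen_q[OF h]
  have p3: "Factorial_Ring.prime (3::nat)" by simp
  have nq: "\<not> 3 dvd q" using primes_dvd_imp_eq[OF p3 q_prime(1)] q3 by auto
  have nq1: "\<not> 3 dvd q + 1"
  proof
    assume "3 dvd q + 1"
    then have "3 dvd (2::nat)" using card_S(1,2) p3 prime_dvd_power by metis
    then show False by simp
  qed
  have d3: "3 dvd q + 2" using nq nq1 by presburger
  have nH: "\<not> 3 dvd card H" unfolding card_Hq using nq nq1 prime_dvd_mult_iff[OF p3] by blast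
  define E where "E = {x \<in> carrier G. x \<noteq> \<one> \<and> x [^] (3::nat) = \<one>}"
  have fE: "finite E" using fin by (simp add: E_def)
  have EG: "x \<in> carrier G" if "x \<in> E" for x using that by (simp add: E_def)
  have EH: "x \<notin> H" if "x \<in> E" for x
  proof
    assume "x \<in> H"
    then show False using elem_prime_dvd_card[OF H(1) _ _ _ p3, of x] that nH by (simp add: E_def)
  qed
  have Einv: "inv x \<in> E" if "x \<in> E" for x using that by (simp add: E_def nat_pow_inv)
  have Esq: "x \<otimes> x = inv x" if "x \<in> E" for x
    using that by (intro inv_equality[symmetric]) (auto simp: E_def numeral_3_eq_3 m_assoc)
  define Om where "Om = lcs H - {H}"
  have fOm: "finite Om" by (simp add: Om_def lcs_finite)
  have cOm: "card Om = q + 1" using lcos_H(3) lcs_finite k(3) by (simp add: Om_def NN_def)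
  have xO: "x <# H \<in> Om" if "x \<in> E" for x
    using EG[OF that] EH[OF that] lcos_H(1) by (auto simp: Om_def lcs_def)
  have xi: "x <# H \<noteq> inv x <# H" if "x \<in> E" for x
  proof
    assume "x <# H = inv x <# H"
    then have "inv x \<otimes> inv x \<in> H" using lcos_eq_iff[OF H(1), of x "inv x"] EG[OF that] by simp
    moreover have "inv x \<otimes> inv x = x" using Esq[OF Einv[OF that]] EG[OF that] by simp
    ultimately show False using EH[OF that] by simp
  qed
  \<comment> \<open>If x and y agree in both points, then g = y x^-1 fixes the three points H, x H
    and x^-1 H.\<close>
  have "inj_on (\<lambda>x. (x <# H, inv x <# H)) E"
  proof (rule inj_onI)
    fix x y assume x: "x \<in> E" and y: "y \<in> E" and "(x <# H, inv x <# H) = (y <# H, inv y <# H)"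
    then have e: "x <# H = y <# H" "inv x <# H = inv y <# H" by auto
    note xG = EG[OF x] and yG = EG[OF y]
    define g where "g = y \<otimes> inv x"
    have gG: "g \<in> carrier G" using xG yG by (simp add: g_def)
    have act: "a <# (b <# H) = (a \<otimes> b) <# H" if "a \<in> carrier G" "b \<in> carrier G" for a b
      using lcs_act[OF H(1) that] .
    have 1: "H \<in> fx g"
    proof -
      have "g <# H = y <# (inv x <# H)" using act[of y "inv x"] xG yG by (simp add: g_def)
      also have "\<dots> = H" using act[of y "inv y"] yG e lcos_H(2) by simp
      finally show ?thesis using lcos_H(3) by (simp add: fx_def)
    qed
    have 2: "x <# H \<in> fx g"
    proof -
      have "g <# (x <# H) = y <# H" using act[of g x] xG yG gG by (simp add: g_def m_assoc)
      then show ?thesis using e xG by (auto simp: fx_def lcs_def)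
    qed
    have 3: "inv x <# H \<in> fx g"
    proof -
      have "g <# (inv x <# H) = y <# ((inv x \<otimes> inv x) <# H)" using act xG yG gG by (simp add: g_def m_assoc)
      also have "inv x \<otimes> inv x = x" using Esq[OF Einv[OF x]] xG by simp
      also have "y <# (x <# H) = (y \<otimes> y) <# H" using e act[of y y] yG by simp
      also have "\<dots> = inv x <# H" using Esq[OF y] e by simp
      finally show ?thesis using xG by (auto simp: fx_def lcs_def)
    qed
    have "g = \<one>"
      using three_fixed_points[OF gG 1 2 3] xO[OF x] xO[OF Einv[OF x]] xi[OF x] by (auto simp: Om_def)
    then have "inv x = inv y" using xG yG unfolding g_def by (metis inv_closed inv_equality inv_inv)
    then show "x = y" using xG yG by (metis inv_inv)
  qed
  then have "card E = card ((\<lambda>x. (x <# H, inv x <# H)) ` E)" by (simp add: card_image)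
  also have "\<dots> \<le> card (SIGMA b:Om. Om - {b})"
    by (rule card_mono) (use fOm xO xi Einv in auto)
  also have "\<dots> = (\<Sum>b\<in>Om. q)" using fOm cOm by (subst card_SigmaI) auto
  also have "\<dots> = (q + 1) * q" using cOm by simp
  finally have cE: "card E \<le> (q + 1) * q" .
  have "3 dvd card (carrier G)" unfolding k(4) by (rule dvd_mult[OF d3])
  then obtain x where x: "x \<in> carrier G" "x \<noteq> \<one>" "x [^] (3::nat) = \<one>" using cauchy[OF subgroup_self p3] by blast
  obtain e where e: "card (cen x) = 3 ^ e" using cen_card[OF x p3] by blast
  define C where "C = (\<lambda>g. cg g x) ` carrier G"
  have CE: "C \<subseteq> E" using x by (auto simp: C_def E_def cg_pow[symmetric])
  have cG: "card (carrier G) = card (cen x) * card C"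
    unfolding C_def using conj_fibre[OF subgroup_self x(1)] by (auto simp: cen_def)
  have "card C \<le> (q + 1) * q" using card_mono[OF fE CE] cE by simp
  have "3 ^ e dvd (q + 1) * q * (q + 2)" using cG e k(4) by simp
  moreover have "coprime (3 ^ e) ((q + 1) * q)"
    using prime_imp_coprime[OF p3 nH] by (simp only: card_Hq coprime_power_left_iff simp_thms)
  ultimately have "3 ^ e dvd q + 2" using coprime_dvd_mult_right_iff by blast
  then have le: "card (cen x) \<le> q + 2" using e by (simp add: dvd_imp_le)
  have "(q + 1) * q * (q + 2) \<le> (q + 1) * q * card (cen x)"
    using cG k(4) \<open>card C \<le> (q + 1) * q\<close> by (metis mult.commute mult_le_mono2)
  moreover have "0 < (q + 1) * q" using q_ge_3 by simp
  ultimately have "q + 2 \<le> card (cen x)" by (metis nat_mult_le_cancel1)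
  then have e2: "q + 2 = 3 ^ e" using le e by simp
  define Eq where "Eq = {x \<in> carrier G. x \<noteq> \<one> \<and> x [^] q = \<one>}"
  have "carrier G \<subseteq> {\<one>} \<union> invols \<union> Eq \<union> E"
  proof
    fix g assume g: "g \<in> carrier G"
    obtain r where r: "Factorial_Ring.prime r" "g [^] (r::nat) = \<one>" using pog[OF g] by blast
    show "g \<in> {\<one>} \<union> invols \<union> Eq \<union> E"
    proof (cases "g = \<one>")
      case False
      have "r dvd (q + 1) * q * 3 ^ e" using elem_prime_dvd_card[OF subgroup_self g False r(2,1)] by (simp only: k(4) e2)
      moreover obtain n where n: "q + 1 = 2 ^ n" using card_S by metis
      ultimately have "r dvd 2 ^ n \<or> r dvd q \<or> r dvd 3 ^ e" using prime_dvd_mult_iff[OF r(1)] by metis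
      then have "r dvd 2 \<or> r dvd q \<or> r dvd 3" using prime_dvd_power[OF r(1)] by blast
      then have "r = 2 \<or> r = q \<or> r = 3" using primes_dvd_imp_eq[OF r(1)] q_prime(1) p3 two_is_prime_nat by blast
      then show ?thesis using g False r by (auto simp: invols_def Eq_def E_def numeral_2_eq_2)
    qed simp
  qed
  then have "card (carrier G) \<le> card ({\<one>} \<union> invols \<union> Eq \<union> E)"
    using fin by (intro card_mono) (auto simp: invols_def Eq_def E_def)
  also have "\<dots> \<le> card {\<one>} + card invols + card Eq + card E"
    by (meson add_mono card_Un_le order_refl order_trans)
  finally have "(q + 1) * q * (q + 2) \<le> 1 + q * (q + 2) + card Eq + (q + 1) * q"
    using k(3,4) card_invols cE by simp
  then have l: "2 * ((q + 1) * q * (q + 2)) \<le> 2 + 2 * (q * (q + 2)) + 2 * card Eq + 2 * ((q + 1) * q)" by linarith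
  have "2 * card Eq = (q + 1) * (q + 2) * (q - 1)" unfolding Eq_def by (rule card_order_q)
  moreover obtain m where m: "q = m + 3" using q_ge_3 by (metis add.commute le_Suc_ex)
  \<comment> \<open>Once \<open>2 * card Eq\<close> is inserted, the left-hand side of
    \<open>l\<close> exceeds the right-hand side by q^3 - q; writing q as m + 3 removes the
    truncated subtraction.\<close>
  ultimately show False using l by (simp add: algebra_simps)
qed

section \<open>The alternating group of degree five\<close>

lemma card_60: "card (lcs H) = 5" "card (carrier G) = 60" "card S = 4"
proof -
  obtain h where h: "h \<in> H" "h \<notin> S" by (rule H_minus_S_ex)
  show "card (lcs H) = 5" "card (carrier G) = 60" using cen_q(3,4)[OF h] q_eq_3 by (auto simp: NN_def)
  show "card S = 4" using card_S(2) q_eq_3 by simp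
qed

text \<open>The action on the five cosets of H is faithful, as nontrivial elements fix at most two
  points. Its sign is trivial on elements of odd order, and on involutions because they are all
  conjugate while the product of two distinct ones in S is again one. Both groups have order
  60.\<close>

lemma iso_alt_group: "G \<cong> alt_group 5"
proof -
  let ?I = "{1..5::nat}"
  obtain \<phi> where bij: "bij_betw \<phi> (lcs H) ?I"
    using finite_same_card_bij[of "lcs H" ?I] lcs_finite card_60(1) by auto
  define \<psi> where "\<psi> = inv_into (lcs H) \<phi>"
  have psi: "\<psi> i \<in> lcs H" "\<phi> (\<psi> i) = i" if "i \<in> ?I" for i
    using that bij_betw_inv_into_right[OF bij] bij_betw_apply[OF bij_betw_inv_into[OF bij]] by (auto simp: \<psi>_def)
  have phi: "\<phi> c \<in> ?I" "\<psi> (\<phi> c) = c" if "c \<in> lcs H" for c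
    using that bij_betw_inv_into_left[OF bij] bij_betw_apply[OF bij] by (auto simp: \<psi>_def)
  have act: "g <# c \<in> lcs H" "(g \<otimes> h) <# c = g <# (h <# c)" "\<one> <# c = c"
    if "g \<in> carrier G" "h \<in> carrier G" "c \<in> lcs H" for g h c
    using that lcs_act[OF H(1)] by (auto simp: lcs_def m_assoc)
  \<comment> \<open>Fixing every number outside 1 to 5 is what \<open>permutes\<close>
    demands.\<close>
  define \<pi> where "\<pi> g i = (if i \<in> ?I then \<phi> (g <# \<psi> i) else i)" for g i
  have mult: "\<pi> (g \<otimes> h) = \<pi> g \<circ> \<pi> h" if "g \<in> carrier G" "h \<in> carrier G" for g h
  proof
    fix i
    show "\<pi> (g \<otimes> h) i = (\<pi> g \<circ> \<pi> h) i"
    proof (cases "i \<in> ?I")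
      case True
      note p = psi[OF True]
      note a = act[OF that p(1)] act(1)[OF that(2) that(1) p(1)]
      show ?thesis using True phi[OF a(4)] a(2) by (simp add: \<pi>_def)
    next
      case False
      then show ?thesis by (simp only: \<pi>_def comp_apply if_False)
    qed
  qed
  have one: "\<pi> \<one> = id" using act(3)[OF one_closed one_closed] psi by (auto simp: \<pi>_def fun_eq_iff)
  have clo: "\<pi> g i \<in> ?I" if "g \<in> carrier G" "i \<in> ?I" for g i
    using phi(1)[OF act(1)[OF that(1) that(1) psi(1)[OF that(2)]]] that(2) by (simp add: \<pi>_def)
  have perm: "\<pi> g permutes ?I" if g: "g \<in> carrier G" for g
  proof (rule bij_imp_permutes)
    have "\<pi> (inv g) (\<pi> g i) = i" for i using mult[of "inv g" g] g one by (simp add: fun_eq_iff)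
    moreover have "\<pi> g (\<pi> (inv g) i) = i" for i using mult[of g "inv g"] g one by (simp add: fun_eq_iff)
    ultimately show "bij_betw (\<pi> g) ?I ?I"
      using clo[OF g] clo[OF inv_closed[OF g]] by (intro bij_betw_byWitness[of _ "\<pi> (inv g)"]) auto
  qed (simp only: \<pi>_def if_False)
  have pm: "permutation (\<pi> g)" if "g \<in> carrier G" for g using perm[OF that] permutation_permutes by blast
  define \<sigma> where "\<sigma> g = sign (\<pi> g)" for g
  have sm: "\<sigma> (g \<otimes> h) = \<sigma> g * \<sigma> h" if "g \<in> carrier G" "h \<in> carrier G" for g h
    unfolding \<sigma>_def mult[OF that] by (rule sign_compose[OF pm pm]) (use that in auto)
  have s1: "\<sigma> \<one> = 1" by (simp add: \<sigma>_def one)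
  have sc: "\<sigma> g = 1 \<or> \<sigma> g = - 1" for g unfolding \<sigma>_def by (cases "\<pi> g" rule: sign_cases) auto
  have scg: "\<sigma> (cg k g) = \<sigma> g" if "k \<in> carrier G" "g \<in> carrier G" for k g
  proof -
    have "\<sigma> k * \<sigma> (inv k) = 1" using sm[of k "inv k"] that s1 by simp
    moreover have "\<sigma> (cg k g) = \<sigma> g * (\<sigma> k * \<sigma> (inv k))" using sm that by (simp add: cg_def)
    ultimately show ?thesis by simp
  qed
  have spow: "\<sigma> (g [^] (n::nat)) = \<sigma> g ^ n" if "g \<in> carrier G" for g n
    by (induction n) (use that s1 sm in auto)
  have invol_even: "\<sigma> g = 1" if g: "g \<in> invols" for g
  proof -
    have sg: "\<sigma> s = \<sigma> g" if s: "s \<in> S" "s \<noteq> \<one>" for s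
    proof -
      obtain k where "k \<in> carrier G" "cg k s = g" using invols_conj[OF S_invols[OF s] g] by blast
      then show ?thesis using scg SG(2)[OF s(1)] by metis
    qed
    have c3: "card (S - {\<one>}) = 3" using card_60(3) subgroup_finite[OF SG(1)] subgroup.one_closed[OF SG(1)] by simp
    then have "S - {\<one>} \<noteq> {}" by (metis card.empty zero_neq_numeral)
    then obtain t where t: "t \<in> S" "t \<noteq> \<one>" by blast
    have "S - {\<one>} \<noteq> {t}"
    proof
      assume e: "S - {\<one>} = {t}"
      show False using c3 unfolding e by simp
    qed
    then obtain u where u: "u \<in> S" "u \<noteq> \<one>" "u \<noteq> t" using t by blast
    note tt = involsD[OF S_invols[OF t]]
    have "t \<otimes> u \<noteq> \<one>"
    proof
      assume "t \<otimes> u = \<one>"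
      then have "t \<otimes> (t \<otimes> u) = t" using tt by simp
      then show False using tt u SG(2)[OF u(1)] by (simp add: m_assoc[symmetric])
    qed
    then have "\<sigma> (t \<otimes> u) = \<sigma> g" using sg subgroup.m_closed[OF SG(1) t(1) u(1)] by blast
    moreover have "\<sigma> (t \<otimes> u) = \<sigma> g * \<sigma> g"
      using sm[OF SG(2)[OF t(1)] SG(2)[OF u(1)]] sg[OF t] sg[OF u(1,2)] by simp
    ultimately show ?thesis using sc[of g] by auto
  qed
  have even: "\<sigma> g = 1" if g: "g \<in> carrier G" for g
  proof -
    obtain p where p: "Factorial_Ring.prime p" "g [^] (p::nat) = \<one>" using pog[OF g] by blast
    show ?thesis
    proof (cases "p = 2 \<and> g \<noteq> \<one>")
      case True
      then have "g \<in> invols" using p g by (simp add: invols_def numeral_2_eq_2)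
      then show ?thesis by (rule invol_even)
    next
      case False
      have "odd p" if "p \<noteq> 2"
      proof (rule prime_odd_nat[OF p(1)])
        show "2 < p" using prime_ge_2_nat[OF p(1)] that by linarith
      qed
      then have "g = \<one> \<or> odd p" using False by blast
      then consider "g = \<one>" | "odd p" by blast
      then show ?thesis
      proof cases
        case 2
        have "\<sigma> g ^ p = 1" using spow[OF g, of p] p s1 by simp
        then show ?thesis using sc[of g] 2 by auto
      qed (simp add: s1)
    qed
  qed
  have ev: "evenperm (\<pi> g)" if "g \<in> carrier G" for g
  proof (rule ccontr)
    assume "\<not> evenperm (\<pi> g)"
    then show False using even[OF that] by (simp add: \<sigma>_def sign_def)
  qed
  have into: "\<pi> g \<in> carrier (alt_group 5)" if "g \<in> carrier G" for g
    using perm[OF that] ev[OF that] by (simp add: alt_group_carrier)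
  have inj1: "g = \<one>" if g: "g \<in> carrier G" "\<pi> g = id" for g
  proof (rule ccontr)
    assume n: "g \<noteq> \<one>"
    have "lcs H \<subseteq> fx g"
    proof
      fix c assume c: "c \<in> lcs H"
      have "\<phi> (g <# c) = \<phi> c" using g(2) phi[OF c] by (auto simp: \<pi>_def fun_eq_iff dest!: spec[of _ "\<phi> c"])
      then have "g <# c = c" using phi(2)[OF act(1)[OF g(1) g(1) c]] phi(2)[OF c] by simp
      then show "c \<in> fx g" using c by (simp add: fx_def)
    qed
    then have "5 \<le> card (fx g)" using card_mono[OF fx_finite] card_60(1) by metis
    then show False using fx_le_2[OF g(1) n] by simp
  qed
  have inj: "inj_on \<pi> (carrier G)"
  proof (rule inj_onI)
    fix g h assume g: "g \<in> carrier G" and h: "h \<in> carrier G" and e: "\<pi> g = \<pi> h"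
    have "\<pi> (inv g \<otimes> h) = \<pi> (inv g) \<circ> \<pi> g" using mult[of "inv g" h] g h e by simp
    also have "\<dots> = \<pi> (inv g \<otimes> g)" using mult[of "inv g" g] g by simp
    finally have "\<pi> (inv g \<otimes> h) = \<pi> (inv g \<otimes> g)" .
    then have "inv g \<otimes> h = \<one>" using inj1[of "inv g \<otimes> h"] g h one by simp
    then show "g = h" using g h by (metis inv_equality inv_inv inv_closed)
  qed
  have "2 * card (carrier (alt_group 5)) = fact 5" by (rule alt_group_card_carrier) simp
  then have c60: "card (carrier (alt_group 5)) = 60" by (simp add: fact_numeral)
  then have fA: "finite (carrier (alt_group 5))" by (metis card.infinite zero_neq_numeral)
  have "\<pi> ` carrier G = carrier (alt_group 5)"
    using into card_image[OF inj] card_60(2) c60 fA by (intro card_subset_eq) auto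
  then have "bij_betw \<pi> (carrier G) (carrier (alt_group 5))" using inj by (simp add: bij_betw_def)
  moreover have "\<pi> \<in> hom G (alt_group 5)" using into mult by (simp add: hom_def alt_group_mult)
  ultimately show ?thesis by (auto simp: is_iso_def iso_def)
qed

end

section \<open>The classification of groups whose nonidentity elements have prime order\<close>

context pog
begin

text \<open>K is the set of elements of exponent p, and C is generated by an element of order r. An
  element of K normalising C commutes with C and is therefore trivial, so \<open>nrm C\<close>
  embeds into the r cosets of K and equals C; as C has prime order, this is the complement
  condition. By Sylow's theorem every element outside K is conjugate into C, which identifies the
  kernel.\<close>

lemma normal_pgroup_classification:
  assumes V: "normal_pgroup p V"
  shows "(\<exists>p. p_group_exp_p G p)
       \<or> (\<exists>C p q. frobenius_complement G C \<and> Factorial_Ring.prime p \<and> Factorial_Ring.prime q \<and> q \<noteq> p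
                \<and> (\<exists>k. card (frobenius_kernel G C) = p ^ k) \<and> exponent_p_set G (frobenius_kernel G C) p \<and> card C = q)"
proof -
  obtain k where v: "Factorial_Ring.prime p" "subgroup V G" "V \<noteq> {\<one>}" "card V = p ^ k"
    "\<And>g v. g \<in> carrier G \<Longrightarrow> v \<in> V \<Longrightarrow> cg g v \<in> V" using V by (auto simp: normal_pgroup_def)
  define K where "K = pel p"
  note K = normal_p_subgroup_structure[OF v, folded K_def]
  have Kp: "x \<in> carrier G" "x [^] p = \<one>" if "x \<in> K" for x using that by (auto simp: K_def pel_def)
  obtain a where a: "card K = p ^ a" using K(2) by blast
  note fK = subgroup_finite[OF K(1)]
  show ?thesis
  proof (cases "card (carrier G) = card K")
    case True
    then have "K = carrier G" using Kp fin by (intro card_subset_eq) auto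
    then have "p_group_exp_p G p" using v(1) a Kp by (auto simp: p_group_exp_p_def exponent_p_set_def)
    then show ?thesis by blast
  next
    case False
    then obtain r where r: "Factorial_Ring.prime r" "r \<noteq> p" "card (carrier G) = card K * r" using K(3) by blast
    have Kn: "cg g x \<in> K" if "g \<in> carrier G" "x \<in> K" for g x
      using that Kp[OF that(2)] by (simp add: K_def pel_def cg_pow[symmetric])
    obtain y where y: "y \<in> carrier G" "y \<noteq> \<one>" "y [^] r = \<one>" using cauchy[OF subgroup_self r(1)] r(3) by auto
    define C where "C = cyc y"
    note c = cyc_prime[OF y r(1), folded C_def]
    have yC: "y \<in> C" using cyc_mem[OF y(1)] by (simp add: C_def)
    note CG = subgroup_inG[OF c(1)]
    have Cr: "x [^] r = \<one>" if "x \<in> C" for x using subgroup_pow_card[OF c(1) that] c(2) by simp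
    have KC: "x = \<one>" if "x \<in> K" "x [^] r = \<one>" for x
      using pow_distinct_primes[OF Kp[OF that(1)] that(2) v(1) r(1)] r(2) by simp
    note N = nrm_subgroup[OF c(1)]
    have NK: "x = \<one>" if x: "x \<in> nrm C" "x \<in> K" for x
    proof (rule ccontr)
      assume x1: "x \<noteq> \<one>"
      have xG: "x \<in> carrier G" using Kp x by blast
      define w where "w = cg x y \<otimes> inv y"
      have "w \<in> C" using nrmD(1)[OF x(1) yC] yC subgroup.m_closed[OF c(1)] subgroup.m_inv_closed[OF c(1)]
        by (simp add: w_def)
      moreover have "w = x \<otimes> cg y (inv x)" using xG y by (simp add: w_def cg_def m_assoc)
      then have "w \<in> K" using Kn[OF y(1)] x subgroup.m_closed[OF K(1)] subgroup.m_inv_closed[OF K(1)] by simp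
      ultimately have "w = \<one>" using KC Cr by blast
      then have "cg x y = y" using xG y by (metis cg_closed inv_closed inv_equality inv_inv w_def)
      then have "x \<otimes> y = y \<otimes> x" using cg_eq_self[OF xG y(1)] by simp
      then have "y [^] p = \<one>" using commuting_same_prime[OF xG x1 Kp(2)[OF x(2)] v(1) y(1)] by simp
      then show False using pow_distinct_primes[OF y(1) _ y(3) v(1) r(1)] r(2) y(2) by simp
    qed
    have "inj_on (\<lambda>x. x <# K) (nrm C)"
    proof (rule inj_onI)
      fix x z assume x: "x \<in> nrm C" and z: "z \<in> nrm C" and e: "x <# K = z <# K"
      have xz: "x \<in> carrier G" "z \<in> carrier G" using x z nrmD(2) by auto
      have "inv x \<otimes> z \<in> K" using lcos_eq_iff[OF K(1) xz] e by simp
      then have "inv x \<otimes> z = \<one>" using NK x z subgroup.m_closed[OF N(1)] subgroup.m_inv_closed[OF N(1)] by blast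
      then show "x = z" using xz by (metis inv_equality inv_inv inv_closed)
    qed
    then have "card (nrm C) = card ((\<lambda>x. x <# K) ` nrm C)" by (simp add: card_image)
    also have "\<dots> \<le> card (lcs K)" using nrmD(2) by (intro card_mono lcs_finite) (auto simp: lcs_def)
    also have "\<dots> = r"
      using card_lcs[OF K(1)] r(3) subgroup_card_pos[OF K(1)] by simp
    finally have NC: "nrm C = C" using c(2) N(2) subgroup_finite[OF N(1)] card_seteq[of "nrm C" C] by simp
    have cgC: "(\<lambda>c. g \<otimes> c \<otimes> inv g) ` C = cg g ` C" for g by (simp add: cg_def)
    have K1: "card K \<noteq> 1"
    proof
      assume "card K = 1"
      then have "K = {\<one>}" using subgroup.one_closed[OF K(1)] by (metis card_1_singletonE singletonD)
      moreover have "V \<subseteq> K"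
        using subgroup_inG[OF v(2)] p_subgroup_exponent[OF v(2,4,1)] by (auto simp: K_def pel_def)
      ultimately show False using v(3) subgroup.one_closed[OF v(2)] by blast
    qed
    have fc: "frobenius_complement G C"
      unfolding frobenius_complement_def cgC
    proof (intro conjI ballI)
      show "subgroup C G" by (rule c)
      show "C \<noteq> {\<one>}" using y(2) yC by auto
      show "C \<noteq> carrier G" using r(3) K1 c(2) prime_gt_0_nat[OF r(1)] by auto
      fix g assume g: "g \<in> carrier G - C"
      show "C \<inter> cg g ` C = {\<one>}"
      proof
        show "{\<one>} \<subseteq> C \<inter> cg g ` C"
          using subgroup.one_closed[OF c(1)] g cg_subgroup(1)[OF c(1)] subgroup.one_closed by blast
        show "C \<inter> cg g ` C \<subseteq> {\<one>}"
        proof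
          fix x assume "x \<in> C \<inter> cg g ` C"
          then obtain z where z: "z \<in> C" "x = cg g z" "x \<in> C" by blast
          have "z = \<one>"
          proof (rule ccontr)
            assume "z \<noteq> \<one>"
            then have "g \<in> nrm C" using prime_order_TI[OF c(1)] c(2) r(1) z g by (auto simp: TI_def)
            then show False using NC g by simp
          qed
          then show "x \<in> {\<one>}" using z g by simp
        qed
      qed
    qed
    have fk: "frobenius_kernel G C = K"
    proof
      show "frobenius_kernel G C \<subseteq> K"
      proof
        fix x assume "x \<in> frobenius_kernel G C"
        then have x: "x = \<one> \<or> (x \<in> carrier G \<and> (\<forall>g\<in>carrier G. x \<notin> cg g ` C))"
          by (auto simp: frobenius_kernel_def cgC)
        show "x \<in> K"
        proof (rule ccontr)
          assume xK: "x \<notin> K"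
          then have x1: "x \<noteq> \<one>" using subgroup.one_closed[OF K(1)] by auto
          have xG: "x \<in> carrier G" using x x1 by auto
          obtain s where s: "Factorial_Ring.prime s" "x [^] (s::nat) = \<one>" using pog[OF xG] by blast
          have "s \<noteq> p" using s xK xG by (auto simp: K_def pel_def)
          have "s dvd p ^ a * r" using elem_prime_dvd_card[OF subgroup_self xG x1 s(2,1)] r(3) a by simp
          then have "s dvd p \<or> s dvd r" using prime_dvd_mult_iff[OF s(1)] prime_dvd_power[OF s(1)] by blast
          then have "s = r" using primes_dvd_imp_eq[OF s(1)] v(1) r(1) \<open>s \<noteq> p\<close> by blast
          then have xr: "x [^] r = \<one>" using s by simp
          note cx = cyc_prime[OF xG x1 xr r(1)]
          have nd: "\<not> r ^ Suc 1 dvd card (carrier G)"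
          proof
            assume "r ^ Suc 1 dvd card (carrier G)"
            then have "r * r dvd p ^ a * r" using r(3) a by simp
            then have "r dvd p ^ a" using prime_gt_0_nat[OF r(1)] by simp
            then show False using prime_dvd_power[OF r(1)] primes_dvd_imp_eq[OF r(1) v(1)] r(2) by blast
          qed
          have cc: "card C = r ^ 1" "card (cyc x) = r ^ 1" using c(2) cx(2) by auto
          obtain g where "g \<in> carrier G" "cyc x \<subseteq> cg g ` C"
            using sylow_contains[OF r(1) c(1) cc(1) nd cx(1) cc(2)] by blast
          then show False using x x1 cyc_mem[OF xG] by blast
        qed
      qed
      show "K \<subseteq> frobenius_kernel G C"
      proof
        fix x assume x: "x \<in> K"
        have "x = \<one>" if "g \<in> carrier G" "z \<in> C" "x = cg g z" for g z
          using KC[OF x] that Cr[OF that(2)] CG[OF that(2)] by (simp add: cg_pow[symmetric])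
        then show "x \<in> frobenius_kernel G C" using Kp(1)[OF x] by (auto simp: frobenius_kernel_def cgC)
      qed
    qed
    have "exponent_p_set G K p" using Kp by (auto simp: exponent_p_set_def)
    then show ?thesis using fc v(1) r(1,2) K(2) c(2) fk by metis
  qed
qed

theorem classification:
  "(\<exists>p. p_group_exp_p G p)
   \<or> (\<exists>C p q. frobenius_complement G C \<and> Factorial_Ring.prime p \<and> Factorial_Ring.prime q \<and> q \<noteq> p
        \<and> (\<exists>k. card (frobenius_kernel G C) = p ^ k) \<and> exponent_p_set G (frobenius_kernel G C) p \<and> card C = q)
   \<or> G \<cong> alt_group 5"
proof (cases "\<exists>p V. normal_pgroup p V")
  case True
  then show ?thesis using normal_pgroup_classification by blast
next
  case no: False
  show ?thesis
  proof (cases "carrier G = {\<one>}")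
    case True
    \<comment> \<open>The trivial group has order 2^0 and counts as a 2-group.\<close>
    then have "p_group_exp_p G 2"
      by (auto simp: p_group_exp_p_def exponent_p_set_def intro: exI[of _ 0])
    then show ?thesis by blast
  next
    case False
    then have "2 dvd card (carrier G)" using odd_pog_normal_pgroup[OF pog_axioms] no by blast
    then obtain S where "syl 2 S" using syl_ex[OF two_is_prime_nat] by blast
    then interpret pog_simple G S
      by (intro pog_simple.intro pog_simple_axioms.intro pog_axioms) (use no in auto)
    show ?thesis using iso_alt_group by blast
  qed
qed

end

section \<open>Elements generating non-maximal cyclic subgroups\<close>

context fin_group
begin

lemma generate_cyc: "x \<in> carrier G \<Longrightarrow> generate G {x} = cyc x"
  using generate_pow_on_finite_carrier[OF fin] by (auto simp: cyc_def)

lemma cyclic_subgroup_iff: "cyclic_subgroup G C \<longleftrightarrow> (\<exists>g\<in>carrier G. C = cyc g)"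
  using generate_cyc generate_is_subgroup[of "{_}"] unfolding cyclic_subgroup_def by force

lemma cyc_subset:
  assumes x: "x \<in> carrier G" and y: "y \<in> carrier G"
  shows "cyc x \<subseteq> cyc y \<longleftrightarrow> x \<in> cyc y"
proof
  have "subgroup (cyc y) G" using generate_is_subgroup[of "{y}"] generate_cyc[OF y] y by simp
  then show "x \<in> cyc y \<Longrightarrow> cyc x \<subseteq> cyc y" by (rule cyc_sub)
  show "cyc x \<subseteq> cyc y \<Longrightarrow> x \<in> cyc y" using cyc_mem[OF x] by blast
qed

lemma Gminus_iff:
  "x \<in> Gminus G \<longleftrightarrow> x \<in> carrier G \<and> (\<exists>y\<in>carrier G. x \<in> cyc y \<and> y \<notin> cyc x)"
proof (cases "x \<in> carrier G")
  case True
  have "cyc x \<subset> cyc y \<longleftrightarrow> x \<in> cyc y \<and> y \<notin> cyc x" if "y \<in> carrier G" for y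
    using cyc_subset[OF True that] cyc_subset[OF that True] by blast
  moreover have "maximal_cyclic G (cyc x) \<longleftrightarrow> \<not> (\<exists>y\<in>carrier G. cyc x \<subset> cyc y)"
    using True unfolding maximal_cyclic_def cyclic_subgroup_iff by blast
  ultimately show ?thesis using True generate_cyc[OF True] by (simp add: Gminus_def)
qed (simp add: Gminus_def)

lemma ord_pos: "x \<in> carrier G \<Longrightarrow> ord x > 0"
  using ord_ge_1[OF fin] by fastforce

lemma pow_eq_self_imp:
  assumes x: "x \<in> carrier G" "x [^] (m::nat) = x"
  shows "\<exists>i. int m - 1 = int (ord x) * i"
proof -
  have "x [^] int m = x [^] (1::int)" using x by (simp add: int_pow_int)
  then have "x [^] (int m - 1) = \<one>" using x(1) by (simp add: int_pow_diff)
  then have "int (ord x) dvd int m - 1" using int_pow_eq_id[OF x(1)] by simp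
  then show ?thesis by (simp add: dvd_def)
qed

end

section \<open>Orders modulo a normal subgroup and the three statements\<close>

locale fin_quotient = fin_group + normal N G for N
begin

lemma quotient_group: "group (G Mod N)"
  by (rule factorgroup_is_group)

definition qord :: "'a \<Rightarrow> nat" where
  "qord x = group.ord (G Mod N) (N #> x)"

lemma rcos_carrier: "x \<in> carrier G \<Longrightarrow> N #> x \<in> carrier (G Mod N)"
  by (simp add: carrier_FactGroup)

lemma rcos_one_iff: "x \<in> carrier G \<Longrightarrow> N #> x = N \<longleftrightarrow> x \<in> N"
  using coset_join1[of N x] coset_join2[of x N] subset subgroup_axioms by auto

lemma rcos_pow: "x \<in> carrier G \<Longrightarrow> (N #> x) [^]\<^bsub>G Mod N\<^esub> (n::nat) = N #> (x [^] n)"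
  by (rule FactGroup_pow)

lemma pow_mem_iff: "x \<in> carrier G \<Longrightarrow> x [^] (n::nat) \<in> N \<longleftrightarrow> qord x dvd n"
  using group.pow_eq_id[OF quotient_group rcos_carrier, of x n] rcos_one_iff[of "x [^] n"] rcos_pow[of x n]
  by (simp add: qord_def)

lemma qord_dvd: "x \<in> carrier G \<Longrightarrow> qord x dvd ord x"
  using pow_mem_iff[of x "ord x"] pow_ord_eq_1[of x] one_closed by simp

lemma qord_1: "x \<in> carrier G \<Longrightarrow> qord x = 1 \<longleftrightarrow> x \<in> N"
  using pow_mem_iff[of x 1] by simp

text \<open>Forward: a power of x outside N generates the same cyclic subgroup as x, so its exponent
  is prime to the order of x. Hence x^p lies in N for every prime p dividing that order, which gives
  prime order modulo N and allows one prime only. Backward: if x = y^m lies outside N, then m is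
  prime to the order of y, a power of the prime \<open>qord y\<close>, and y is a power of
  x.\<close>

lemma Gminus_subset_iff:
  "Gminus G \<subseteq> N \<longleftrightarrow> (\<forall>x\<in>carrier G - N. prime_power_order G x \<and> Factorial_Ring.prime (qord x))"
proof
  assume Gm: "Gminus G \<subseteq> N"
  show "\<forall>x\<in>carrier G - N. prime_power_order G x \<and> Factorial_Ring.prime (qord x)"
  proof
    fix x assume x: "x \<in> carrier G - N"
    then have xG: "x \<in> carrier G" by simp
    have q1: "qord x \<noteq> 1" using qord_1[OF xG] x by simp
    have pw: "coprime (ord x) m" if m: "x [^] (m::nat) \<notin> N" for m
    proof -
      have "x [^] m \<notin> Gminus G" using Gm m by blast
      then have "x \<in> cyc (x [^] m)" using Gminus_iff xG by (auto simp: cyc_def)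
      then obtain i where "x = x [^] (m * i)" using xG by (auto simp: cyc_def nat_pow_pow)
      then obtain j where j: "int (m * i) - 1 = int (ord x) * j" using pow_eq_self_imp[OF xG, of "m * i"] by auto
      show ?thesis
      proof (rule coprimeI)
        fix d assume "d dvd ord x" "d dvd m"
        then have "int d dvd int (ord x) * j" "int d dvd int (m * i)" by simp_all
        then have "int d dvd int (m * i) - int (ord x) * j" by (metis dvd_diff)
        moreover have "int (m * i) - int (ord x) * j = 1" using j by simp
        ultimately have "int d dvd 1" by (simp only:)
        then show "is_unit d" by simp
      qed
    qed
    obtain p where p: "Factorial_Ring.prime p" "p dvd qord x" using prime_factor_nat[OF q1] by blast
    have po: "p dvd ord x" using p(2) qord_dvd[OF xG] dvd_trans by blast
    have "x [^] p \<in> N"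
    proof (rule ccontr)
      assume "x [^] p \<notin> N"
      then have "coprime (ord x) p" by (rule pw)
      then show False using po p(1) by (metis coprime_common_divisor dvd_refl not_prime_unit)
    qed
    then have "qord x dvd p" using pow_mem_iff[OF xG] by simp
    then have qp: "qord x = p" using p(1) q1 by (metis prime_nat_iff)
    have "\<exists>k. ord x = p ^ k"
    proof (rule only_prime_factor[OF ord_pos[OF xG]])
      fix r assume r: "Factorial_Ring.prime r" "r dvd ord x"
      show "r = p"
      proof (rule ccontr)
        assume rp: "r \<noteq> p"
        have "x [^] r \<notin> N"
          using pow_mem_iff[OF xG, of r] qp prime_dvd_prime_iff[OF p(1) r(1)] rp by simp
        then have "coprime (ord x) r" by (rule pw)
        then show False using r by (metis coprime_common_divisor dvd_refl not_prime_unit)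
      qed
    qed
    then show "prime_power_order G x \<and> Factorial_Ring.prime (qord x)"
      using p(1) qp by (auto simp: prime_power_order_def)
  qed
next
  assume h: "\<forall>x\<in>carrier G - N. prime_power_order G x \<and> Factorial_Ring.prime (qord x)"
  show "Gminus G \<subseteq> N"
  proof (rule subsetI, rule ccontr)
    fix x assume xm: "x \<in> Gminus G" and xN: "x \<notin> N"
    then obtain y where y: "y \<in> carrier G" "x \<in> cyc y" "y \<notin> cyc x" and xG: "x \<in> carrier G" using Gminus_iff by blast
    obtain m where m: "x = y [^] (m::nat)" using y(2) by (auto simp: cyc_def)
    have ndv: "\<not> qord y dvd m" using pow_mem_iff[OF y(1)] xN m by simp
    then have "y \<notin> N" using qord_1[OF y(1)] by auto
    then have "prime_power_order G y" and qy: "Factorial_Ring.prime (qord y)" using h y(1) by auto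
    then obtain p k where p: "Factorial_Ring.prime p" "ord y = p ^ k" unfolding prime_power_order_def by blast
    have "qord y dvd p" using qord_dvd[OF y(1)] p(2) prime_dvd_power[OF qy] by simp
    then have "qord y = p" using primes_dvd_imp_eq[OF qy p(1)] by simp
    then have "coprime p m" using ndv prime_imp_coprime[OF p(1)] by simp
    then have "gcd m (ord y) = 1" by (simp add: p(2) coprime_commute flip: coprime_iff_gcd_eq_1)
    moreover have "m \<noteq> 0" using ndv by (metis dvd_0_right)
    ultimately obtain i j where "m * i = ord y * j + 1" using bezout_nat[of m "ord y"] by auto
    then have "y [^] (m * i) = y [^] (ord y * j) \<otimes> y" by simp
    also have "\<dots> = y" using y(1) pow_ord_eq_1[OF y(1)] by (simp flip: nat_pow_pow)
    finally have "y [^] (m * i) = y" .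
    then have "y = x [^] i" using y(1) m by (simp add: nat_pow_pow)
    then show False using y(3) by (auto simp: cyc_def)
  qed
qed

lemma Mod_prime_orders:
  "(\<forall>Y\<in>carrier (G Mod N). Y \<noteq> one (G Mod N) \<longrightarrow> Factorial_Ring.prime (group.ord (G Mod N) Y))
   \<longleftrightarrow> (\<forall>x\<in>carrier G - N. Factorial_Ring.prime (qord x))"
  using rcos_one_iff by (auto simp: carrier_FactGroup qord_def)

lemma quotient_pog:
  assumes "\<forall>x\<in>carrier G - N. Factorial_Ring.prime (qord x)"
  shows "pog (G Mod N)"
proof (intro pog.intro pog_axioms.intro fin_group.intro fin_group_axioms.intro quotient_group)
  show "finite (carrier (G Mod N))" using fin by (simp add: carrier_FactGroup)
  fix Y assume "Y \<in> carrier (G Mod N)"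
  then obtain x where x: "x \<in> carrier G" "Y = N #> x" by (auto simp: carrier_FactGroup)
  show "\<exists>p. Factorial_Ring.prime p \<and> Y [^]\<^bsub>G Mod N\<^esub> (p::nat) = \<one>\<^bsub>G Mod N\<^esub>"
  proof (cases "x \<in> N")
    case True
    then have "Y = \<one>\<^bsub>G Mod N\<^esub>" using rcos_one_iff x by simp
    then show ?thesis using group.is_monoid[OF quotient_group] two_is_prime_nat by (metis monoid.nat_pow_one)
  next
    case False
    then have p: "Factorial_Ring.prime (qord x)" using assms x by blast
    have "x [^] qord x \<in> N" using pow_mem_iff[OF x(1)] by simp
    then have "Y [^]\<^bsub>G Mod N\<^esub> qord x = \<one>\<^bsub>G Mod N\<^esub>"
      using rcos_pow[OF x(1)] rcos_one_iff x by simp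
    then show ?thesis using p by blast
  qed
qed

lemma Gminus_subset_classification:
  assumes "Gminus G \<subseteq> N"
  shows "(\<exists>p. p_group_exp_p (G Mod N) p)
           \<or> (\<exists>C p q. frobenius_complement (G Mod N) C \<and> Factorial_Ring.prime p \<and> Factorial_Ring.prime q \<and> q \<noteq> p
                \<and> (\<exists>k. card (frobenius_kernel (G Mod N) C) = p ^ k)
                \<and> exponent_p_set (G Mod N) (frobenius_kernel (G Mod N) C) p
                \<and> card C = q)
           \<or> (G Mod N) \<cong> alt_group 5"
proof -
  interpret Q: pog "G Mod N" using quotient_pog assms Gminus_subset_iff by blast
  show ?thesis by (rule Q.classification)
qed

text \<open>Outside N every element has order p modulo N, so p divides its order and prime power
  order means p-power order.\<close>

lemma Gminus_subset_prime_index: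
  assumes p: "Factorial_Ring.prime p" and i: "card (rcosets N) = p"
  shows "Gminus G \<subseteq> N \<longleftrightarrow> (\<forall>x\<in>carrier G - N. \<exists>k. ord x = p ^ k)"
proof -
  have qp: "qord x = p" if x: "x \<in> carrier G - N" for x
  proof -
    have xG: "x \<in> carrier G" using x by simp
    have "qord x dvd p"
      using group.ord_dvd_group_order[OF quotient_group rcos_carrier[OF xG]] i
      by (simp add: qord_def Coset.order_def FactGroup_def)
    moreover have "qord x \<noteq> 1" using qord_1[OF xG] x by simp
    ultimately show ?thesis using p by (metis prime_nat_iff)
  qed
  have "prime_power_order G x \<longleftrightarrow> (\<exists>k. ord x = p ^ k)" if x: "x \<in> carrier G - N" for x
  proof
    assume "prime_power_order G x"
    then obtain r k where r: "Factorial_Ring.prime r" "ord x = r ^ k" by (auto simp: prime_power_order_def)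
    have "p dvd r ^ k" using qord_dvd[of x] qp[OF x] x r by simp
    then have "p = r" using prime_dvd_power[OF p] primes_dvd_imp_eq[OF p r(1)] by blast
    then show "\<exists>k. ord x = p ^ k" using r by blast
  qed (use p in \<open>auto simp: prime_power_order_def\<close>)
  then show ?thesis unfolding Gminus_subset_iff using qp p by auto
qed

lemma Gminus_subset_p_group:
  assumes p: "Factorial_Ring.prime p" and c: "card (carrier G) = p ^ k"
    and e: "exponent_p_set (G Mod N) (carrier (G Mod N)) p"
  shows "Gminus G \<subseteq> N"
  unfolding Gminus_subset_iff
proof
  fix x assume x: "x \<in> carrier G - N"
  then have xG: "x \<in> carrier G" by simp
  have "ord x dvd p ^ k" using ord_dvd_group_order[OF xG] c by (simp add: Coset.order_def)
  then have "prime_power_order G x" using divides_primepow_nat[OF p] p by (auto simp: prime_power_order_def)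
  moreover have "(N #> x) [^]\<^bsub>G Mod N\<^esub> p = N" using e rcos_carrier[OF xG] by (simp add: exponent_p_set_def)
  then have "x [^] p \<in> N" using rcos_pow[OF xG] rcos_one_iff[of "x [^] p"] xG by simp
  then have "qord x dvd p" using pow_mem_iff[OF xG] by simp
  moreover have "qord x \<noteq> 1" using qord_1[OF xG] x by simp
  ultimately show "prime_power_order G x \<and> Factorial_Ring.prime (qord x)" using p by (metis prime_nat_iff)
qed

end

theorem theorem3p2:
  fixes G :: "('a, 'b) monoid_scheme"
  assumes "group G" and "finite (carrier G)"
  shows
   "(\<forall>N. N \<lhd> G \<longrightarrow>
       ((Gminus G \<subseteq> N \<longleftrightarrow>
          ((\<forall>x\<in>carrier G - N. prime_power_order G x) \<and>
           (\<forall>Y\<in>carrier (G Mod N). Y \<noteq> one (G Mod N) \<longrightarrow> Factorial_Ring.prime (group.ord (G Mod N) Y))))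
        \<and> (Gminus G \<subseteq> N \<longrightarrow>
             (\<exists>p. p_group_exp_p (G Mod N) p)
           \<or> (\<exists>C p q. frobenius_complement (G Mod N) C \<and> Factorial_Ring.prime p \<and> Factorial_Ring.prime q \<and> q \<noteq> p
                \<and> (\<exists>k. card (frobenius_kernel (G Mod N) C) = p ^ k)
                \<and> exponent_p_set (G Mod N) (frobenius_kernel (G Mod N) C) p
                \<and> card C = q)
           \<or> (G Mod N) \<cong> alt_group 5)))
  \<and> (\<forall>M p. M \<lhd> G \<longrightarrow> Factorial_Ring.prime p \<longrightarrow> card (rcosets\<^bsub>G\<^esub> M) = p \<longrightarrow>
       (Gminus G \<subseteq> M \<longleftrightarrow> (\<forall>x\<in>carrier G - M. \<exists>k. group.ord G x = p ^ k)))
  \<and> (\<forall>p N. Factorial_Ring.prime p \<longrightarrow> (\<exists>k. card (carrier G) = p ^ k) \<longrightarrow> N \<lhd> G \<longrightarrow>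
       exponent_p_set (G Mod N) (carrier (G Mod N)) p \<longrightarrow> Gminus G \<subseteq> N)"
proof -
  have fq: "fin_quotient G N" if "N \<lhd> G" for N
    using assms that by (intro fin_quotient.intro fin_group.intro fin_group_axioms.intro)
  show ?thesis
  proof (intro conjI allI impI)
    fix N assume N: "N \<lhd> G"
    interpret fin_quotient G N by (rule fq[OF N])
    show "Gminus G \<subseteq> N \<longleftrightarrow>
          ((\<forall>x\<in>carrier G - N. prime_power_order G x) \<and>
           (\<forall>Y\<in>carrier (G Mod N). Y \<noteq> one (G Mod N) \<longrightarrow> Factorial_Ring.prime (group.ord (G Mod N) Y)))"
      unfolding Mod_prime_orders Gminus_subset_iff by blast
    show "(\<exists>p. p_group_exp_p (G Mod N) p)
           \<or> (\<exists>C p q. frobenius_complement (G Mod N) C \<and> Factorial_Ring.prime p \<and> Factorial_Ring.prime q \<and> q \<noteq> p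
                \<and> (\<exists>k. card (frobenius_kernel (G Mod N) C) = p ^ k)
                \<and> exponent_p_set (G Mod N) (frobenius_kernel (G Mod N) C) p
                \<and> card C = q)
           \<or> (G Mod N) \<cong> alt_group 5" if "Gminus G \<subseteq> N"
      by (rule Gminus_subset_classification[OF that])
  next
    fix M p assume "M \<lhd> G" "Factorial_Ring.prime p" "card (rcosets\<^bsub>G\<^esub> M) = p"
    then show "Gminus G \<subseteq> M \<longleftrightarrow> (\<forall>x\<in>carrier G - M. \<exists>k. group.ord G x = p ^ k)"
      using fin_quotient.Gminus_subset_prime_index[OF fq] by blast
  next
    fix p N assume "Factorial_Ring.prime p" "\<exists>k. card (carrier G) = p ^ k" "N \<lhd> G"
      "exponent_p_set (G Mod N) (carrier (G Mod N)) p"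
    then show "Gminus G \<subseteq> N"
      using fin_quotient.Gminus_subset_p_group[OF fq] by blast
  qed
qed

end
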